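(* Let $\mathscr{C}$ be an $\mathscr{I}$-partial fusion C$^*$-category with indecomposable units, $\varphi:I\to\mathscr{I}$ a surjective map of sets, and $F$ a unital morphism from $\mathscr{C}$ to $\{\mathrm{Hilb}_{\mathrm{fd}}\}_{I\times I}$ based on $\varphi$. Let $(\mathscr{A},\Delta)$ be the partial bialgebra over $I$, with its $^*$-structure, reconstructed from $(\mathscr{C},F)$ as described in the context. Then $(\mathscr{A},\Delta)$ with this $^*$-structure defines a partial compact quantum group.
   Context: An assignment $(r,s)\mapsto x_{rs}$ is rcf if for each fixed $r$ only finitely many $x_{rs}$ are nonzero, and likewise for each fixed $s$. PARTIAL FUSION C$^*$-CATEGORIES. Categories are small, $\mathbb{C}$-linear, additive. A partial tensor category over $\mathscr{I}$ consists of categories $\mathcal{C}_{\alpha\beta}$, bilinear functors $\otimes:\mathcal{C}_{\alpha\beta}\times\mathcal{C}_{\beta\gamma}\to\mathcal{C}_{\alpha\gamma}$, nonzero objects $\mathbb{1}_\alpha\in\mathcal{C}_{\alpha\alpha}$, and natural associativity and unit isomorphisms with the usual coherence (treated as strict). It has duality if each $X\in\mathcal{C}_{\alpha\beta}$ has $\hat X\in\mathcal{C}_{\beta\alpha}$ with $\mathrm{ev}_X:\hat X\otimes X\to\mathbb{1}_\beta$, $\mathrm{coev}_X:\mathbb{1}_\alpha\to X\otimes\hat X$ satisfying the snake identities, and similarly a right dual. A partial fusion C$^*$-category is a partial tensor category with duality such that all $\mathcal{C}_{\alpha\beta}$ are semi-simple C$^*$-categories (each object a finite direct sum of irreducibles),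 $(f\otimes g)^*=f^*\otimes g^*$, and the constraints are unitary. $\{\mathrm{Hilb}_{\mathrm{fd}}\}_{I\times I}$ is the partial fusion C$^*$-category over $I$ all of whose components are the finite-dimensional Hilbert spaces, with ordinary tensor product. With $k'=\varphi(k)$ and $I_\alpha=\varphi^{-1}(\alpha)$, a unital morphism $(F,\iota,\mu)$ based on $\varphi$ consists of linear $*$-functors $F_{kl}:\mathcal{C}_{k'l'}\to\mathrm{Hilb}_{\mathrm{fd}}$, natural isometries $\iota^{(klm)}_{X,Y}:F_{kl}(X)\otimes F_{lm}(Y)\to F_{km}(X\otimes Y)$ and unitaries $\mu_k:\mathbb{C}\to F_{kk}(\mathbb{1}_{k'})$ with: $F_{kl}(\mathbb{1}_\alpha)=0$ for $k\neq l$ in $I_\alpha$; for $X\in\mathcal{C}_{\alpha\beta}$, $(k,l)\mapsto F_{kl}(X)$ rcf on $I_\alpha\times I_\beta$; for $X\in\mathcal{C}_{k'\beta},Y\in\mathcal{C}_{\beta m'}$, $\bigoplus_{l\in I_\beta}\iota^{(klm)}_{X,Y}$ is a unitary isomorphism onto $F_{km}(X\otimes Y)$; and the usual associativity and unit coherence. RECONSTRUCTION. Put $\pi^{(klm)}_{X,Y}=(\iota^{(klm)}_{X,Y})^*$. Let $\{u_a\}$ be a maximal family of mutually inequivalent irreducible objects of the $\mathcal C_{\alpha\beta}$, including the units; $u_a\in\mathcal C_{\lambda_a\rho_a}$. Put $A^{kl}_{mn}(a)=\mathrm{Hom}_{\mathbb C}(F_{mn}(u_a),F_{kl}(u_a))^*$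 if $k'=m'=\lambda_a$ and $l'=n'=\rho_a$, and $0$ otherwise; $A^{kl}_{mn}=\bigoplus_aA^{kl}_{mn}(a)$. It pairs with $\mathrm{Nat}(F_{mn},F_{kl})\cong\prod_a\mathrm{Hom}_{\mathbb C}(F_{mn}(u_a),F_{kl}(u_a))$ (for $k'=m',l'=n'$), and tensor products $A^{kl}_{mn}\otimes A^{pq}_{rs}$ pair with $\mathrm{Nat}(F_{mn}\otimes F_{rs},F_{kl}\otimes F_{pq})$. $\Delta_{rs}:A^{kl}_{mn}\to A^{kl}_{rs}\otimes A^{rs}_{mn}$ is dual to composition $x\otimes y\mapsto x\circ y$; $\epsilon(f)=f(\mathrm{id})$ on $A^{kl}_{kl}$; the product $A^{kl}_{rs}\otimes A^{lm}_{st}\to A^{km}_{rt}$ is $(f\cdot g)(x)=(f\otimes g)(\hat\Delta^l_s(x))$ with $\hat\Delta^l_s(x)_{X,Y}=\pi^{(klm)}_{X,Y}\circ x_{X\otimes Y}\circ\iota^{(rst)}_{X,Y}$; the unit $\mathbf 1^k_l\in A^{kk}_{ll}(\mathbb 1_\alpha)$ ($\alpha=k'=l'$; $\mathbf 1^k_l=0$ if $k'\ne l'$) corresponds to $1\in\mathbb C\cong\mathrm{Hom}(F_{ll}(\mathbb 1_\alpha),F_{kk}(\mathbb 1_\alpha))^*$ via $\mu$. With $\mathrm{coev}^{kl}_X=\pi^{(klk)}_{X,\hat X}F_{kk}(\mathrm{coev}_X)$ and $\mathrm{ev}^{kl}_X=F_{ll}(\mathrm{ev}_X)\iota^{(lkl)}_{\hat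 X,X}$ (units of target identified with $\mathbb C$), put for $x\in\mathrm{Nat}(F_{mn},F_{kl})$: $\hat S(x)_X=(\mathrm{id}\otimes\mathrm{ev}^{lk}_X)(\mathrm{id}\otimes x_{\hat X}\otimes\mathrm{id})(\mathrm{coev}^{nm}_X\otimes\mathrm{id}):F_{lk}(X)\to F_{nm}(X)$. The $^*$-structure $A^{kl}_{mn}\to A^{lk}_{nm}$ is $f^*(x)=\overline{f(\hat S(x)^* )}$ for $x\in\mathrm{Nat}(F_{nm},F_{lk})$. PARTIAL COMPACT QUANTUM GROUPS. An $I$-partial bialgebra consists of complex vector spaces $A^{kl}_{mn}$; associative multiplications $A^{kl}_{mn}\otimes A^{lp}_{nq}\to A^{kp}_{mq}$ with unit elements $\mathbf{1}^k_m\in A^{kk}_{mm}$ (possibly zero), $\mathbf 1^k_m a=a=a\mathbf 1^l_n$; comultiplications $\Delta_{rs}:A^{kl}_{mn}\to A^{kl}_{rs}\otimes A^{rs}_{mn}$ with $(\Delta_{pq}\otimes\mathrm{id})\Delta_{rs}=(\mathrm{id}\otimes\Delta_{rs})\Delta_{pq}$; counits $\epsilon:A^{kl}_{kl}\to\mathbb{C}$ (extended by $0$ to $A^{kl}_{mn}$, $(k,l)\ne(m,n)$) with $(\epsilon\otimes\mathrm{id})\Delta_{kl}(a)=a=(\mathrm{id}\otimes\epsilon)\Delta_{mn}(a)$; such that $\Delta_{l,l'}(\mathbf 1^k_m)=\delta_{l,l'}\mathbf 1^k_l\otimes\mathbf 1^l_m$; $\epsilon(ab)=\epsilon(a)\epsilon(b)$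 for composable $a,b$; $\epsilon(\mathbf 1^k_k)=1$; $(r,s)\mapsto\Delta_{rs}(a)$ is rcf; $\Delta_{rs}(ab)=\sum_t\Delta_{rt}(a)\Delta_{ts}(b)$. It is a partial Hopf algebra if there are linear maps $S:A^{kl}_{mn}\to A^{nm}_{lk}$ with $\sum_s M_A(\mathrm{id}\otimes S)\Delta_{rs}(a)=\delta_{k,m}\epsilon(a)\mathbf 1^k_r$ for $a\in A^{kl}_{ml}$ and $\sum_r M_A(S\otimes\mathrm{id})\Delta_{rs}(a)=\delta_{l,n}\epsilon(a)\mathbf 1^s_n$ for $a\in A^{kl}_{kn}$ ($M_A$ the multiplication). It is a partial Hopf $^*$-algebra if moreover $A=\bigoplus A^{kl}_{mn}$ has an antilinear antimultiplicative involution mapping $A^{kl}_{mn}$ to $A^{lk}_{nm}$ with $(\mathbf 1^k_m)^*=\mathbf 1^k_m$ and $\Delta_{rs}(a)^*=\Delta_{sr}(a^* )$. It defines a partial compact quantum group if it admits an invariant integral $\phi$ with $\phi(a^*a)\ge0$ for all $a\in A$, where an invariant integral is a family of functionals $\phi:A^{kk}_{mm}\to\mathbb{C}$ (extended by $0$) with $\phi(\mathbf 1^k_k)=1$, $(\mathrm{id}\otimes\phi)\Delta_{ll}(a)=\delta_{k,p}\phi(a)\mathbf 1^k_l$ for $a\in A^{kp}_{mm}$, and $(\phi\otimes\mathrm{id})\Delta_{ll}(a)=\delta_{m,p}\phi(a)\mathbf 1^l_m$ for $a\in A^{kk}_{mp}$. *)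

theory Defs
  imports Complex_Main "HOL-Library.Function_Algebras" "HOL-Library.Nonpos_Ints"
begin

section \<open>Complex vector spaces and algebraic tensor products\<close>

text \<open>
  Complex vector spaces are subspaces of an ambient type of class \<open>complex_vs\<close>. This is no
  restriction: any family of vector spaces sits inside its direct sum.
\<close>

class complex_vs = ab_group_add +
  fixes scaleC :: "complex \<Rightarrow> 'a \<Rightarrow> 'a" (infixr "*\<^sub>C" 75)
  assumes scaleC_add_right: "c *\<^sub>C (x + y) = c *\<^sub>C x + c *\<^sub>C y"
    and scaleC_add_left: "(c + d) *\<^sub>C x = c *\<^sub>C x + d *\<^sub>C x"
    and scaleC_scaleC: "c *\<^sub>C d *\<^sub>C x = (c * d) *\<^sub>C x"
    and scaleC_one: "1 *\<^sub>C x = x"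

global_interpretation cvs: vector_space "scaleC :: complex \<Rightarrow> 'a \<Rightarrow> 'a::complex_vs"
  by standard (simp_all add: scaleC_add_right scaleC_add_left scaleC_scaleC scaleC_one)

instantiation complex :: complex_vs
begin
definition scaleC_complex :: "complex \<Rightarrow> complex \<Rightarrow> complex"
  where "scaleC_complex c x = c * x"
instance by standard (simp_all add: scaleC_complex_def algebra_simps)
end

instantiation "fun" :: (type, complex_vs) complex_vs
begin
definition scaleC_fun :: "complex \<Rightarrow> ('a \<Rightarrow> 'b) \<Rightarrow> 'a \<Rightarrow> 'b"
  where "scaleC_fun c f = (\<lambda>x. c *\<^sub>C f x)"
instance
  by standard
    (simp_all add: scaleC_fun_def fun_eq_iff scaleC_add_right scaleC_add_left scaleC_scaleC scaleC_one)
end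

definition linear_on :: "'a::complex_vs set \<Rightarrow> ('a \<Rightarrow> 'b::complex_vs) \<Rightarrow> bool" where
  "linear_on V f \<longleftrightarrow>
     (\<forall>x\<in>V. \<forall>y\<in>V. f (x + y) = f x + f y) \<and> (\<forall>c. \<forall>x\<in>V. f (c *\<^sub>C x) = c *\<^sub>C f x)"

definition antilinear_on :: "'a::complex_vs set \<Rightarrow> ('a \<Rightarrow> 'b::complex_vs) \<Rightarrow> bool" where
  "antilinear_on V f \<longleftrightarrow>
     (\<forall>x\<in>V. \<forall>y\<in>V. f (x + y) = f x + f y) \<and> (\<forall>c. \<forall>x\<in>V. f (c *\<^sub>C x) = cnj c *\<^sub>C f x)"

definition bilinear_on ::
  "'a::complex_vs set \<Rightarrow> 'b::complex_vs set \<Rightarrow> ('a \<Rightarrow> 'b \<Rightarrow> 'c::complex_vs) \<Rightarrow> bool" where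
  "bilinear_on V W b \<longleftrightarrow>
     (\<forall>v\<in>V. linear_on W (b v)) \<and> (\<forall>w\<in>W. linear_on V (\<lambda>v. b v w))"

text \<open>The dual of a subspace; functionals are set to \<open>0\<close> off the subspace to make them unique.\<close>

definition dual_space :: "'a::complex_vs set \<Rightarrow> ('a \<Rightarrow> complex) set" where
  "dual_space V = {f. linear_on V f \<and> (\<forall>x. x \<notin> V \<longrightarrow> f x = 0)}"

text \<open>
  An elementary tensor is represented by the bilinear form that it induces on pairs of linear
  functionals. As functionals separate points, the span of the \<open>v \<otimes> w\<close> with \<open>v \<in> V\<close>, \<open>w \<in> W\<close> is
  a model of the algebraic tensor product of \<open>V\<close> and \<open>W\<close>.
\<close>

type_synonym ('a, 'b) tensor = "('a \<Rightarrow> complex) \<times> ('b \<Rightarrow> complex) \<Rightarrow> complex"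

definition tens :: "'a::complex_vs \<Rightarrow> 'b::complex_vs \<Rightarrow> ('a, 'b) tensor" (infixr "\<otimes>" 72) where
  "v \<otimes> w = (\<lambda>(f, g). if linear_on UNIV f \<and> linear_on UNIV g then f v * g w else 0)"

definition tensor_space ::
  "'a::complex_vs set \<Rightarrow> 'b::complex_vs set \<Rightarrow> ('a, 'b) tensor set" where
  "tensor_space V W = cvs.span {v \<otimes> w | v w. v \<in> V \<and> w \<in> W}"

text \<open>
  \<open>tlift V W b\<close> is the map on the tensor product with \<open>v \<otimes> w \<mapsto> b v w\<close>. It does not depend on the
  chosen representation if \<open>b\<close> is bilinear (or conjugate linear in both arguments).
\<close>

definition tens_rep ::
  "'a::complex_vs set \<Rightarrow> 'b::complex_vs set \<Rightarrow> ('a, 'b) tensor \<Rightarrow> ('a \<times> 'b) list \<Rightarrow> bool" where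
  "tens_rep V W t ps \<longleftrightarrow> set ps \<subseteq> V \<times> W \<and> t = (\<Sum>(v, w)\<leftarrow>ps. v \<otimes> w)"

definition tlift ::
  "'a::complex_vs set \<Rightarrow> 'b::complex_vs set \<Rightarrow> ('a \<Rightarrow> 'b \<Rightarrow> 'c::complex_vs) \<Rightarrow> ('a, 'b) tensor \<Rightarrow> 'c"
  where "tlift V W b t = (\<Sum>(v, w)\<leftarrow>(SOME ps. tens_rep V W t ps). b v w)"

definition tmap ::
  "'a::complex_vs set \<Rightarrow> 'b::complex_vs set \<Rightarrow> ('a \<Rightarrow> 'c::complex_vs) \<Rightarrow> ('b \<Rightarrow> 'd::complex_vs)
     \<Rightarrow> ('a, 'b) tensor \<Rightarrow> ('c, 'd) tensor" where
  "tmap V W f g = tlift V W (\<lambda>v w. f v \<otimes> g w)"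

text \<open>The identification of \<open>(U \<otimes> V) \<otimes> W\<close> with \<open>U \<otimes> (V \<otimes> W)\<close>.\<close>

definition tassoc ::
  "'a::complex_vs set \<Rightarrow> 'b::complex_vs set \<Rightarrow> 'c::complex_vs set
     \<Rightarrow> (('a, 'b) tensor, 'c) tensor \<Rightarrow> ('a, ('b, 'c) tensor) tensor" where
  "tassoc U V W = tlift (tensor_space U V) W (\<lambda>s w. tlift U V (\<lambda>u v. u \<otimes> (v \<otimes> w)) s)"


section \<open>Finite-dimensional Hilbert spaces\<close>

text \<open>Inner products are conjugate linear in the first argument.\<close>

record 'v hilb =
  hsp :: "'v set"
  ip :: "'v \<Rightarrow> 'v \<Rightarrow> complex"

definition fd_hilbert :: "'v::complex_vs hilb \<Rightarrow> bool" where
  "fd_hilbert H \<longleftrightarrow>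
     cvs.subspace (hsp H) \<and> (\<exists>B. finite B \<and> hsp H \<subseteq> cvs.span B) \<and>
     (\<forall>v\<in>hsp H. linear_on (hsp H) (ip H v)) \<and>
     (\<forall>v\<in>hsp H. \<forall>w\<in>hsp H. ip H w v = cnj (ip H v w)) \<and>
     (\<forall>v\<in>hsp H. ip H v v \<in> \<real>\<^sub>\<ge>\<^sub>0 \<and> (ip H v v = 0 \<longrightarrow> v = 0))"

definition hC :: "complex hilb" where
  "hC = \<lparr>hsp = UNIV, ip = (\<lambda>a b. cnj a * b)\<rparr>"

text \<open>\<open>hmap H K\<close> is Hom(H, K); linear maps are set to \<open>0\<close> off \<open>hsp H\<close> to make them unique.\<close>

definition hmap :: "'v::complex_vs hilb \<Rightarrow> 'w::complex_vs hilb \<Rightarrow> ('v \<Rightarrow> 'w) set" where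
  "hmap H K = {T. linear_on (hsp H) T \<and> T ` hsp H \<subseteq> hsp K \<and> (\<forall>v. v \<notin> hsp H \<longrightarrow> T v = 0)}"

definition hid :: "'v::complex_vs hilb \<Rightarrow> 'v \<Rightarrow> 'v" where
  "hid H = (\<lambda>v. if v \<in> hsp H then v else 0)"

definition hadj ::
  "'v::complex_vs hilb \<Rightarrow> 'w::complex_vs hilb \<Rightarrow> ('v \<Rightarrow> 'w) \<Rightarrow> 'w \<Rightarrow> 'v" where
  "hadj H K T =
     (THE S. S \<in> hmap K H \<and> (\<forall>v\<in>hsp H. \<forall>w\<in>hsp K. ip H (S w) v = ip K w (T v)))"

definition hisometry ::
  "'v::complex_vs hilb \<Rightarrow> 'w::complex_vs hilb \<Rightarrow> ('v \<Rightarrow> 'w) \<Rightarrow> bool" where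
  "hisometry H K T \<longleftrightarrow>
     T \<in> hmap H K \<and> (\<forall>v\<in>hsp H. \<forall>w\<in>hsp H. ip K (T v) (T w) = ip H v w)"

definition hunitary ::
  "'v::complex_vs hilb \<Rightarrow> 'w::complex_vs hilb \<Rightarrow> ('v \<Rightarrow> 'w) \<Rightarrow> bool" where
  "hunitary H K T \<longleftrightarrow> hisometry H K T \<and> T ` hsp H = hsp K"

text \<open>The inner product is determined by \<open>\<langle>v \<otimes> w, v' \<otimes> w'\<rangle> = \<langle>v, v'\<rangle> \<langle>w, w'\<rangle>\<close>.\<close>

definition htensor ::
  "'v::complex_vs hilb \<Rightarrow> 'w::complex_vs hilb \<Rightarrow> ('v, 'w) tensor hilb" where
  "htensor H K =
     \<lparr>hsp = tensor_space (hsp H) (hsp K),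
      ip = (\<lambda>s t. tlift (hsp H) (hsp K)
             (\<lambda>v w. tlift (hsp H) (hsp K) (\<lambda>v' w'. ip H v v' * ip K w w') t) s)\<rparr>"

definition htmap ::
  "'v::complex_vs hilb \<Rightarrow> 'w::complex_vs hilb \<Rightarrow> ('v \<Rightarrow> 'v2::complex_vs) \<Rightarrow> ('w \<Rightarrow> 'w2::complex_vs)
     \<Rightarrow> ('v, 'w) tensor \<Rightarrow> ('v2, 'w2) tensor" where
  "htmap H K P Q =
     (\<lambda>t. if t \<in> hsp (htensor H K) then tmap (hsp H) (hsp K) P Q t else 0)"

text \<open>
  For functionals \<open>f\<close> on Hom(H, H') and \<open>g\<close> on Hom(K, K'), \<open>functional_tensor H H' K K' f g\<close> is
  the functional \<open>f \<otimes> g\<close> on Hom(H \<otimes> K, H' \<otimes> K'), the latter being identified with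
  Hom(H, H') \<otimes> Hom(K, K').
\<close>

definition functional_tensor ::
  "'v::complex_vs hilb \<Rightarrow> 'v2::complex_vs hilb \<Rightarrow> 'w::complex_vs hilb \<Rightarrow> 'w2::complex_vs hilb
     \<Rightarrow> (('v \<Rightarrow> 'v2) \<Rightarrow> complex) \<Rightarrow> (('w \<Rightarrow> 'w2) \<Rightarrow> complex)
     \<Rightarrow> (('v, 'w) tensor \<Rightarrow> ('v2, 'w2) tensor) \<Rightarrow> complex" where
  "functional_tensor H H' K K' f g T =
     (\<Sum>(P, Q)\<leftarrow>(SOME ps. set ps \<subseteq> hmap H H' \<times> hmap K K' \<and>
                          T = (\<Sum>(P, Q)\<leftarrow>ps. htmap H K P Q)). f P * g Q)"

definition hdsum :: "'i set \<Rightarrow> ('i \<Rightarrow> 'v::complex_vs hilb) \<Rightarrow> ('i \<Rightarrow> 'v) hilb" where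
  "hdsum L H =
     \<lparr>hsp = {t. (\<forall>l\<in>L. t l \<in> hsp (H l)) \<and> (\<forall>l. l \<notin> L \<longrightarrow> t l = 0) \<and> finite {l. t l \<noteq> 0}},
      ip = (\<lambda>s t. \<Sum>l | s l \<noteq> 0 \<and> t l \<noteq> 0. ip (H l) (s l) (t l))\<rparr>"

text \<open>Row and column finiteness on \<open>K \<times> L\<close> of the family of those \<open>(r, s)\<close> satisfying \<open>P r s\<close>.\<close>

definition rcf_on :: "'r set \<Rightarrow> 's set \<Rightarrow> ('r \<Rightarrow> 's \<Rightarrow> bool) \<Rightarrow> bool" where
  "rcf_on K L P \<longleftrightarrow>
     (\<forall>r\<in>K. finite {s \<in> L. P r s}) \<and> (\<forall>s\<in>L. finite {r \<in> K. P r s})"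


section \<open>Partial fusion C*-categories\<close>

text \<open>
  The categories \<open>C\<^sub>\<alpha>\<^sub>\<beta>\<close> are encoded as one collection of objects \<open>'o\<close>, each object \<open>X\<close> belonging
  to \<open>C\<^sub>\<alpha>\<^sub>\<beta>\<close> for \<open>\<alpha> = lft X\<close> and \<open>\<beta> = rgt X\<close>. The set \<open>hom X Y\<close> is only meaningful
  for \<open>X\<close>, \<open>Y\<close> in the same component. The associativity and unit isomorphisms are kept as data;
  the strict case is that of identities. \<open>ldual\<close>, \<open>ev\<close>, \<open>coev\<close> are a choice of left duals.
\<close>

record ('j, 'o, 'm) pcat =
  lft :: "'o \<Rightarrow> 'j"
  rgt :: "'o \<Rightarrow> 'j"
  hom :: "'o \<Rightarrow> 'o \<Rightarrow> 'm set"
  idm :: "'o \<Rightarrow> 'm"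
  cmp :: "'m \<Rightarrow> 'm \<Rightarrow> 'm" (infixr "\<cdot>\<index>" 68)
  tob :: "'o \<Rightarrow> 'o \<Rightarrow> 'o" (infixr "\<boxtimes>\<index>" 74)
  tmo :: "'m \<Rightarrow> 'm \<Rightarrow> 'm" (infixr "\<odot>\<index>" 74)
  unit :: "'j \<Rightarrow> 'o"
  assoc :: "'o \<Rightarrow> 'o \<Rightarrow> 'o \<Rightarrow> 'm"
  lun :: "'o \<Rightarrow> 'm"
  run :: "'o \<Rightarrow> 'm"
  ldual :: "'o \<Rightarrow> 'o"
  ev :: "'o \<Rightarrow> 'm"
  coev :: "'o \<Rightarrow> 'm"
  dag :: "'m \<Rightarrow> 'm"
  nrm :: "'m \<Rightarrow> real"

definition obj :: "('j, 'o, 'm) pcat \<Rightarrow> 'j \<Rightarrow> 'j \<Rightarrow> 'o set" where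
  "obj C \<alpha> \<beta> = {X. lft C X = \<alpha> \<and> rgt C X = \<beta>}"

definition par :: "('j, 'o, 'm) pcat \<Rightarrow> 'o \<Rightarrow> 'o \<Rightarrow> bool" where
  "par C X Y \<longleftrightarrow> lft C X = lft C Y \<and> rgt C X = rgt C Y"

definition inverse_arrows :: "('j, 'o, 'm) pcat \<Rightarrow> 'o \<Rightarrow> 'o \<Rightarrow> 'm \<Rightarrow> 'm \<Rightarrow> bool" where
  "inverse_arrows C X Y f g \<longleftrightarrow>
     f \<in> hom C X Y \<and> g \<in> hom C Y X \<and> g \<cdot>\<^bsub>C\<^esub> f = idm C X \<and> f \<cdot>\<^bsub>C\<^esub> g = idm C Y"

definition iso_arrow :: "('j, 'o, 'm) pcat \<Rightarrow> 'o \<Rightarrow> 'o \<Rightarrow> 'm \<Rightarrow> bool" where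
  "iso_arrow C X Y f \<longleftrightarrow> (\<exists>g. inverse_arrows C X Y f g)"

definition isomorphic :: "('j, 'o, 'm) pcat \<Rightarrow> 'o \<Rightarrow> 'o \<Rightarrow> bool" where
  "isomorphic C X Y \<longleftrightarrow> par C X Y \<and> (\<exists>f. iso_arrow C X Y f)"

text \<open>\<open>X\<close> is the direct sum of \<open>Y 0, \<dots>, Y (n - 1)\<close>; a zero object for \<open>n = 0\<close>.\<close>

definition direct_sum ::
  "('j, 'o, 'm::complex_vs) pcat \<Rightarrow> 'o \<Rightarrow> nat \<Rightarrow> (nat \<Rightarrow> 'o) \<Rightarrow> (nat \<Rightarrow> 'm) \<Rightarrow> (nat \<Rightarrow> 'm) \<Rightarrow> bool"
  where
  "direct_sum C X n Y i p \<longleftrightarrow>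
     (\<forall>j<n. par C (Y j) X \<and> i j \<in> hom C (Y j) X \<and> p j \<in> hom C X (Y j)) \<and>
     (\<forall>j<n. \<forall>k<n. p j \<cdot>\<^bsub>C\<^esub> i k = (if j = k then idm C (Y j) else 0)) \<and>
     (\<Sum>j<n. i j \<cdot>\<^bsub>C\<^esub> p j) = idm C X"

definition zero_object :: "('j, 'o, 'm::complex_vs) pcat \<Rightarrow> 'o \<Rightarrow> bool" where
  "zero_object C X \<longleftrightarrow> idm C X = 0"

definition irreducible_object :: "('j, 'o, 'm::complex_vs) pcat \<Rightarrow> 'o \<Rightarrow> bool" where
  "irreducible_object C X \<longleftrightarrow>
     \<not> zero_object C X \<and> hom C X X = {c *\<^sub>C idm C X | c. True}"

definition indecomposable_object :: "('j, 'o, 'm::complex_vs) pcat \<Rightarrow> 'o \<Rightarrow> bool" where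
  "indecomposable_object C X \<longleftrightarrow>
     \<not> zero_object C X \<and>
     (\<forall>Y i p. direct_sum C X 2 Y i p \<longrightarrow> zero_object C (Y 0) \<or> zero_object C (Y 1))"

locale additive_categories =
  fixes C :: "('j, 'o, 'm::complex_vs) pcat" (structure)
  assumes hom_subspace: "par C X Y \<Longrightarrow> cvs.subspace (hom C X Y)"
    and idm_hom: "idm C X \<in> hom C X X"
    and cmp_hom: "\<lbrakk>par C X Y; par C Y Z; f \<in> hom C X Y; g \<in> hom C Y Z\<rbrakk> \<Longrightarrow> g \<cdot> f \<in> hom C X Z"
    and cmp_idm: "\<lbrakk>par C X Y; f \<in> hom C X Y\<rbrakk> \<Longrightarrow> f \<cdot> idm C X = f"
    and idm_cmp: "\<lbrakk>par C X Y; f \<in> hom C X Y\<rbrakk> \<Longrightarrow> idm C Y \<cdot> f = f"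
    and cmp_assoc: "\<lbrakk>par C W X; par C X Y; par C Y Z;
        f \<in> hom C W X; g \<in> hom C X Y; h \<in> hom C Y Z\<rbrakk> \<Longrightarrow> (h \<cdot> g) \<cdot> f = h \<cdot> (g \<cdot> f)"
    and cmp_bilinear: "\<lbrakk>par C X Y; par C Y Z\<rbrakk> \<Longrightarrow> bilinear_on (hom C Y Z) (hom C X Y) (\<cdot>)"
    and direct_sums: "(\<And>j. j < n \<Longrightarrow> Ys j \<in> obj C \<alpha> \<beta>) \<Longrightarrow>
        \<exists>X\<in>obj C \<alpha> \<beta>. \<exists>i p. direct_sum C X n Ys i p"

locale partial_tensor_category = additive_categories +
  assumes tob_obj: "\<lbrakk>X \<in> obj C \<alpha> \<beta>; Y \<in> obj C \<beta> \<gamma>\<rbrakk> \<Longrightarrow> X \<boxtimes> Y \<in> obj C \<alpha> \<gamma>"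
    and tmo_hom: "\<lbrakk>par C X X'; par C Y Y'; rgt C X = lft C Y; f \<in> hom C X X'; g \<in> hom C Y Y'\<rbrakk>
        \<Longrightarrow> f \<odot> g \<in> hom C (X \<boxtimes> Y) (X' \<boxtimes> Y')"
    and tmo_idm: "rgt C X = lft C Y \<Longrightarrow> idm C X \<odot> idm C Y = idm C (X \<boxtimes> Y)"
    and tmo_cmp: "\<lbrakk>par C X X'; par C X' X''; par C Y Y'; par C Y' Y''; rgt C X = lft C Y;
        f \<in> hom C X X'; f' \<in> hom C X' X''; g \<in> hom C Y Y'; g' \<in> hom C Y' Y''\<rbrakk>
        \<Longrightarrow> (f' \<cdot> f) \<odot> (g' \<cdot> g) = (f' \<odot> g') \<cdot> (f \<odot> g)"
    and tmo_bilinear: "\<lbrakk>par C X X'; par C Y Y'; rgt C X = lft C Y\<rbrakk>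
        \<Longrightarrow> bilinear_on (hom C X X') (hom C Y Y') (\<odot>)"
    and unit_obj: "unit C \<alpha> \<in> obj C \<alpha> \<alpha>"
    and unit_nonzero: "\<not> zero_object C (unit C \<alpha>)"
    and assoc_iso: "\<lbrakk>rgt C X = lft C Y; rgt C Y = lft C Z\<rbrakk>
        \<Longrightarrow> iso_arrow C ((X \<boxtimes> Y) \<boxtimes> Z) (X \<boxtimes> (Y \<boxtimes> Z)) (assoc C X Y Z)"
    and assoc_natural: "\<lbrakk>par C X X'; par C Y Y'; par C Z Z'; rgt C X = lft C Y; rgt C Y = lft C Z;
        f \<in> hom C X X'; g \<in> hom C Y Y'; h \<in> hom C Z Z'\<rbrakk>
        \<Longrightarrow> assoc C X' Y' Z' \<cdot> ((f \<odot> g) \<odot> h) = (f \<odot> (g \<odot> h)) \<cdot> assoc C X Y Z"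
    and lun_iso: "iso_arrow C (unit C (lft C X) \<boxtimes> X) X (lun C X)"
    and lun_natural: "\<lbrakk>par C X X'; f \<in> hom C X X'\<rbrakk>
        \<Longrightarrow> lun C X' \<cdot> (idm C (unit C (lft C X)) \<odot> f) = f \<cdot> lun C X"
    and run_iso: "iso_arrow C (X \<boxtimes> unit C (rgt C X)) X (run C X)"
    and run_natural: "\<lbrakk>par C X X'; f \<in> hom C X X'\<rbrakk>
        \<Longrightarrow> run C X' \<cdot> (f \<odot> idm C (unit C (rgt C X))) = f \<cdot> run C X"
    and pentagon: "\<lbrakk>rgt C W = lft C X; rgt C X = lft C Y; rgt C Y = lft C Z\<rbrakk>
        \<Longrightarrow> assoc C W X (Y \<boxtimes> Z) \<cdot> assoc C (W \<boxtimes> X) Y Z =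
            (idm C W \<odot> assoc C X Y Z) \<cdot> (assoc C W (X \<boxtimes> Y) Z \<cdot> (assoc C W X Y \<odot> idm C Z))"
    and triangle: "rgt C X = lft C Y
        \<Longrightarrow> (idm C X \<odot> lun C Y) \<cdot> assoc C X (unit C (rgt C X)) Y = run C X \<odot> idm C Y"

text \<open>
  \<open>is_left_dual C X X' e c\<close>: \<open>X'\<close> is a left dual of \<open>X\<close> via \<open>e : X' \<boxtimes> X \<rightarrow> 1\<close> and
  \<open>c : 1 \<rightarrow> X \<boxtimes> X'\<close>. Equivalently, \<open>X\<close> is a right dual of \<open>X'\<close>.
\<close>

definition is_left_dual ::
  "('j, 'o, 'm::complex_vs) pcat \<Rightarrow> 'o \<Rightarrow> 'o \<Rightarrow> 'm \<Rightarrow> 'm \<Rightarrow> bool" where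
  "is_left_dual C X X' e c \<longleftrightarrow>
     X' \<in> obj C (rgt C X) (lft C X) \<and>
     e \<in> hom C (X' \<boxtimes>\<^bsub>C\<^esub> X) (unit C (rgt C X)) \<and>
     c \<in> hom C (unit C (lft C X)) (X \<boxtimes>\<^bsub>C\<^esub> X') \<and>
     run C X \<cdot>\<^bsub>C\<^esub> ((idm C X \<odot>\<^bsub>C\<^esub> e) \<cdot>\<^bsub>C\<^esub> (assoc C X X' X \<cdot>\<^bsub>C\<^esub> (c \<odot>\<^bsub>C\<^esub> idm C X))) = lun C X \<and>
     (\<forall>b. inverse_arrows C ((X' \<boxtimes>\<^bsub>C\<^esub> X) \<boxtimes>\<^bsub>C\<^esub> X') (X' \<boxtimes>\<^bsub>C\<^esub> (X \<boxtimes>\<^bsub>C\<^esub> X')) (assoc C X' X X') b \<longrightarrow>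
        lun C X' \<cdot>\<^bsub>C\<^esub> ((e \<odot>\<^bsub>C\<^esub> idm C X') \<cdot>\<^bsub>C\<^esub> (b \<cdot>\<^bsub>C\<^esub> (idm C X' \<odot>\<^bsub>C\<^esub> c))) = run C X')"

locale partial_tensor_category_duality = partial_tensor_category +
  assumes left_dual: "is_left_dual C X (ldual C X) (ev C X) (coev C X)"
    and right_dual: "\<exists>Y e c. is_left_dual C Y X e c"

locale cstar_categories = additive_categories +
  assumes dag_hom: "\<lbrakk>par C X Y; f \<in> hom C X Y\<rbrakk> \<Longrightarrow> dag C f \<in> hom C Y X"
    and dag_antilinear: "par C X Y \<Longrightarrow> antilinear_on (hom C X Y) (dag C)"
    and dag_dag: "\<lbrakk>par C X Y; f \<in> hom C X Y\<rbrakk> \<Longrightarrow> dag C (dag C f) = f"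
    and dag_cmp: "\<lbrakk>par C X Y; par C Y Z; f \<in> hom C X Y; g \<in> hom C Y Z\<rbrakk>
        \<Longrightarrow> dag C (g \<cdot> f) = dag C f \<cdot> dag C g"
    and nrm_nonneg: "\<lbrakk>par C X Y; f \<in> hom C X Y\<rbrakk> \<Longrightarrow> 0 \<le> nrm C f"
    and nrm_eq_0: "\<lbrakk>par C X Y; f \<in> hom C X Y\<rbrakk> \<Longrightarrow> nrm C f = 0 \<longleftrightarrow> f = 0"
    and nrm_triangle: "\<lbrakk>par C X Y; f \<in> hom C X Y; g \<in> hom C X Y\<rbrakk>
        \<Longrightarrow> nrm C (f + g) \<le> nrm C f + nrm C g"
    and nrm_scale: "\<lbrakk>par C X Y; f \<in> hom C X Y\<rbrakk> \<Longrightarrow> nrm C (c *\<^sub>C f) = cmod c * nrm C f"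
    and nrm_complete: "\<lbrakk>par C X Y; \<And>n. s n \<in> hom C X Y;
        \<And>e. e > 0 \<Longrightarrow> \<exists>N. \<forall>m\<ge>N. \<forall>n\<ge>N. nrm C (s m - s n) < e\<rbrakk>
        \<Longrightarrow> \<exists>f\<in>hom C X Y. (\<lambda>n. nrm C (s n - f)) \<longlonglongrightarrow> (0::real)"
    and nrm_cmp: "\<lbrakk>par C X Y; par C Y Z; f \<in> hom C X Y; g \<in> hom C Y Z\<rbrakk>
        \<Longrightarrow> nrm C (g \<cdot> f) \<le> nrm C g * nrm C f"
    and cstar_identity: "\<lbrakk>par C X Y; f \<in> hom C X Y\<rbrakk> \<Longrightarrow> nrm C (dag C f \<cdot> f) = (nrm C f)\<^sup>2"
    and dag_positive: "\<lbrakk>par C X Y; f \<in> hom C X Y\<rbrakk>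
        \<Longrightarrow> \<exists>g\<in>hom C X X. dag C f \<cdot> f = dag C g \<cdot> g"

locale partial_fusion_cstar_category = partial_tensor_category_duality + cstar_categories +
  assumes semisimple:
      "\<exists>n Ys i p. direct_sum C X n Ys i p \<and> (\<forall>j<n. irreducible_object C (Ys j))"
    and dag_tmo: "\<lbrakk>par C X X'; par C Y Y'; rgt C X = lft C Y; f \<in> hom C X X'; g \<in> hom C Y Y'\<rbrakk>
        \<Longrightarrow> dag C (f \<odot> g) = dag C f \<odot> dag C g"
    and assoc_unitary: "\<lbrakk>rgt C X = lft C Y; rgt C Y = lft C Z\<rbrakk>
        \<Longrightarrow> inverse_arrows C ((X \<boxtimes> Y) \<boxtimes> Z) (X \<boxtimes> (Y \<boxtimes> Z)) (assoc C X Y Z) (dag C (assoc C X Y Z))"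
    and lun_unitary:
      "inverse_arrows C (unit C (lft C X) \<boxtimes> X) X (lun C X) (dag C (lun C X))"
    and run_unitary:
      "inverse_arrows C (X \<boxtimes> unit C (rgt C X)) X (run C X) (dag C (run C X))"

definition indecomposable_units :: "('j, 'o, 'm::complex_vs) pcat \<Rightarrow> bool" where
  "indecomposable_units C \<longleftrightarrow> (\<forall>\<alpha>. indecomposable_object C (unit C \<alpha>))"

definition maximal_irreducible_family ::
  "('j, 'o, 'm::complex_vs) pcat \<Rightarrow> ('a \<Rightarrow> 'o) \<Rightarrow> bool" where
  "maximal_irreducible_family C u \<longleftrightarrow>
     (\<forall>a. irreducible_object C (u a)) \<and>
     (\<forall>a b. isomorphic C (u a) (u b) \<longrightarrow> a = b) \<and>
     (\<forall>X. irreducible_object C X \<longrightarrow> (\<exists>a. isomorphic C X (u a))) \<and>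
     (\<forall>\<alpha>. \<exists>a. u a = unit C \<alpha>)"


section \<open>Unital morphisms to finite-dimensional Hilbert spaces\<close>

text \<open>
  \<open>Fob k l X\<close> is \<open>F\<^sub>k\<^sub>l(X)\<close>, \<open>Fmo k l X Y f\<close> is \<open>F\<^sub>k\<^sub>l(f)\<close> for \<open>f : X \<rightarrow> Y\<close>, \<open>Fio k l m X Y\<close> is the
  map \<open>\<iota>\<close> for \<open>(klm)\<close> defined on \<open>F\<^sub>k\<^sub>l(X) \<otimes> F\<^sub>l\<^sub>m(Y)\<close>, and \<open>Fmu k\<close> is \<open>\<mu>\<^sub>k\<close>.
\<close>

record ('i, 'o, 'm, 'v) umorph =
  Fob :: "'i \<Rightarrow> 'i \<Rightarrow> 'o \<Rightarrow> 'v hilb"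
  Fmo :: "'i \<Rightarrow> 'i \<Rightarrow> 'o \<Rightarrow> 'o \<Rightarrow> 'm \<Rightarrow> 'v \<Rightarrow> 'v"
  Fio :: "'i \<Rightarrow> 'i \<Rightarrow> 'i \<Rightarrow> 'o \<Rightarrow> 'o \<Rightarrow> ('v, 'v) tensor \<Rightarrow> 'v"
  Fmu :: "'i \<Rightarrow> complex \<Rightarrow> 'v"

locale unital_morphism =
  fixes C :: "('j, 'o, 'm::complex_vs) pcat" (structure)
    and \<phi> :: "'i \<Rightarrow> 'j"
    and F :: "('i, 'o, 'm, 'v::complex_vs) umorph"
  assumes Fob_hilbert: "X \<in> obj C (\<phi> k) (\<phi> l) \<Longrightarrow> fd_hilbert (Fob F k l X)"
    and Fmo_hmap: "\<lbrakk>X \<in> obj C (\<phi> k) (\<phi> l); Y \<in> obj C (\<phi> k) (\<phi> l); f \<in> hom C X Y\<rbrakk>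
        \<Longrightarrow> Fmo F k l X Y f \<in> hmap (Fob F k l X) (Fob F k l Y)"
    and Fmo_linear: "\<lbrakk>X \<in> obj C (\<phi> k) (\<phi> l); Y \<in> obj C (\<phi> k) (\<phi> l)\<rbrakk>
        \<Longrightarrow> linear_on (hom C X Y) (Fmo F k l X Y)"
    and Fmo_idm: "X \<in> obj C (\<phi> k) (\<phi> l) \<Longrightarrow> Fmo F k l X X (idm C X) = hid (Fob F k l X)"
    and Fmo_cmp: "\<lbrakk>X \<in> obj C (\<phi> k) (\<phi> l); Y \<in> obj C (\<phi> k) (\<phi> l); Z \<in> obj C (\<phi> k) (\<phi> l);
        f \<in> hom C X Y; g \<in> hom C Y Z\<rbrakk>
        \<Longrightarrow> Fmo F k l X Z (g \<cdot> f) = Fmo F k l Y Z g \<circ> Fmo F k l X Y f"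
    and Fmo_dag: "\<lbrakk>X \<in> obj C (\<phi> k) (\<phi> l); Y \<in> obj C (\<phi> k) (\<phi> l); f \<in> hom C X Y\<rbrakk>
        \<Longrightarrow> Fmo F k l Y X (dag C f) = hadj (Fob F k l X) (Fob F k l Y) (Fmo F k l X Y f)"
    and Fio_isometry: "\<lbrakk>X \<in> obj C (\<phi> k) (\<phi> l); Y \<in> obj C (\<phi> l) (\<phi> m)\<rbrakk>
        \<Longrightarrow> hisometry (htensor (Fob F k l X) (Fob F l m Y)) (Fob F k m (X \<boxtimes> Y)) (Fio F k l m X Y)"
    and Fio_natural: "\<lbrakk>X \<in> obj C (\<phi> k) (\<phi> l); X' \<in> obj C (\<phi> k) (\<phi> l);
        Y \<in> obj C (\<phi> l) (\<phi> m); Y' \<in> obj C (\<phi> l) (\<phi> m); f \<in> hom C X X'; g \<in> hom C Y Y'\<rbrakk>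
        \<Longrightarrow> Fmo F k m (X \<boxtimes> Y) (X' \<boxtimes> Y') (f \<odot> g) \<circ> Fio F k l m X Y =
            Fio F k l m X' Y' \<circ>
              htmap (Fob F k l X) (Fob F l m Y) (Fmo F k l X X' f) (Fmo F l m Y Y' g)"
    and Fmu_unitary: "hunitary hC (Fob F k k (unit C (\<phi> k))) (Fmu F k)"
    and Fob_unit_zero: "\<lbrakk>k \<noteq> l; \<phi> k = \<phi> l\<rbrakk> \<Longrightarrow> hsp (Fob F k l (unit C (\<phi> k))) = {0}"
    and Fob_rcf: "X \<in> obj C \<alpha> \<beta>
        \<Longrightarrow> rcf_on (\<phi> -` {\<alpha>}) (\<phi> -` {\<beta>}) (\<lambda>k l. hsp (Fob F k l X) \<noteq> {0})"
    and Fio_sum_unitary: "\<lbrakk>X \<in> obj C (\<phi> k) \<beta>; Y \<in> obj C \<beta> (\<phi> m)\<rbrakk>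
        \<Longrightarrow> let D = hdsum (\<phi> -` {\<beta>}) (\<lambda>l. htensor (Fob F k l X) (Fob F l m Y))
            in hunitary D (Fob F k m (X \<boxtimes> Y))
                 (\<lambda>t. if t \<in> hsp D then \<Sum>l | t l \<noteq> 0. Fio F k l m X Y (t l) else 0)"
    and Fio_assoc: "\<lbrakk>X \<in> obj C (\<phi> k) (\<phi> l); Y \<in> obj C (\<phi> l) (\<phi> m); Z \<in> obj C (\<phi> m) (\<phi> n);
        x \<in> hsp (Fob F k l X); y \<in> hsp (Fob F l m Y); z \<in> hsp (Fob F m n Z)\<rbrakk>
        \<Longrightarrow> Fmo F k n ((X \<boxtimes> Y) \<boxtimes> Z) (X \<boxtimes> (Y \<boxtimes> Z)) (assoc C X Y Z)
              (Fio F k m n (X \<boxtimes> Y) Z (Fio F k l m X Y (x \<otimes> y) \<otimes> z)) =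
            Fio F k l n X (Y \<boxtimes> Z) (x \<otimes> Fio F l m n Y Z (y \<otimes> z))"
    and Fio_lun: "\<lbrakk>X \<in> obj C (\<phi> k) (\<phi> l); x \<in> hsp (Fob F k l X)\<rbrakk>
        \<Longrightarrow> Fmo F k l (unit C (\<phi> k) \<boxtimes> X) X (lun C X)
              (Fio F k k l (unit C (\<phi> k)) X (Fmu F k c \<otimes> x)) = c *\<^sub>C x"
    and Fio_run: "\<lbrakk>X \<in> obj C (\<phi> k) (\<phi> l); x \<in> hsp (Fob F k l X)\<rbrakk>
        \<Longrightarrow> Fmo F k l (X \<boxtimes> unit C (\<phi> l)) X (run C X)
              (Fio F k l l X (unit C (\<phi> l)) (x \<otimes> Fmu F l c)) = c *\<^sub>C x"


section \<open>Partial compact quantum groups\<close>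

text \<open>
  \<open>sp k l m n\<close> is the space \<open>A\<close> with upper indices \<open>k l\<close> and lower indices \<open>m n\<close>. The spaces are
  not assumed to be independent in the ambient type, so all operations are indexed:
  \<open>mul k l p m n q\<close> is the product on \<open>sp k l m n \<times> sp l p n q\<close>, \<open>comul k l m n r s\<close> is \<open>\<Delta>\<^sub>r\<^sub>s\<close>
  on \<open>sp k l m n\<close>, \<open>counit k l\<close> is \<open>\<epsilon>\<close> on \<open>sp k l k l\<close>, \<open>one k m\<close> is the unit element in
  \<open>sp k k m m\<close>, and \<open>invol k l m n\<close> is the involution on \<open>sp k l m n\<close>.
\<close>

record ('i, 'x) pbialg =
  sp :: "'i \<Rightarrow> 'i \<Rightarrow> 'i \<Rightarrow> 'i \<Rightarrow> 'x set"
  mul :: "'i \<Rightarrow> 'i \<Rightarrow> 'i \<Rightarrow> 'i \<Rightarrow> 'i \<Rightarrow> 'i \<Rightarrow> 'x \<Rightarrow> 'x \<Rightarrow> 'x"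
  one :: "'i \<Rightarrow> 'i \<Rightarrow> 'x"
  comul :: "'i \<Rightarrow> 'i \<Rightarrow> 'i \<Rightarrow> 'i \<Rightarrow> 'i \<Rightarrow> 'i \<Rightarrow> 'x \<Rightarrow> ('x, 'x) tensor"
  counit :: "'i \<Rightarrow> 'i \<Rightarrow> 'x \<Rightarrow> complex"
  invol :: "'i \<Rightarrow> 'i \<Rightarrow> 'i \<Rightarrow> 'i \<Rightarrow> 'x \<Rightarrow> 'x"

definition counit0 :: "('i, 'x) pbialg \<Rightarrow> 'i \<Rightarrow> 'i \<Rightarrow> 'i \<Rightarrow> 'i \<Rightarrow> 'x \<Rightarrow> complex" where
  "counit0 A k l m n a = (if (k, l) = (m, n) then counit A k l a else 0)"

text \<open>
  The product of \<open>x \<in> sp k l r t \<otimes> sp r t m n\<close> and \<open>y \<in> sp l p t s \<otimes> sp t s n q\<close>.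
\<close>

definition tensor_mul ::
  "('i, 'x::complex_vs) pbialg \<Rightarrow> 'i \<Rightarrow> 'i \<Rightarrow> 'i \<Rightarrow> 'i \<Rightarrow> 'i \<Rightarrow> 'i \<Rightarrow> 'i \<Rightarrow> 'i \<Rightarrow> 'i
     \<Rightarrow> ('x, 'x) tensor \<Rightarrow> ('x, 'x) tensor \<Rightarrow> ('x, 'x) tensor" where
  "tensor_mul A k l p m n q r t s x y =
     tlift (sp A k l r t) (sp A r t m n)
       (\<lambda>a a'. tlift (sp A l p t s) (sp A t s n q)
          (\<lambda>b b'. mul A k l p r t s a b \<otimes> mul A r t s m n q a' b') y) x"

locale partial_bialgebra =
  fixes A :: "('i, 'x::complex_vs) pbialg"
  assumes sp_subspace: "cvs.subspace (sp A k l m n)"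
    and mul_closed: "\<lbrakk>a \<in> sp A k l m n; b \<in> sp A l p n q\<rbrakk> \<Longrightarrow> mul A k l p m n q a b \<in> sp A k p m q"
    and mul_bilinear: "bilinear_on (sp A k l m n) (sp A l p n q) (mul A k l p m n q)"
    and mul_assoc: "\<lbrakk>a \<in> sp A k l m n; b \<in> sp A l p n q; c \<in> sp A p r q s\<rbrakk>
        \<Longrightarrow> mul A k p r m q s (mul A k l p m n q a b) c = mul A k l r m n s a (mul A l p r n q s b c)"
    and one_closed: "one A k m \<in> sp A k k m m"
    and one_mul: "a \<in> sp A k l m n \<Longrightarrow> mul A k k l m m n (one A k m) a = a"
    and mul_one: "a \<in> sp A k l m n \<Longrightarrow> mul A k l l m n n a (one A l n) = a"
    and comul_closed: "a \<in> sp A k l m n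
        \<Longrightarrow> comul A k l m n r s a \<in> tensor_space (sp A k l r s) (sp A r s m n)"
    and comul_linear: "linear_on (sp A k l m n) (comul A k l m n r s)"
    and coassoc: "a \<in> sp A k l m n
        \<Longrightarrow> tassoc (sp A k l p q) (sp A p q r s) (sp A r s m n)
              (tmap (sp A k l r s) (sp A r s m n) (comul A k l r s p q) id
                (comul A k l m n r s a)) =
            tmap (sp A k l p q) (sp A p q m n) id (comul A p q m n r s)
              (comul A k l m n p q a)"
    and counit_linear: "linear_on (sp A k l k l) (counit A k l)"
    and counit_left: "a \<in> sp A k l m n
        \<Longrightarrow> tlift (sp A k l k l) (sp A k l m n) (\<lambda>b c. counit A k l b *\<^sub>C c)
              (comul A k l m n k l a) = a"
    and counit_right: "a \<in> sp A k l m n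
        \<Longrightarrow> tlift (sp A k l m n) (sp A m n m n) (\<lambda>b c. counit A m n c *\<^sub>C b)
              (comul A k l m n m n a) = a"
    and comul_one: "comul A k k m m l l' (one A k m) =
        (if l = l' then one A k l \<otimes> one A l m else 0)"
    and counit_mul: "\<lbrakk>a \<in> sp A k l m n; b \<in> sp A l p n q\<rbrakk>
        \<Longrightarrow> counit0 A k p m q (mul A k l p m n q a b) = counit0 A k l m n a * counit0 A l p n q b"
    and counit_one: "counit A k k (one A k k) = 1"
    and comul_rcf: "a \<in> sp A k l m n
        \<Longrightarrow> rcf_on UNIV UNIV (\<lambda>r s. comul A k l m n r s a \<noteq> 0)"
    and comul_mul: "\<lbrakk>a \<in> sp A k l m n; b \<in> sp A l p n q\<rbrakk>
        \<Longrightarrow> comul A k p m q r s (mul A k l p m n q a b) =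
            (\<Sum>t | comul A k l m n r t a \<noteq> 0 \<and> comul A l p n q t s b \<noteq> 0.
               tensor_mul A k l p m n q r t s (comul A k l m n r t a) (comul A l p n q t s b))"

definition is_antipode ::
  "('i, 'x::complex_vs) pbialg \<Rightarrow> ('i \<Rightarrow> 'i \<Rightarrow> 'i \<Rightarrow> 'i \<Rightarrow> 'x \<Rightarrow> 'x) \<Rightarrow> bool" where
  "is_antipode A S \<longleftrightarrow>
     (\<forall>k l m n. linear_on (sp A k l m n) (S k l m n) \<and>
        S k l m n ` sp A k l m n \<subseteq> sp A n m l k) \<and>
     (\<forall>k l m r. \<forall>a\<in>sp A k l m l.
        (\<Sum>s | comul A k l m l r s a \<noteq> 0.
           tlift (sp A k l r s) (sp A r s m l)
             (\<lambda>b c. mul A k l m r s r b (S r s m l c)) (comul A k l m l r s a)) =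
        (if k = m then counit A k l a *\<^sub>C one A k r else 0)) \<and>
     (\<forall>k l n s. \<forall>a\<in>sp A k l k n.
        (\<Sum>r | comul A k l k n r s a \<noteq> 0.
           tlift (sp A k l r s) (sp A r s k n)
             (\<lambda>b c. mul A s r s l k n (S k l r s b) c) (comul A k l k n r s a)) =
        (if l = n then counit A k l a *\<^sub>C one A s n else 0))"

locale partial_hopf_algebra = partial_bialgebra +
  assumes antipode: "\<exists>S. is_antipode A S"

locale partial_hopf_star_algebra = partial_hopf_algebra +
  assumes invol_closed: "a \<in> sp A k l m n \<Longrightarrow> invol A k l m n a \<in> sp A l k n m"
    and invol_antilinear: "antilinear_on (sp A k l m n) (invol A k l m n)"
    and invol_invol: "a \<in> sp A k l m n \<Longrightarrow> invol A l k n m (invol A k l m n a) = a"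
    and invol_mul: "\<lbrakk>a \<in> sp A k l m n; b \<in> sp A l p n q\<rbrakk>
        \<Longrightarrow> invol A k p m q (mul A k l p m n q a b) =
            mul A p l k q n m (invol A l p n q b) (invol A k l m n a)"
    and invol_one: "invol A k k m m (one A k m) = one A k m"
    and comul_invol: "a \<in> sp A k l m n
        \<Longrightarrow> tmap (sp A k l r s) (sp A r s m n) (invol A k l r s) (invol A r s m n)
              (comul A k l m n r s a) =
            comul A l k n m s r (invol A k l m n a)"

text \<open>The total algebra \<open>A\<close>, that is, the direct sum of all \<open>sp k l m n\<close>, as finitely supported families.\<close>

definition total_space ::
  "('i, 'x::complex_vs) pbialg \<Rightarrow> ('i \<Rightarrow> 'i \<Rightarrow> 'i \<Rightarrow> 'i \<Rightarrow> 'x) set" where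
  "total_space A = {a. (\<forall>k l m n. a k l m n \<in> sp A k l m n) \<and> finite {(k, l, m, n). a k l m n \<noteq> 0}}"

definition total_mul ::
  "('i, 'x::complex_vs) pbialg \<Rightarrow> ('i \<Rightarrow> 'i \<Rightarrow> 'i \<Rightarrow> 'i \<Rightarrow> 'x) \<Rightarrow> ('i \<Rightarrow> 'i \<Rightarrow> 'i \<Rightarrow> 'i \<Rightarrow> 'x)
     \<Rightarrow> 'i \<Rightarrow> 'i \<Rightarrow> 'i \<Rightarrow> 'i \<Rightarrow> 'x" where
  "total_mul A a b = (\<lambda>k p m q.
     \<Sum>(l, n) | a k l m n \<noteq> 0 \<and> b l p n q \<noteq> 0. mul A k l p m n q (a k l m n) (b l p n q))"

definition total_invol ::
  "('i, 'x::complex_vs) pbialg \<Rightarrow> ('i \<Rightarrow> 'i \<Rightarrow> 'i \<Rightarrow> 'i \<Rightarrow> 'x) \<Rightarrow> 'i \<Rightarrow> 'i \<Rightarrow> 'i \<Rightarrow> 'i \<Rightarrow> 'x" where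
  "total_invol A a = (\<lambda>k l m n. invol A l k n m (a l k n m))"

definition total_functional ::
  "('i \<Rightarrow> 'i \<Rightarrow> 'x::complex_vs \<Rightarrow> complex) \<Rightarrow> ('i \<Rightarrow> 'i \<Rightarrow> 'i \<Rightarrow> 'i \<Rightarrow> 'x) \<Rightarrow> complex" where
  "total_functional h a = (\<Sum>(k, m) | a k k m m \<noteq> 0. h k m (a k k m m))"

definition invariant_integral ::
  "('i, 'x::complex_vs) pbialg \<Rightarrow> ('i \<Rightarrow> 'i \<Rightarrow> 'x \<Rightarrow> complex) \<Rightarrow> bool" where
  "invariant_integral A h \<longleftrightarrow>
     (\<forall>k m. linear_on (sp A k k m m) (h k m)) \<and>
     (\<forall>k. h k k (one A k k) = 1) \<and>
     (\<forall>k p m l. \<forall>a\<in>sp A k p m m.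
        tlift (sp A k p l l) (sp A l l m m) (\<lambda>b c. h l m c *\<^sub>C b) (comul A k p m m l l a) =
        (if k = p then h k m a *\<^sub>C one A k l else 0)) \<and>
     (\<forall>k m p l. \<forall>a\<in>sp A k k m p.
        tlift (sp A k k l l) (sp A l l m p) (\<lambda>b c. h k l b *\<^sub>C c) (comul A k k m p l l a) =
        (if m = p then h k m a *\<^sub>C one A l m else 0))"

locale partial_compact_quantum_group = partial_hopf_star_algebra +
  assumes positive_invariant_integral:
    "\<exists>h. invariant_integral A h \<and>
       (\<forall>a\<in>total_space A. total_functional h (total_mul A (total_invol A a) a) \<in> \<real>\<^sub>\<ge>\<^sub>0)"


section \<open>Reconstruction\<close>

text \<open>
  \<open>nat_trans C \<phi> F m n k l\<close> is \<open>Nat(F\<^sub>m\<^sub>n, F\<^sub>k\<^sub>l)\<close>, for \<open>\<phi> k = \<phi> m\<close> and \<open>\<phi> l = \<phi> n\<close>. Components at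
  objects of other categories are set to \<open>0\<close>.
\<close>

definition nat_trans ::
  "('j, 'o, 'm::complex_vs) pcat \<Rightarrow> ('i \<Rightarrow> 'j) \<Rightarrow> ('i, 'o, 'm, 'v::complex_vs) umorph
     \<Rightarrow> 'i \<Rightarrow> 'i \<Rightarrow> 'i \<Rightarrow> 'i \<Rightarrow> ('o \<Rightarrow> 'v \<Rightarrow> 'v) set" where
  "nat_trans C \<phi> F m n k l = {x. \<phi> k = \<phi> m \<and> \<phi> l = \<phi> n \<and>
     (\<forall>X\<in>obj C (\<phi> k) (\<phi> l). x X \<in> hmap (Fob F m n X) (Fob F k l X)) \<and>
     (\<forall>X. X \<notin> obj C (\<phi> k) (\<phi> l) \<longrightarrow> x X = 0) \<and>
     (\<forall>X\<in>obj C (\<phi> k) (\<phi> l). \<forall>Y\<in>obj C (\<phi> k) (\<phi> l). \<forall>f\<in>hom C X Y.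
        x Y \<circ> Fmo F m n X Y f = Fmo F k l X Y f \<circ> x X)}"

definition nat_id ::
  "('j, 'o, 'm::complex_vs) pcat \<Rightarrow> ('i \<Rightarrow> 'j) \<Rightarrow> ('i, 'o, 'm, 'v::complex_vs) umorph
     \<Rightarrow> 'i \<Rightarrow> 'i \<Rightarrow> 'o \<Rightarrow> 'v \<Rightarrow> 'v" where
  "nat_id C \<phi> F k l = (\<lambda>X. if X \<in> obj C (\<phi> k) (\<phi> l) then hid (Fob F k l X) else 0)"

definition nat_comp :: "('o \<Rightarrow> 'v \<Rightarrow> 'v) \<Rightarrow> ('o \<Rightarrow> 'v \<Rightarrow> 'v) \<Rightarrow> 'o \<Rightarrow> 'v \<Rightarrow> 'v" where
  "nat_comp x y = (\<lambda>X. x X \<circ> y X)"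

text \<open>The pointwise adjoint of \<open>x \<in> nat_trans C \<phi> F m n k l\<close>.\<close>

definition nat_adj ::
  "('j, 'o, 'm::complex_vs) pcat \<Rightarrow> ('i \<Rightarrow> 'j) \<Rightarrow> ('i, 'o, 'm, 'v::complex_vs) umorph
     \<Rightarrow> 'i \<Rightarrow> 'i \<Rightarrow> 'i \<Rightarrow> 'i \<Rightarrow> ('o \<Rightarrow> 'v \<Rightarrow> 'v) \<Rightarrow> 'o \<Rightarrow> 'v \<Rightarrow> 'v" where
  "nat_adj C \<phi> F m n k l x =
     (\<lambda>X. if X \<in> obj C (\<phi> k) (\<phi> l) then hadj (Fob F m n X) (Fob F k l X) (x X) else 0)"

type_synonym ('a, 'v) rec_elem = "'a \<Rightarrow> ('v \<Rightarrow> 'v) \<Rightarrow> complex"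

definition rec_comp ::
  "('j, 'o, 'm::complex_vs) pcat \<Rightarrow> ('i \<Rightarrow> 'j) \<Rightarrow> ('i, 'o, 'm, 'v::complex_vs) umorph \<Rightarrow> ('a \<Rightarrow> 'o)
     \<Rightarrow> 'i \<Rightarrow> 'i \<Rightarrow> 'i \<Rightarrow> 'i \<Rightarrow> 'a \<Rightarrow> (('v \<Rightarrow> 'v) \<Rightarrow> complex) set" where
  "rec_comp C \<phi> F u k l m n a =
     (if \<phi> k = \<phi> m \<and> \<phi> m = lft C (u a) \<and> \<phi> l = \<phi> n \<and> \<phi> n = rgt C (u a)
      then dual_space (hmap (Fob F m n (u a)) (Fob F k l (u a))) else {0})"

definition rec_sp ::
  "('j, 'o, 'm::complex_vs) pcat \<Rightarrow> ('i \<Rightarrow> 'j) \<Rightarrow> ('i, 'o, 'm, 'v::complex_vs) umorph \<Rightarrow> ('a \<Rightarrow> 'o)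
     \<Rightarrow> 'i \<Rightarrow> 'i \<Rightarrow> 'i \<Rightarrow> 'i \<Rightarrow> ('a, 'v) rec_elem set" where
  "rec_sp C \<phi> F u k l m n = {f. (\<forall>a. f a \<in> rec_comp C \<phi> F u k l m n a) \<and> finite {a. f a \<noteq> 0}}"

definition rec_pair :: "('a \<Rightarrow> 'o) \<Rightarrow> ('a, 'v) rec_elem \<Rightarrow> ('o \<Rightarrow> 'v \<Rightarrow> 'v) \<Rightarrow> complex" where
  "rec_pair u f x = (\<Sum>a | f a \<noteq> 0. f a (x (u a)))"

definition rec_comul ::
  "('j, 'o, 'm::complex_vs) pcat \<Rightarrow> ('i \<Rightarrow> 'j) \<Rightarrow> ('i, 'o, 'm, 'v::complex_vs) umorph \<Rightarrow> ('a \<Rightarrow> 'o)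
     \<Rightarrow> 'i \<Rightarrow> 'i \<Rightarrow> 'i \<Rightarrow> 'i \<Rightarrow> 'i \<Rightarrow> 'i \<Rightarrow> ('a, 'v) rec_elem
     \<Rightarrow> (('a, 'v) rec_elem, ('a, 'v) rec_elem) tensor" where
  "rec_comul C \<phi> F u k l m n r s f =
     (THE t. t \<in> tensor_space (rec_sp C \<phi> F u k l r s) (rec_sp C \<phi> F u r s m n) \<and>
        (\<forall>x\<in>nat_trans C \<phi> F r s k l. \<forall>y\<in>nat_trans C \<phi> F m n r s.
           tlift (rec_sp C \<phi> F u k l r s) (rec_sp C \<phi> F u r s m n)
             (\<lambda>g h. rec_pair u g x * rec_pair u h y) t = rec_pair u f (nat_comp x y)))"

definition rec_counit ::
  "('j, 'o, 'm::complex_vs) pcat \<Rightarrow> ('i \<Rightarrow> 'j) \<Rightarrow> ('i, 'o, 'm, 'v::complex_vs) umorph \<Rightarrow> ('a \<Rightarrow> 'o)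
     \<Rightarrow> 'i \<Rightarrow> 'i \<Rightarrow> ('a, 'v) rec_elem \<Rightarrow> complex" where
  "rec_counit C \<phi> F u k l f = rec_pair u f (nat_id C \<phi> F k l)"

text \<open>
  \<open>Fpi C F k l m X Y\<close> is \<open>\<pi>\<close>, the adjoint of \<open>\<iota>\<close>. For \<open>x \<in> Nat(F\<^sub>r\<^sub>t, F\<^sub>k\<^sub>m)\<close>,
  \<open>rec_hat C F k l m r s t x\<close> is the dual coproduct of \<open>x\<close> with intermediate indices \<open>l\<close> and \<open>s\<close>.
\<close>

definition Fpi ::
  "('j, 'o, 'm::complex_vs) pcat \<Rightarrow> ('i, 'o, 'm, 'v::complex_vs) umorph
     \<Rightarrow> 'i \<Rightarrow> 'i \<Rightarrow> 'i \<Rightarrow> 'o \<Rightarrow> 'o \<Rightarrow> 'v \<Rightarrow> ('v, 'v) tensor" where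
  "Fpi C F k l m X Y =
     hadj (htensor (Fob F k l X) (Fob F l m Y)) (Fob F k m (X \<boxtimes>\<^bsub>C\<^esub> Y)) (Fio F k l m X Y)"

definition rec_hat ::
  "('j, 'o, 'm::complex_vs) pcat \<Rightarrow> ('i, 'o, 'm, 'v::complex_vs) umorph
     \<Rightarrow> 'i \<Rightarrow> 'i \<Rightarrow> 'i \<Rightarrow> 'i \<Rightarrow> 'i \<Rightarrow> 'i \<Rightarrow> ('o \<Rightarrow> 'v \<Rightarrow> 'v)
     \<Rightarrow> 'o \<Rightarrow> 'o \<Rightarrow> ('v, 'v) tensor \<Rightarrow> ('v, 'v) tensor" where
  "rec_hat C F k l m r s t x X Y = Fpi C F k l m X Y \<circ> x (X \<boxtimes>\<^bsub>C\<^esub> Y) \<circ> Fio F r s t X Y"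

text \<open>
  The product of \<open>f \<in> rec_sp k l r s\<close> and \<open>g \<in> rec_sp l m s t\<close>; the functional \<open>f \<otimes> g\<close> on
  \<open>Nat(F\<^sub>r\<^sub>s \<otimes> F\<^sub>s\<^sub>t, F\<^sub>k\<^sub>l \<otimes> F\<^sub>l\<^sub>m)\<close> is evaluated through the components at pairs \<open>(u a, u b)\<close>.
\<close>

definition rec_mul ::
  "('j, 'o, 'm::complex_vs) pcat \<Rightarrow> ('i \<Rightarrow> 'j) \<Rightarrow> ('i, 'o, 'm, 'v::complex_vs) umorph \<Rightarrow> ('a \<Rightarrow> 'o)
     \<Rightarrow> 'i \<Rightarrow> 'i \<Rightarrow> 'i \<Rightarrow> 'i \<Rightarrow> 'i \<Rightarrow> 'i \<Rightarrow> ('a, 'v) rec_elem \<Rightarrow> ('a, 'v) rec_elem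
     \<Rightarrow> ('a, 'v) rec_elem" where
  "rec_mul C \<phi> F u k l m r s t f g =
     (THE h. h \<in> rec_sp C \<phi> F u k m r t \<and>
        (\<forall>x\<in>nat_trans C \<phi> F r t k m. rec_pair u h x =
           (\<Sum>a | f a \<noteq> 0. \<Sum>b | g b \<noteq> 0.
              functional_tensor (Fob F r s (u a)) (Fob F k l (u a)) (Fob F s t (u b)) (Fob F l m (u b))
                (f a) (g b) (rec_hat C F k l m r s t x (u a) (u b)))))"

text \<open>
  \<open>T \<mapsto> \<mu>\<^sub>k\<^sup>* T \<mu>\<^sub>l\<close> identifies \<open>Hom(F\<^sub>l\<^sub>l(1), F\<^sub>k\<^sub>k(1))\<close> with the complex numbers; the unit element is
  this functional.
\<close>

definition rec_one ::
  "('j, 'o, 'm::complex_vs) pcat \<Rightarrow> ('i \<Rightarrow> 'j) \<Rightarrow> ('i, 'o, 'm, 'v::complex_vs) umorph \<Rightarrow> ('a \<Rightarrow> 'o)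
     \<Rightarrow> 'i \<Rightarrow> 'i \<Rightarrow> ('a, 'v) rec_elem" where
  "rec_one C \<phi> F u k l = (\<lambda>a T.
     let I = unit C (\<phi> k) in
     if \<phi> k = \<phi> l \<and> u a = I \<and> T \<in> hmap (Fob F l l I) (Fob F k k I)
     then hadj hC (Fob F k k I) (Fmu F k) (T (Fmu F l 1)) else 0)"

definition Fcoev ::
  "('j, 'o, 'm::complex_vs) pcat \<Rightarrow> ('i \<Rightarrow> 'j) \<Rightarrow> ('i, 'o, 'm, 'v::complex_vs) umorph
     \<Rightarrow> 'i \<Rightarrow> 'i \<Rightarrow> 'o \<Rightarrow> ('v, 'v) tensor" where
  "Fcoev C \<phi> F k l X = Fpi C F k l k X (ldual C X)
     (Fmo F k k (unit C (\<phi> k)) (X \<boxtimes>\<^bsub>C\<^esub> ldual C X) (coev C X) (Fmu F k 1))"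

definition Fev ::
  "('j, 'o, 'm::complex_vs) pcat \<Rightarrow> ('i \<Rightarrow> 'j) \<Rightarrow> ('i, 'o, 'm, 'v::complex_vs) umorph
     \<Rightarrow> 'i \<Rightarrow> 'i \<Rightarrow> 'o \<Rightarrow> ('v, 'v) tensor \<Rightarrow> complex" where
  "Fev C \<phi> F k l X t = hadj hC (Fob F l l (unit C (\<phi> l))) (Fmu F l)
     (Fmo F l l (ldual C X \<boxtimes>\<^bsub>C\<^esub> X) (unit C (\<phi> l)) (ev C X) (Fio F l k l (ldual C X) X t))"

text \<open>
  For \<open>x \<in> Nat(F\<^sub>m\<^sub>n, F\<^sub>k\<^sub>l)\<close>, \<open>rec_antipode C \<phi> F k l m n x \<in> Nat(F\<^sub>l\<^sub>k, F\<^sub>n\<^sub>m)\<close> is the composite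
  \<open>(id \<otimes> ev) (id \<otimes> x \<otimes> id) (coev \<otimes> id)\<close>: if \<open>coev\<close> is a sum of tensors \<open>w \<otimes> z\<close>, then \<open>v\<close> is mapped
  to the sum of the vectors \<open>ev (x z \<otimes> v) w\<close>.
\<close>

definition rec_antipode ::
  "('j, 'o, 'm::complex_vs) pcat \<Rightarrow> ('i \<Rightarrow> 'j) \<Rightarrow> ('i, 'o, 'm, 'v::complex_vs) umorph
     \<Rightarrow> 'i \<Rightarrow> 'i \<Rightarrow> 'i \<Rightarrow> 'i \<Rightarrow> ('o \<Rightarrow> 'v \<Rightarrow> 'v) \<Rightarrow> 'o \<Rightarrow> 'v \<Rightarrow> 'v" where
  "rec_antipode C \<phi> F k l m n x = (\<lambda>X v.
     if X \<in> obj C (\<phi> l) (\<phi> k) \<and> v \<in> hsp (Fob F l k X)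
     then tlift (hsp (Fob F n m X)) (hsp (Fob F m n (ldual C X)))
            (\<lambda>w z. Fev C \<phi> F l k X (x (ldual C X) z \<otimes> v) *\<^sub>C w) (Fcoev C \<phi> F n m X)
     else 0)"

definition rec_invol ::
  "('j, 'o, 'm::complex_vs) pcat \<Rightarrow> ('i \<Rightarrow> 'j) \<Rightarrow> ('i, 'o, 'm, 'v::complex_vs) umorph \<Rightarrow> ('a \<Rightarrow> 'o)
     \<Rightarrow> 'i \<Rightarrow> 'i \<Rightarrow> 'i \<Rightarrow> 'i \<Rightarrow> ('a, 'v) rec_elem \<Rightarrow> ('a, 'v) rec_elem" where
  "rec_invol C \<phi> F u k l m n f =
     (THE h. h \<in> rec_sp C \<phi> F u l k n m \<and>
        (\<forall>x\<in>nat_trans C \<phi> F n m l k. rec_pair u h x =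
           cnj (rec_pair u f (nat_adj C \<phi> F k l m n (rec_antipode C \<phi> F l k n m x)))))"

definition reconstruction ::
  "('j, 'o, 'm::complex_vs) pcat \<Rightarrow> ('i \<Rightarrow> 'j) \<Rightarrow> ('i, 'o, 'm, 'v::complex_vs) umorph \<Rightarrow> ('a \<Rightarrow> 'o)
     \<Rightarrow> ('i, ('a, 'v) rec_elem) pbialg" where
  "reconstruction C \<phi> F u =
     \<lparr>sp = rec_sp C \<phi> F u,
      mul = rec_mul C \<phi> F u,
      one = rec_one C \<phi> F u,
      comul = rec_comul C \<phi> F u,
      counit = rec_counit C \<phi> F u,
      invol = rec_invol C \<phi> F u\<rparr>"

end

theory Submission
  imports Defs
begin

text \<open>
  The elements of \<open>A\<^sup>k\<^sup>l\<^sub>m\<^sub>n\<close> are sums of matrix coefficients \<open>c\<^sub>X(v, w) : x \<mapsto> \<langle>v, x\<^sub>X w\<rangle>\<close> with \<open>v \<in> F\<^sub>k\<^sub>l X\<close> and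
  \<open>w \<in> F\<^sub>m\<^sub>n X\<close>, where \<open>X\<close> may be any object: by semisimplicity such a functional is a sum of
  coefficients of irreducible objects (\<open>mc\<close>, \<open>A_induct\<close>). By Schur's lemma every family of
  operators on the irreducible objects extends to a natural transformation (\<open>nat_extend\<close>), so elements of
  \<open>A\<close> and of tensor products are determined by their values on natural transformations (\<open>A_eqI\<close>,
  \<open>A_tensor_eqI\<close>). In this way all structure maps become formulas for vectors:

    \<^item> \<open>\<Delta>\<^sub>r\<^sub>s c(v, w) = \<Sum>\<^sub>e c(v, e) \<otimes> c(e, w)\<close> for an orthonormal basis of \<open>F\<^sub>r\<^sub>s X\<close> (\<open>comul_mc\<close>), and
      \<open>\<epsilon>(c(v, w)) = \<langle>v, w\<rangle>\<close>;
    \<^item> \<open>c\<^sub>X(v, w) c\<^sub>Y(v', w')\<close> is the coefficient of \<open>X \<otimes> Y\<close> for \<open>\<iota>(v \<otimes> v')\<close> and \<open>\<iota>(w \<otimes> w')\<close>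
      (\<open>mul_mc\<close>), and the unit is the coefficient of the unit object for the vectors \<open>\<mu>\<close>;
    \<^item> \<open>c\<^sub>X(v, w)\<^sup>*\<close> and \<open>S(c\<^sub>X(v, w))\<close> are coefficients of the dual of \<open>X\<close>, for vectors that are read off
      from the images of \<open>coev\<close> and \<open>ev\<close> under \<open>F\<close> (\<open>inv_mc\<close>, \<open>S_mc\<close>).

  Equality of two coefficients of different objects is always an instance of naturality: a morphism
  \<open>g : X \<rightarrow> Y\<close> may be moved from one vector to the other (\<open>mc_natural\<close>). Associativity and the unit laws
  arise in this way from the constraints of the category. Multiplicativity of \<open>\<Delta>\<close> and of \<open>\<epsilon>\<close> says that
  the vectors \<open>\<iota>(e \<otimes> f)\<close>, over all intermediate indices, form an orthonormal basis of \<open>F(X \<otimes> Y)\<close>.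
  Writing \<open>X'\<close> for the dual of \<open>X\<close>, the antipode identities arise from \<open>coev : 1 \<rightarrow> X \<otimes> X'\<close> and
  \<open>ev : X' \<otimes> X \<rightarrow> 1\<close>. For the involution, the point is that the adjoint of a coefficient of \<open>X\<close> can be
  computed with every object that pairs with \<open>X\<close>, not just with the chosen dual (\<open>inv_mc_general\<close>):
  with \<open>X\<close> itself for the dual of \<open>X\<close>, which gives \<open>a\<^sup>*\<^sup>* = a\<close>, and with \<open>Y' \<otimes> X'\<close> for \<open>X \<otimes> Y\<close>, which
  gives \<open>(ab)\<^sup>* = b\<^sup>*a\<^sup>*\<close>.

  The invariant integral is evaluation at the natural transformation that vanishes on all irreducible
  objects except the unit, where it is the rank one operator sending \<open>\<mu>\<^sub>m\<close> to \<open>\<mu>\<^sub>k\<close>. Invariance holds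
  because composing with this transformation leaves only a value at the unit object. For positivity,
  a morphism from the dual of \<open>u\<^sub>a\<close> tensored with \<open>u\<^sub>b\<close> to the unit is a multiple of \<open>ev\<close> if \<open>a = b\<close> and
  vanishes otherwise. This yields the orthogonality relations for coefficients of the form
  \<open>c(v, e)\<close> with \<open>e\<close> in an orthonormal basis, up to a constant that depends on the irreducible object
  only; the diagonal values are nonnegative since for coinciding indices the transformation consists of
  orthogonal projections (\<open>unit_proj_nonneg\<close>, \<open>haar_orthogonality\<close>, \<open>haar_mc\<close>).
\<close>

(* Tensors and elements of the reconstructed spaces are functions, but their sums are to be read as
   sums of vectors. *)
declare plus_fun_apply [simp del] zero_fun_apply [simp del]

section \<open>Linear maps on subspaces and the universal property of the tensor product\<close>

lemma linear_onD:
  assumes "linear_on V f"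
  shows linear_on_add: "x \<in> V \<Longrightarrow> y \<in> V \<Longrightarrow> f (x + y) = f x + f y"
    and linear_on_scale: "x \<in> V \<Longrightarrow> f (c *\<^sub>C x) = c *\<^sub>C f x"
  using assms by (auto simp: linear_on_def)

lemma linear_on_zero: "linear_on V f \<Longrightarrow> 0 \<in> V \<Longrightarrow> f 0 = 0"
  using linear_on_scale[of V f 0 0] by simp

lemma linear_on_sum:
  assumes "linear_on V f" "cvs.subspace V" "\<And>i. i \<in> I \<Longrightarrow> x i \<in> V"
  shows "f (\<Sum>i\<in>I. x i) = (\<Sum>i\<in>I. f (x i))"
  using assms(3)
proof (induction I rule: infinite_finite_induct)
  case (insert i I)
  have "(\<Sum>i\<in>I. x i) \<in> V" using insert assms(2) by (auto intro: cvs.subspace_sum)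
  with insert show ?case using linear_on_add[OF assms(1)] by simp
qed (use linear_on_zero[OF assms(1)] assms(2) cvs.subspace_0 in auto)

lemma scaleC_sum_list: "c *\<^sub>C (\<Sum>x\<leftarrow>xs. f x) = (\<Sum>x\<leftarrow>xs. c *\<^sub>C f x)"
  by (induction xs) (auto simp: cvs.scale_right_distrib)

lemma sum_list_fun_apply: "(\<Sum>x\<leftarrow>xs. f x) y = (\<Sum>x\<leftarrow>xs. f x y)"
  by (induction xs) (auto simp: plus_fun_apply zero_fun_apply)

lemma sum_list_in_subspace:
  "cvs.subspace V \<Longrightarrow> (\<And>x. x \<in> set xs \<Longrightarrow> f x \<in> V) \<Longrightarrow> (\<Sum>x\<leftarrow>xs. f x) \<in> V"
  by (induction xs) (auto intro: cvs.subspace_add cvs.subspace_0)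

lemma sum_list_additive:
  assumes "cvs.subspace V" "\<And>x y. x \<in> V \<Longrightarrow> y \<in> V \<Longrightarrow> L (x + y) = L x + L y" "L 0 = 0"
    and "\<And>x. x \<in> set xs \<Longrightarrow> f x \<in> V"
  shows "L (\<Sum>x\<leftarrow>xs. f x) = (\<Sum>x\<leftarrow>xs. L (f x))"
  using assms(4)
proof (induction xs)
  case (Cons a xs)
  have "(\<Sum>x\<leftarrow>xs. f x) \<in> V" using Cons by (intro sum_list_in_subspace[OF assms(1)]) auto
  with Cons show ?case by (simp add: assms(2))
qed (simp add: assms(3))

lemma sum_sum_list_swap: "(\<Sum>b\<in>S. \<Sum>x\<leftarrow>xs. f b x) = (\<Sum>x\<leftarrow>xs. \<Sum>b\<in>S. f b x)"
  by (induction xs) (auto simp: sum.distrib)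

text \<open>Coordinate functionals come from a basis of the ambient space that extends the given one.\<close>

lemma basis_functional:
  assumes "cvs.independent B"
  shows "linear_on UNIV (\<lambda>v. cvs.representation (cvs.extend_basis B) v b)"
  using assms unfolding linear_on_def
  by (simp add: cvs.representation_add cvs.representation_scale cvs.independent_extend_basis
      cvs.span_extend_basis scaleC_complex_def)

lemma functionals_separate_points:
  fixes x :: "'a::complex_vs"
  assumes "\<And>g. linear_on UNIV g \<Longrightarrow> g x = (0 :: complex)"
  shows "x = 0"
proof (rule ccontr)
  assume "x \<noteq> 0"
  then have i: "cvs.independent {x}" by simp
  then have "cvs.representation (cvs.extend_basis {x}) x x = 1"
    using cvs.representation_basis[OF cvs.independent_extend_basis[OF i], of x]
      cvs.extend_basis_superset[OF i] by auto
  with assms[OF basis_functional[OF i, of x]] show False by simp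
qed

text \<open>
  A map out of the tensor product is well defined as soon as it is biadditive and balanced; this
  covers bilinear maps as well as maps that are conjugate linear in both arguments.
\<close>

definition balanced_on ::
  "'a::complex_vs set \<Rightarrow> 'b::complex_vs set \<Rightarrow> ('a \<Rightarrow> 'b \<Rightarrow> 'c::ab_group_add) \<Rightarrow> bool" where
  "balanced_on V W b \<longleftrightarrow>
     (\<forall>v\<in>V. \<forall>v'\<in>V. \<forall>w\<in>W. b (v + v') w = b v w + b v' w) \<and>
     (\<forall>v\<in>V. \<forall>w\<in>W. \<forall>w'\<in>W. b v (w + w') = b v w + b v w') \<and>
     (\<forall>c. \<forall>v\<in>V. \<forall>w\<in>W. b (c *\<^sub>C v) w = b v (c *\<^sub>C w))"

lemma bilinear_balanced: "bilinear_on V W b \<Longrightarrow> balanced_on V W b"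
  by (auto simp: bilinear_on_def balanced_on_def linear_on_def)

lemma balanced_zero:
  assumes "balanced_on V W b" "cvs.subspace V" "cvs.subspace W"
  shows "v \<in> V \<Longrightarrow> b v 0 = 0" "w \<in> W \<Longrightarrow> b 0 w = 0"
proof -
  show "b v 0 = 0" if "v \<in> V"
    using assms that cvs.subspace_0[OF assms(3)] unfolding balanced_on_def
    by (metis add_cancel_right_right)
  show "b 0 w = 0" if "w \<in> W"
    using assms that cvs.subspace_0[OF assms(2)] unfolding balanced_on_def
    by (metis add_cancel_right_right)
qed

text \<open>
  Only finitely many basis vectors occur in a given list, which avoids infinite sums although the
  spaces may have infinite dimension. The coordinates are functionals on the whole ambient type, as
  is required for evaluating a tensor on them.
\<close>

lemma tensor_list_basis:
  fixes ps :: "('a::complex_vs \<times> 'b::complex_vs) list"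
  assumes V: "cvs.subspace V" and ps: "set ps \<subseteq> V \<times> W"
  obtains S r where "finite S" "S \<subseteq> V" "cvs.independent S"
    and "\<And>b. b \<in> S \<Longrightarrow> linear_on UNIV (\<lambda>v. r v b :: complex)"
    and "\<And>v w. (v, w) \<in> set ps \<Longrightarrow> v = (\<Sum>b\<in>S. r v b *\<^sub>C b)"
proof -
  let ?P = "fst ` set ps"
  obtain B where B: "B \<subseteq> V" "cvs.independent B" "V \<subseteq> cvs.span B"
    using cvs.basis_exists by metis
  let ?r = "\<lambda>v. cvs.representation (cvs.extend_basis B) v"
  let ?S = "\<Union>v\<in>?P. {b. ?r v b \<noteq> 0}"
  have e: "?r v = cvs.representation B v" if "v \<in> V" for v
    using that B cvs.representation_extend[OF cvs.independent_extend_basis[OF B(2)], of v B]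
      cvs.extend_basis_superset[OF B(2)] by auto
  have P: "?P \<subseteq> V" using ps by auto
  have sub: "?S \<subseteq> B"
  proof
    fix b assume "b \<in> ?S"
    then obtain v where v: "v \<in> ?P" "?r v b \<noteq> 0" by auto
    then show "b \<in> B" using e[of v] P cvs.representation_ne_zero[of B v b] by auto
  qed
  have fin: "finite ?S" by (auto intro: cvs.finite_representation)
  show ?thesis
  proof (rule that[of ?S ?r])
    show "finite ?S" by fact
    show "?S \<subseteq> V" using sub B by blast
    show "cvs.independent ?S" using sub B(2) cvs.independent_mono by blast
    show "linear_on UNIV (\<lambda>v. ?r v b)" for b using basis_functional[OF B(2)] .
    show "v = (\<Sum>b\<in>?S. ?r v b *\<^sub>C b)" if "(v, w) \<in> set ps" for v w
    proof -
      have vV: "v \<in> V" "v \<in> ?P" using that ps by force+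
      have "v = (\<Sum>b | ?r v b \<noteq> 0. ?r v b *\<^sub>C b)"
        using cvs.sum_nonzero_representation_eq[OF B(2), of v] vV B(3) e[OF vV(1)] by auto
      also have "\<dots> = (\<Sum>b\<in>?S. ?r v b *\<^sub>C b)"
        using fin vV(2) by (intro sum.mono_neutral_left) auto
      finally show ?thesis .
    qed
  qed
qed

text \<open>Collecting the terms of a balanced expression along a basis of the first factor.\<close>

lemma tens_rep_subsp:
  assumes V: "cvs.subspace V" and W: "cvs.subspace W" and ps: "set ps \<subseteq> V \<times> W"
    and b: "balanced_on V W b"
    and S: "finite S" "S \<subseteq> V"
    and r: "\<And>v w. (v, w) \<in> set ps \<Longrightarrow> v = (\<Sum>b\<in>S. r v b *\<^sub>C b)"
  shows "(\<Sum>(v, w)\<leftarrow>ps. b v w) = (\<Sum>s\<in>S. b s (\<Sum>(v, w)\<leftarrow>ps. r v s *\<^sub>C w))"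
proof -
  have 1: "b v w = (\<Sum>s\<in>S. b s (r v s *\<^sub>C w))" if vw: "(v, w) \<in> set ps" for v w
  proof -
    have w: "w \<in> W" using vw ps by auto
    have "b (\<Sum>s\<in>S'. r v s *\<^sub>C s) w = (\<Sum>s\<in>S'. b s (r v s *\<^sub>C w))" if "S' \<subseteq> S" for S'
      using finite_subset[OF that S(1)] that
    proof (induction S' rule: finite_induct)
      case (insert s S')
      have m: "(\<Sum>s\<in>S'. r v s *\<^sub>C s) \<in> V" "s \<in> V" "r v s *\<^sub>C s \<in> V"
        using insert S V by (auto intro!: cvs.subspace_sum cvs.subspace_scale)
      show ?case using insert b m w unfolding balanced_on_def by simp
    qed (use balanced_zero[OF b V W] w in auto)
    from this[of S] show ?thesis using r[OF vw] by simp
  qed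
  have "(\<Sum>(v, w)\<leftarrow>ps. b v w) = (\<Sum>p\<leftarrow>ps. \<Sum>s\<in>S. b s (r (fst p) s *\<^sub>C snd p))"
    using 1 by (intro arg_cong[of _ _ sum_list] map_cong) auto
  also have "\<dots> = (\<Sum>s\<in>S. \<Sum>p\<leftarrow>ps. b s (r (fst p) s *\<^sub>C snd p))"
    by (simp add: sum_sum_list_swap)
  also have "\<dots> = (\<Sum>s\<in>S. b s (\<Sum>p\<leftarrow>ps. r (fst p) s *\<^sub>C snd p))"
  proof (rule sum.cong[OF refl])
    fix s assume "s \<in> S"
    then have s: "s \<in> V" using S by auto
    show "(\<Sum>p\<leftarrow>ps. b s (r (fst p) s *\<^sub>C snd p)) = b s (\<Sum>p\<leftarrow>ps. r (fst p) s *\<^sub>C snd p)"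
      by (rule sum_list_additive[OF W, symmetric])
        (use b s balanced_zero[OF b V W] ps W in
          \<open>auto simp: balanced_on_def intro!: cvs.subspace_scale\<close>)
  qed
  finally show ?thesis by (simp add: case_prod_unfold)
qed

lemma tens_balanced: "balanced_on V W (\<otimes>)"
  by (auto simp: plus_fun_apply balanced_on_def tens_def fun_eq_iff linear_on_def scaleC_complex_def algebra_simps)

lemma tens_list_zero_coeff:
  fixes ps :: "('a::complex_vs \<times> 'b::complex_vs) list"
  assumes "(\<Sum>(v, w)\<leftarrow>ps. v \<otimes> w) = 0" "linear_on UNIV (\<lambda>v. r v :: complex)"
  shows "(\<Sum>(v, w)\<leftarrow>ps. r v *\<^sub>C w) = 0"
proof (rule functionals_separate_points)
  fix g :: "'b \<Rightarrow> complex" assume g: "linear_on UNIV g"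
  have "g (\<Sum>p\<leftarrow>ps. r (fst p) *\<^sub>C snd p) = (\<Sum>p\<leftarrow>ps. g (r (fst p) *\<^sub>C snd p))"
    by (rule sum_list_additive[of UNIV]) (use g linear_on_zero[OF g] in \<open>auto simp: linear_on_def\<close>)
  also have "\<dots> = (\<Sum>p\<leftarrow>ps. (fst p \<otimes> snd p) (r, g))"
    using g assms(2) by (simp add: tens_def linear_on_scale scaleC_complex_def)
  also have "\<dots> = (\<Sum>(v, w)\<leftarrow>ps. v \<otimes> w) (r, g)"
    by (simp add: sum_list_fun_apply case_prod_unfold)
  finally show "g (\<Sum>(v, w)\<leftarrow>ps. r v *\<^sub>C w) = 0" using assms(1) by (simp add: case_prod_unfold zero_fun_apply)
qed

text \<open>
  The universal property: expanding the first legs in a basis, the second legs have to vanish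
  because functionals separate points, and hence so does every balanced expression.
\<close>

lemma balanced_vanishes:
  assumes V: "cvs.subspace V" and W: "cvs.subspace W" and ps: "set ps \<subseteq> V \<times> W"
    and b: "balanced_on V W b" and z: "(\<Sum>(v, w)\<leftarrow>ps. v \<otimes> w) = 0"
  shows "(\<Sum>(v, w)\<leftarrow>ps. b v w) = 0"
proof -
  obtain S r where S: "finite S" "S \<subseteq> V" "cvs.independent S"
    and lin: "\<And>b. b \<in> S \<Longrightarrow> linear_on UNIV (\<lambda>v. r v b :: complex)"
    and r: "\<And>v w. (v, w) \<in> set ps \<Longrightarrow> v = (\<Sum>b\<in>S. r v b *\<^sub>C b)"
    using tensor_list_basis[OF V ps] by metis
  have "(\<Sum>(v, w)\<leftarrow>ps. b v w) = (\<Sum>s\<in>S. b s (\<Sum>(v, w)\<leftarrow>ps. r v s *\<^sub>C w))"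
    by (rule tens_rep_subsp[OF V W ps b S(1,2) r])
  also have "\<dots> = 0"
    using tens_list_zero_coeff[OF z lin] balanced_zero[OF b V W] S by (auto intro!: sum.neutral)
  finally show ?thesis .
qed

lemma tensor_space_subspace: "cvs.subspace (tensor_space V W)"
  by (simp add: tensor_space_def)

lemma tens_in: "v \<in> V \<Longrightarrow> w \<in> W \<Longrightarrow> v \<otimes> w \<in> tensor_space V W"
  unfolding tensor_space_def by (rule cvs.span_base) auto

lemma tens_simps:
  "(v + v') \<otimes> w = v \<otimes> w + v' \<otimes> w" "v \<otimes> (w + w') = v \<otimes> w + v \<otimes> w'"
  "(c *\<^sub>C v) \<otimes> w = c *\<^sub>C (v \<otimes> w)" "v \<otimes> (c *\<^sub>C w) = c *\<^sub>C (v \<otimes> w)"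
  "0 \<otimes> w = 0" "v \<otimes> 0 = 0"
  by (auto simp: plus_fun_apply zero_fun_apply tens_def fun_eq_iff linear_on_def scaleC_complex_def
      scaleC_fun_def algebra_simps intro: linear_on_zero)
lemma tens_minus: "(- v) \<otimes> w = - (v \<otimes> w)"
  using tens_simps(3)[of "- 1" v w] by simp

lemma tens_rep_exists:
  assumes V: "cvs.subspace V" and t: "t \<in> tensor_space V W"
  shows "\<exists>ps. tens_rep V W t ps"
  using t unfolding tensor_space_def
proof (induction rule: cvs.span_induct_alt)
  case base
  show ?case by (rule exI[of _ "[]"]) (simp add: tens_rep_def zero_fun_def)
next
  case (step c x y)
  then obtain v w ps where vw: "x = v \<otimes> w" "v \<in> V" "w \<in> W" "tens_rep V W y ps" by auto
  then show ?case using V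
    by (intro exI[of _ "(c *\<^sub>C v, w) # ps"]) (auto simp: tens_rep_def tens_simps cvs.subspace_scale)
qed

lemma tens_rep_in: "tens_rep V W t ps \<Longrightarrow> t \<in> tensor_space V W"
  unfolding tens_rep_def by (auto intro!: sum_list_in_subspace tensor_space_subspace tens_in)

lemma tlift_rep:
  assumes V: "cvs.subspace V" and W: "cvs.subspace W" and b: "balanced_on V W b"
    and ps: "tens_rep V W t ps"
  shows "tlift V W b t = (\<Sum>(v, w)\<leftarrow>ps. b v w)"
proof -
  define qs where "qs = (SOME ps. tens_rep V W t ps)"
  have qs: "tens_rep V W t qs" unfolding qs_def using ps by (rule someI)
  let ?m = "map (\<lambda>(v, w). ((-1) *\<^sub>C v, w)) qs"
  have n1: "(\<Sum>(v, w)\<leftarrow>?m. v \<otimes> w) = - (\<Sum>(v, w)\<leftarrow>qs. v \<otimes> w)"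
    by (induction qs) (auto simp: tens_simps tens_minus)
  have qV: "set qs \<subseteq> V \<times> W" using qs by (simp add: tens_rep_def)
  then have n2: "(\<Sum>(v, w)\<leftarrow>?m. b v w) = - (\<Sum>(v, w)\<leftarrow>qs. b v w)"
  proof (induction qs)
    case (Cons p qs)
    obtain v w where p: "p = (v, w)" by force
    have v: "v \<in> V" "w \<in> W" "- v \<in> V" using Cons p V cvs.subspace_neg by auto
    have "b (v + - v) w = b v w + b (- v) w" using b v unfolding balanced_on_def by blast
    then have "b (- v) w = - b v w" using balanced_zero[OF b V W] v
      by (simp add: eq_neg_iff_add_eq_0 add.commute)
    with Cons p show ?case by auto
  qed simp
  have "(\<Sum>(v, w)\<leftarrow>ps @ ?m. b v w) = 0"
  proof (rule balanced_vanishes[OF V W _ b])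
    show "set (ps @ ?m) \<subseteq> V \<times> W"
      using ps qs V by (auto simp: tens_rep_def dest: cvs.subspace_neg)
    show "(\<Sum>(v, w)\<leftarrow>ps @ ?m. v \<otimes> w) = 0" using ps qs n1 by (simp add: tens_rep_def)
  qed
  then show ?thesis using n2 unfolding tlift_def qs_def[symmetric] by simp
qed

lemma tlift_tens:
  assumes "cvs.subspace V" "cvs.subspace W" "balanced_on V W b" "v \<in> V" "w \<in> W"
  shows "tlift V W b (v \<otimes> w) = b v w"
  using tlift_rep[OF assms(1-3), of "v \<otimes> w" "[(v, w)]"] assms(4,5) by (simp add: tens_rep_def)

lemma tlift_add:
  assumes "cvs.subspace V" "cvs.subspace W" "balanced_on V W b"
    and "s \<in> tensor_space V W" "t \<in> tensor_space V W"
  shows "tlift V W b (s + t) = tlift V W b s + tlift V W b t"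
proof -
  obtain ps qs where p: "tens_rep V W s ps" "tens_rep V W t qs"
    using tens_rep_exists[OF assms(1)] assms(4,5) by metis
  then have "tens_rep V W (s + t) (ps @ qs)" by (auto simp: tens_rep_def)
  from tlift_rep[OF assms(1-3) this] p show ?thesis
    by (simp add: tlift_rep[OF assms(1-3) p(1)] tlift_rep[OF assms(1-3) p(2)])
qed

lemma tlift_zero:
  assumes "cvs.subspace V" "cvs.subspace W" "balanced_on V W b"
  shows "tlift V W b 0 = 0"
  using tlift_rep[OF assms, of 0 "[]"] by (simp add: tens_rep_def)

lemma tlift_sum:
  assumes "cvs.subspace V" "cvs.subspace W" "balanced_on V W b" "\<And>i. i \<in> I \<Longrightarrow> t i \<in> tensor_space V W"
  shows "tlift V W b (\<Sum>i\<in>I. t i) = (\<Sum>i\<in>I. tlift V W b (t i))"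
  using assms(4)
proof (induction I rule: infinite_finite_induct)
  case (insert i I)
  have "(\<Sum>i\<in>I. t i) \<in> tensor_space V W"
    using insert tensor_space_subspace by (auto intro!: cvs.subspace_sum)
  with insert tlift_add[OF assms(1-3)] show ?case by simp
qed (simp_all add: tlift_zero[OF assms(1-3)])

lemma tlift_sum_tens:
  assumes "cvs.subspace V" "cvs.subspace W" "balanced_on V W b"
    and "\<And>i. i \<in> I \<Longrightarrow> v i \<in> V" "\<And>i. i \<in> I \<Longrightarrow> w i \<in> W"
  shows "tlift V W b (\<Sum>i\<in>I. v i \<otimes> w i) = (\<Sum>i\<in>I. b (v i) (w i))"
  using assms by (subst tlift_sum) (auto simp: tens_in tlift_tens)

text \<open>
  The lift is a sum over one chosen representation, so an additive map passes through it for
  every \<open>b\<close>, balanced or not.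
\<close>

lemma tlift_additive_comp:
  assumes "cvs.subspace V" "t \<in> tensor_space V W" "cvs.subspace Z"
    and "\<And>v w. v \<in> V \<Longrightarrow> w \<in> W \<Longrightarrow> b v w \<in> Z"
    and "\<And>x y. x \<in> Z \<Longrightarrow> y \<in> Z \<Longrightarrow> L (x + y) = L x + L y" "L 0 = 0"
  shows "L (tlift V W b t) = tlift V W (\<lambda>v w. L (b v w)) t"
proof -
  define ps where "ps = (SOME ps. tens_rep V W t ps)"
  have ps: "tens_rep V W t ps" unfolding ps_def by (rule someI_ex[OF tens_rep_exists[OF assms(1,2)]])
  show ?thesis unfolding tlift_def ps_def[symmetric] case_prod_unfold
    by (rule sum_list_additive[OF assms(3,5,6)]) (use ps assms(4) in \<open>auto simp: tens_rep_def\<close>)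
qed

lemma tlift_in:
  assumes "cvs.subspace V" "t \<in> tensor_space V W" "cvs.subspace Z"
    and "\<And>v w. v \<in> V \<Longrightarrow> w \<in> W \<Longrightarrow> b v w \<in> Z"
  shows "tlift V W b t \<in> Z"
proof -
  define ps where "ps = (SOME ps. tens_rep V W t ps)"
  have ps: "tens_rep V W t ps" unfolding ps_def by (rule someI_ex[OF tens_rep_exists[OF assms(1,2)]])
  show ?thesis unfolding tlift_def ps_def[symmetric] case_prod_unfold
    by (rule sum_list_in_subspace[OF assms(3)]) (use ps assms(4) in \<open>auto simp: tens_rep_def\<close>)
qed

lemma tlift_cong:
  assumes "cvs.subspace V" "t \<in> tensor_space V W"
    and "\<And>v w. v \<in> V \<Longrightarrow> w \<in> W \<Longrightarrow> b v w = b' v w"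
  shows "tlift V W b t = tlift V W b' t"
proof -
  define ps where "ps = (SOME ps. tens_rep V W t ps)"
  have ps: "tens_rep V W t ps" unfolding ps_def by (rule someI_ex[OF tens_rep_exists[OF assms(1,2)]])
  show ?thesis unfolding tlift_def ps_def[symmetric] case_prod_unfold
    by (intro arg_cong[of _ _ sum_list] map_cong refl)
      (use ps assms(3) in \<open>auto simp: tens_rep_def\<close>)
qed

lemma tensor_space_induct [consumes 2, case_names zero add tens]:
  assumes "cvs.subspace V" "t \<in> tensor_space V W" "P 0"
    and "\<And>s t. s \<in> tensor_space V W \<Longrightarrow> t \<in> tensor_space V W \<Longrightarrow> P s \<Longrightarrow> P t \<Longrightarrow> P (s + t)"
    and "\<And>v w. v \<in> V \<Longrightarrow> w \<in> W \<Longrightarrow> P (v \<otimes> w)"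
  shows "P t"
proof -
  obtain ps where ps: "tens_rep V W t ps" using tens_rep_exists[OF assms(1,2)] by blast
  then have "set ps \<subseteq> V \<times> W" "t = (\<Sum>(v, w)\<leftarrow>ps. v \<otimes> w)" by (auto simp: tens_rep_def)
  then show ?thesis
  proof (induction ps arbitrary: t)
    case (Cons p ps)
    have "tens_rep V W (\<Sum>(v, w)\<leftarrow>ps. v \<otimes> w) ps" using Cons by (auto simp: tens_rep_def)
    then have "(\<Sum>(v, w)\<leftarrow>ps. v \<otimes> w) \<in> tensor_space V W" by (rule tens_rep_in)
    with Cons show ?case by (auto intro!: assms(4,5) tens_in)
  qed (simp add: assms(3))
qed

text \<open>
  Separating families of functionals on the two factors separate the tensors: after expanding the
  first leg in a basis, fix the second functional and use independence of the first legs.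
\<close>

lemma tensor_eq_zeroI:
  assumes V: "cvs.subspace V" and W: "cvs.subspace W" and t: "t \<in> tensor_space V W"
    and P: "\<And>p. p \<in> P \<Longrightarrow> linear_on V p" and Q: "\<And>q. q \<in> Q \<Longrightarrow> linear_on W q"
    and sV: "\<And>v. v \<in> V \<Longrightarrow> (\<And>p. p \<in> P \<Longrightarrow> p v = (0::complex)) \<Longrightarrow> v = 0"
    and sW: "\<And>w. w \<in> W \<Longrightarrow> (\<And>q. q \<in> Q \<Longrightarrow> q w = (0::complex)) \<Longrightarrow> w = 0"
    and z: "\<And>p q. p \<in> P \<Longrightarrow> q \<in> Q \<Longrightarrow> tlift V W (\<lambda>v w. p v * q w) t = 0"
  shows "t = 0"
proof -
  obtain ps where ps: "tens_rep V W t ps" using tens_rep_exists[OF V t] by blast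
  then have pV: "set ps \<subseteq> V \<times> W" by (simp add: tens_rep_def)
  obtain S r where S: "finite S" "S \<subseteq> V" "cvs.independent S"
    and r: "\<And>v w. (v, w) \<in> set ps \<Longrightarrow> v = (\<Sum>b\<in>S. (r v b :: complex) *\<^sub>C b)"
    using tensor_list_basis[OF V pV] by metis
  let ?w = "\<lambda>s. \<Sum>(v, w)\<leftarrow>ps. r v s *\<^sub>C w"
  have wW: "?w s \<in> W" for s unfolding case_prod_unfold
    by (rule sum_list_in_subspace[OF W]) (use pV in \<open>auto intro!: cvs.subspace_scale[OF W]\<close>)
  have t_eq: "t = (\<Sum>s\<in>S. s \<otimes> ?w s)"
    using tens_rep_subsp[OF V W pV tens_balanced S(1,2) r] ps by (simp add: tens_rep_def)
  have "?w s = 0" if s: "s \<in> S" for s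
  proof (rule sW[OF wW])
    fix q assume q: "q \<in> Q"
    have "(\<Sum>s\<in>S. q (?w s) *\<^sub>C s) = 0"
    proof (rule sV)
      show "(\<Sum>s\<in>S. q (?w s) *\<^sub>C s) \<in> V"
        using S V by (auto intro!: cvs.subspace_sum cvs.subspace_scale)
      fix p assume p: "p \<in> P"
      have "p (\<Sum>s\<in>S. q (?w s) *\<^sub>C s) = (\<Sum>s\<in>S. p (q (?w s) *\<^sub>C s))"
        by (rule linear_on_sum[OF P[OF p] V]) (use S V cvs.subspace_scale in auto)
      also have "\<dots> = (\<Sum>s\<in>S. p s * q (?w s))"
        using S by (intro sum.cong refl)
          (auto simp: linear_on_scale[OF P[OF p]] scaleC_complex_def subset_iff)
      also have "\<dots> = tlift V W (\<lambda>v w. p v * q w) t"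
        unfolding t_eq
      proof (subst tlift_sum_tens[OF V W])
        show "balanced_on V W (\<lambda>v w. p v * q w)"
          using P[OF p] Q[OF q] by (auto simp: balanced_on_def linear_on_def algebra_simps scaleC_complex_def)
      qed (use S wW in auto)
      finally show "p (\<Sum>s\<in>S. q (?w s) *\<^sub>C s) = 0" using z[OF p q] by simp
    qed
    then show "q (?w s) = 0" using cvs.independentD[OF S(3,1)] s by fast
  qed
  then show ?thesis using t_eq by (simp add: tens_simps)
qed

lemma tlift_fun_add:
  "tlift V W (\<lambda>v w. b v w + b' v w) t = tlift V W b t + tlift V W b' t"
  by (simp add: tlift_def case_prod_unfold sum_list_addf)

lemma bilinear_scale:
  "bilinear_on V W b \<Longrightarrow> v \<in> V \<Longrightarrow> w \<in> W \<Longrightarrow> b (c *\<^sub>C v) w = c *\<^sub>C b v w"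
  "bilinear_on V W b \<Longrightarrow> v \<in> V \<Longrightarrow> w \<in> W \<Longrightarrow> b v (c *\<^sub>C w) = c *\<^sub>C b v w"
  by (auto simp: bilinear_on_def linear_on_def)

lemma tlift_linear:
  assumes V: "cvs.subspace V" and W: "cvs.subspace W" and b: "bilinear_on V W b"
  shows "linear_on (tensor_space V W) (tlift V W b)"
  unfolding linear_on_def
proof (intro conjI ballI allI)
  note bb = bilinear_balanced[OF b]
  show "tlift V W b (x + y) = tlift V W b x + tlift V W b y"
    if "x \<in> tensor_space V W" "y \<in> tensor_space V W" for x y
    by (rule tlift_add[OF V W bb that])
  show "tlift V W b (c *\<^sub>C x) = c *\<^sub>C tlift V W b x" if "x \<in> tensor_space V W" for c x
    using V that
  proof (induction x rule: tensor_space_induct)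
    case zero
    then show ?case by (simp add: tlift_zero[OF V W bb])
  next
    case (add s t)
    then show ?case
      by (simp add: scaleC_add_right tlift_add[OF V W bb] cvs.subspace_scale[OF tensor_space_subspace])
  next
    case (tens v w)
    then show ?case using tlift_tens[OF V W bb, of "c *\<^sub>C v" w] tlift_tens[OF V W bb, of v w]
        cvs.subspace_scale[OF V] bilinear_scale(1)[OF b] by (simp add: tens_simps)
  qed
qed

lemma bilinear_mult:
  assumes "linear_on V (p :: _ \<Rightarrow> complex)" "linear_on W q"
  shows "bilinear_on V W (\<lambda>v w. p v * q w)"
  using assms by (auto simp: bilinear_on_def linear_on_def algebra_simps scaleC_complex_def)

section \<open>Finite-dimensional Hilbert spaces\<close>

lemma fdh_subspace: "fd_hilbert H \<Longrightarrow> cvs.subspace (hsp H)"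
  by (simp add: fd_hilbert_def)

lemma fdh_zero: "fd_hilbert H \<Longrightarrow> 0 \<in> hsp H"
  using fdh_subspace cvs.subspace_0 by blast

lemma fdh_add: "fd_hilbert H \<Longrightarrow> x \<in> hsp H \<Longrightarrow> y \<in> hsp H \<Longrightarrow> x + y \<in> hsp H"
  using fdh_subspace cvs.subspace_add by blast

lemma fdh_scale: "fd_hilbert H \<Longrightarrow> x \<in> hsp H \<Longrightarrow> c *\<^sub>C x \<in> hsp H"
  using fdh_subspace cvs.subspace_scale by blast

lemma fdh_sum: "fd_hilbert H \<Longrightarrow> (\<And>i. i \<in> I \<Longrightarrow> x i \<in> hsp H) \<Longrightarrow> (\<Sum>i\<in>I. x i) \<in> hsp H"
  using fdh_subspace cvs.subspace_sum by metis

lemma ip_linear: "fd_hilbert H \<Longrightarrow> v \<in> hsp H \<Longrightarrow> linear_on (hsp H) (ip H v)"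
  by (simp add: fd_hilbert_def)

lemma ip_cnj: "fd_hilbert H \<Longrightarrow> v \<in> hsp H \<Longrightarrow> w \<in> hsp H \<Longrightarrow> cnj (ip H v w) = ip H w v"
  unfolding fd_hilbert_def by metis

context
  fixes H :: "'v::complex_vs hilb"
  assumes H: "fd_hilbert H"
begin

lemma ip_add_right: "v \<in> hsp H \<Longrightarrow> x \<in> hsp H \<Longrightarrow> y \<in> hsp H \<Longrightarrow> ip H v (x + y) = ip H v x + ip H v y"
  using linear_on_add[OF ip_linear[OF H]] .

lemma ip_scale_right: "v \<in> hsp H \<Longrightarrow> x \<in> hsp H \<Longrightarrow> ip H v (c *\<^sub>C x) = c * ip H v x"
  using linear_on_scale[OF ip_linear[OF H]] by (simp add: scaleC_complex_def)

lemma ip_zero_right: "v \<in> hsp H \<Longrightarrow> ip H v 0 = 0"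
  using linear_on_zero[OF ip_linear[OF H]] fdh_zero[OF H] by blast

lemma ip_sum_right:
  "v \<in> hsp H \<Longrightarrow> (\<And>i. i \<in> I \<Longrightarrow> x i \<in> hsp H) \<Longrightarrow> ip H v (\<Sum>i\<in>I. x i) = (\<Sum>i\<in>I. ip H v (x i))"
  by (rule linear_on_sum[OF ip_linear[OF H] fdh_subspace[OF H]])

lemma ip_add_left: "v \<in> hsp H \<Longrightarrow> x \<in> hsp H \<Longrightarrow> y \<in> hsp H \<Longrightarrow> ip H (x + y) v = ip H x v + ip H y v"
  using ip_cnj[OF H, of v x] ip_cnj[OF H, of v y] ip_cnj[OF H, of v "x + y"] fdh_add[OF H, of x y] ip_add_right[of v x y] by (metis complex_cnj_add)

lemma ip_scale_left: "v \<in> hsp H \<Longrightarrow> x \<in> hsp H \<Longrightarrow> ip H (c *\<^sub>C x) v = cnj c * ip H x v"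
  using ip_cnj[OF H, of v x] ip_cnj[OF H, of v "c *\<^sub>C x"] fdh_scale[OF H, of x c] ip_scale_right[of v x c] by (metis complex_cnj_mult)

lemma ip_zero_left: "v \<in> hsp H \<Longrightarrow> ip H 0 v = 0"
  using ip_cnj[OF H, of v 0] ip_zero_right[of v] fdh_zero[OF H] by simp

lemma ip_sum_left:
  assumes "v \<in> hsp H" "\<And>i. i \<in> I \<Longrightarrow> x i \<in> hsp H"
  shows "ip H (\<Sum>i\<in>I. x i) v = (\<Sum>i\<in>I. ip H (x i) v)"
proof -
  have "ip H (\<Sum>i\<in>I. x i) v = cnj (ip H v (\<Sum>i\<in>I. x i))"
    using ip_cnj[OF H assms(1) fdh_sum[OF H assms(2), of I]] by simp
  also have "\<dots> = (\<Sum>i\<in>I. cnj (ip H v (x i)))" using assms by (simp add: ip_sum_right)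
  also have "\<dots> = (\<Sum>i\<in>I. ip H (x i) v)" using assms by (intro sum.cong refl ip_cnj[OF H])
  finally show ?thesis .
qed

lemma ip_self_eq_0: "v \<in> hsp H \<Longrightarrow> ip H v v = 0 \<Longrightarrow> v = 0"
  using H unfolding fd_hilbert_def by blast

lemma ip_self_nonneg: "v \<in> hsp H \<Longrightarrow> ip H v v \<in> \<real>\<^sub>\<ge>\<^sub>0"
  using H unfolding fd_hilbert_def by blast

lemma ip_eqI:
  assumes "v \<in> hsp H" "w \<in> hsp H" "\<And>z. z \<in> hsp H \<Longrightarrow> ip H z v = ip H z w"
  shows "v = w"
proof -
  have d: "v + (- 1) *\<^sub>C w \<in> hsp H" using assms by (intro fdh_add[OF H] fdh_scale[OF H])
  have "ip H (v + (- 1) *\<^sub>C w) (v + (- 1) *\<^sub>C w) = 0"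
    using assms d fdh_scale[OF H] by (simp add: ip_add_right ip_scale_right del: cvs.scale_minus_left)
  from ip_self_eq_0[OF d this] show ?thesis by simp
qed

definition orthonormal :: "'v set \<Rightarrow> bool" where
  "orthonormal B \<longleftrightarrow> finite B \<and> B \<subseteq> hsp H \<and> (\<forall>e\<in>B. \<forall>e'\<in>B. ip H e e' = (if e = e' then 1 else 0))"

lemma orthonormal_independent:
  assumes "orthonormal B" shows "cvs.independent B"
proof (rule cvs.independent_if_scalars_zero)
  show "finite B" using assms by (simp add: orthonormal_def)
  fix f e assume s: "(\<Sum>x\<in>B. f x *\<^sub>C x) = 0" and e: "e \<in> B"
  have "0 = ip H e (\<Sum>x\<in>B. f x *\<^sub>C x)" using s e assms by (auto simp: orthonormal_def ip_zero_right)
  also have "\<dots> = (\<Sum>x\<in>B. f x * ip H e x)"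
    using assms e by (subst ip_sum_right)
      (auto simp: orthonormal_def ip_scale_right subset_iff intro: fdh_scale[OF H] intro!: sum.cong)
  also have "\<dots> = (\<Sum>x\<in>B. if x = e then f x else 0)"
    using assms e by (intro sum.cong) (auto simp: orthonormal_def)
  also have "\<dots> = f e" using assms e by (simp add: orthonormal_def)
  finally show "f e = 0" by simp
qed

text \<open>An orthonormal set of maximal size exists by finite dimension, and it spans.\<close>

lemma onb_exists: "\<exists>B. orthonormal B \<and> (\<forall>v\<in>hsp H. v = (\<Sum>e\<in>B. ip H e v *\<^sub>C e))"
proof -
  obtain B0 where B0: "finite B0" "hsp H \<subseteq> cvs.span B0" using H by (auto simp: fd_hilbert_def)
  have bd: "card B \<le> card B0" if "orthonormal B" for B
    using cvs.independent_span_bound[OF B0(1) orthonormal_independent[OF that]] that B0(2)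
    by (auto simp: orthonormal_def)
  have "orthonormal {}" by (simp add: orthonormal_def)
  then obtain B where B: "orthonormal B" "\<And>B'. orthonormal B' \<Longrightarrow> card B' \<le> card B"
    using ex_has_greatest_nat[of orthonormal "{}" card "Suc (card B0)"] bd le_imp_less_Suc by metis
  have Bin: "e \<in> B \<Longrightarrow> e \<in> hsp H" for e using B(1) by (auto simp: orthonormal_def)
  have "v = (\<Sum>e\<in>B. ip H e v *\<^sub>C e)" if v: "v \<in> hsp H" for v
  proof (rule ccontr)
    assume ne: "v \<noteq> (\<Sum>e\<in>B. ip H e v *\<^sub>C e)"
    define r where "r = v + (- 1) *\<^sub>C (\<Sum>e\<in>B. ip H e v *\<^sub>C e)"
    have p: "(\<Sum>e\<in>B. ip H e v *\<^sub>C e) \<in> hsp H" using Bin by (intro fdh_sum[OF H] fdh_scale[OF H])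
    have r: "r \<in> hsp H" "r \<noteq> 0" using ne p v unfolding r_def
      by (auto simp: cvs.subspace_diff fdh_subspace[OF H])
    have orth: "ip H e r = 0" if e: "e \<in> B" for e
    proof -
      have "ip H e (\<Sum>x\<in>B. ip H x v *\<^sub>C x) = (\<Sum>x\<in>B. ip H x v * ip H e x)"
        using Bin e by (subst ip_sum_right) (auto simp: ip_scale_right intro: fdh_scale[OF H])
      also have "\<dots> = (\<Sum>x\<in>B. if x = e then ip H x v else 0)"
        using B(1) e by (intro sum.cong) (auto simp: orthonormal_def)
      also have "\<dots> = ip H e v" using B(1) e by (simp add: orthonormal_def)
      finally show ?thesis unfolding r_def using Bin e v p fdh_scale[OF H p]
        by (simp add: ip_add_right ip_scale_right del: cvs.scale_minus_left)
    qed
    obtain x where x: "ip H r r = of_real x" "x \<ge> 0"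
      using ip_self_nonneg[OF r(1)] by (auto elim: nonneg_Reals_cases)
    have "x > 0" using x r ip_self_eq_0[OF r(1)] by (cases "x = 0") auto
    \<comment> \<open>The normalised remainder would enlarge the orthonormal set.\<close>
    define c :: complex where "c = of_real (1 / sqrt x)"
    have cc: "cnj c * (c * ip H r r) = 1"
      using \<open>x > 0\<close> x by (simp add: c_def flip: of_real_mult)
    have cr: "c *\<^sub>C r \<in> hsp H" using fdh_scale[OF H r(1)] .
    have i1: "ip H (c *\<^sub>C r) (c *\<^sub>C r) = 1" using r(1) cr cc by (simp add: ip_scale_left ip_scale_right mult.left_commute)
    have i2: "ip H e (c *\<^sub>C r) = 0" "ip H (c *\<^sub>C r) e = 0" if "e \<in> B" for e
    proof -
      show "ip H e (c *\<^sub>C r) = 0" using orth[OF that] r Bin[OF that] by (simp add: ip_scale_right)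
      then show "ip H (c *\<^sub>C r) e = 0" using ip_cnj[OF H Bin[OF that] cr] by simp
    qed
    have nB: "c *\<^sub>C r \<notin> B" using i1 i2 by auto
    then have "orthonormal (insert (c *\<^sub>C r) B)"
      using B(1) i1 i2 cr unfolding orthonormal_def by auto
    from B(2)[OF this] nB B(1) show False by (simp add: orthonormal_def)
  qed
  with B(1) show ?thesis by blast
qed

definition onb :: "'v set" where
  "onb = (SOME B. orthonormal B \<and> (\<forall>v\<in>hsp H. v = (\<Sum>e\<in>B. ip H e v *\<^sub>C e)))"

lemma onb_spec: "orthonormal onb \<and> (\<forall>v\<in>hsp H. v = (\<Sum>e\<in>onb. ip H e v *\<^sub>C e))"
  unfolding onb_def by (rule someI_ex[OF onb_exists])

lemma finite_onb: "finite onb"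
  and onb_in: "e \<in> onb \<Longrightarrow> e \<in> hsp H"
  and onb_ip: "e \<in> onb \<Longrightarrow> e' \<in> onb \<Longrightarrow> ip H e e' = (if e = e' then 1 else 0)"
  using conjunct1[OF onb_spec] unfolding orthonormal_def by blast+

lemma onb_expand: "v \<in> hsp H \<Longrightarrow> (\<Sum>e\<in>onb. ip H e v *\<^sub>C e) = v"
  using onb_spec by metis

end

lemma tens_sum_left: "(\<Sum>i\<in>I. x i) \<otimes> w = (\<Sum>i\<in>I. x i \<otimes> w)"
  and tens_sum_right: "v \<otimes> (\<Sum>i\<in>I. y i) = (\<Sum>i\<in>I. v \<otimes> y i)"
  by (induction I rule: infinite_finite_induct) (auto simp: tens_simps)

lemma nonneg_Reals_sum:
  fixes f :: "'i \<Rightarrow> complex"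
  shows "(\<And>i. i \<in> I \<Longrightarrow> f i \<in> \<real>\<^sub>\<ge>\<^sub>0) \<Longrightarrow> (\<Sum>i\<in>I. f i) \<in> \<real>\<^sub>\<ge>\<^sub>0"
  by (induction I rule: infinite_finite_induct) auto

lemma hmapI:
  "linear_on (hsp H) T \<Longrightarrow> (\<And>v. v \<in> hsp H \<Longrightarrow> T v \<in> hsp K) \<Longrightarrow> (\<And>v. v \<notin> hsp H \<Longrightarrow> T v = 0) \<Longrightarrow> T \<in> hmap H K"
  by (auto simp: hmap_def)

lemma hmap_linear: "T \<in> hmap H K \<Longrightarrow> linear_on (hsp H) T"
  by (simp add: hmap_def)

lemma hmap_in: "T \<in> hmap H K \<Longrightarrow> v \<in> hsp H \<Longrightarrow> T v \<in> hsp K"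
  by (auto simp: hmap_def)

lemma hmap_off: "T \<in> hmap H K \<Longrightarrow> v \<notin> hsp H \<Longrightarrow> T v = 0"
  by (auto simp: hmap_def)

lemma hmap_eqI:
  "S \<in> hmap H K \<Longrightarrow> T \<in> hmap H K \<Longrightarrow> (\<And>v. v \<in> hsp H \<Longrightarrow> S v = T v) \<Longrightarrow> S = T"
  by (rule ext) (metis hmap_off)

lemma hmap_subspace: "fd_hilbert K \<Longrightarrow> cvs.subspace (hmap H K)"
  unfolding cvs.subspace_def hmap_def linear_on_def
  by (auto simp: plus_fun_apply zero_fun_apply scaleC_fun_def fdh_zero fdh_add fdh_scale
      scaleC_add_right scaleC_scaleC mult.commute image_subset_iff)

lemma hadj:
  assumes H: "fd_hilbert H" and K: "fd_hilbert K" and T: "T \<in> hmap H K"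
  shows hadj_hmap: "hadj H K T \<in> hmap K H"
    and hadj_ip: "v \<in> hsp H \<Longrightarrow> w \<in> hsp K \<Longrightarrow> ip H (hadj H K T w) v = ip K w (T v)"
proof -
  let ?P = "\<lambda>S. S \<in> hmap K H \<and> (\<forall>v\<in>hsp H. \<forall>w\<in>hsp K. ip H (S w) v = ip K w (T v))"
  define S where "S = (\<lambda>w. if w \<in> hsp K then \<Sum>e\<in>onb H. ip K (T e) w *\<^sub>C e else 0)"
  note oi = onb_in[OF H] and Ti = hmap_in[OF T]
  have "S \<in> hmap K H"
  proof (rule hmapI)
    show "linear_on (hsp K) S" unfolding linear_on_def S_def
      using K Ti oi by (auto simp: fdh_add fdh_scale ip_add_right ip_scale_right scaleC_add_left
          sum.distrib cvs.scale_sum_right scaleC_scaleC intro!: sum.cong)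
    show "S w \<in> hsp H" if "w \<in> hsp K" for w
      using that oi H by (auto simp: S_def intro!: fdh_sum fdh_scale)
    show "S w = 0" if "w \<notin> hsp K" for w using that by (simp add: S_def)
  qed
  moreover have "ip H (S w) v = ip K w (T v)" if v: "v \<in> hsp H" and w: "w \<in> hsp K" for v w
  proof -
    have "ip H (S w) v = (\<Sum>e\<in>onb H. ip H (ip K (T e) w *\<^sub>C e) v)"
      using v w oi by (simp add: S_def ip_sum_left[OF H v] fdh_scale[OF H])
    also have "\<dots> = (\<Sum>e\<in>onb H. ip K w (ip H e v *\<^sub>C T e))"
      using oi Ti v w by (intro sum.cong refl)
        (simp add: ip_scale_left[OF H] ip_scale_right[OF K] ip_cnj[OF K])
    also have "\<dots> = ip K w (\<Sum>e\<in>onb H. T (ip H e v *\<^sub>C e))"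
      using oi Ti v w by (simp add: ip_sum_right[OF K] fdh_scale[OF K] fdh_scale[OF H]
          linear_on_scale[OF hmap_linear[OF T]])
    also have "(\<Sum>e\<in>onb H. T (ip H e v *\<^sub>C e)) = T (\<Sum>e\<in>onb H. ip H e v *\<^sub>C e)"
      using oi by (intro linear_on_sum[OF hmap_linear[OF T] fdh_subspace[OF H], symmetric])
        (auto intro: fdh_scale[OF H])
    also have "(\<Sum>e\<in>onb H. ip H e v *\<^sub>C e) = v" by (rule onb_expand[OF H v])
    finally show ?thesis .
  qed
  ultimately have ex: "?P S" by blast
  have uni: "S1 = S2" if "?P S1" "?P S2" for S1 S2
  proof (rule hmap_eqI)
    show "S1 \<in> hmap K H" "S2 \<in> hmap K H" using that by auto
    show "S1 w = S2 w" if w: "w \<in> hsp K" for w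
    proof (rule ip_eqI[OF H])
      have 1: "S1 w \<in> hsp H" "S2 w \<in> hsp H" using \<open>?P S1\<close> \<open>?P S2\<close> w hmap_in by blast+
      then show "S1 w \<in> hsp H" "S2 w \<in> hsp H" .
      fix z assume z: "z \<in> hsp H"
      have "ip H (S1 w) z = ip H (S2 w) z" using \<open>?P S1\<close> \<open>?P S2\<close> w z by simp
      then show "ip H z (S1 w) = ip H z (S2 w)" using ip_cnj[OF H _ z] 1 by metis
    qed
  qed
  have "?P (hadj H K T)" unfolding hadj_def
    by (rule theI[of ?P, OF ex]) (use uni[OF _ ex] in blast)
  then show "hadj H K T \<in> hmap K H"
    "v \<in> hsp H \<Longrightarrow> w \<in> hsp K \<Longrightarrow> ip H (hadj H K T w) v = ip K w (T v)" by auto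
qed

lemma hC_simps: "hsp hC = UNIV" "ip hC a b = cnj a * b"
  by (auto simp: hC_def)

lemma fdh_hC: "fd_hilbert hC"
  unfolding fd_hilbert_def hC_simps
proof (intro conjI ballI)
  have "x \<in> cvs.span {1 :: complex}" for x
    using cvs.span_scale[of 1 "{1 :: complex}" x] cvs.span_base[of "1::complex" "{1}"]
    by (simp add: scaleC_complex_def)
  then show "\<exists>B :: complex set. finite B \<and> UNIV \<subseteq> cvs.span B" by (intro exI[of _ "{1}"]) auto
  show "cnj v * v \<in> \<real>\<^sub>\<ge>\<^sub>0" for v :: complex
    using complex_norm_square[of v] by (metis mult.commute nonneg_Reals_of_real_iff of_real_power
        zero_le_power2)
qed (auto simp: linear_on_def scaleC_complex_def algebra_simps)

section \<open>Tensor products of Hilbert spaces\<close>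

context
  fixes H :: "'v::complex_vs hilb" and K :: "'w::complex_vs hilb"
  assumes H: "fd_hilbert H" and K: "fd_hilbert K"
begin

lemma hsp_htensor: "hsp (htensor H K) = tensor_space (hsp H) (hsp K)"
  by (simp add: htensor_def)

lemma htensor_in: "v \<in> hsp H \<Longrightarrow> w \<in> hsp K \<Longrightarrow> v \<otimes> w \<in> hsp (htensor H K)"
  by (simp add: hsp_htensor tens_in)

private lemma inner_bilinear:
  assumes "v \<in> hsp H" "w \<in> hsp K"
  shows "bilinear_on (hsp H) (hsp K) (\<lambda>v' w'. ip H v v' * ip K w w')"
  using bilinear_mult ip_linear[OF H assms(1)] ip_linear[OF K assms(2)] by blast

private lemma outer_balanced:
  assumes t: "t \<in> tensor_space (hsp H) (hsp K)"
  shows "balanced_on (hsp H) (hsp K)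
    (\<lambda>v w. tlift (hsp H) (hsp K) (\<lambda>v' w'. ip H v v' * ip K w w') t)"
  unfolding balanced_on_def
  by (intro conjI ballI allI; subst tlift_fun_add[symmetric] tlift_cong[OF fdh_subspace[OF H] t])
    (auto simp: ip_add_left[OF H] ip_add_left[OF K] ip_scale_left[OF H] ip_scale_left[OF K] algebra_simps
      intro!: tlift_cong[OF fdh_subspace[OF H] t])

lemma ip_htensor_left:
  assumes "v \<in> hsp H" "w \<in> hsp K" "t \<in> hsp (htensor H K)"
  shows "ip (htensor H K) (v \<otimes> w) t = tlift (hsp H) (hsp K) (\<lambda>v' w'. ip H v v' * ip K w w') t"
  using assms tlift_tens[OF fdh_subspace[OF H] fdh_subspace[OF K] outer_balanced]
  by (simp add: htensor_def)

lemma ip_htensor: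
  assumes "v \<in> hsp H" "w \<in> hsp K" "v' \<in> hsp H" "w' \<in> hsp K"
  shows "ip (htensor H K) (v \<otimes> w) (v' \<otimes> w') = ip H v v' * ip K w w'"
  using assms htensor_in tlift_tens[OF fdh_subspace[OF H] fdh_subspace[OF K]
      bilinear_balanced[OF inner_bilinear]] by (simp add: ip_htensor_left)

private lemma ip_add_l:
  assumes "s \<in> hsp (htensor H K)" "s' \<in> hsp (htensor H K)" "t \<in> hsp (htensor H K)"
  shows "ip (htensor H K) (s + s') t = ip (htensor H K) s t + ip (htensor H K) s' t"
  using assms tlift_add[OF fdh_subspace[OF H] fdh_subspace[OF K] outer_balanced]
  by (simp add: htensor_def)

private lemma ip_zero_l: "t \<in> hsp (htensor H K) \<Longrightarrow> ip (htensor H K) 0 t = 0"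
  using tlift_zero[OF fdh_subspace[OF H] fdh_subspace[OF K] outer_balanced]
  by (simp add: htensor_def)

private lemma ip_lin_r:
  assumes "s \<in> hsp (htensor H K)"
  shows "linear_on (hsp (htensor H K)) (ip (htensor H K) s)"
  using fdh_subspace[OF H] assms unfolding hsp_htensor
proof (induction s rule: tensor_space_induct)
  case zero
  then show ?case by (simp add: linear_on_def ip_zero_l hsp_htensor scaleC_complex_def
        cvs.subspace_add[OF tensor_space_subspace] cvs.subspace_scale[OF tensor_space_subspace])
next
  case (add s t)
  then show ?case by (simp add: linear_on_def ip_add_l hsp_htensor scaleC_complex_def
        cvs.subspace_add[OF tensor_space_subspace] cvs.subspace_scale[OF tensor_space_subspace]
        algebra_simps)
next
  case (tens v w)
  have "linear_on (tensor_space (hsp H) (hsp K)) (tlift (hsp H) (hsp K) (\<lambda>v' w'. ip H v v' * ip K w w'))"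
    by (rule tlift_linear[OF fdh_subspace[OF H] fdh_subspace[OF K] inner_bilinear[OF tens]])
  then show ?case using tens by (simp add: linear_on_def ip_htensor_left hsp_htensor
        cvs.subspace_add[OF tensor_space_subspace] cvs.subspace_scale[OF tensor_space_subspace])
qed

private lemma ip_herm:
  assumes s: "s \<in> tensor_space (hsp H) (hsp K)" and t: "t \<in> tensor_space (hsp H) (hsp K)"
  shows "ip (htensor H K) t s = cnj (ip (htensor H K) s t)"
  using fdh_subspace[OF H] s
proof (induction s rule: tensor_space_induct)
  case zero
  then show ?case using t by (simp add: ip_zero_l hsp_htensor linear_on_zero[OF ip_lin_r]
        cvs.subspace_0[OF tensor_space_subspace])
next
  case (add s s')
  then show ?case using t by (simp add: ip_add_l hsp_htensor linear_on_add[OF ip_lin_r])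
next
  case (tens v w)
  note vw = this
  show ?case using fdh_subspace[OF H] t
  proof (induction t rule: tensor_space_induct)
    case zero
    then show ?case using vw by (simp add: ip_zero_l hsp_htensor linear_on_zero[OF ip_lin_r] tens_in
        cvs.subspace_0[OF tensor_space_subspace])
  next
    case (add s s')
    then show ?case using vw by (simp add: ip_add_l hsp_htensor linear_on_add[OF ip_lin_r] tens_in)
  next
    case (tens v' w')
    then show ?case using vw by (simp add: ip_htensor ip_cnj[OF H] ip_cnj[OF K])
  qed
qed

private lemma rep_first_leg:
  assumes "t \<in> tensor_space (hsp H) (hsp K)"
  shows "\<exists>w. (\<forall>e\<in>onb H. w e \<in> hsp K) \<and> t = (\<Sum>e\<in>onb H. e \<otimes> w e)"
  using fdh_subspace[OF H] assms
proof (induction t rule: tensor_space_induct)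
  case zero
  then show ?case by (intro exI[of _ "\<lambda>_. 0"]) (simp add: tens_simps fdh_zero[OF K])
next
  case (add s t)
  then obtain w w' where "(\<forall>e\<in>onb H. w e \<in> hsp K) \<and> s = (\<Sum>e\<in>onb H. e \<otimes> w e)"
    "(\<forall>e\<in>onb H. w' e \<in> hsp K) \<and> t = (\<Sum>e\<in>onb H. e \<otimes> w' e)" by blast
  then show ?case by (intro exI[of _ "\<lambda>e. w e + w' e"]) (simp add: tens_simps sum.distrib fdh_add[OF K])
next
  case (tens v w)
  have "v \<otimes> w = (\<Sum>e\<in>onb H. ip H e v *\<^sub>C e) \<otimes> w" using tens by (simp add: onb_expand[OF H])
  also have "\<dots> = (\<Sum>e\<in>onb H. e \<otimes> (ip H e v *\<^sub>C w))"
    by (simp add: tens_simps tens_sum_left)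
  finally show ?case using tens by (intro exI[of _ "\<lambda>e. ip H e v *\<^sub>C w"]) (auto intro: fdh_scale[OF K])
qed

text \<open>Positivity: a tensor is \<open>\<Sum> e \<otimes> w\<^sub>e\<close> for orthonormal \<open>e\<close>, of squared norm \<open>\<Sum> \<parallel>w\<^sub>e\<parallel>\<^sup>2\<close>.\<close>

lemma fdh_htensor: "fd_hilbert (htensor H K)"
  unfolding fd_hilbert_def
proof (intro conjI ballI)
  let ?T = "htensor H K"
  show "cvs.subspace (hsp ?T)" by (simp add: hsp_htensor tensor_space_subspace)
  show "linear_on (hsp ?T) (ip ?T v)" if "v \<in> hsp ?T" for v using ip_lin_r[OF that] .
  show "ip ?T w v = cnj (ip ?T v w)" if "v \<in> hsp ?T" "w \<in> hsp ?T" for v w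
    using ip_herm[of v w] that unfolding hsp_htensor by blast
  let ?B = "(\<lambda>(e, f). e \<otimes> f) ` (onb H \<times> onb K)"
  have "t \<in> cvs.span ?B" if "t \<in> hsp ?T" for t
    using fdh_subspace[OF H] that unfolding hsp_htensor
  proof (induction t rule: tensor_space_induct)
    case (tens v w)
    have "v \<otimes> w = (\<Sum>e\<in>onb H. ip H e v *\<^sub>C e) \<otimes> (\<Sum>f\<in>onb K. ip K f w *\<^sub>C f)"
      using tens by (simp add: onb_expand[OF H] onb_expand[OF K])
    also have "\<dots> = (\<Sum>e\<in>onb H. \<Sum>f\<in>onb K. (ip H e v *\<^sub>C e) \<otimes> (ip K f w *\<^sub>C f))"
      by (subst tens_sum_left) (simp add: tens_sum_right)
    also have "\<dots> \<in> cvs.span ?B"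
      by (intro cvs.span_sum) (auto simp: tens_simps intro!: cvs.span_scale intro: cvs.span_base)
    finally show ?case .
  qed (auto intro: cvs.span_zero cvs.span_add)
  then show "\<exists>B. finite B \<and> hsp ?T \<subseteq> cvs.span B"
    using finite_onb[OF H] finite_onb[OF K] by (intro exI[of _ ?B]) auto
  fix t assume t: "t \<in> hsp ?T"
  then obtain w where w: "\<And>e. e \<in> onb H \<Longrightarrow> w e \<in> hsp K" and tw: "t = (\<Sum>e\<in>onb H. e \<otimes> w e)"
    using rep_first_leg by (auto simp: hsp_htensor)
  have 1: "ip ?T (e \<otimes> w e) t = ip K (w e) (w e)" if e: "e \<in> onb H" for e
  proof -
    have "ip ?T (e \<otimes> w e) t = (\<Sum>e'\<in>onb H. ip H e e' * ip K (w e) (w e'))"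
      using e w onb_in[OF H] unfolding ip_htensor_left[OF onb_in[OF H e] w[OF e] t] unfolding tw
      by (intro tlift_sum_tens fdh_subspace H K bilinear_balanced inner_bilinear) auto
    also have "\<dots> = (\<Sum>e'\<in>onb H. if e' = e then ip K (w e) (w e') else 0)"
      using e by (intro sum.cong) (auto simp: onb_ip[OF H])
    finally show ?thesis using e finite_onb[OF H] by simp
  qed
  have "ip ?T (\<Sum>e\<in>S. e \<otimes> w e) t = (\<Sum>e\<in>S. ip ?T (e \<otimes> w e) t)" if "S \<subseteq> onb H" for S
    using finite_subset[OF that finite_onb[OF H]] that
  proof (induction S rule: finite_induct)
    case (insert e S)
    have "(\<Sum>e\<in>S. e \<otimes> w e) \<in> hsp ?T" using insert w onb_in[OF H] unfolding hsp_htensor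
      by (intro cvs.subspace_sum[OF tensor_space_subspace]) (auto intro: tens_in)
    then show ?case using insert w onb_in[OF H] t by (simp add: ip_add_l htensor_in)
  qed (simp add: ip_zero_l t)
  from this[of "onb H"] have s: "ip ?T t t = (\<Sum>e\<in>onb H. ip K (w e) (w e))"
    using 1 tw by simp
  have nn: "ip K (w e) (w e) \<in> \<real>\<^sub>\<ge>\<^sub>0" if "e \<in> onb H" for e using ip_self_nonneg[OF K w[OF that]] .
  show "ip ?T t t \<in> \<real>\<^sub>\<ge>\<^sub>0" unfolding s using nn
    by (rule nonneg_Reals_sum)
  show "ip ?T t t = 0 \<longrightarrow> t = 0"
  proof
    assume "ip ?T t t = 0"
    then have "(\<Sum>e\<in>onb H. Re (ip K (w e) (w e))) = 0" unfolding s by (simp flip: Re_sum)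
    then have "Re (ip K (w e) (w e)) = 0" if "e \<in> onb H" for e
      using that nn finite_onb[OF H]
      by (subst (asm) sum_nonneg_eq_0_iff) (auto simp: complex_nonneg_Reals_iff)
    then have "ip K (w e) (w e) = 0" if "e \<in> onb H" for e
      using that nn[OF that] by (simp add: complex_nonneg_Reals_iff complex_eq_iff)
    then have "w e = 0" if "e \<in> onb H" for e using ip_self_eq_0[OF K w[OF that]] that by blast
    then show "t = 0" unfolding tw by (simp add: tens_simps)
  qed
qed

lemma htensor_expand:
  assumes "t \<in> hsp (htensor H K)"
  shows "(\<Sum>e\<in>onb H. \<Sum>f\<in>onb K. ip (htensor H K) (e \<otimes> f) t *\<^sub>C (e \<otimes> f)) = t"
proof -
  note T = fdh_htensor
  show ?thesis using fdh_subspace[OF H] assms unfolding hsp_htensor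
  proof (induction t rule: tensor_space_induct)
    case zero
    then show ?case using onb_in[OF H] onb_in[OF K] by (simp add: ip_zero_right[OF T] htensor_in)
  next
    case (add s t)
    then show ?case using onb_in[OF H] onb_in[OF K]
      by (simp add: ip_add_right[OF T] tens_in hsp_htensor scaleC_add_left sum.distrib)
  next
    case (tens v w)
    have "v \<otimes> w = (\<Sum>e\<in>onb H. ip H e v *\<^sub>C e) \<otimes> (\<Sum>f\<in>onb K. ip K f w *\<^sub>C f)"
      using tens by (simp add: onb_expand[OF H] onb_expand[OF K])
    also have "\<dots> = (\<Sum>e\<in>onb H. \<Sum>f\<in>onb K. (ip H e v *\<^sub>C e) \<otimes> (ip K f w *\<^sub>C f))"
      by (subst tens_sum_left) (simp add: tens_sum_right)
    also have "\<dots> = (\<Sum>e\<in>onb H. \<Sum>f\<in>onb K. ip (htensor H K) (e \<otimes> f) (v \<otimes> w) *\<^sub>C (e \<otimes> f))"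
      using tens onb_in[OF H] onb_in[OF K]
      by (intro sum.cong refl) (simp add: tens_simps ip_htensor scaleC_scaleC)
    finally show ?case by simp
  qed
qed

end

lemma htmap_tens:
  assumes "fd_hilbert H" "fd_hilbert K" "P \<in> hmap H H'" "Q \<in> hmap K K'" "v \<in> hsp H" "w \<in> hsp K"
  shows "htmap H K P Q (v \<otimes> w) = P v \<otimes> Q w"
proof -
  have "balanced_on (hsp H) (hsp K) (\<lambda>v w. P v \<otimes> Q w)"
    using hmap_linear[OF assms(3)] hmap_linear[OF assms(4)]
    by (auto simp: balanced_on_def linear_on_def tens_simps)
  then show ?thesis using assms
    by (simp add: htmap_def htensor_in tmap_def tlift_tens fdh_subspace)
qed

lemma htmap_hmap:
  assumes H: "fd_hilbert H" and K: "fd_hilbert K" and H': "fd_hilbert H'" and K': "fd_hilbert K'"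
    and P: "P \<in> hmap H H'" and Q: "Q \<in> hmap K K'"
  shows "htmap H K P Q \<in> hmap (htensor H K) (htensor H' K')"
proof (rule hmapI)
  have b: "bilinear_on (hsp H) (hsp K) (\<lambda>v w. P v \<otimes> Q w)"
    using hmap_linear[OF P] hmap_linear[OF Q]
    by (auto simp: bilinear_on_def linear_on_def tens_simps)
  have "linear_on (hsp (htensor H K)) (tmap (hsp H) (hsp K) P Q)"
    unfolding hsp_htensor[OF H K] tmap_def
    by (rule tlift_linear[OF fdh_subspace[OF H] fdh_subspace[OF K] b])
  then show "linear_on (hsp (htensor H K)) (htmap H K P Q)"
    unfolding linear_on_def htmap_def
    by (simp add: fdh_add[OF fdh_htensor[OF H K]] fdh_scale[OF fdh_htensor[OF H K]])
  show "htmap H K P Q t \<in> hsp (htensor H' K')" if "t \<in> hsp (htensor H K)" for t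
    using that unfolding htmap_def tmap_def hsp_htensor[OF H K] hsp_htensor[OF H' K']
    by (auto intro!: tlift_in fdh_subspace[OF H] tensor_space_subspace tens_in hmap_in[OF P] hmap_in[OF Q])
qed (simp add: htmap_def)

lemma hmap_tensor_eqI:
  assumes H: "fd_hilbert H" and K: "fd_hilbert K"
    and S: "S \<in> hmap (htensor H K) L" and T: "T \<in> hmap (htensor H K) L"
    and eq: "\<And>v w. v \<in> hsp H \<Longrightarrow> w \<in> hsp K \<Longrightarrow> S (v \<otimes> w) = T (v \<otimes> w)"
  shows "S = T"
proof (rule hmap_eqI[OF S T])
  fix t assume "t \<in> hsp (htensor H K)"
  note SL = hmap_linear[OF S, unfolded hsp_htensor[OF H K]]
    and TL = hmap_linear[OF T, unfolded hsp_htensor[OF H K]]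
  from \<open>t \<in> _\<close> have "t \<in> tensor_space (hsp H) (hsp K)" by (simp add: hsp_htensor[OF H K])
  from fdh_subspace[OF H] this show "S t = T t"
    by (induction t rule: tensor_space_induct)
      (auto simp: linear_on_zero[OF SL] linear_on_zero[OF TL] linear_on_add[OF SL]
        linear_on_add[OF TL] eq cvs.subspace_0[OF tensor_space_subspace])
qed

lemma rank_one_hmap:
  assumes H: "fd_hilbert H" and K: "fd_hilbert K" and e: "e \<in> hsp H" and v: "v \<in> hsp K"
  shows "(\<lambda>x. if x \<in> hsp H then ip H e x *\<^sub>C v else 0) \<in> hmap H K"
proof (rule hmapI)
  show "linear_on (hsp H) (\<lambda>x. if x \<in> hsp H then ip H e x *\<^sub>C v else 0)"
    unfolding linear_on_def
    by (simp add: fdh_add[OF H] fdh_scale[OF H] ip_add_right[OF H e] ip_scale_right[OF H e]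
        scaleC_add_left scaleC_scaleC)
qed (use v in \<open>auto intro: fdh_scale[OF K]\<close>)

text \<open>
  Operators between tensor products decompose into elementary ones: expand in matrix units of
  orthonormal bases.
\<close>

lemma hmap_htensor_decompose:
  fixes H :: "'v::complex_vs hilb" and H' :: "'v2::complex_vs hilb"
    and K :: "'w::complex_vs hilb" and K' :: "'w2::complex_vs hilb"
  assumes H: "fd_hilbert H" and K: "fd_hilbert K" and H': "fd_hilbert H'" and K': "fd_hilbert K'"
    and T: "T \<in> hmap (htensor H K) (htensor H' K')"
  shows "\<exists>ps. set ps \<subseteq> hmap H H' \<times> hmap K K' \<and> T = (\<Sum>(P, Q)\<leftarrow>ps. htmap H K P Q)"
proof -
  let ?E = "(onb H' \<times> onb K') \<times> (onb H \<times> onb K)"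
  define P where "P = (\<lambda>((e', f'), (e, f)). \<lambda>x. if x \<in> hsp H
    then ip H e x *\<^sub>C ip (htensor H' K') (e' \<otimes> f') (T (e \<otimes> f)) *\<^sub>C e' else 0)"
  define Q where "Q = (\<lambda>((e' :: 'v2, f' :: 'w2), (e :: 'v, f :: 'w)). \<lambda>x. if x \<in> hsp K then ip K f x *\<^sub>C f' else 0)"
  note oi = onb_in[OF H] onb_in[OF K] onb_in[OF H'] onb_in[OF K']
  have Pm: "P i \<in> hmap H H'" and Qm: "Q i \<in> hmap K K'" if "i \<in> ?E" for i
    using that oi
    by (auto simp: P_def Q_def intro!: rank_one_hmap H K H' K' fdh_scale[OF H'])
  have fE: "finite ?E" using finite_onb[OF H] finite_onb[OF K] finite_onb[OF H'] finite_onb[OF K'] by simp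
  obtain xs where xs: "set xs = ?E" "distinct xs" using finite_distinct_list[OF fE] by blast
  let ?ps = "map (\<lambda>i. (P i, Q i)) xs"
  have "(\<Sum>(P, Q)\<leftarrow>?ps. htmap H K P Q) = (\<Sum>i\<in>?E. htmap H K (P i) (Q i))"
    using xs by (simp add: o_def sum_list_distinct_conv_sum_set)
  also have "\<dots> = T"
  proof (rule hmap_tensor_eqI[OF H K _ T])
    have hm: "htmap H K (P i) (Q i) \<in> hmap (htensor H K) (htensor H' K')" if "i \<in> ?E" for i
      by (rule htmap_hmap[OF H K H' K' Pm[OF that] Qm[OF that]])
    then show "(\<Sum>i\<in>?E. htmap H K (P i) (Q i)) \<in> hmap (htensor H K) (htensor H' K')"
      by (rule cvs.subspace_sum[OF hmap_subspace[OF fdh_htensor[OF H' K']]])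
    fix x y assume x: "x \<in> hsp H" and y: "y \<in> hsp K"
    note TT = fdh_htensor[OF H K] and TL = hmap_linear[OF T]
    have 1: "(\<Sum>i\<in>?E. htmap H K (P i) (Q i)) (x \<otimes> y) = (\<Sum>i\<in>?E. P i x \<otimes> Q i y)"
    proof -
      have "(\<Sum>i\<in>?E. htmap H K (P i) (Q i)) (x \<otimes> y) = (\<Sum>i\<in>?E. htmap H K (P i) (Q i) (x \<otimes> y))"
        by (induction rule: infinite_finite_induct) (auto simp: plus_fun_apply zero_fun_apply)
      also have "\<dots> = (\<Sum>i\<in>?E. P i x \<otimes> Q i y)"
        by (rule sum.cong[OF refl], rule htmap_tens[OF H K Pm Qm x y])
      finally show ?thesis .
    qed
    also have "\<dots> = (\<Sum>(p, q)\<in>(onb H' \<times> onb K') \<times> (onb H \<times> onb K).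
       (ip H (fst q) x * ip K (snd q) y) *\<^sub>C
         ip (htensor H' K') (fst p \<otimes> snd p) (T (fst q \<otimes> snd q)) *\<^sub>C (fst p \<otimes> snd p))"
      using x y by (intro sum.cong) (auto simp: P_def Q_def tens_simps scaleC_scaleC mult.commute mult.left_commute)
    also have "\<dots> = (\<Sum>q\<in>onb H \<times> onb K. (ip H (fst q) x * ip K (snd q) y) *\<^sub>C
       (\<Sum>p\<in>onb H' \<times> onb K'. ip (htensor H' K') (fst p \<otimes> snd p) (T (fst q \<otimes> snd q)) *\<^sub>C (fst p \<otimes> snd p)))"
      unfolding cvs.scale_sum_right
      by (subst sum.swap) (simp add: sum.cartesian_product[symmetric])
    also have "\<dots> = (\<Sum>q\<in>onb H \<times> onb K. (ip H (fst q) x * ip K (snd q) y) *\<^sub>C T (fst q \<otimes> snd q))"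
    proof (intro sum.cong refl arg_cong[of _ _ "\<lambda>z. _ *\<^sub>C z"])
      fix q assume "q \<in> onb H \<times> onb K"
      then have "T (fst q \<otimes> snd q) \<in> hsp (htensor H' K')"
        using oi by (intro hmap_in[OF T]) (auto intro!: htensor_in H K)
      from htensor_expand[OF H' K' this]
      show "(\<Sum>p\<in>onb H' \<times> onb K'. ip (htensor H' K') (fst p \<otimes> snd p) (T (fst q \<otimes> snd q)) *\<^sub>C (fst p \<otimes> snd p))
        = T (fst q \<otimes> snd q)" by (simp add: sum.cartesian_product case_prod_unfold)
    qed
    also have "\<dots> = (\<Sum>q\<in>onb H \<times> onb K. T (ip (htensor H K) (fst q \<otimes> snd q) (x \<otimes> y) *\<^sub>C (fst q \<otimes> snd q)))"
      using oi x y by (intro sum.cong)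
        (auto simp: ip_htensor[OF H K] linear_on_scale[OF TL] htensor_in[OF H K])
    also have "\<dots> = T (\<Sum>q\<in>onb H \<times> onb K. ip (htensor H K) (fst q \<otimes> snd q) (x \<otimes> y) *\<^sub>C (fst q \<otimes> snd q))"
      using oi by (intro linear_on_sum[OF TL fdh_subspace[OF TT], symmetric])
        (auto intro!: fdh_scale[OF TT] htensor_in[OF H K])
    also have "\<dots> = T (x \<otimes> y)"
      using htensor_expand[OF H K htensor_in[OF H K x y]]
      by (simp add: sum.cartesian_product case_prod_unfold)
    finally show "(\<Sum>i\<in>?E. htmap H K (P i) (Q i)) (x \<otimes> y) = T (x \<otimes> y)" .
  qed
  finally show ?thesis using Pm Qm xs by (intro exI[of _ ?ps]) auto
qed

text \<open>
  Functionals of the form \<open>P \<mapsto> \<langle>v, P w\<rangle>\<close> are those of matrix coefficients. Their tensor product is again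
  of this form, since on each term \<open>P \<otimes> Q\<close> of a decomposition of \<open>T\<close> the inner product factorises.
\<close>

lemma functional_tensor_rank_one:
  assumes H: "fd_hilbert H" and K: "fd_hilbert K" and H': "fd_hilbert H'" and K': "fd_hilbert K'"
    and T: "T \<in> hmap (htensor H K) (htensor H' K')"
    and vw: "v \<in> hsp H'" "w \<in> hsp H" "v' \<in> hsp K'" "w' \<in> hsp K"
    and f: "\<And>P. P \<in> hmap H H' \<Longrightarrow> f P = ip H' v (P w)"
    and g: "\<And>P. P \<in> hmap K K' \<Longrightarrow> g P = ip K' v' (P w')"
  shows "functional_tensor H H' K K' f g T = ip (htensor H' K') (v \<otimes> v') (T (w \<otimes> w'))"
proof -
  define ps where "ps = (SOME ps. set ps \<subseteq> hmap H H' \<times> hmap K K' \<and> T = (\<Sum>(P, Q)\<leftarrow>ps. htmap H K P Q))"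
  have ps: "set ps \<subseteq> hmap H H' \<times> hmap K K'" "T = (\<Sum>(P, Q)\<leftarrow>ps. htmap H K P Q)"
    using someI_ex[OF hmap_htensor_decompose[OF H K H' K' T]] unfolding ps_def[symmetric] by auto
  note TT = fdh_htensor[OF H' K']
  have "T (w \<otimes> w') = (\<Sum>p\<leftarrow>ps. htmap H K (fst p) (snd p) (w \<otimes> w'))"
    unfolding ps(2) by (simp add: sum_list_fun_apply case_prod_unfold)
  also have "\<dots> = (\<Sum>p\<leftarrow>ps. fst p w \<otimes> snd p w')"
    using ps(1) vw by (intro arg_cong[of _ _ sum_list] map_cong refl) (auto intro!: htmap_tens[OF H K])
  moreover have vv: "v \<otimes> v' \<in> hsp (htensor H' K')" using vw by (intro htensor_in[OF H' K'])
  moreover have mem: "fst p w \<otimes> snd p w' \<in> hsp (htensor H' K')" if "p \<in> set ps" for p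
    using subsetD[OF ps(1) that] vw by (intro htensor_in[OF H' K'])
      (auto intro!: hmap_in[of "fst p" H H'] hmap_in[of "snd p" K K'] simp: mem_Times_iff)
  ultimately have "ip (htensor H' K') (v \<otimes> v') (T (w \<otimes> w'))
      = (\<Sum>p\<leftarrow>ps. ip (htensor H' K') (v \<otimes> v') (fst p w \<otimes> snd p w'))"
    by (simp only:) (rule sum_list_additive[OF fdh_subspace[OF TT] ip_add_right[OF TT vv]
        ip_zero_right[OF TT vv] mem])
  also have "\<dots> = (\<Sum>p\<leftarrow>ps. f (fst p) * g (snd p))"
  proof (intro arg_cong[of _ _ sum_list] map_cong refl)
    fix p assume "p \<in> set ps"
    then have p: "fst p \<in> hmap H H'" "snd p \<in> hmap K K'" using ps(1) by (auto simp: mem_Times_iff)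
    show "ip (htensor H' K') (v \<otimes> v') (fst p w \<otimes> snd p w') = f (fst p) * g (snd p)"
      using p vw by (simp add: f g ip_htensor[OF H' K'] hmap_in[OF p(1)] hmap_in[OF p(2)])
  qed
  finally show ?thesis unfolding functional_tensor_def ps_def[symmetric] by (simp add: case_prod_unfold)
qed

lemma functional_tensor_add:
  "functional_tensor H H' K K' (f + f') g T = functional_tensor H H' K K' f g T + functional_tensor H H' K K' f' g T"
  "functional_tensor H H' K K' f (g + g') T = functional_tensor H H' K K' f g T + functional_tensor H H' K K' f g' T"
  unfolding functional_tensor_def case_prod_unfold
  by (simp_all add: plus_fun_apply algebra_simps sum_list_addf)

lemma functional_tensor_zero:
  "functional_tensor H H' K K' 0 g T = 0" "functional_tensor H H' K K' f 0 T = 0"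
  unfolding functional_tensor_def case_prod_unfold by (simp_all add: zero_fun_apply)

lemma onb_trivial: "fd_hilbert K \<Longrightarrow> hsp K = {0} \<Longrightarrow> onb K = {}"
  using onb_in[of K] onb_ip[of K] ip_zero_right[of K 0] by fastforce

lemma riesz:
  assumes K: "fd_hilbert K" and p: "linear_on (hsp K) p"
  shows "\<exists>r\<in>hsp K. \<forall>z\<in>hsp K. ip K r z = p z"
proof (intro bexI[of _ "\<Sum>e\<in>onb K. cnj (p e) *\<^sub>C e"] ballI)
  note oi = onb_in[OF K]
  show "(\<Sum>e\<in>onb K. cnj (p e) *\<^sub>C e) \<in> hsp K" by (intro fdh_sum[OF K] fdh_scale[OF K] oi)
  fix z assume z: "z \<in> hsp K"
  have "ip K (\<Sum>e\<in>onb K. cnj (p e) *\<^sub>C e) z = (\<Sum>e\<in>onb K. p (ip K e z *\<^sub>C e))"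
    using z oi by (simp add: ip_sum_left[OF K z] fdh_scale[OF K] ip_scale_left[OF K]
        linear_on_scale[OF p] scaleC_complex_def mult.commute)
  also have "\<dots> = p (\<Sum>e\<in>onb K. ip K e z *\<^sub>C e)"
    using oi by (intro linear_on_sum[OF p fdh_subspace[OF K], symmetric]) (auto intro: fdh_scale[OF K])
  finally show "ip K (\<Sum>e\<in>onb K. cnj (p e) *\<^sub>C e) z = p z" by (simp add: onb_expand[OF K z])
qed

section \<open>Fibre functors at the level of vectors\<close>

locale fibre_functor = partial_fusion_cstar_category C + unital_morphism C \<phi> F
  for C :: "('j, 'o, 'm::complex_vs) pcat" (structure) and \<phi> :: "'i \<Rightarrow> 'j"
    and F :: "('i, 'o, 'm, 'v::complex_vs) umorph"
begin

abbreviation H :: "'i \<Rightarrow> 'i \<Rightarrow> 'o \<Rightarrow> 'v set" where "H k l X \<equiv> hsp (Fob F k l X)"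
abbreviation pr :: "'i \<Rightarrow> 'i \<Rightarrow> 'o \<Rightarrow> 'v \<Rightarrow> 'v \<Rightarrow> complex" where "pr k l X \<equiv> ip (Fob F k l X)"
abbreviation Ob :: "'i \<Rightarrow> 'i \<Rightarrow> 'o set" where "Ob k l \<equiv> obj C (\<phi> k) (\<phi> l)"
abbreviation ONB :: "'i \<Rightarrow> 'i \<Rightarrow> 'o \<Rightarrow> 'v set" where "ONB k l X \<equiv> onb (Fob F k l X)"
abbreviation io :: "'i \<Rightarrow> 'i \<Rightarrow> 'i \<Rightarrow> 'o \<Rightarrow> 'o \<Rightarrow> 'v \<Rightarrow> 'v \<Rightarrow> 'v" where
  "io k l m X Y x y \<equiv> Fio F k l m X Y (x \<otimes> y)"
abbreviation un :: "'i \<Rightarrow> 'o" where "un k \<equiv> unit C (\<phi> k)"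
abbreviation mu :: "'i \<Rightarrow> 'v" where "mu k \<equiv> Fmu F k 1"

lemma obj_par: "X \<in> obj C \<alpha> \<beta> \<Longrightarrow> Y \<in> obj C \<alpha> \<beta> \<Longrightarrow> par C X Y"
  by (auto simp: obj_def par_def)

lemma obj_lr: "X \<in> obj C \<alpha> \<beta> \<Longrightarrow> lft C X = \<alpha>" "X \<in> obj C \<alpha> \<beta> \<Longrightarrow> rgt C X = \<beta>"
  by (auto simp: obj_def)

lemma hom_comp:
  "\<lbrakk>X \<in> obj C \<alpha> \<beta>; Y \<in> obj C \<alpha> \<beta>; Z \<in> obj C \<alpha> \<beta>; f \<in> hom C X Y; g \<in> hom C Y Z\<rbrakk> \<Longrightarrow> g \<cdot> f \<in> hom C X Z"
  using cmp_hom obj_par by blast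

lemma hom_tensor:
  "\<lbrakk>X \<in> obj C \<alpha> \<beta>; X' \<in> obj C \<alpha> \<beta>; Y \<in> obj C \<beta> \<gamma>; Y' \<in> obj C \<beta> \<gamma>; f \<in> hom C X X'; g \<in> hom C Y Y'\<rbrakk>
    \<Longrightarrow> f \<odot> g \<in> hom C (X \<boxtimes> Y) (X' \<boxtimes> Y')"
  using tmo_hom[of X X' Y Y'] obj_par obj_lr by metis

lemma hom_dag: "\<lbrakk>X \<in> obj C \<alpha> \<beta>; Y \<in> obj C \<alpha> \<beta>; f \<in> hom C X Y\<rbrakk> \<Longrightarrow> dag C f \<in> hom C Y X"
  using dag_hom obj_par by blast

lemma ldual_obj: "X \<in> obj C \<alpha> \<beta> \<Longrightarrow> ldual C X \<in> obj C \<beta> \<alpha>"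
  using left_dual[of X] obj_lr by (auto simp: is_left_dual_def)

lemma ev_hom: "X \<in> obj C \<alpha> \<beta> \<Longrightarrow> ev C X \<in> hom C (ldual C X \<boxtimes> X) (unit C \<beta>)"
  using left_dual[of X] obj_lr by (auto simp: is_left_dual_def)

lemma coev_hom: "X \<in> obj C \<alpha> \<beta> \<Longrightarrow> coev C X \<in> hom C (unit C \<alpha>) (X \<boxtimes> ldual C X)"
  using left_dual[of X] obj_lr by (auto simp: is_left_dual_def)

lemma assoc_hom:
  assumes "X \<in> obj C \<alpha> \<beta>" "Y \<in> obj C \<beta> \<gamma>" "Z \<in> obj C \<gamma> \<delta>"
  shows "assoc C X Y Z \<in> hom C ((X \<boxtimes> Y) \<boxtimes> Z) (X \<boxtimes> (Y \<boxtimes> Z))"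
    and "dag C (assoc C X Y Z) \<in> hom C (X \<boxtimes> (Y \<boxtimes> Z)) ((X \<boxtimes> Y) \<boxtimes> Z)"
    and "dag C (assoc C X Y Z) \<cdot> assoc C X Y Z = idm C ((X \<boxtimes> Y) \<boxtimes> Z)"
    and "assoc C X Y Z \<cdot> dag C (assoc C X Y Z) = idm C (X \<boxtimes> (Y \<boxtimes> Z))"
    and "inverse_arrows C ((X \<boxtimes> Y) \<boxtimes> Z) (X \<boxtimes> (Y \<boxtimes> Z)) (assoc C X Y Z) (dag C (assoc C X Y Z))"
  using assoc_unitary[of X Y Z] assms obj_lr by (auto simp: inverse_arrows_def)

lemma lun_hom:
  assumes "X \<in> obj C \<alpha> \<beta>"
  shows "lun C X \<in> hom C (unit C \<alpha> \<boxtimes> X) X" "dag C (lun C X) \<in> hom C X (unit C \<alpha> \<boxtimes> X)"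
    "dag C (lun C X) \<cdot> lun C X = idm C (unit C \<alpha> \<boxtimes> X)" "lun C X \<cdot> dag C (lun C X) = idm C X"
  using lun_unitary[of X] assms obj_lr by (auto simp: inverse_arrows_def)

lemma run_hom:
  assumes "X \<in> obj C \<alpha> \<beta>"
  shows "run C X \<in> hom C (X \<boxtimes> unit C \<beta>) X" "dag C (run C X) \<in> hom C X (X \<boxtimes> unit C \<beta>)"
    "dag C (run C X) \<cdot> run C X = idm C (X \<boxtimes> unit C \<beta>)" "run C X \<cdot> dag C (run C X) = idm C X"
  using run_unitary[of X] assms obj_lr by (auto simp: inverse_arrows_def)

lemmas fd = Fob_hilbert

lemma Fmo_in: "\<lbrakk>X \<in> Ob k l; Y \<in> Ob k l; f \<in> hom C X Y; v \<in> H k l X\<rbrakk> \<Longrightarrow> Fmo F k l X Y f v \<in> H k l Y"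
  using hmap_in[OF Fmo_hmap] .

lemma Fmo_lin: "\<lbrakk>X \<in> Ob k l; Y \<in> Ob k l; f \<in> hom C X Y\<rbrakk> \<Longrightarrow> linear_on (H k l X) (Fmo F k l X Y f)"
  using hmap_linear[OF Fmo_hmap] .

lemma Fmo_id: "X \<in> Ob k l \<Longrightarrow> v \<in> H k l X \<Longrightarrow> Fmo F k l X X (idm C X) v = v"
  by (simp add: Fmo_idm hid_def)

lemma Fmo_comp:
  "\<lbrakk>X \<in> Ob k l; Y \<in> Ob k l; Z \<in> Ob k l; f \<in> hom C X Y; g \<in> hom C Y Z\<rbrakk>
    \<Longrightarrow> Fmo F k l X Z (g \<cdot> f) v = Fmo F k l Y Z g (Fmo F k l X Y f v)"
  by (simp add: Fmo_cmp)

lemma Fmo_dag_ip: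
  "\<lbrakk>X \<in> Ob k l; Y \<in> Ob k l; f \<in> hom C X Y; v \<in> H k l X; w \<in> H k l Y\<rbrakk>
    \<Longrightarrow> pr k l X (Fmo F k l Y X (dag C f) w) v = pr k l Y w (Fmo F k l X Y f v)"
  using hadj_ip[OF fd fd Fmo_hmap] by (simp add: Fmo_dag)

lemma Fmo_inverse:
  assumes "X \<in> Ob k l" "Y \<in> Ob k l" "f \<in> hom C X Y" "g \<in> hom C Y X" "g \<cdot> f = idm C X" "v \<in> H k l X"
  shows "Fmo F k l Y X g (Fmo F k l X Y f v) = v"
  using Fmo_comp[of X k l Y X f g v] assms by (simp add: Fmo_id)

text \<open>The isometries \<open>\<iota>\<close> on elementary tensors.\<close>

context
  fixes k l m X Y assumes X: "X \<in> Ob k l" and Y: "Y \<in> Ob l m"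
begin

lemma tob_Ob: "X \<boxtimes> Y \<in> Ob k m"
  using tob_obj[OF X Y] .

lemma io_hmap: "Fio F k l m X Y \<in> hmap (htensor (Fob F k l X) (Fob F l m Y)) (Fob F k m (X \<boxtimes> Y))"
  using Fio_isometry[OF X Y] by (simp add: hisometry_def)

lemma io_in: "x \<in> H k l X \<Longrightarrow> y \<in> H l m Y \<Longrightarrow> io k l m X Y x y \<in> H k m (X \<boxtimes> Y)"
  using hmap_in[OF io_hmap htensor_in[OF fd[OF X] fd[OF Y]]] .

lemma io_bilinear: "bilinear_on (H k l X) (H l m Y) (io k l m X Y)"
proof -
  note ht = htensor_in[OF fd[OF X] fd[OF Y]]
  show ?thesis using hmap_linear[OF io_hmap] fdh_add[OF fd[OF X]] fdh_add[OF fd[OF Y]]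
      fdh_scale[OF fd[OF X]] fdh_scale[OF fd[OF Y]]
    by (auto simp: bilinear_on_def linear_on_def tens_simps ht)
qed

lemma io_lin_r: "x \<in> H k l X \<Longrightarrow> linear_on (H l m Y) (io k l m X Y x)"
  and io_lin_l: "y \<in> H l m Y \<Longrightarrow> linear_on (H k l X) (\<lambda>x. io k l m X Y x y)"
  using io_bilinear by (auto simp: bilinear_on_def)

lemma io_ip:
  "\<lbrakk>x \<in> H k l X; y \<in> H l m Y; x' \<in> H k l X; y' \<in> H l m Y\<rbrakk>
    \<Longrightarrow> pr k m (X \<boxtimes> Y) (io k l m X Y x y) (io k l m X Y x' y') = pr k l X x x' * pr l m Y y y'"
  using Fio_isometry[OF X Y] htensor_in[OF fd[OF X] fd[OF Y]] ip_htensor[OF fd[OF X] fd[OF Y]]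
  by (simp add: hisometry_def)

lemma io_nat:
  assumes "X' \<in> Ob k l" "Y' \<in> Ob l m" "f \<in> hom C X X'" "g \<in> hom C Y Y'" "x \<in> H k l X" "y \<in> H l m Y"
  shows "Fmo F k m (X \<boxtimes> Y) (X' \<boxtimes> Y') (f \<odot> g) (io k l m X Y x y)
    = io k l m X' Y' (Fmo F k l X X' f x) (Fmo F l m Y Y' g y)"
  using fun_cong[OF Fio_natural[OF X assms(1) Y assms(2-4)], of "x \<otimes> y"] assms
    htmap_tens[OF fd[OF X] fd[OF Y] Fmo_hmap[OF X assms(1,3)] Fmo_hmap[OF Y assms(2,4)] assms(5,6)]
  by simp

end

context
  fixes k m X Y \<beta> assumes X: "X \<in> obj C (\<phi> k) \<beta>" and Y: "Y \<in> obj C \<beta> (\<phi> m)"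
begin

private definition "D = hdsum (\<phi> -` {\<beta>}) (\<lambda>l. htensor (Fob F k l X) (Fob F l m Y))"

private lemma DU:
  "hunitary D (Fob F k m (X \<boxtimes> Y)) (\<lambda>t. if t \<in> hsp D then \<Sum>l | t l \<noteq> 0. Fio F k l m X Y (t l) else 0)"
  using Fio_sum_unitary[OF X Y] by (simp add: D_def Let_def)

private lemma XO: "\<phi> l = \<beta> \<Longrightarrow> X \<in> Ob k l" "\<phi> l = \<beta> \<Longrightarrow> Y \<in> Ob l m"
  using X Y by auto

private lemma single_D:
  assumes "\<phi> l = \<beta>" "t \<in> hsp (htensor (Fob F k l X) (Fob F l m Y))"
  shows "(\<lambda>l'. if l' = l then t else 0) \<in> hsp D"
  using assms fdh_zero[OF fdh_htensor[OF fd[OF XO(1)] fd[OF XO(2)]]] by (auto simp: D_def hdsum_def)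

text \<open>
  The ranges of \<open>\<iota>\<close> for different intermediate indices are orthogonal because the sum of all \<open>\<iota>\<close> is isometric.
\<close>

lemma io_orth:
  assumes "\<phi> l = \<beta>" "\<phi> l' = \<beta>" "l \<noteq> l'" "x \<in> H k l X" "y \<in> H l m Y" "x' \<in> H k l' X" "y' \<in> H l' m Y"
  shows "pr k m (X \<boxtimes> Y) (io k l m X Y x y) (io k l' m X Y x' y') = 0"
proof -
  let ?t = "\<lambda>j. if j = l then x \<otimes> y else 0" and ?t' = "\<lambda>j. if j = l' then x' \<otimes> y' else 0"
  let ?U = "\<lambda>t. if t \<in> hsp D then \<Sum>l | t l \<noteq> 0. Fio F k l m X Y (t l) else 0"
  have m: "?t \<in> hsp D" "?t' \<in> hsp D"
    by (rule single_D htensor_in[OF fd[OF XO(1)] fd[OF XO(2)]] assms)+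
  have z: "Fio F k j m X Y 0 = 0" if "\<phi> j = \<beta>" for j
    using linear_on_zero[OF hmap_linear[OF io_hmap[OF XO[OF that]]]]
      fdh_zero[OF fdh_htensor[OF fd[OF XO(1)[OF that]] fd[OF XO(2)[OF that]]]] by blast
  have "?U ?t = io k l m X Y x y"
  proof (cases "x \<otimes> y = 0")
    case False
    then have "{j. ?t j \<noteq> 0} = {l}" by auto
    then show ?thesis using m by simp
  qed (use m z assms(1) in auto)
  moreover have "?U ?t' = io k l' m X Y x' y'"
  proof (cases "x' \<otimes> y' = 0")
    case False
    then have "{j. ?t' j \<noteq> 0} = {l'}" by auto
    then show ?thesis using m by simp
  qed (use m z assms(2) in auto)
  moreover have "pr k m (X \<boxtimes> Y) (?U ?t) (?U ?t') = ip D ?t ?t'"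
    using DU m by (simp add: hunitary_def hisometry_def)
  moreover have "ip D ?t ?t' = 0" using assms(3) by (auto simp: D_def hdsum_def intro!: sum.neutral)
  ultimately show ?thesis by simp
qed

lemma XY_Ob: "X \<boxtimes> Y \<in> Ob k m" using tob_obj[OF X Y] .

text \<open>
  As the sum of all \<open>\<iota>\<close> is onto, additive statements on \<open>F\<^sub>k\<^sub>m(X \<otimes> Y)\<close> need only be checked on vectors
  \<open>\<iota>(x \<otimes> y)\<close>, where all intermediate indices have to be considered.
\<close>

lemma io_induct [consumes 1, case_names zero add io]:
  assumes xi: "\<xi> \<in> H k m (X \<boxtimes> Y)" and 0: "P 0"
    and add: "\<And>a b. a \<in> H k m (X \<boxtimes> Y) \<Longrightarrow> b \<in> H k m (X \<boxtimes> Y) \<Longrightarrow> P a \<Longrightarrow> P b \<Longrightarrow> P (a + b)"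
    and io: "\<And>l x y. \<phi> l = \<beta> \<Longrightarrow> x \<in> H k l X \<Longrightarrow> y \<in> H l m Y \<Longrightarrow> P (io k l m X Y x y)"
  shows "P \<xi>"
proof -
  note K = fd[OF XY_Ob]
  obtain t where t: "t \<in> hsp D" "\<xi> = (\<Sum>l | t l \<noteq> 0. Fio F k l m X Y (t l))"
    using DU xi unfolding hunitary_def by (smt (verit, del_insts) imageE)
  have 1: "P (Fio F k l m X Y s) \<and> Fio F k l m X Y s \<in> H k m (X \<boxtimes> Y)"
    if l: "\<phi> l = \<beta>" and s: "s \<in> tensor_space (H k l X) (H l m Y)" for l s
  proof
    have hl: "hsp (htensor (Fob F k l X) (Fob F l m Y)) = tensor_space (H k l X) (H l m Y)"
      by (rule hsp_htensor[OF fd[OF XO(1)[OF l]] fd[OF XO(2)[OF l]]])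
    note h = io_hmap[OF XO[OF l]]
    have inn: "Fio F k l m X Y s \<in> H k m (X \<boxtimes> Y)" if "s \<in> tensor_space (H k l X) (H l m Y)" for s
      using hmap_in[OF h] that hl by simp
    note lin = hmap_linear[OF h, unfolded hl]
    show "Fio F k l m X Y s \<in> H k m (X \<boxtimes> Y)" using inn[OF s] .
    show "P (Fio F k l m X Y s)" using fdh_subspace[OF fd[OF XO(1)[OF l]]] s
    proof (induction s rule: tensor_space_induct)
      case zero
      then show ?case using linear_on_zero[OF lin cvs.subspace_0[OF tensor_space_subspace]] 0 by simp
    next
      case (add s t)
      then show ?case using linear_on_add[OF lin] assms(3) inn by simp
    next
      case (tens v w)
      then show ?case using io[OF l] by simp
    qed
  qed
  have tl: "\<phi> l = \<beta> \<and> t l \<in> tensor_space (H k l X) (H l m Y)" if "t l \<noteq> 0" for l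
  proof -
    have l: "\<phi> l = \<beta>" using that t(1) by (auto simp: D_def hdsum_def)
    then have "t l \<in> hsp (htensor (Fob F k l X) (Fob F l m Y))" using t(1) by (auto simp: D_def hdsum_def)
    then show ?thesis using l hsp_htensor[OF fd[OF XO(1)[OF l]] fd[OF XO(2)[OF l]]] by simp
  qed
  have "P (\<Sum>l\<in>S. Fio F k l m X Y (t l)) \<and> (\<Sum>l\<in>S. Fio F k l m X Y (t l)) \<in> H k m (X \<boxtimes> Y)"
    if "S \<subseteq> {l. t l \<noteq> 0}" for S
    using that
  proof (induction S rule: infinite_finite_induct)
    case (insert l S)
    then show ?case using 1[of l "t l"] tl[of l] add fdh_add[OF K] by auto
  qed (use 0 fdh_zero[OF K] in auto)
  then show ?thesis using t(2) by blast
qed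

text \<open>
  The intermediate indices that contribute to \<open>F\<^sub>k\<^sub>m(X \<otimes> Y)\<close>; row finiteness makes this set finite.
\<close>

definition fibre_indices :: "'i set" where "fibre_indices = {l. \<phi> l = \<beta> \<and> H k l X \<noteq> {0}}"

lemma fibre_indices_finite: "finite fibre_indices"
proof -
  have "fibre_indices = {s \<in> \<phi> -` {\<beta>}. H k s X \<noteq> {0}}" by (auto simp: fibre_indices_def)
  then show ?thesis using Fob_rcf[OF X] by (auto simp: rcf_on_def)
qed

lemma fibre_indices_phi: "l \<in> fibre_indices \<Longrightarrow> \<phi> l = \<beta>" by (simp add: fibre_indices_def)

lemma fibre_indices_off: "l \<notin> fibre_indices \<Longrightarrow> \<phi> l = \<beta> \<Longrightarrow> ONB k l X = {}"
  using onb_trivial[OF fd[OF XO(1)]] by (auto simp: fibre_indices_def)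

text \<open>The unitarity of \<open>\<Oplus>\<^sub>l \<iota>\<close> in coordinates: the vectors \<open>\<iota>(e \<otimes> f)\<close> form an orthonormal basis.\<close>

lemma io_expand:
  assumes xi: "\<xi> \<in> H k m (X \<boxtimes> Y)"
  shows "(\<Sum>l\<in>fibre_indices. \<Sum>e\<in>ONB k l X. \<Sum>f\<in>ONB l m Y.
    pr k m (X \<boxtimes> Y) (io k l m X Y e f) \<xi> *\<^sub>C io k l m X Y e f) = \<xi>"
  using xi
proof (induction rule: io_induct)
  note K = fd[OF XY_Ob]
  have inn: "io k l m X Y e f \<in> H k m (X \<boxtimes> Y)" if "l \<in> fibre_indices" "e \<in> ONB k l X" "f \<in> ONB l m Y" for l e f
    using io_in[OF XO[OF fibre_indices_phi[OF that(1)]]] onb_in[OF fd[OF XO(1)[OF fibre_indices_phi[OF that(1)]]]]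
      onb_in[OF fd[OF XO(2)[OF fibre_indices_phi[OF that(1)]]]] that by blast
  { case zero
    then show ?case by (simp add: ip_zero_right[OF K] inn)
  next
    case (add a b)
    have "pr k m (X \<boxtimes> Y) (io k l m X Y e f) (a + b) *\<^sub>C io k l m X Y e f
      = pr k m (X \<boxtimes> Y) (io k l m X Y e f) a *\<^sub>C io k l m X Y e f + pr k m (X \<boxtimes> Y) (io k l m X Y e f) b *\<^sub>C io k l m X Y e f"
      if "l \<in> fibre_indices" "e \<in> ONB k l X" "f \<in> ONB l m Y" for l e f
      using inn[OF that] add by (simp add: ip_add_right[OF K] scaleC_add_left)
    then show ?case using add(3,4) by (simp add: sum.distrib)
  next
    case (io l x y)
    note XO' = XO[OF io(1)]
    note FX = fd[OF XO'(1)] and FY = fd[OF XO'(2)]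
    have "(\<Sum>l'\<in>fibre_indices. \<Sum>e\<in>ONB k l' X. \<Sum>f\<in>ONB l' m Y.
        pr k m (X \<boxtimes> Y) (io k l' m X Y e f) (io k l m X Y x y) *\<^sub>C io k l' m X Y e f) =
      (\<Sum>l'\<in>fibre_indices. if l' = l then \<Sum>e\<in>ONB k l' X. \<Sum>f\<in>ONB l' m Y.
        pr k m (X \<boxtimes> Y) (io k l' m X Y e f) (io k l m X Y x y) *\<^sub>C io k l' m X Y e f else 0)"
    proof (intro sum.cong refl)
      fix l' assume l': "l' \<in> fibre_indices"
      show "(\<Sum>e\<in>ONB k l' X. \<Sum>f\<in>ONB l' m Y.
          pr k m (X \<boxtimes> Y) (io k l' m X Y e f) (io k l m X Y x y) *\<^sub>C io k l' m X Y e f) =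
        (if l' = l then \<Sum>e\<in>ONB k l' X. \<Sum>f\<in>ONB l' m Y.
          pr k m (X \<boxtimes> Y) (io k l' m X Y e f) (io k l m X Y x y) *\<^sub>C io k l' m X Y e f else 0)"
        using io_orth[OF fibre_indices_phi[OF l'] io(1) _ _ _ io(2,3)] onb_in[OF fd[OF XO(1)[OF fibre_indices_phi[OF l']]]]
          onb_in[OF fd[OF XO(2)[OF fibre_indices_phi[OF l']]]] by (auto intro!: sum.neutral)
    qed
    also have "\<dots> = (\<Sum>e\<in>ONB k l X. \<Sum>f\<in>ONB l m Y.
        pr k m (X \<boxtimes> Y) (io k l m X Y e f) (io k l m X Y x y) *\<^sub>C io k l m X Y e f)"
      using fibre_indices_finite fibre_indices_off[OF _ io(1)] by simp
    also have "\<dots> = (\<Sum>e\<in>ONB k l X. \<Sum>f\<in>ONB l m Y. io k l m X Y (pr k l X e x *\<^sub>C e) (pr l m Y f y *\<^sub>C f))"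
    proof (intro sum.cong refl)
      fix e f assume "e \<in> ONB k l X" "f \<in> ONB l m Y"
      then have ef: "e \<in> H k l X" "f \<in> H l m Y" using onb_in[OF FX] onb_in[OF FY] by auto
      show "pr k m (X \<boxtimes> Y) (io k l m X Y e f) (io k l m X Y x y) *\<^sub>C io k l m X Y e f
        = io k l m X Y (pr k l X e x *\<^sub>C e) (pr l m Y f y *\<^sub>C f)"
        using ef io bilinear_scale[OF io_bilinear[OF XO']] fdh_scale[OF FY]
        by (simp add: io_ip[OF XO'] scaleC_scaleC)
    qed
    also have "\<dots> = (\<Sum>e\<in>ONB k l X. io k l m X Y (pr k l X e x *\<^sub>C e) y)"
    proof (intro sum.cong refl)
      fix e assume "e \<in> ONB k l X"
      then have e: "pr k l X e x *\<^sub>C e \<in> H k l X" using onb_in[OF FX] fdh_scale[OF FX] by blast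
      have "(\<Sum>f\<in>ONB l m Y. io k l m X Y (pr k l X e x *\<^sub>C e) (pr l m Y f y *\<^sub>C f))
        = io k l m X Y (pr k l X e x *\<^sub>C e) (\<Sum>f\<in>ONB l m Y. pr l m Y f y *\<^sub>C f)"
        using onb_in[OF FY] fdh_scale[OF FY]
        by (intro linear_on_sum[OF io_lin_r[OF XO' e] fdh_subspace[OF FY], symmetric]) blast
      then show "(\<Sum>f\<in>ONB l m Y. io k l m X Y (pr k l X e x *\<^sub>C e) (pr l m Y f y *\<^sub>C f))
        = io k l m X Y (pr k l X e x *\<^sub>C e) y" by (simp add: onb_expand[OF FY io(3)])
    qed
    also have "\<dots> = io k l m X Y (\<Sum>e\<in>ONB k l X. pr k l X e x *\<^sub>C e) y"
      using onb_in[OF FX] fdh_scale[OF FX]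
      by (intro linear_on_sum[OF io_lin_l[OF XO' io(3)] fdh_subspace[OF FX], symmetric]) blast
    finally show ?case by (simp add: onb_expand[OF FX io(2)]) }
qed

end

subsection \<open>Units\<close>

lemma un_Ob: "un k \<in> Ob k k" by (rule unit_obj)

lemma un_Ob': "\<phi> k = \<phi> l \<Longrightarrow> un k \<in> Ob k l" using unit_obj by metis

lemma Fmu_hmap: "Fmu F k \<in> hmap hC (Fob F k k (un k))"
  using Fmu_unitary by (simp add: hunitary_def hisometry_def)

lemma mu_in: "mu k \<in> H k k (un k)"
  using hmap_in[OF Fmu_hmap] by (simp add: hC_simps)

lemma Fmu_scale: "Fmu F k c = c *\<^sub>C mu k"
  using linear_on_scale[OF hmap_linear[OF Fmu_hmap], of 1 k c] by (simp add: hC_simps scaleC_complex_def)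

lemma mu_ip: "pr k k (un k) (mu k) (mu k) = 1"
proof -
  have "pr k k (un k) (mu k) (mu k) = ip hC 1 1"
    using Fmu_unitary unfolding hunitary_def hisometry_def by (auto simp: hC_simps)
  then show ?thesis by (simp add: hC_simps)
qed

lemma mu_expand:
  assumes "\<xi> \<in> H k k (un k)" shows "\<xi> = pr k k (un k) (mu k) \<xi> *\<^sub>C mu k"
proof -
  from assms
  obtain c where "\<xi> = Fmu F k c" using Fmu_unitary[of k] unfolding hunitary_def by blast
  then have c: "\<xi> = c *\<^sub>C mu k" using Fmu_scale[of k c] by (rule trans)
  have "pr k k (un k) (mu k) \<xi> = c"
    unfolding c ip_scale_right[OF fd[OF un_Ob] mu_in mu_in] mu_ip by simp
  then show ?thesis by (rule ssubst) (rule c)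
qed

lemma Fmu_adj: "\<xi> \<in> H k k (un k) \<Longrightarrow> hadj hC (Fob F k k (un k)) (Fmu F k) \<xi> = pr k k (un k) (mu k) \<xi>"
  using hadj_ip[OF fdh_hC fd[OF un_Ob] Fmu_hmap, of 1 \<xi>] ip_cnj[OF fd[OF un_Ob] mu_in, of \<xi>]
  by (simp add: hC_simps) (metis complex_cnj_cnj)

lemma un_off: "k \<noteq> l \<Longrightarrow> \<phi> k = \<phi> l \<Longrightarrow> \<xi> \<in> H k l (un k) \<Longrightarrow> \<xi> = 0"
  "k \<noteq> l \<Longrightarrow> \<phi> k = \<phi> l \<Longrightarrow> \<xi> \<in> H k l (un l) \<Longrightarrow> \<xi> = 0"
  using Fob_unit_zero[of k l] by auto

lemma io_lun: "X \<in> Ob k l \<Longrightarrow> x \<in> H k l X \<Longrightarrow> Fmo F k l (un k \<boxtimes> X) X (lun C X) (io k k l (un k) X (mu k) x) = x"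
  using Fio_lun[of X k l x 1] by simp

lemma io_run: "X \<in> Ob k l \<Longrightarrow> x \<in> H k l X \<Longrightarrow> Fmo F k l (X \<boxtimes> un l) X (run C X) (io k l l X (un l) x (mu l)) = x"
  using Fio_run[of X k l x 1] by simp

lemma dag_lun: assumes X: "X \<in> Ob k l" and x: "x \<in> H k l X"
  shows "Fmo F k l X (un k \<boxtimes> X) (dag C (lun C X)) x = io k k l (un k) X (mu k) x"
  using Fmo_inverse[OF tob_Ob[OF un_Ob X] X lun_hom(1,2,3)[OF X] io_in[OF un_Ob X mu_in x]] io_lun[OF X x]
  by simp

lemma dag_run: assumes X: "X \<in> Ob k l" and x: "x \<in> H k l X"
  shows "Fmo F k l X (X \<boxtimes> un l) (dag C (run C X)) x = io k l l X (un l) x (mu l)"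
  using Fmo_inverse[OF tob_Ob[OF X un_Ob] X run_hom(1,2,3)[OF X] io_in[OF X un_Ob x mu_in]] io_run[OF X x]
  by simp

lemma dag_assoc:
  assumes X: "X \<in> Ob k l" and Y: "Y \<in> Ob l m" and Z: "Z \<in> Ob m n"
    and x: "x \<in> H k l X" and y: "y \<in> H l m Y" and z: "z \<in> H m n Z"
  shows "Fmo F k n (X \<boxtimes> (Y \<boxtimes> Z)) ((X \<boxtimes> Y) \<boxtimes> Z) (dag C (assoc C X Y Z))
    (io k l n X (Y \<boxtimes> Z) x (io l m n Y Z y z)) = io k m n (X \<boxtimes> Y) Z (io k l m X Y x y) z"
proof -
  note o = tob_Ob[OF tob_Ob[OF X Y] Z] tob_Ob[OF X tob_Ob[OF Y Z]]
  show ?thesis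
    using Fmo_inverse[OF o assoc_hom(1,2,3)[OF X Y Z] io_in[OF tob_Ob[OF X Y] Z io_in[OF X Y x y] z]]
      Fio_assoc[OF X Y Z x y z] by simp
qed

subsection \<open>The pairing induced by a morphism to a unit\<close>

text \<open>
  A morphism \<open>e : X' \<otimes> X \<rightarrow> 1\<close> induces a bilinear form on the fibres, because \<open>F\<^sub>l\<^sub>l(1)\<close> is spanned by \<open>\<mu>\<^sub>l\<close>.
\<close>

definition bform :: "'m \<Rightarrow> 'o \<Rightarrow> 'o \<Rightarrow> 'i \<Rightarrow> 'i \<Rightarrow> 'v \<Rightarrow> 'v \<Rightarrow> complex" where
  "bform e X' X k l z v = pr l l (un l) (mu l) (Fmo F l l (X' \<boxtimes> X) (un l) e (io l k l X' X z v))"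

context
  fixes e X' X k l
  assumes X: "X \<in> Ob k l" and X': "X' \<in> Ob l k" and e: "e \<in> hom C (X' \<boxtimes> X) (un l)"
begin

lemma bform_vec:
  assumes "z \<in> H l k X'" "v \<in> H k l X"
  shows "Fmo F l l (X' \<boxtimes> X) (un l) e (io l k l X' X z v) = bform e X' X k l z v *\<^sub>C mu l"
  unfolding bform_def
  using mu_expand[OF Fmo_in[OF tob_Ob[OF X' X] un_Ob e io_in[OF X' X assms]]] .

lemma bform_bilinear: "bilinear_on (H l k X') (H k l X) (bform e X' X k l)"
proof -
  note b = io_bilinear[OF X' X] and L = Fmo_lin[OF tob_Ob[OF X' X] un_Ob e]
  have i: "io l k l X' X z v \<in> H l l (X' \<boxtimes> X)" if "z \<in> H l k X'" "v \<in> H k l X" for z v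
    using io_in[OF X' X that] .
  have j: "Fmo F l l (X' \<boxtimes> X) (un l) e (io l k l X' X z v) \<in> H l l (un l)" if "z \<in> H l k X'" "v \<in> H k l X" for z v
    using Fmo_in[OF tob_Ob[OF X' X] un_Ob e i[OF that]] .
  show ?thesis
    using b i j unfolding bilinear_on_def linear_on_def bform_def
    by (simp add: linear_on_add[OF L] linear_on_scale[OF L] ip_add_right[OF fd[OF un_Ob] mu_in]
        ip_scale_right[OF fd[OF un_Ob] mu_in] scaleC_complex_def)
qed

lemma bform_lin: "z \<in> H l k X' \<Longrightarrow> linear_on (H k l X) (bform e X' X k l z)"
  "v \<in> H k l X \<Longrightarrow> linear_on (H l k X') (\<lambda>z. bform e X' X k l z v)"
  using bform_bilinear by (auto simp: bilinear_on_def)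

end

text \<open>
  For different outer indices the value lies in an off-diagonal fibre of the unit object, which is zero.
\<close>

lemma bform_off:
  assumes X: "X \<in> Ob k l" and X': "X' \<in> Ob l' k" and e: "e \<in> hom C (X' \<boxtimes> X) (un l)"
    and l: "\<phi> l = \<phi> l'" "l \<noteq> l'" and "z \<in> H l' k X'" "v \<in> H k l X"
  shows "Fmo F l' l (X' \<boxtimes> X) (un l) e (io l' k l X' X z v) = 0"
proof -
  have u: "un l \<in> Ob l' l" using un_Ob'[of l' l] l unit_obj by metis
  show ?thesis
    using un_off(2)[of l' l] Fmo_in[OF tob_Ob[OF X' X] u e io_in[OF X' X assms(6,7)]] l by auto
qed

lemma bform_nat_right:
  assumes X: "X \<in> Ob k l" and Y: "Y \<in> Ob k l" and X': "X' \<in> Ob l k"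
    and e: "e \<in> hom C (X' \<boxtimes> X) (un l)" and t: "t \<in> hom C Y X"
    and z: "z \<in> H l k X'" and v: "v \<in> H k l Y"
  shows "bform (e \<cdot> (idm C X' \<odot> t)) X' Y k l z v = bform e X' X k l z (Fmo F k l Y X t v)"
  unfolding bform_def
  using Fmo_comp[OF tob_Ob[OF X' Y] tob_Ob[OF X' X] un_Ob hom_tensor[OF X' X' Y X idm_hom t] e]
    io_nat[OF X' Y X' X idm_hom t z v] Fmo_id[OF X' z] by simp

subsection \<open>Contractions\<close>

text \<open>
  Contracting the first two legs of \<open>X' \<otimes> (X \<otimes> Y)\<close>, or the last two legs of \<open>(Y \<otimes> X') \<otimes> X\<close>,
  against \<open>e : X' \<otimes> X \<rightarrow> 1\<close>. On vectors the associativity and unit constraints disappear, and the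
  result vanishes unless the intermediate indices match (\<open>lcontr_vec\<close>, \<open>rcontr_vec\<close>).
\<close>

definition lcontr :: "'m \<Rightarrow> 'o \<Rightarrow> 'o \<Rightarrow> 'o \<Rightarrow> 'm" where
  "lcontr e X' X Y = lun C Y \<cdot> ((e \<odot> idm C Y) \<cdot> dag C (assoc C X' X Y))"

definition rcontr :: "'m \<Rightarrow> 'o \<Rightarrow> 'o \<Rightarrow> 'o \<Rightarrow> 'm" where
  "rcontr e Y X' X = run C Y \<cdot> ((idm C Y \<odot> e) \<cdot> assoc C Y X' X)"

lemma lcontr_hom:
  assumes X: "X \<in> obj C \<alpha> \<beta>" and X': "X' \<in> obj C \<beta> \<alpha>" and Y: "Y \<in> obj C \<beta> \<gamma>"
    and e: "e \<in> hom C (X' \<boxtimes> X) (unit C \<beta>)"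
  shows "lcontr e X' X Y \<in> hom C (X' \<boxtimes> (X \<boxtimes> Y)) Y"
    "(e \<odot> idm C Y) \<cdot> dag C (assoc C X' X Y) \<in> hom C (X' \<boxtimes> (X \<boxtimes> Y)) (unit C \<beta> \<boxtimes> Y)"
    "e \<odot> idm C Y \<in> hom C ((X' \<boxtimes> X) \<boxtimes> Y) (unit C \<beta> \<boxtimes> Y)"
proof -
  note o = tob_obj[OF tob_obj[OF X' X] Y] tob_obj[OF X' tob_obj[OF X Y]] tob_obj[OF unit_obj Y]
  show 3: "e \<odot> idm C Y \<in> hom C ((X' \<boxtimes> X) \<boxtimes> Y) (unit C \<beta> \<boxtimes> Y)"
    by (rule hom_tensor[OF tob_obj[OF X' X] unit_obj Y Y e idm_hom])
  show 2: "(e \<odot> idm C Y) \<cdot> dag C (assoc C X' X Y) \<in> hom C (X' \<boxtimes> (X \<boxtimes> Y)) (unit C \<beta> \<boxtimes> Y)"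
    by (rule hom_comp[OF o(2,1,3) assoc_hom(2)[OF X' X Y] 3])
  show "lcontr e X' X Y \<in> hom C (X' \<boxtimes> (X \<boxtimes> Y)) Y"
    unfolding lcontr_def by (rule hom_comp[OF o(2,3) Y 2 lun_hom(1)[OF Y]])
qed

lemma rcontr_hom:
  assumes X: "X \<in> obj C \<alpha> \<beta>" and X': "X' \<in> obj C \<beta> \<alpha>" and Y: "Y \<in> obj C \<gamma> \<beta>"
    and e: "e \<in> hom C (X' \<boxtimes> X) (unit C \<beta>)"
  shows "rcontr e Y X' X \<in> hom C ((Y \<boxtimes> X') \<boxtimes> X) Y"
    "(idm C Y \<odot> e) \<cdot> assoc C Y X' X \<in> hom C ((Y \<boxtimes> X') \<boxtimes> X) (Y \<boxtimes> unit C \<beta>)"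
    "idm C Y \<odot> e \<in> hom C (Y \<boxtimes> (X' \<boxtimes> X)) (Y \<boxtimes> unit C \<beta>)"
proof -
  note o = tob_obj[OF tob_obj[OF Y X'] X] tob_obj[OF Y tob_obj[OF X' X]] tob_obj[OF Y unit_obj]
  show 3: "idm C Y \<odot> e \<in> hom C (Y \<boxtimes> (X' \<boxtimes> X)) (Y \<boxtimes> unit C \<beta>)"
    by (rule hom_tensor[OF Y Y tob_obj[OF X' X] unit_obj idm_hom e])
  show 2: "(idm C Y \<odot> e) \<cdot> assoc C Y X' X \<in> hom C ((Y \<boxtimes> X') \<boxtimes> X) (Y \<boxtimes> unit C \<beta>)"
    by (rule hom_comp[OF o(1,2,3) assoc_hom(1)[OF Y X' X] 3])
  show "rcontr e Y X' X \<in> hom C ((Y \<boxtimes> X') \<boxtimes> X) Y"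
    unfolding rcontr_def by (rule hom_comp[OF o(1,3) Y 2 run_hom(1)[OF Y]])
qed

lemma lcontr_vec:
  assumes X: "X \<in> Ob k l'" and X': "X' \<in> Ob l k" and Y: "Y \<in> Ob l' n" and l: "\<phi> l = \<phi> l'"
    and e: "e \<in> hom C (X' \<boxtimes> X) (un l)"
    and z: "z \<in> H l k X'" and x: "x \<in> H k l' X" and y: "y \<in> H l' n Y"
  shows "Fmo F l n (X' \<boxtimes> (X \<boxtimes> Y)) Y (lcontr e X' X Y) (io l k n X' (X \<boxtimes> Y) z (io k l' n X Y x y))
    = (if l = l' then bform e X' X k l z x *\<^sub>C y else 0)"
proof -
  have Xl: "X \<in> obj C (\<phi> k) (\<phi> l)" and Yl: "Y \<in> obj C (\<phi> l) (\<phi> n)" using X Y l by auto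
  have ul: "un l \<in> Ob l l'" using un_Ob' l by blast
  note h = lcontr_hom[OF Xl X' Yl e]
  note o = tob_Ob[OF tob_Ob[OF X' X] Y] tob_Ob[OF X' tob_Ob[OF X Y]] tob_Ob[OF ul Y]
  have "Fmo F l n (X' \<boxtimes> (X \<boxtimes> Y)) Y (lcontr e X' X Y) (io l k n X' (X \<boxtimes> Y) z (io k l' n X Y x y))
    = Fmo F l n (un l \<boxtimes> Y) Y (lun C Y) (io l l' n (un l) Y (Fmo F l l' (X' \<boxtimes> X) (un l) e (io l k l' X' X z x)) y)"
    unfolding lcontr_def
    using Fmo_comp[OF o(2,3) Yl h(2) lun_hom(1)[OF Yl]] Fmo_comp[OF o(2,1,3) assoc_hom(2)[OF X' Xl Yl] h(3)]
      dag_assoc[OF X' X Y z x y] io_nat[OF tob_Ob[OF X' X] Y ul Y e idm_hom io_in[OF X' X z x] y]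
      Fmo_id[OF Y y] by simp
  also have "\<dots> = (if l = l' then bform e X' X k l z x *\<^sub>C y else 0)"
  proof (cases "l = l'")
    case True
    have "io l l n (un l) Y (bform e X' X k l z x *\<^sub>C mu l) y = bform e X' X k l z x *\<^sub>C io l l n (un l) Y (mu l) y"
      using bilinear_scale(1)[OF io_bilinear[OF un_Ob Yl] mu_in] y True by simp
    then show ?thesis using True bform_vec[OF Xl X' e z] x y io_lun[OF Yl]
        linear_on_scale[OF Fmo_lin[OF tob_Ob[OF un_Ob Yl] Yl lun_hom(1)[OF Yl]] io_in[OF un_Ob Yl mu_in]]
      by simp
  next
    case False
    have "e \<in> hom C (X' \<boxtimes> X) (un l')" using e l by simp
    from bform_off[OF X X' this _ _ z x] have 0: "Fmo F l l' (X' \<boxtimes> X) (un l) e (io l k l' X' X z x) = 0"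
      using l False by simp
    have "io l l' n (un l) Y 0 y = 0" using linear_on_zero[OF io_lin_l[OF ul Y y] fdh_zero[OF fd[OF ul]]] .
    then show ?thesis using 0 False
        linear_on_zero[OF Fmo_lin[OF o(3) Yl lun_hom(1)[OF Yl]] fdh_zero[OF fd[OF o(3)]]] by simp
  qed
  finally show ?thesis .
qed

lemma rcontr_vec:
  assumes X: "X \<in> Ob k l" and X': "X' \<in> Ob l' k" and Y: "Y \<in> Ob n l'" and l: "\<phi> l = \<phi> l'"
    and e: "e \<in> hom C (X' \<boxtimes> X) (un l)"
    and z: "z \<in> H l' k X'" and x: "x \<in> H k l X" and y: "y \<in> H n l' Y"
  shows "Fmo F n l ((Y \<boxtimes> X') \<boxtimes> X) Y (rcontr e Y X' X) (io n k l (Y \<boxtimes> X') X (io n l' k Y X' y z) x)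
    = (if l = l' then bform e X' X k l z x *\<^sub>C y else 0)"
proof -
  have Xl: "X' \<in> obj C (\<phi> l) (\<phi> k)" and Yl: "Y \<in> obj C (\<phi> n) (\<phi> l)" using X' Y l by auto
  have ul: "un l \<in> Ob l' l" using un_Ob'[of l' l] l unit_obj by metis
  note h = rcontr_hom[OF X Xl Yl e]
  note o = tob_Ob[OF tob_Ob[OF Y X'] X] tob_Ob[OF Y tob_Ob[OF X' X]] tob_Ob[OF Y ul]
  have "Fmo F n l ((Y \<boxtimes> X') \<boxtimes> X) Y (rcontr e Y X' X) (io n k l (Y \<boxtimes> X') X (io n l' k Y X' y z) x)
    = Fmo F n l (Y \<boxtimes> un l) Y (run C Y) (io n l' l Y (un l) y (Fmo F l' l (X' \<boxtimes> X) (un l) e (io l' k l X' X z x)))"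
    unfolding rcontr_def
    using Fmo_comp[OF o(1,3) Yl h(2) run_hom(1)[OF Yl]] Fmo_comp[OF o(1,2,3) assoc_hom(1)[OF Yl Xl X] h(3)]
      Fio_assoc[OF Y X' X y z x] io_nat[OF Y tob_Ob[OF X' X] Y ul idm_hom e y io_in[OF X' X z x]]
      Fmo_id[OF Y y] by simp
  also have "\<dots> = (if l = l' then bform e X' X k l z x *\<^sub>C y else 0)"
  proof (cases "l = l'")
    case True
    have "io n l l Y (un l) y (bform e X' X k l z x *\<^sub>C mu l) = bform e X' X k l z x *\<^sub>C io n l l Y (un l) y (mu l)"
      using bilinear_scale(2)[OF io_bilinear[OF Yl un_Ob] _ mu_in] y True by simp
    then show ?thesis using True bform_vec[OF X Xl e _ x] z y io_run[OF Yl]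
        linear_on_scale[OF Fmo_lin[OF tob_Ob[OF Yl un_Ob] Yl run_hom(1)[OF Yl]] io_in[OF Yl un_Ob _ mu_in]]
      by simp
  next
    case False
    from bform_off[OF X X' e l False z x] have 0: "Fmo F l' l (X' \<boxtimes> X) (un l) e (io l' k l X' X z x) = 0" .
    have "io n l' l Y (un l) y 0 = 0" using linear_on_zero[OF io_lin_r[OF Y ul y] fdh_zero[OF fd[OF ul]]] .
    then show ?thesis using 0 False
        linear_on_zero[OF Fmo_lin[OF o(3) Yl run_hom(1)[OF Yl]] fdh_zero[OF fd[OF o(3)]]] by simp
  qed
  finally show ?thesis .
qed

subsection \<open>The conjugation induced by a coevaluation\<close>

definition coev_vec :: "'i \<Rightarrow> 'o \<Rightarrow> 'v" where
  "coev_vec k X = Fmo F k k (un k) (X \<boxtimes> ldual C X) (coev C X) (mu k)"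

text \<open>
  The component \<open>\<pi>(F(coev) \<mu>\<^sub>k)\<close> of the coevaluation in \<open>F\<^sub>k\<^sub>l X \<otimes> F\<^sub>l\<^sub>k (ldual X)\<close>, turned into a conjugate linear map
  by pairing its first leg with \<open>w\<close>; thus \<open>\<langle>y, J w\<rangle> = \<langle>\<iota>(w \<otimes> y), F(coev) \<mu>\<^sub>k\<rangle>\<close>.
\<close>

definition J :: "'i \<Rightarrow> 'i \<Rightarrow> 'o \<Rightarrow> 'v \<Rightarrow> 'v" where
  "J k l X w = (\<Sum>f\<in>ONB l k (ldual C X). pr k k (X \<boxtimes> ldual C X) (io k l k X (ldual C X) w f) (coev_vec k X) *\<^sub>C f)"

abbreviation ev_form :: "'o \<Rightarrow> 'i \<Rightarrow> 'i \<Rightarrow> 'v \<Rightarrow> 'v \<Rightarrow> complex" where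
  "ev_form X k l z v \<equiv> bform (ev C X) (ldual C X) X k l z v"

context
  fixes k l X assumes X: "X \<in> Ob k l"
begin

lemma coev_vec_in: "coev_vec k X \<in> H k k (X \<boxtimes> ldual C X)"
  unfolding coev_vec_def
  by (rule Fmo_in[OF un_Ob tob_Ob[OF X ldual_obj[OF X]] coev_hom[OF X] mu_in])

lemma J_in: "w \<in> H k l X \<Longrightarrow> J k l X w \<in> H l k (ldual C X)"
  unfolding J_def using fd[OF ldual_obj[OF X]] by (intro fdh_sum fdh_scale) (auto intro: onb_in)

lemma J_ip:
  assumes w: "w \<in> H k l X" and y: "y \<in> H l k (ldual C X)"
  shows "pr l k (ldual C X) y (J k l X w) = pr k k (X \<boxtimes> ldual C X) (io k l k X (ldual C X) w y) (coev_vec k X)"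
proof -
  note X' = ldual_obj[OF X] note FX = fd[OF X'] and FXX = fd[OF tob_Ob[OF X X']]
  note io1 = io_in[OF X X' w] and oi = onb_in[OF FX]
  have "pr l k (ldual C X) y (J k l X w) = (\<Sum>f\<in>ONB l k (ldual C X).
      pr k k (X \<boxtimes> ldual C X) (io k l k X (ldual C X) w f) (coev_vec k X) * pr l k (ldual C X) y f)"
    unfolding J_def using y oi by (simp add: ip_sum_right[OF FX] fdh_scale[OF FX] ip_scale_right[OF FX])
  also have "\<dots> = (\<Sum>f\<in>ONB l k (ldual C X).
      pr k k (X \<boxtimes> ldual C X) (io k l k X (ldual C X) w (pr l k (ldual C X) f y *\<^sub>C f)) (coev_vec k X))"
    using oi by (intro sum.cong refl) (simp add: linear_on_scale[OF io_lin_r[OF X X' w]]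
        ip_scale_left[OF FXX coev_vec_in io1] ip_cnj[OF FX _ y] mult.commute)
  also have "\<dots> = pr k k (X \<boxtimes> ldual C X)
      (\<Sum>f\<in>ONB l k (ldual C X). io k l k X (ldual C X) w (pr l k (ldual C X) f y *\<^sub>C f)) (coev_vec k X)"
    using oi by (intro ip_sum_left[OF FXX coev_vec_in, symmetric] io1 fdh_scale[OF FX])
  also have "(\<Sum>f\<in>ONB l k (ldual C X). io k l k X (ldual C X) w (pr l k (ldual C X) f y *\<^sub>C f))
    = io k l k X (ldual C X) w (\<Sum>f\<in>ONB l k (ldual C X). pr l k (ldual C X) f y *\<^sub>C f)"
    using oi by (intro linear_on_sum[OF io_lin_r[OF X X' w] fdh_subspace[OF FX], symmetric] fdh_scale[OF FX])
  finally show ?thesis by (simp add: onb_expand[OF FX y])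
qed

lemma J_antilinear: "antilinear_on (H k l X) (J k l X)"
proof -
  note X' = ldual_obj[OF X] note FX = fd[OF X'] and FXX = fd[OF tob_Ob[OF X X']]
  note FX1 = fd[OF X]
  note B = io_bilinear[OF X X']
  have 1: "J k l X (x + y) = J k l X x + J k l X y" if "x \<in> H k l X" "y \<in> H k l X" for x y
  proof (rule ip_eqI[OF FX])
    show "J k l X (x + y) \<in> H l k (ldual C X)" "J k l X x + J k l X y \<in> H l k (ldual C X)"
      using that J_in fdh_add[OF FX1] fdh_add[OF FX] by auto
    fix z assume z: "z \<in> H l k (ldual C X)"
    show "pr l k (ldual C X) z (J k l X (x + y)) = pr l k (ldual C X) z (J k l X x + J k l X y)"
      using that z J_in fdh_add[OF FX1] linear_on_add[OF io_lin_l[OF X X' z]] io_in[OF X X']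
      by (simp add: ip_add_right[OF FX] J_ip ip_add_left[OF FXX coev_vec_in])
  qed
  have 2: "J k l X (c *\<^sub>C x) = cnj c *\<^sub>C J k l X x" if "x \<in> H k l X" for x c
  proof (rule ip_eqI[OF FX])
    show "J k l X (c *\<^sub>C x) \<in> H l k (ldual C X)" "cnj c *\<^sub>C J k l X x \<in> H l k (ldual C X)"
      using that J_in fdh_scale[OF FX1] fdh_scale[OF FX] by auto
    fix z assume z: "z \<in> H l k (ldual C X)"
    show "pr l k (ldual C X) z (J k l X (c *\<^sub>C x)) = pr l k (ldual C X) z (cnj c *\<^sub>C J k l X x)"
      using that z J_in fdh_scale[OF FX1] linear_on_scale[OF io_lin_l[OF X X' z]] io_in[OF X X']
      by (simp add: ip_scale_right[OF FX] J_ip ip_scale_left[OF FXX coev_vec_in])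
  qed
  show ?thesis using 1 2 by (simp add: antilinear_on_def)
qed

lemma J_sum:
  assumes w: "w \<in> H k l X"
  shows "(\<Sum>e\<in>ONB k l X. pr k l X w e *\<^sub>C J k l X e) = J k l X w"
proof -
  note FX = fd[OF X]
  have "(\<Sum>e\<in>S. pr k l X w e *\<^sub>C J k l X e) = J k l X (\<Sum>e\<in>S. pr k l X e w *\<^sub>C e)"
    if "S \<subseteq> ONB k l X" for S
    using finite_subset[OF that finite_onb[OF FX]] that
  proof (induction S rule: finite_induct)
    case empty
    have "J k l X (0 + 0) = J k l X 0 + J k l X 0"
      using J_antilinear fdh_zero[OF FX] unfolding antilinear_on_def by blast
    then show ?case by simp
  next
    case (insert e S)
    have m: "e \<in> H k l X" "pr k l X e w *\<^sub>C e \<in> H k l X" "(\<Sum>e\<in>S. pr k l X e w *\<^sub>C e) \<in> H k l X"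
      using insert onb_in[OF FX] by (auto intro!: fdh_sum[OF FX] fdh_scale[OF FX])
    show ?case using insert m J_antilinear ip_cnj[OF FX m(1) w] unfolding antilinear_on_def by simp
  qed
  from this[of "ONB k l X"] show ?thesis by (simp add: onb_expand[OF FX w])
qed

end

lemma coev_vec_expand:
  assumes X: "X \<in> obj C (\<phi> k) \<beta>"
  shows "coev_vec k X = (\<Sum>l\<in>fibre_indices k X \<beta>. \<Sum>e\<in>ONB k l X. io k l k X (ldual C X) e (J k l X e))"
proof -
  note X' = ldual_obj[OF X]
  have c: "coev_vec k X \<in> H k k (X \<boxtimes> ldual C X)"
    unfolding coev_vec_def by (rule Fmo_in[OF un_Ob tob_obj[OF X X'] coev_hom[OF X] mu_in])
  have "(\<Sum>l\<in>fibre_indices k X \<beta>. \<Sum>e\<in>ONB k l X. io k l k X (ldual C X) e (J k l X e)) =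
    (\<Sum>l\<in>fibre_indices k X \<beta>. \<Sum>e\<in>ONB k l X. \<Sum>f\<in>ONB l k (ldual C X).
      pr k k (X \<boxtimes> ldual C X) (io k l k X (ldual C X) e f) (coev_vec k X) *\<^sub>C io k l k X (ldual C X) e f)"
  proof (intro sum.cong refl)
    fix l e assume l: "l \<in> fibre_indices k X \<beta>" and e: "e \<in> ONB k l X"
    have XX: "X \<in> Ob k l" "ldual C X \<in> Ob l k" using X X' fibre_indices_phi[OF X X' l] by auto
    have e': "e \<in> H k l X" using onb_in[OF fd[OF XX(1)] e] .
    note oi = onb_in[OF fd[OF XX(2)]]
    show "io k l k X (ldual C X) e (J k l X e) = (\<Sum>f\<in>ONB l k (ldual C X).
      pr k k (X \<boxtimes> ldual C X) (io k l k X (ldual C X) e f) (coev_vec k X) *\<^sub>C io k l k X (ldual C X) e f)"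
      unfolding J_def
      by (subst linear_on_sum[OF io_lin_r[OF XX e'] fdh_subspace[OF fd[OF XX(2)]]])
        (auto intro: fdh_scale[OF fd[OF XX(2)] oi] intro!: sum.cong
          simp: linear_on_scale[OF io_lin_r[OF XX e'] oi])
  qed
  also have "\<dots> = coev_vec k X" by (rule io_expand[OF X X' c])
  finally show ?thesis by simp
qed

text \<open>
  Contractions against a morphism to the unit kill every component of \<open>coev_vec\<close> except the one whose
  intermediate index matches; this formula evaluates the surviving component.
\<close>

lemma coev_vec_apply:
  assumes X: "X \<in> Ob k l" and K: "fd_hilbert K"
    and L: "linear_on (H k k (X \<boxtimes> ldual C X)) L"
    and g: "\<And>l' e f. \<phi> l' = \<phi> l \<Longrightarrow> e \<in> H k l' X \<Longrightarrow> f \<in> H l' k (ldual C X) \<Longrightarrow>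
      L (io k l' k X (ldual C X) e f) = (if l' = l then g e f else 0)"
  shows "L (coev_vec k X) = (\<Sum>e\<in>ONB k l X. g e (J k l X e))"
proof -
  let ?M = "fibre_indices k X (\<phi> l)"
  note X' = ldual_obj[OF X] note S = fdh_subspace[OF fd[OF tob_obj[OF X X']]]
  have m: "io k l' k X (ldual C X) e (J k l' X e) \<in> H k k (X \<boxtimes> ldual C X)"
    and j: "L (io k l' k X (ldual C X) e (J k l' X e)) = (if l' = l then g e (J k l' X e) else 0)"
    if l': "l' \<in> ?M" and e: "e \<in> ONB k l' X" for l' e
  proof -
    have XX: "X \<in> Ob k l'" "ldual C X \<in> Ob l' k" using X X' fibre_indices_phi[OF X X' l'] by auto
    have e': "e \<in> H k l' X" using onb_in[OF fd[OF XX(1)] e] .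
    show "io k l' k X (ldual C X) e (J k l' X e) \<in> H k k (X \<boxtimes> ldual C X)"
      using io_in[OF XX e' J_in[OF XX(1) e']] .
    show "L (io k l' k X (ldual C X) e (J k l' X e)) = (if l' = l then g e (J k l' X e) else 0)"
      using g[OF fibre_indices_phi[OF X X' l'] e' J_in[OF XX(1) e']] .
  qed
  have "L (coev_vec k X) = (\<Sum>l'\<in>?M. L (\<Sum>e\<in>ONB k l' X. io k l' k X (ldual C X) e (J k l' X e)))"
    unfolding coev_vec_expand[OF X] using m
    by (intro linear_on_sum[OF L S]) (auto intro!: cvs.subspace_sum[OF S])
  also have "\<dots> = (\<Sum>l'\<in>?M. \<Sum>e\<in>ONB k l' X. L (io k l' k X (ldual C X) e (J k l' X e)))"
    using m by (intro sum.cong refl linear_on_sum[OF L S]) auto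
  also have "\<dots> = (\<Sum>l'\<in>?M. if l' = l then \<Sum>e\<in>ONB k l' X. g e (J k l' X e) else 0)"
    using j by (intro sum.cong refl) auto
  also have "\<dots> = (\<Sum>e\<in>ONB k l X. g e (J k l X e))"
    using fibre_indices_finite[OF X X'] fibre_indices_off[OF X X'] by simp
  finally show ?thesis .
qed

text \<open>
  Every \<open>e : X'' \<otimes> X \<rightarrow> 1\<close> factors through the evaluation of \<open>X\<close> by a morphism \<open>X'' \<rightarrow> ldual X\<close>, and
  every \<open>e : ldual X \<otimes> Y \<rightarrow> 1\<close> by a morphism \<open>Y \<rightarrow> X\<close>.
\<close>

definition ltrans :: "'m \<Rightarrow> 'o \<Rightarrow> 'o \<Rightarrow> 'm" where
  "ltrans e X'' X = lcontr e X'' X (ldual C X) \<cdot> ((idm C X'' \<odot> coev C X) \<cdot> dag C (run C X''))"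

definition rtrans :: "'m \<Rightarrow> 'o \<Rightarrow> 'o \<Rightarrow> 'm" where
  "rtrans e X Y = rcontr e X (ldual C X) Y \<cdot> ((coev C X \<odot> idm C Y) \<cdot> dag C (lun C Y))"

lemma ltrans_hom:
  assumes X: "X \<in> obj C \<alpha> \<beta>" and X'': "X'' \<in> obj C \<beta> \<alpha>" and e: "e \<in> hom C (X'' \<boxtimes> X) (unit C \<beta>)"
  shows "ltrans e X'' X \<in> hom C X'' (ldual C X)"
    "idm C X'' \<odot> coev C X \<in> hom C (X'' \<boxtimes> unit C \<alpha>) (X'' \<boxtimes> (X \<boxtimes> ldual C X))"
    "(idm C X'' \<odot> coev C X) \<cdot> dag C (run C X'') \<in> hom C X'' (X'' \<boxtimes> (X \<boxtimes> ldual C X))"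
proof -
  note X' = ldual_obj[OF X]
  note o = tob_obj[OF X'' unit_obj] tob_obj[OF X'' tob_obj[OF X X']]
  show 1: "idm C X'' \<odot> coev C X \<in> hom C (X'' \<boxtimes> unit C \<alpha>) (X'' \<boxtimes> (X \<boxtimes> ldual C X))"
    by (rule hom_tensor[OF X'' X'' unit_obj tob_obj[OF X X'] idm_hom coev_hom[OF X]])
  show 2: "(idm C X'' \<odot> coev C X) \<cdot> dag C (run C X'') \<in> hom C X'' (X'' \<boxtimes> (X \<boxtimes> ldual C X))"
    by (rule hom_comp[OF X'' o run_hom(2)[OF X''] 1])
  show "ltrans e X'' X \<in> hom C X'' (ldual C X)" unfolding ltrans_def
    by (rule hom_comp[OF X'' o(2) X' 2 lcontr_hom(1)[OF X X'' X' e]])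
qed

lemma rtrans_hom:
  assumes X: "X \<in> obj C \<alpha> \<beta>" and Y: "Y \<in> obj C \<alpha> \<beta>" and e: "e \<in> hom C (ldual C X \<boxtimes> Y) (unit C \<beta>)"
  shows "rtrans e X Y \<in> hom C Y X"
    "coev C X \<odot> idm C Y \<in> hom C (unit C \<alpha> \<boxtimes> Y) ((X \<boxtimes> ldual C X) \<boxtimes> Y)"
    "(coev C X \<odot> idm C Y) \<cdot> dag C (lun C Y) \<in> hom C Y ((X \<boxtimes> ldual C X) \<boxtimes> Y)"
proof -
  note X' = ldual_obj[OF X]
  note o = tob_obj[OF unit_obj Y] tob_obj[OF tob_obj[OF X X'] Y]
  show 1: "coev C X \<odot> idm C Y \<in> hom C (unit C \<alpha> \<boxtimes> Y) ((X \<boxtimes> ldual C X) \<boxtimes> Y)"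
    by (rule hom_tensor[OF unit_obj tob_obj[OF X X'] Y Y coev_hom[OF X] idm_hom])
  show 2: "(coev C X \<odot> idm C Y) \<cdot> dag C (lun C Y) \<in> hom C Y ((X \<boxtimes> ldual C X) \<boxtimes> Y)"
    by (rule hom_comp[OF Y o lun_hom(2)[OF Y] 1])
  show "rtrans e X Y \<in> hom C Y X" unfolding rtrans_def
    by (rule hom_comp[OF Y o(2) X 2 rcontr_hom(1)[OF Y X' X e]])
qed

lemma lcontr_coev_vec:
  assumes X: "X \<in> Ob k l" and X'': "X'' \<in> Ob l k" and e: "e \<in> hom C (X'' \<boxtimes> X) (un l)" and z: "z \<in> H l k X''"
  shows "Fmo F l k (X'' \<boxtimes> (X \<boxtimes> ldual C X)) (ldual C X) (lcontr e X'' X (ldual C X))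
      (io l k k X'' (X \<boxtimes> ldual C X) z (coev_vec k X))
    = (\<Sum>x\<in>ONB k l X. bform e X'' X k l z x *\<^sub>C J k l X x)"
proof -
  note X' = ldual_obj[OF X]
  let ?L = "\<lambda>\<xi>. Fmo F l k (X'' \<boxtimes> (X \<boxtimes> ldual C X)) (ldual C X) (lcontr e X'' X (ldual C X))
      (io l k k X'' (X \<boxtimes> ldual C X) z \<xi>)"
  note oo = tob_Ob[OF X'' tob_Ob[OF X X']]
  note i = io_lin_r[OF X'' tob_Ob[OF X X'] z] and ii = io_in[OF X'' tob_Ob[OF X X'] z]
    and f = Fmo_lin[OF oo X' lcontr_hom(1)[OF X X'' X' e]]
  have L: "linear_on (H k k (X \<boxtimes> ldual C X)) ?L"
    unfolding linear_on_def using ii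
    by (simp add: linear_on_add[OF i] linear_on_add[OF f] linear_on_scale[OF i] linear_on_scale[OF f])
  show ?thesis
  proof (rule coev_vec_apply[OF X fd[OF X'] L])
    fix l' x y assume l': "\<phi> l' = \<phi> l" and x: "x \<in> H k l' X" and y: "y \<in> H l' k (ldual C X)"
    have "X \<in> Ob k l'" "ldual C X \<in> Ob l' k" using X X' l' by auto
    from lcontr_vec[OF this(1) X'' this(2) l'[symmetric] e z x y]
    show "?L (io k l' k X (ldual C X) x y) = (if l' = l then bform e X'' X k l z x *\<^sub>C y else 0)" by auto
  qed
qed

lemma rcontr_coev_vec:
  assumes X: "X \<in> Ob k l" and Y: "Y \<in> Ob k l" and e: "e \<in> hom C (ldual C X \<boxtimes> Y) (un l)" and y: "y \<in> H k l Y"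
  shows "Fmo F k l ((X \<boxtimes> ldual C X) \<boxtimes> Y) X (rcontr e X (ldual C X) Y)
      (io k k l (X \<boxtimes> ldual C X) Y (coev_vec k X) y)
    = (\<Sum>x\<in>ONB k l X. bform e (ldual C X) Y k l (J k l X x) y *\<^sub>C x)"
proof -
  note X' = ldual_obj[OF X]
  let ?L = "\<lambda>\<xi>. Fmo F k l ((X \<boxtimes> ldual C X) \<boxtimes> Y) X (rcontr e X (ldual C X) Y)
      (io k k l (X \<boxtimes> ldual C X) Y \<xi> y)"
  note oo = tob_Ob[OF tob_Ob[OF X X'] Y]
  note i = io_lin_l[OF tob_Ob[OF X X'] Y y] and ii = io_in[OF tob_Ob[OF X X'] Y _ y]
    and f = Fmo_lin[OF oo X rcontr_hom(1)[OF Y X' X e]]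
  have L: "linear_on (H k k (X \<boxtimes> ldual C X)) ?L"
    unfolding linear_on_def using ii
    by (simp add: linear_on_add[OF i] linear_on_add[OF f] linear_on_scale[OF i] linear_on_scale[OF f])
  show ?thesis
  proof (rule coev_vec_apply[OF X fd[OF X] L])
    fix l' x z assume l': "\<phi> l' = \<phi> l" and x: "x \<in> H k l' X" and z: "z \<in> H l' k (ldual C X)"
    have "X \<in> Ob k l'" "ldual C X \<in> Ob l' k" using X X' l' by auto
    from rcontr_vec[OF Y this(2) this(1) l'[symmetric] e z y x]
    show "?L (io k l' k X (ldual C X) x z) = (if l' = l then bform e (ldual C X) Y k l z y *\<^sub>C x else 0)" by auto
  qed
qed

lemma io_coev_vec_right:
  assumes X: "X \<in> Ob k l" and X'': "X'' \<in> Ob l k" and z: "z \<in> H l k X''"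
  shows "Fmo F l k (X'' \<boxtimes> un k) (X'' \<boxtimes> (X \<boxtimes> ldual C X)) (idm C X'' \<odot> coev C X) (io l k k X'' (un k) z (mu k))
    = io l k k X'' (X \<boxtimes> ldual C X) z (coev_vec k X)"
  using io_nat[OF X'' un_Ob X'' tob_Ob[OF X ldual_obj[OF X]] idm_hom coev_hom[OF X] z mu_in] Fmo_id[OF X'' z]
  by (simp add: coev_vec_def)

lemma io_coev_vec_left:
  assumes X: "X \<in> Ob k l" and Y: "Y \<in> Ob k l" and y: "y \<in> H k l Y"
  shows "Fmo F k l (un k \<boxtimes> Y) ((X \<boxtimes> ldual C X) \<boxtimes> Y) (coev C X \<odot> idm C Y) (io k k l (un k) Y (mu k) y)
    = io k k l (X \<boxtimes> ldual C X) Y (coev_vec k X) y"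
  using io_nat[OF un_Ob Y tob_Ob[OF X ldual_obj[OF X]] Y coev_hom[OF X] idm_hom mu_in y] Fmo_id[OF Y y]
  by (simp add: coev_vec_def)

lemma ltrans_vec:
  assumes X: "X \<in> Ob k l" and X'': "X'' \<in> Ob l k" and e: "e \<in> hom C (X'' \<boxtimes> X) (un l)" and z: "z \<in> H l k X''"
  shows "Fmo F l k X'' (ldual C X) (ltrans e X'' X) z = (\<Sum>x\<in>ONB k l X. bform e X'' X k l z x *\<^sub>C J k l X x)"
proof -
  note X' = ldual_obj[OF X] and h = ltrans_hom[OF X X'' e]
  note o = tob_obj[OF X'' unit_obj[of "\<phi> k"]] tob_obj[OF X'' tob_obj[OF X X']]
  show ?thesis unfolding ltrans_def
      Fmo_comp[OF X'' o(2) X' h(3) lcontr_hom(1)[OF X X'' X' e]] Fmo_comp[OF X'' o run_hom(2)[OF X''] h(2)]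
      dag_run[OF X'' z] io_coev_vec_right[OF X X'' z] lcontr_coev_vec[OF X X'' e z] ..
qed

lemma rtrans_vec:
  assumes X: "X \<in> Ob k l" and Y: "Y \<in> Ob k l" and e: "e \<in> hom C (ldual C X \<boxtimes> Y) (un l)" and y: "y \<in> H k l Y"
  shows "Fmo F k l Y X (rtrans e X Y) y = (\<Sum>x\<in>ONB k l X. bform e (ldual C X) Y k l (J k l X x) y *\<^sub>C x)"
proof -
  note X' = ldual_obj[OF X] and h = rtrans_hom[OF X Y e]
  note o = tob_obj[OF unit_obj[of "\<phi> k"] Y] tob_obj[OF tob_obj[OF X X'] Y]
  show ?thesis unfolding rtrans_def
      Fmo_comp[OF Y o(2) X h(3) rcontr_hom(1)[OF Y X' X e]] Fmo_comp[OF Y o lun_hom(2)[OF Y] h(2)]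
      dag_lun[OF Y y] io_coev_vec_left[OF X Y y] rcontr_coev_vec[OF X Y e y] ..
qed

subsection \<open>The snake identities on vectors\<close>

lemma snake_right:
  assumes X: "X \<in> Ob k l" and v: "v \<in> H k l X"
  shows "(\<Sum>x\<in>ONB k l X. ev_form X k l (J k l X x) v *\<^sub>C x) = v"
proof -
  note X' = ldual_obj[OF X] and h = rtrans_hom[OF X X ev_hom[OF X]]
  note o = tob_obj[OF unit_obj[of "\<phi> k"] X] tob_obj[OF tob_obj[OF X X'] X]
    tob_obj[OF X tob_obj[OF X' X]] tob_obj[OF X unit_obj[of "\<phi> l"]]
  note rh = rcontr_hom[OF X X' X ev_hom[OF X]]
  have d: "run C X \<cdot> ((idm C X \<odot> ev C X) \<cdot> (assoc C X (ldual C X) X \<cdot> (coev C X \<odot> idm C X))) = lun C X"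
    using left_dual[of X] by (simp add: is_left_dual_def)
  have io: "io k k l (un k) X (mu k) v \<in> H k l (un k \<boxtimes> X)" by (rule io_in[OF un_Ob X mu_in v])
  have a: "assoc C X (ldual C X) X \<cdot> (coev C X \<odot> idm C X) \<in> hom C (un k \<boxtimes> X) (X \<boxtimes> (ldual C X \<boxtimes> X))"
    by (rule hom_comp[OF o(1-3) h(2) assoc_hom(1)[OF X X' X]])
  have b: "(idm C X \<odot> ev C X) \<cdot> (assoc C X (ldual C X) X \<cdot> (coev C X \<odot> idm C X)) \<in> hom C (un k \<boxtimes> X) (X \<boxtimes> un l)"
    by (rule hom_comp[OF o(1,3,4) a rh(3)])
  let ?x = "Fmo F k l (un k \<boxtimes> X) ((X \<boxtimes> ldual C X) \<boxtimes> X) (coev C X \<odot> idm C X) (io k k l (un k) X (mu k) v)"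
  have "v = Fmo F k l (X \<boxtimes> un l) X (run C X) (Fmo F k l (X \<boxtimes> (ldual C X \<boxtimes> X)) (X \<boxtimes> un l) (idm C X \<odot> ev C X)
     (Fmo F k l ((X \<boxtimes> ldual C X) \<boxtimes> X) (X \<boxtimes> (ldual C X \<boxtimes> X)) (assoc C X (ldual C X) X) ?x))"
    using io_lun[OF X v] unfolding d[symmetric]
      Fmo_comp[OF o(1,4) X b run_hom(1)[OF X]] Fmo_comp[OF o(1,3,4) a rh(3)]
      Fmo_comp[OF o(1-3) h(2) assoc_hom(1)[OF X X' X]] by simp
  also have "\<dots> = Fmo F k l ((X \<boxtimes> ldual C X) \<boxtimes> X) X (rcontr (ev C X) X (ldual C X) X) ?x"
    unfolding rcontr_def Fmo_comp[OF o(2,4) X rh(2) run_hom(1)[OF X]]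
      Fmo_comp[OF o(2-4) assoc_hom(1)[OF X X' X] rh(3)] ..
  also have "\<dots> = (\<Sum>x\<in>ONB k l X. ev_form X k l (J k l X x) v *\<^sub>C x)"
    unfolding io_coev_vec_left[OF X X v] by (rule rcontr_coev_vec[OF X X ev_hom[OF X] v])
  finally show ?thesis by simp
qed

lemma snake_left:
  assumes X: "X \<in> Ob k l" and z: "z \<in> H l k (ldual C X)"
  shows "(\<Sum>x\<in>ONB k l X. ev_form X k l z x *\<^sub>C J k l X x) = z"
proof -
  note X' = ldual_obj[OF X] and h = ltrans_hom[OF X ldual_obj[OF X] ev_hom[OF X]]
  let ?Y = "ldual C X" and ?b = "dag C (assoc C (ldual C X) X (ldual C X))"
  note o = tob_obj[OF X' unit_obj[of "\<phi> k"]] tob_obj[OF X' tob_obj[OF X X']]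
    tob_obj[OF tob_obj[OF X' X] X'] tob_obj[OF unit_obj[of "\<phi> l"] X']
  note lh = lcontr_hom[OF X X' X' ev_hom[OF X]]
  have d: "lun C ?Y \<cdot> ((ev C X \<odot> idm C ?Y) \<cdot> (?b \<cdot> (idm C ?Y \<odot> coev C X))) = run C ?Y"
    using left_dual[of X] assoc_hom(5)[OF X' X X'] by (simp add: is_left_dual_def)
  have a: "?b \<cdot> (idm C ?Y \<odot> coev C X) \<in> hom C (?Y \<boxtimes> un k) ((?Y \<boxtimes> X) \<boxtimes> ?Y)"
    by (rule hom_comp[OF o(1-3) h(2) assoc_hom(2)[OF X' X X']])
  have b: "(ev C X \<odot> idm C ?Y) \<cdot> (?b \<cdot> (idm C ?Y \<odot> coev C X)) \<in> hom C (?Y \<boxtimes> un k) (un l \<boxtimes> ?Y)"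
    by (rule hom_comp[OF o(1,3,4) a lh(3)])
  let ?x = "Fmo F l k (?Y \<boxtimes> un k) (?Y \<boxtimes> (X \<boxtimes> ?Y)) (idm C ?Y \<odot> coev C X) (io l k k ?Y (un k) z (mu k))"
  have "z = Fmo F l k (un l \<boxtimes> ?Y) ?Y (lun C ?Y) (Fmo F l k ((?Y \<boxtimes> X) \<boxtimes> ?Y) (un l \<boxtimes> ?Y) (ev C X \<odot> idm C ?Y)
     (Fmo F l k (?Y \<boxtimes> (X \<boxtimes> ?Y)) ((?Y \<boxtimes> X) \<boxtimes> ?Y) ?b ?x))"
    using io_run[OF X' z] unfolding d[symmetric]
      Fmo_comp[OF o(1,4) X' b lun_hom(1)[OF X']] Fmo_comp[OF o(1,3,4) a lh(3)]
      Fmo_comp[OF o(1-3) h(2) assoc_hom(2)[OF X' X X']] by simp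
  also have "\<dots> = Fmo F l k (?Y \<boxtimes> (X \<boxtimes> ?Y)) ?Y (lcontr (ev C X) ?Y X ?Y) ?x"
    unfolding lcontr_def Fmo_comp[OF o(2,4) X' lh(2) lun_hom(1)[OF X']]
      Fmo_comp[OF o(2-4) assoc_hom(2)[OF X' X X'] lh(3)] ..
  also have "\<dots> = (\<Sum>x\<in>ONB k l X. ev_form X k l z x *\<^sub>C J k l X x)"
    unfolding io_coev_vec_right[OF X X' z] by (rule lcontr_coev_vec[OF X X' ev_hom[OF X] z])
  finally show ?thesis by simp
qed

text \<open>
  The snake identity, written for the pairing of two vectors: evaluation inverts \<open>J\<close>.
\<close>

lemma ev_J:
  assumes X: "X \<in> Ob k l" and w: "w \<in> H k l X" and v: "v \<in> H k l X"
  shows "ev_form X k l (J k l X w) v = pr k l X w v"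
proof -
  note FX = fd[OF X] and X' = ldual_obj[OF X] and oi = onb_in[OF fd[OF X]]
  note L = bform_lin(2)[OF X X' ev_hom[OF X] v]
  have "pr k l X w v = pr k l X w (\<Sum>x\<in>ONB k l X. ev_form X k l (J k l X x) v *\<^sub>C x)"
    by (simp add: snake_right[OF X v])
  also have "\<dots> = (\<Sum>x\<in>ONB k l X. ev_form X k l (J k l X x) v * pr k l X w x)"
    using oi by (simp add: ip_sum_right[OF FX w] fdh_scale[OF FX] ip_scale_right[OF FX w])
  also have "\<dots> = (\<Sum>x\<in>ONB k l X. ev_form X k l (pr k l X w x *\<^sub>C J k l X x) v)"
    using oi J_in[OF X] by (intro sum.cong refl) (simp add: linear_on_scale[OF L] scaleC_complex_def)
  also have "\<dots> = ev_form X k l (\<Sum>x\<in>ONB k l X. pr k l X w x *\<^sub>C J k l X x) v"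
    using oi J_in[OF X] fd[OF X']
    by (intro linear_on_sum[OF L fdh_subspace[OF fd[OF X']], symmetric]) (auto intro: fdh_scale)
  finally show ?thesis by (simp add: J_sum[OF X w])
qed

lemma bform_ltrans:
  assumes X: "X \<in> Ob k l" and X'': "X'' \<in> Ob l k" and e: "e \<in> hom C (X'' \<boxtimes> X) (un l)"
    and z: "z \<in> H l k X''" and v: "v \<in> H k l X"
  shows "ev_form X k l (Fmo F l k X'' (ldual C X) (ltrans e X'' X) z) v = bform e X'' X k l z v"
proof -
  note FX = fd[OF X] and X' = ldual_obj[OF X] and oi = onb_in[OF fd[OF X]]
  note L = bform_lin(2)[OF X X' ev_hom[OF X] v] and L' = bform_lin(1)[OF X X'' e z]
  have "ev_form X k l (Fmo F l k X'' (ldual C X) (ltrans e X'' X) z) v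
    = (\<Sum>x\<in>ONB k l X. ev_form X k l (bform e X'' X k l z x *\<^sub>C J k l X x) v)"
    unfolding ltrans_vec[OF X X'' e z] using oi J_in[OF X] fd[OF X']
    by (intro linear_on_sum[OF L fdh_subspace[OF fd[OF X']]]) (auto intro: fdh_scale)
  also have "\<dots> = (\<Sum>x\<in>ONB k l X. bform e X'' X k l z (pr k l X x v *\<^sub>C x))"
    using oi J_in[OF X] v by (intro sum.cong refl)
      (simp add: linear_on_scale[OF L] linear_on_scale[OF L'] scaleC_complex_def ev_J[OF X] mult.commute)
  also have "\<dots> = bform e X'' X k l z (\<Sum>x\<in>ONB k l X. pr k l X x v *\<^sub>C x)"
    using oi by (intro linear_on_sum[OF L' fdh_subspace[OF FX], symmetric]) (auto intro: fdh_scale[OF FX])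
  finally show ?thesis by (simp add: onb_expand[OF FX v])
qed

lemma bform_rtrans:
  assumes X: "X \<in> Ob k l" and Y: "Y \<in> Ob k l" and e: "e \<in> hom C (ldual C X \<boxtimes> Y) (un l)"
    and z: "z \<in> H l k (ldual C X)" and y: "y \<in> H k l Y"
  shows "ev_form X k l z (Fmo F k l Y X (rtrans e X Y) y) = bform e (ldual C X) Y k l z y"
proof -
  note FX = fd[OF X] and X' = ldual_obj[OF X] and oi = onb_in[OF fd[OF X]]
  note L = bform_lin(1)[OF X X' ev_hom[OF X] z] and L' = bform_lin(2)[OF Y X' e y]
  have "ev_form X k l z (Fmo F k l Y X (rtrans e X Y) y)
    = (\<Sum>x\<in>ONB k l X. ev_form X k l z (bform e (ldual C X) Y k l (J k l X x) y *\<^sub>C x))"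
    unfolding rtrans_vec[OF X Y e y] using oi
    by (intro linear_on_sum[OF L fdh_subspace[OF FX]]) (auto intro: fdh_scale[OF FX])
  also have "\<dots> = (\<Sum>x\<in>ONB k l X. bform e (ldual C X) Y k l (ev_form X k l z x *\<^sub>C J k l X x) y)"
    using oi J_in[OF X] by (intro sum.cong refl)
      (simp add: linear_on_scale[OF L] linear_on_scale[OF L'] scaleC_complex_def mult.commute)
  also have "\<dots> = bform e (ldual C X) Y k l (\<Sum>x\<in>ONB k l X. ev_form X k l z x *\<^sub>C J k l X x) y"
    using oi J_in[OF X] fd[OF X']
    by (intro linear_on_sum[OF L' fdh_subspace[OF fd[OF X']], symmetric]) (auto intro: fdh_scale)
  finally show ?thesis by (simp add: snake_left[OF X z])
qed

text \<open>The Riesz dual of the evaluation pairing; it is the inverse adjoint of \<open>J\<close>.\<close>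

definition Jd :: "'i \<Rightarrow> 'i \<Rightarrow> 'o \<Rightarrow> 'v \<Rightarrow> 'v" where
  "Jd k l X v = (SOME r. r \<in> H l k (ldual C X) \<and> (\<forall>z\<in>H l k (ldual C X). pr l k (ldual C X) r z = ev_form X k l z v))"

lemma Jd:
  assumes X: "X \<in> Ob k l" and v: "v \<in> H k l X"
  shows Jd_in: "Jd k l X v \<in> H l k (ldual C X)"
    and Jd_ip: "z \<in> H l k (ldual C X) \<Longrightarrow> pr l k (ldual C X) (Jd k l X v) z = ev_form X k l z v"
proof -
  have "\<exists>r. r \<in> H l k (ldual C X) \<and> (\<forall>z\<in>H l k (ldual C X). pr l k (ldual C X) r z = ev_form X k l z v)"
    using riesz[OF fd[OF ldual_obj[OF X]] bform_lin(2)[OF X ldual_obj[OF X] ev_hom[OF X] v]] by blast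
  from someI_ex[OF this] show "Jd k l X v \<in> H l k (ldual C X)"
    "z \<in> H l k (ldual C X) \<Longrightarrow> pr l k (ldual C X) (Jd k l X v) z = ev_form X k l z v"
    unfolding Jd_def by auto
qed

end

lemma sum_fun_apply: "(\<Sum>i\<in>I. f i) x = (\<Sum>i\<in>I. f i x)"
  by (induction I rule: infinite_finite_induct) (auto simp: plus_fun_apply zero_fun_apply)

lemma additive_closed_sum:
  assumes "cvs.subspace V" "P 0" "\<And>x y. x \<in> V \<Longrightarrow> y \<in> V \<Longrightarrow> P x \<Longrightarrow> P y \<Longrightarrow> P (x + y)"
    and "\<And>i. i \<in> I \<Longrightarrow> f i \<in> V \<and> P (f i)"
  shows "(\<Sum>i\<in>I. f i) \<in> V \<and> P (\<Sum>i\<in>I. f i)"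
  using assms(4)
  by (induction I rule: infinite_finite_induct)
    (auto simp: assms(2) cvs.subspace_0[OF assms(1)] intro!: assms(3) cvs.subspace_add[OF assms(1)])

text \<open>Expansion of \<open>T\<close> in the matrix units of orthonormal bases.\<close>

lemma dual_hmap_expand:
  assumes H: "fd_hilbert H" and K: "fd_hilbert K" and f: "f \<in> dual_space (hmap H K)" and T: "T \<in> hmap H K"
  shows "f T = (\<Sum>e\<in>onb K. \<Sum>b\<in>onb H. f (\<lambda>x. if x \<in> hsp H then ip H b x *\<^sub>C e else 0) * ip K e (T b))"
proof -
  let ?r = "\<lambda>e b x. if x \<in> hsp H then ip H b x *\<^sub>C e else 0"
  note oi = onb_in[OF H] onb_in[OF K]
  have r: "?r e b \<in> hmap H K" if "e \<in> onb K" "b \<in> onb H" for e b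
    using rank_one_hmap[OF H K oi(1)[OF that(2)] oi(2)[OF that(1)]] .
  note sub = hmap_subspace[OF K, of H]
  have fl: "linear_on (hmap H K) f" using f by (simp add: dual_space_def)
  have "T = (\<Sum>e\<in>onb K. \<Sum>b\<in>onb H. ip K e (T b) *\<^sub>C ?r e b)"
  proof (rule hmap_eqI[OF T])
    show "(\<Sum>e\<in>onb K. \<Sum>b\<in>onb H. ip K e (T b) *\<^sub>C ?r e b) \<in> hmap H K"
      using r by (intro cvs.subspace_sum[OF sub] cvs.subspace_scale[OF sub])
    fix v assume v: "v \<in> hsp H"
    have "T v = T (\<Sum>b\<in>onb H. ip H b v *\<^sub>C b)" by (simp add: onb_expand[OF H v])
    also have "\<dots> = (\<Sum>b\<in>onb H. T (ip H b v *\<^sub>C b))"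
      by (intro linear_on_sum[OF hmap_linear[OF T] fdh_subspace[OF H]] fdh_scale[OF H] oi)
    also have "\<dots> = (\<Sum>b\<in>onb H. ip H b v *\<^sub>C T b)"
      using oi by (intro sum.cong refl linear_on_scale[OF hmap_linear[OF T]])
    also have "\<dots> = (\<Sum>b\<in>onb H. ip H b v *\<^sub>C (\<Sum>e\<in>onb K. ip K e (T b) *\<^sub>C e))"
      using oi by (intro sum.cong refl) (simp add: onb_expand[OF K hmap_in[OF T]])
    also have "\<dots> = (\<Sum>e\<in>onb K. \<Sum>b\<in>onb H. ip K e (T b) *\<^sub>C ip H b v *\<^sub>C e)"
      by (subst sum.swap) (simp add: cvs.scale_sum_right scaleC_scaleC mult.commute)
    finally show "T v = (\<Sum>e\<in>onb K. \<Sum>b\<in>onb H. ip K e (T b) *\<^sub>C ?r e b) v"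
      using v by (simp add: sum_fun_apply scaleC_fun_def)
  qed
  then have "f T = f (\<Sum>e\<in>onb K. \<Sum>b\<in>onb H. ip K e (T b) *\<^sub>C ?r e b)" by (rule arg_cong)
  also have "\<dots> = (\<Sum>e\<in>onb K. f (\<Sum>b\<in>onb H. ip K e (T b) *\<^sub>C ?r e b))"
    using r by (intro linear_on_sum[OF fl sub] cvs.subspace_sum[OF sub] cvs.subspace_scale[OF sub])
  also have "\<dots> = (\<Sum>e\<in>onb K. \<Sum>b\<in>onb H. f (ip K e (T b) *\<^sub>C ?r e b))"
    using r by (intro sum.cong refl linear_on_sum[OF fl sub] cvs.subspace_scale[OF sub])
  also have "\<dots> = (\<Sum>e\<in>onb K. \<Sum>b\<in>onb H. f (?r e b) * ip K e (T b))"
    using r by (intro sum.cong refl) (simp add: linear_on_scale[OF fl] scaleC_complex_def mult.commute)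
  finally show ?thesis .
qed

section \<open>Semisimplicity and natural transformations\<close>

locale tannaka_data = fibre_functor C \<phi> F
  for C :: "('j, 'o, 'm::complex_vs) pcat" (structure) and \<phi> :: "'i \<Rightarrow> 'j"
    and F :: "('i, 'o, 'm, 'v::complex_vs) umorph" +
  fixes u :: "'a \<Rightarrow> 'o"
  assumes family: "maximal_irreducible_family C u"
begin

lemma u_irred: "irreducible_object C (u a)"
  using family by (simp add: maximal_irreducible_family_def)

lemma u_inj: "isomorphic C (u a) (u b) \<Longrightarrow> a = b"
  using family by (simp add: maximal_irreducible_family_def)

lemma hom_sub: "X \<in> obj C \<alpha> \<beta> \<Longrightarrow> Y \<in> obj C \<alpha> \<beta> \<Longrightarrow> cvs.subspace (hom C X Y)"
  using hom_subspace obj_par by blast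

lemma comp_lin:
  assumes "X \<in> obj C \<alpha> \<beta>" "Y \<in> obj C \<alpha> \<beta>" "Z \<in> obj C \<alpha> \<beta>"
  shows "g \<in> hom C Y Z \<Longrightarrow> linear_on (hom C X Y) (\<lambda>f. g \<cdot> f)"
    and "f \<in> hom C X Y \<Longrightarrow> linear_on (hom C Y Z) (\<lambda>g. g \<cdot> f)"
  using cmp_bilinear[OF obj_par[OF assms(1,2)] obj_par[OF assms(2,3)]] by (auto simp: bilinear_on_def)

lemma comp_assoc:
  "\<lbrakk>W \<in> obj C \<alpha> \<beta>; X \<in> obj C \<alpha> \<beta>; Y \<in> obj C \<alpha> \<beta>; Z \<in> obj C \<alpha> \<beta>;
    f \<in> hom C W X; g \<in> hom C X Y; h \<in> hom C Y Z\<rbrakk> \<Longrightarrow> (h \<cdot> g) \<cdot> f = h \<cdot> (g \<cdot> f)"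
  using cmp_assoc[OF obj_par obj_par obj_par] by blast

text \<open>Schur's lemma: \<open>f\<^sup>* f\<close> and \<open>f f\<^sup>*\<close> are the same scalar, nonzero by the C*-identity.\<close>

lemma schur:
  assumes X: "X \<in> obj C \<alpha> \<beta>" and Y: "Y \<in> obj C \<alpha> \<beta>" and iX: "irreducible_object C X"
    and iY: "irreducible_object C Y" and f: "f \<in> hom C X Y" and f0: "f \<noteq> 0"
  shows "isomorphic C X Y"
proof -
  let ?d = "dag C f"
  note d = hom_dag[OF X Y f]
  note pXY = obj_par[OF X Y] and pYX = obj_par[OF Y X]
  obtain c where c: "?d \<cdot> f = c *\<^sub>C idm C X" using hom_comp[OF X Y X f d] iX by (auto simp: irreducible_object_def)
  obtain c' where c': "f \<cdot> ?d = c' *\<^sub>C idm C Y" using hom_comp[OF Y X Y d f] iY by (auto simp: irreducible_object_def)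
  have "c \<noteq> 0"
  proof
    assume "c = 0"
    then have "nrm C (?d \<cdot> f) = 0"
      using c nrm_eq_0[OF obj_par[OF X X], of 0] cvs.subspace_0[OF hom_sub[OF X X]] by simp
    then show False using cstar_identity[OF pXY f] nrm_eq_0[OF pXY f] f0 by simp
  qed
  \<comment> \<open>Both scalars agree: compute \<open>f f\<^sup>* f\<close> in two ways.\<close>
  have "c *\<^sub>C f = f \<cdot> (?d \<cdot> f)"
    unfolding c using linear_on_scale[OF comp_lin(1)[OF X X Y f] idm_hom] cmp_idm[OF pXY f] by simp
  also have "\<dots> = (f \<cdot> ?d) \<cdot> f" using comp_assoc[OF X Y X Y f d f] by simp
  also have "\<dots> = c' *\<^sub>C f"
    unfolding c' using linear_on_scale[OF comp_lin(2)[OF X Y Y f] idm_hom] idm_cmp[OF pXY f] by simp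
  finally have cc: "c = c'" using f0 by (simp add: cvs.scale_right_imp_eq)
  have g: "(1/c) *\<^sub>C ?d \<in> hom C Y X" using cvs.subspace_scale[OF hom_sub[OF Y X] d] .
  have "((1/c) *\<^sub>C ?d) \<cdot> f = idm C X" "f \<cdot> ((1/c) *\<^sub>C ?d) = idm C Y"
    using linear_on_scale[OF comp_lin(2)[OF X Y X f] d] linear_on_scale[OF comp_lin(1)[OF Y X Y f] d]
      c c' cc \<open>c \<noteq> 0\<close> by (simp_all add: scaleC_scaleC scaleC_one)
  then show ?thesis using f g pXY by (auto simp: isomorphic_def iso_arrow_def inverse_arrows_def)
qed

lemma u_hom:
  assumes "u a \<in> obj C \<alpha> \<beta>" "u b \<in> obj C \<alpha> \<beta>" "h \<in> hom C (u a) (u b)"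
  shows "a = b \<and> (\<exists>c. h = c *\<^sub>C idm C (u a)) \<or> h = 0"
proof (cases "h = 0")
  case False
  from schur[OF assms(1,2) u_irred u_irred assms(3) False] u_inj have "a = b" by blast
  then show ?thesis using u_irred[of a] assms(3) by (auto simp: irreducible_object_def)
qed simp

lemma direct_sumD:
  assumes "direct_sum C X n Z i p" "X \<in> obj C \<alpha> \<beta>"
  shows "j < n \<Longrightarrow> Z j \<in> obj C \<alpha> \<beta>" "j < n \<Longrightarrow> i j \<in> hom C (Z j) X" "j < n \<Longrightarrow> p j \<in> hom C X (Z j)"
    "(\<Sum>j<n. i j \<cdot> p j) = idm C X"
  using assms by (auto simp: direct_sum_def par_def obj_def)

text \<open>Semisimplicity, with each irreducible summand replaced by the isomorphic member of the family.\<close>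

lemma decompose:
  assumes X: "X \<in> obj C \<alpha> \<beta>"
  shows "\<exists>n a i p. direct_sum C X n (\<lambda>j. u (a j)) i p"
proof -
  obtain n Y i p where d: "direct_sum C X n Y i p" and irr: "\<forall>j<n. irreducible_object C (Y j)"
    using semisimple by blast
  note D = direct_sumD[OF d X]
  have "\<forall>j. \<exists>a f g. j < n \<longrightarrow> par C (Y j) (u a) \<and> inverse_arrows C (Y j) (u a) f g"
  proof
    fix j
    show "\<exists>a f g. j < n \<longrightarrow> par C (Y j) (u a) \<and> inverse_arrows C (Y j) (u a) f g"
    proof (cases "j < n")
      case True
      then obtain a where "isomorphic C (Y j) (u a)"
        using irr family unfolding maximal_irreducible_family_def by blast
      then show ?thesis unfolding isomorphic_def iso_arrow_def by blast
    qed simp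
  qed
  then obtain a f g where afg: "\<And>j. j < n \<Longrightarrow> par C (Y j) (u (a j)) \<and> inverse_arrows C (Y j) (u (a j)) (f j) (g j)"
    by metis
  have U: "u (a j) \<in> obj C \<alpha> \<beta>" if "j < n" for j
    using afg[OF that] D(1)[OF that] by (auto simp: par_def obj_def)
  have f: "f j \<in> hom C (Y j) (u (a j))" and g: "g j \<in> hom C (u (a j)) (Y j)"
    and gf: "g j \<cdot> f j = idm C (Y j)" and fg: "f j \<cdot> g j = idm C (u (a j))" if "j < n" for j
    using afg[OF that] by (auto simp: inverse_arrows_def)
  have pi: "p j \<cdot> i k = (if j = k then idm C (Y j) else 0)" if "j < n" "k < n" for j k
    using d that unfolding direct_sum_def by blast
  have "direct_sum C X n (\<lambda>j. u (a j)) (\<lambda>j. i j \<cdot> g j) (\<lambda>j. f j \<cdot> p j)"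
    unfolding direct_sum_def
  proof (intro conjI allI impI)
    fix j assume j: "j < n"
    show "par C (u (a j)) X" using obj_par[OF U[OF j] X] .
    show "i j \<cdot> g j \<in> hom C (u (a j)) X" using hom_comp[OF U[OF j] D(1)[OF j] X g[OF j] D(2)[OF j]] .
    show "f j \<cdot> p j \<in> hom C X (u (a j))" using hom_comp[OF X D(1)[OF j] U[OF j] D(3)[OF j] f[OF j]] .
    fix k assume k: "k < n"
    have 1: "i k \<cdot> g k \<in> hom C (u (a k)) X" using hom_comp[OF U[OF k] D(1)[OF k] X g[OF k] D(2)[OF k]] .
    have "(f j \<cdot> p j) \<cdot> (i k \<cdot> g k) = f j \<cdot> (p j \<cdot> (i k \<cdot> g k))"
      by (rule comp_assoc[OF U[OF k] X D(1)[OF j] U[OF j] 1 D(3)[OF j] f[OF j]])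
    also have "p j \<cdot> (i k \<cdot> g k) = (p j \<cdot> i k) \<cdot> g k"
      by (rule comp_assoc[OF U[OF k] D(1)[OF k] X D(1)[OF j] g[OF k] D(2)[OF k] D(3)[OF j], symmetric])
    also have "f j \<cdot> ((p j \<cdot> i k) \<cdot> g k) = (if j = k then idm C (u (a j)) else 0)"
    proof (cases "j = k")
      case True
      then show ?thesis using pi[OF j k] idm_cmp[OF obj_par[OF U[OF j] D(1)[OF j]] g[OF j]] fg[OF j] by simp
    next
      case False
      then show ?thesis using pi[OF j k] linear_on_zero[OF comp_lin(2)[OF U[OF k] D(1)[OF k] D(1)[OF j] g[OF k]]
            cvs.subspace_0[OF hom_sub[OF D(1)[OF k] D(1)[OF j]]]]
          linear_on_zero[OF comp_lin(1)[OF U[OF k] D(1)[OF j] U[OF j] f[OF j]]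
            cvs.subspace_0[OF hom_sub[OF U[OF k] D(1)[OF j]]]] by simp
    qed
    finally show "(f j \<cdot> p j) \<cdot> i k \<cdot> g k = (if j = k then idm C (u (a j)) else 0)" .
  next
    have "(i j \<cdot> g j) \<cdot> (f j \<cdot> p j) = i j \<cdot> p j" if j: "j < n" for j
    proof -
      note fp = hom_comp[OF X D(1)[OF j] U[OF j] D(3)[OF j] f[OF j]]
      have "(i j \<cdot> g j) \<cdot> (f j \<cdot> p j) = i j \<cdot> (g j \<cdot> (f j \<cdot> p j))"
        by (rule comp_assoc[OF X U[OF j] D(1)[OF j] X fp g[OF j] D(2)[OF j]])
      also have "g j \<cdot> (f j \<cdot> p j) = (g j \<cdot> f j) \<cdot> p j"
        by (rule comp_assoc[OF X D(1)[OF j] U[OF j] D(1)[OF j] D(3)[OF j] f[OF j] g[OF j], symmetric])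
      also have "\<dots> = p j" using gf[OF j] idm_cmp[OF obj_par[OF X D(1)[OF j]] D(3)[OF j]] by simp
      finally show ?thesis .
    qed
    then show "(\<Sum>j<n. (i j \<cdot> g j) \<cdot> f j \<cdot> p j) = idm C X" using D(4) by simp
  qed
  then show ?thesis by blast
qed

lemma Fmo_resolution:
  assumes d: "direct_sum C X n Z i p" and X: "X \<in> Ob k l" and v: "v \<in> H k l X"
  shows "(\<Sum>j<n. Fmo F k l (Z j) X (i j) (Fmo F k l X (Z j) (p j) v)) = v"
proof -
  note D = direct_sumD[OF d X]
  have "v = Fmo F k l X X (\<Sum>j<n. i j \<cdot> p j) v" unfolding D(4) by (simp add: Fmo_id[OF X v])
  also have "Fmo F k l X X (\<Sum>j<n. i j \<cdot> p j) = (\<Sum>j<n. Fmo F k l X X (i j \<cdot> p j))"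
    using D by (intro linear_on_sum[OF Fmo_linear[OF X X] hom_sub[OF X X]] hom_comp[OF X _ X]) auto
  also have "\<dots> v = (\<Sum>j<n. Fmo F k l (Z j) X (i j) (Fmo F k l X (Z j) (p j) v))"
    using D by (auto simp: sum_fun_apply intro!: sum.cong Fmo_comp[OF X _ X])
  finally show ?thesis by simp
qed

lemma nat_in: "x \<in> nat_trans C \<phi> F m n k l \<Longrightarrow> X \<in> Ob k l \<Longrightarrow> x X \<in> hmap (Fob F m n X) (Fob F k l X)"
  by (simp add: nat_trans_def)

lemma nat_vec: "x \<in> nat_trans C \<phi> F m n k l \<Longrightarrow> X \<in> Ob k l \<Longrightarrow> v \<in> H m n X \<Longrightarrow> x X v \<in> H k l X"
  using hmap_in[OF nat_in] .

lemma nat_phi: "x \<in> nat_trans C \<phi> F m n k l \<Longrightarrow> \<phi> k = \<phi> m \<and> \<phi> l = \<phi> n"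
  by (simp add: nat_trans_def)

lemma nat_nat:
  "\<lbrakk>x \<in> nat_trans C \<phi> F m n k l; X \<in> Ob k l; Y \<in> Ob k l; f \<in> hom C X Y\<rbrakk>
    \<Longrightarrow> x Y (Fmo F m n X Y f v) = Fmo F k l X Y f (x X v)"
  unfolding nat_trans_def by (simp add: fun_eq_iff)

lemma natI:
  assumes "\<phi> k = \<phi> m" "\<phi> l = \<phi> n" "\<And>X. X \<in> Ob k l \<Longrightarrow> x X \<in> hmap (Fob F m n X) (Fob F k l X)"
    and "\<And>X. X \<notin> Ob k l \<Longrightarrow> x X = 0"
    and nat: "\<And>X Y f v. X \<in> Ob k l \<Longrightarrow> Y \<in> Ob k l \<Longrightarrow> f \<in> hom C X Y \<Longrightarrow> v \<in> H m n X
      \<Longrightarrow> x Y (Fmo F m n X Y f v) = Fmo F k l X Y f (x X v)"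
  shows "x \<in> nat_trans C \<phi> F m n k l"
proof -
  have "x Y (Fmo F m n X Y f v) = Fmo F k l X Y f (x X v)"
    if X: "X \<in> Ob k l" and Y: "Y \<in> Ob k l" and f: "f \<in> hom C X Y" for X Y f v
  proof (cases "v \<in> H m n X")
    case False
    have XO: "X \<in> Ob m n" "Y \<in> Ob m n" using X Y assms by auto
    have "x Y (Fmo F m n X Y f v) = 0"
      using hmap_off[OF Fmo_hmap[OF XO f] False] linear_on_zero[OF hmap_linear[OF assms(3)[OF Y]] fdh_zero[OF fd[OF XO(2)]]]
      by simp
    moreover have "Fmo F k l X Y f (x X v) = 0"
      using hmap_off[OF assms(3)[OF X] False] linear_on_zero[OF Fmo_lin[OF X Y f] fdh_zero[OF fd[OF X]]] by simp
    ultimately show ?thesis by simp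
  qed (use nat X Y f in auto)
  then show ?thesis using assms by (auto simp: nat_trans_def fun_eq_iff)
qed

text \<open>
  A family of operators on the irreducible objects of the family extends to a natural
  transformation: on a direct sum one takes the corresponding block diagonal operator.
\<close>

context
  fixes k l m n and T :: "'a \<Rightarrow> 'v \<Rightarrow> 'v"
  assumes km: "\<phi> k = \<phi> m" and ln: "\<phi> l = \<phi> n"
    and T: "\<And>a. u a \<in> Ob k l \<Longrightarrow> T a \<in> hmap (Fob F m n (u a)) (Fob F k l (u a))"
begin

private lemma OO: "X \<in> Ob k l \<Longrightarrow> X \<in> Ob m n" using km ln by simp

private lemma T_commute:
  assumes a: "u a \<in> Ob k l" and b: "u b \<in> Ob k l" and h: "h \<in> hom C (u a) (u b)" and v: "v \<in> H m n (u a)"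
  shows "Fmo F k l (u a) (u b) h (T a v) = T b (Fmo F m n (u a) (u b) h v)"
  using u_hom[OF a b h]
proof (elim disjE conjE exE)
  fix c assume ab: "a = b" and h: "h = c *\<^sub>C idm C (u a)"
  have 1: "Fmo F k' l' (u a) (u a) h w = c *\<^sub>C w" if "u a \<in> Ob k' l'" "w \<in> H k' l' (u a)" for k' l' w
    unfolding h using linear_on_scale[OF Fmo_linear[OF that(1,1)] idm_hom] Fmo_id[OF that]
    by (simp add: scaleC_fun_def)
  show ?thesis using 1[OF a hmap_in[OF T[OF a] v]] 1[OF OO[OF a] v]
      linear_on_scale[OF hmap_linear[OF T[OF a]] v] ab by simp
next
  assume h: "h = 0"
  have 1: "Fmo F k' l' (u a) (u b) h w = 0" if "u a \<in> Ob k' l'" "u b \<in> Ob k' l'" for k' l' w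
    unfolding h using linear_on_zero[OF Fmo_linear[OF that] cvs.subspace_0[OF hom_sub[OF that]]]
    by (simp add: zero_fun_apply)
  show ?thesis using 1[OF a b] 1[OF OO[OF a] OO[OF b]]
      linear_on_zero[OF hmap_linear[OF T[OF b]] fdh_zero[OF fd[OF OO[OF b]]]] by simp
qed

private definition block :: "'o \<Rightarrow> nat \<Rightarrow> (nat \<Rightarrow> 'a) \<Rightarrow> (nat \<Rightarrow> 'm) \<Rightarrow> (nat \<Rightarrow> 'm) \<Rightarrow> 'v \<Rightarrow> 'v" where
  "block X N a i p v = (\<Sum>j<N. Fmo F k l (u (a j)) X (i j) (T (a j) (Fmo F m n X (u (a j)) (p j) v)))"

private lemma block_nat:
  assumes X: "X \<in> Ob k l" and Y: "Y \<in> Ob k l" and d: "direct_sum C X N (\<lambda>j. u (a j)) i p"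
    and d': "direct_sum C Y N' (\<lambda>j. u (a' j)) i' p'" and g: "g \<in> hom C X Y" and v: "v \<in> H m n X"
  shows "block Y N' a' i' p' (Fmo F m n X Y g v) = Fmo F k l X Y g (block X N a i p v)"
proof -
  note D = direct_sumD[OF d X] and D' = direct_sumD[OF d' Y]
  define s where "s j = Fmo F m n X (u (a j)) (p j) v" for j
  have s: "s j \<in> H m n (u (a j))" if "j < N" for j
    unfolding s_def by (rule Fmo_in[OF OO[OF X] OO[OF D(1)[OF that]] D(3)[OF that] v])
  have Ts: "T (a j) (s j) \<in> H k l (u (a j))" if "j < N" for j using hmap_in[OF T[OF D(1)] s] that by blast
  have gi: "g \<cdot> i j \<in> hom C (u (a j)) Y" if "j < N" for j
    using hom_comp[OF D(1) X Y D(2) g] that by blast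
  have pgi: "p' r \<cdot> (g \<cdot> i j) \<in> hom C (u (a j)) (u (a' r))" if "j < N" "r < N'" for j r
    using hom_comp[OF D(1) Y D'(1) gi D'(3)] that by blast
  have e1: "Fmo F m n X Y g v = (\<Sum>j<N. Fmo F m n (u (a j)) Y (g \<cdot> i j) (s j))"
  proof -
    have "Fmo F m n X Y g v = Fmo F m n X Y g (\<Sum>j<N. Fmo F m n (u (a j)) X (i j) (s j))"
      using Fmo_resolution[OF d OO[OF X] v] by (simp add: s_def)
    also have "\<dots> = (\<Sum>j<N. Fmo F m n X Y g (Fmo F m n (u (a j)) X (i j) (s j)))"
      using s D OO X by (intro linear_on_sum[OF Fmo_lin[OF OO[OF X] OO[OF Y] g] fdh_subspace[OF fd[OF OO[OF X]]]]
          Fmo_in) auto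
    also have "\<dots> = (\<Sum>j<N. Fmo F m n (u (a j)) Y (g \<cdot> i j) (s j))"
      using D OO X Y g by (intro sum.cong refl Fmo_comp[symmetric]) auto
    finally show ?thesis .
  qed
  have e2: "Fmo F m n Y (u (a' r)) (p' r) (Fmo F m n X Y g v)
    = (\<Sum>j<N. Fmo F m n (u (a j)) (u (a' r)) (p' r \<cdot> (g \<cdot> i j)) (s j))" if r: "r < N'" for r
  proof -
    note o = OO[OF Y] OO[OF D'(1)[OF r]]
    have "Fmo F m n Y (u (a' r)) (p' r) (Fmo F m n X Y g v)
      = (\<Sum>j<N. Fmo F m n Y (u (a' r)) (p' r) (Fmo F m n (u (a j)) Y (g \<cdot> i j) (s j)))"
      unfolding e1 using s D OO X Y gi
      by (intro linear_on_sum[OF Fmo_lin[OF o D'(3)[OF r]] fdh_subspace[OF fd[OF o(1)]]] Fmo_in) auto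
    also have "\<dots> = (\<Sum>j<N. Fmo F m n (u (a j)) (u (a' r)) (p' r \<cdot> (g \<cdot> i j)) (s j))"
      using D D' r OO Y gi by (intro sum.cong refl Fmo_comp[symmetric]) auto
    finally show ?thesis .
  qed
  have e3: "Fmo F k l (u (a' r)) Y (i' r) (T (a' r) (Fmo F m n Y (u (a' r)) (p' r) (Fmo F m n X Y g v)))
    = (\<Sum>j<N. Fmo F k l (u (a' r)) Y (i' r) (Fmo F k l Y (u (a' r)) (p' r) (Fmo F k l (u (a j)) Y (g \<cdot> i j) (T (a j) (s j)))))"
    if r: "r < N'" for r
  proof -
    note U = D'(1)[OF r]
    have m: "Fmo F m n (u (a j)) (u (a' r)) (p' r \<cdot> (g \<cdot> i j)) (s j) \<in> H m n (u (a' r))" if "j < N" for j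
      using Fmo_in[OF OO[OF D(1)] OO[OF U] pgi s] that r by blast
    have "T (a' r) (Fmo F m n Y (u (a' r)) (p' r) (Fmo F m n X Y g v))
      = (\<Sum>j<N. T (a' r) (Fmo F m n (u (a j)) (u (a' r)) (p' r \<cdot> (g \<cdot> i j)) (s j)))"
      unfolding e2[OF r] using m
      by (intro linear_on_sum[OF hmap_linear[OF T[OF U]] fdh_subspace[OF fd[OF OO[OF U]]]]) auto
    also have "\<dots> = (\<Sum>j<N. Fmo F k l (u (a j)) (u (a' r)) (p' r \<cdot> (g \<cdot> i j)) (T (a j) (s j)))"
      using D U pgi s r by (intro sum.cong refl T_commute[symmetric]) auto
    finally have "Fmo F k l (u (a' r)) Y (i' r) (T (a' r) (Fmo F m n Y (u (a' r)) (p' r) (Fmo F m n X Y g v)))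
      = Fmo F k l (u (a' r)) Y (i' r) (\<Sum>j<N. Fmo F k l (u (a j)) (u (a' r)) (p' r \<cdot> (g \<cdot> i j)) (T (a j) (s j)))"
      by simp
    also have "\<dots> = (\<Sum>j<N. Fmo F k l (u (a' r)) Y (i' r) (Fmo F k l (u (a j)) (u (a' r)) (p' r \<cdot> (g \<cdot> i j)) (T (a j) (s j))))"
      using D U pgi Ts r by (intro linear_on_sum[OF Fmo_lin[OF U Y D'(2)[OF r]] fdh_subspace[OF fd[OF U]]] Fmo_in) auto
    also have "\<dots> = (\<Sum>j<N. Fmo F k l (u (a' r)) Y (i' r) (Fmo F k l Y (u (a' r)) (p' r) (Fmo F k l (u (a j)) Y (g \<cdot> i j) (T (a j) (s j)))))"
      using D D' U gi Y r by (intro sum.cong refl arg_cong[of _ _ "Fmo F k l (u (a' r)) Y (i' r)"] Fmo_comp) auto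
    finally show ?thesis .
  qed
  have "block Y N' a' i' p' (Fmo F m n X Y g v) = (\<Sum>r<N'. \<Sum>j<N. Fmo F k l (u (a' r)) Y (i' r)
     (Fmo F k l Y (u (a' r)) (p' r) (Fmo F k l (u (a j)) Y (g \<cdot> i j) (T (a j) (s j)))))"
    unfolding block_def using e3 by (intro sum.cong refl) auto
  also have "\<dots> = (\<Sum>j<N. \<Sum>r<N'. Fmo F k l (u (a' r)) Y (i' r)
     (Fmo F k l Y (u (a' r)) (p' r) (Fmo F k l (u (a j)) Y (g \<cdot> i j) (T (a j) (s j)))))"
    by (rule sum.swap)
  also have "\<dots> = (\<Sum>j<N. Fmo F k l (u (a j)) Y (g \<cdot> i j) (T (a j) (s j)))"
    using Ts gi D Y by (intro sum.cong refl Fmo_resolution[OF d' Y] Fmo_in) auto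
  also have "\<dots> = (\<Sum>j<N. Fmo F k l X Y g (Fmo F k l (u (a j)) X (i j) (T (a j) (s j))))"
    using D X Y g by (intro sum.cong refl Fmo_comp) auto
  also have "\<dots> = Fmo F k l X Y g (\<Sum>j<N. Fmo F k l (u (a j)) X (i j) (T (a j) (s j)))"
    using D X Ts by (intro linear_on_sum[OF Fmo_lin[OF X Y g] fdh_subspace[OF fd[OF X]], symmetric] Fmo_in) auto
  finally show ?thesis by (simp add: block_def s_def)
qed

lemma nat_extend: "\<exists>x\<in>nat_trans C \<phi> F m n k l. \<forall>a. u a \<in> Ob k l \<longrightarrow> x (u a) = T a"
proof -
  obtain N a i p where d: "\<And>X. X \<in> Ob k l \<Longrightarrow> direct_sum C X (N X) (\<lambda>j. u (a X j)) (i X) (p X)"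
    using decompose by metis
  define x where "x = (\<lambda>X v. if X \<in> Ob k l \<and> v \<in> H m n X then block X (N X) (a X) (i X) (p X) v else 0)"
  have hm: "x X \<in> hmap (Fob F m n X) (Fob F k l X)" if X: "X \<in> Ob k l" for X
  proof (rule hmapI)
    note D = direct_sumD[OF d[OF X] X]
    have inn: "T (a X j) (Fmo F m n X (u (a X j)) (p X j) v) \<in> H k l (u (a X j))" if "j < N X" "v \<in> H m n X" for j v
      using hmap_in[OF T[OF D(1)] Fmo_in[OF OO[OF X] OO[OF D(1)] D(3)]] that by blast
    show "x X v \<in> H k l X" if v: "v \<in> H m n X" for v
      using X v inn[OF _ v] D unfolding x_def block_def
      by (auto intro!: fdh_sum[OF fd[OF X]] Fmo_in[OF _ X])
    show "linear_on (H m n X) (x X)"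
    proof -
      have "block X (N X) (a X) (i X) (p X) (v + w) = block X (N X) (a X) (i X) (p X) v + block X (N X) (a X) (i X) (p X) w"
        if "v \<in> H m n X" "w \<in> H m n X" for v w
        unfolding block_def sum.distrib[symmetric]
      proof (intro sum.cong refl)
        fix j assume "j \<in> {..<N X}"
        then have j: "j < N X" by simp
        note o = D(1)[OF j] OO[OF D(1)[OF j]]
        show "Fmo F k l (u (a X j)) X (i X j) (T (a X j) (Fmo F m n X (u (a X j)) (p X j) (v + w))) =
          Fmo F k l (u (a X j)) X (i X j) (T (a X j) (Fmo F m n X (u (a X j)) (p X j) v)) +
          Fmo F k l (u (a X j)) X (i X j) (T (a X j) (Fmo F m n X (u (a X j)) (p X j) w))"
          using linear_on_add[OF Fmo_lin[OF OO[OF X] o(2) D(3)[OF j]] that]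
            linear_on_add[OF hmap_linear[OF T[OF o(1)]] Fmo_in[OF OO[OF X] o(2) D(3)[OF j] that(1)]
              Fmo_in[OF OO[OF X] o(2) D(3)[OF j] that(2)]]
            linear_on_add[OF Fmo_lin[OF o(1) X D(2)[OF j]] inn[OF j that(1)] inn[OF j that(2)]] by simp
      qed
      moreover have "block X (N X) (a X) (i X) (p X) (c *\<^sub>C v) = c *\<^sub>C block X (N X) (a X) (i X) (p X) v"
        if "v \<in> H m n X" for v c
        unfolding block_def cvs.scale_sum_right
      proof (intro sum.cong refl)
        fix j assume "j \<in> {..<N X}"
        then have j: "j < N X" by simp
        note o = D(1)[OF j] OO[OF D(1)[OF j]]
        show "Fmo F k l (u (a X j)) X (i X j) (T (a X j) (Fmo F m n X (u (a X j)) (p X j) (c *\<^sub>C v))) =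
          c *\<^sub>C Fmo F k l (u (a X j)) X (i X j) (T (a X j) (Fmo F m n X (u (a X j)) (p X j) v))"
          using linear_on_scale[OF Fmo_lin[OF OO[OF X] o(2) D(3)[OF j]] that]
            linear_on_scale[OF hmap_linear[OF T[OF o(1)]] Fmo_in[OF OO[OF X] o(2) D(3)[OF j] that]]
            linear_on_scale[OF Fmo_lin[OF o(1) X D(2)[OF j]] inn[OF j that]] by simp
      qed
      ultimately show ?thesis using X fdh_add[OF fd[OF OO[OF X]]] fdh_scale[OF fd[OF OO[OF X]]]
        unfolding linear_on_def x_def by simp
    qed
    show "x X v = 0" if "v \<notin> H m n X" for v using that by (simp add: x_def)
  qed
  have "x \<in> nat_trans C \<phi> F m n k l"
  proof (rule natI[OF km ln hm])
    show "x X = 0" if "X \<notin> Ob k l" for X using that by (simp add: x_def fun_eq_iff zero_fun_apply)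
    show "x Y (Fmo F m n X Y f v) = Fmo F k l X Y f (x X v)"
      if X: "X \<in> Ob k l" and Y: "Y \<in> Ob k l" and f: "f \<in> hom C X Y" and v: "v \<in> H m n X" for X Y f v
      using X Y v Fmo_in[OF OO[OF X] OO[OF Y] f v] block_nat[OF X Y d[OF X] d[OF Y] f v]
      by (simp add: x_def)
  qed
  moreover have "x (u b) = T b" if b: "u b \<in> Ob k l" for b
  proof (rule hmap_eqI[OF hm[OF b] T[OF b]])
    note D = direct_sumD[OF d[OF b] b]
    let ?X = "u b"
    fix v assume v: "v \<in> H m n ?X"
    have "x ?X v = (\<Sum>j<N ?X. Fmo F k l (u (a ?X j)) ?X (i ?X j) (Fmo F k l ?X (u (a ?X j)) (p ?X j) (T b v)))"
      using b v D T_commute[OF b _ _ v] by (simp add: x_def block_def)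
    also have "\<dots> = T b v" by (rule Fmo_resolution[OF d[OF b] b hmap_in[OF T[OF b] v]])
    finally show "x ?X v = T b v" .
  qed
  ultimately show ?thesis by blast
qed

end

section \<open>Matrix coefficients\<close>

abbreviation A :: "'i \<Rightarrow> 'i \<Rightarrow> 'i \<Rightarrow> 'i \<Rightarrow> ('a, 'v) rec_elem set" where "A \<equiv> rec_sp C \<phi> F u"
abbreviation Nat :: "'i \<Rightarrow> 'i \<Rightarrow> 'i \<Rightarrow> 'i \<Rightarrow> ('o \<Rightarrow> 'v \<Rightarrow> 'v) set" where "Nat \<equiv> nat_trans C \<phi> F"

lemma dual_space_subspace: "cvs.subspace (dual_space V)"
  unfolding cvs.subspace_def dual_space_def linear_on_def
  by (auto simp: plus_fun_apply zero_fun_apply scaleC_fun_def scaleC_complex_def algebra_simps)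

lemma rec_comp_subspace: "cvs.subspace (rec_comp C \<phi> F u k l m n a)"
  using dual_space_subspace by (auto simp: rec_comp_def)

lemma A_subspace: "cvs.subspace (A k l m n)"
proof (rule cvs.subspaceI)
  note S = rec_comp_subspace
  show "0 \<in> A k l m n" by (simp add: rec_sp_def zero_fun_apply cvs.subspace_0[OF S])
  show "f + g \<in> A k l m n" if f: "f \<in> A k l m n" and g: "g \<in> A k l m n" for f g
  proof -
    have "finite ({a. f a \<noteq> 0} \<union> {a. g a \<noteq> 0})" using f g by (simp add: rec_sp_def)
    then have "finite {a. (f + g) a \<noteq> 0}" by (rule rev_finite_subset) (auto simp: plus_fun_apply)
    then show ?thesis using f g by (simp add: rec_sp_def plus_fun_apply cvs.subspace_add[OF S])
  qed
  show "c *\<^sub>C f \<in> A k l m n" if f: "f \<in> A k l m n" for c f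
  proof -
    have "finite {a. f a \<noteq> 0}" using f by (simp add: rec_sp_def)
    then have "finite {a. (c *\<^sub>C f) a \<noteq> 0}" by (rule rev_finite_subset) (auto simp: scaleC_fun_def[of c f])
    then show ?thesis using f by (simp add: rec_sp_def scaleC_fun_def[of c f] cvs.subspace_scale[OF S])
  qed
qed

lemma A_zero: "0 \<in> A k l m n" and A_add: "f \<in> A k l m n \<Longrightarrow> g \<in> A k l m n \<Longrightarrow> f + g \<in> A k l m n"
  and A_scale: "f \<in> A k l m n \<Longrightarrow> c *\<^sub>C f \<in> A k l m n"
  and A_sum: "(\<And>i. i \<in> S \<Longrightarrow> h i \<in> A k l m n) \<Longrightarrow> (\<Sum>i\<in>S. h i) \<in> A k l m n"
  using A_subspace cvs.subspace_0 cvs.subspace_add cvs.subspace_scale cvs.subspace_sum by blast+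

lemma A_trivial:
  assumes n: "\<not> (\<phi> k = \<phi> m \<and> \<phi> l = \<phi> n)" and f: "f \<in> A k l m n"
  shows "f = 0"
proof (rule ext)
  fix a
  have "rec_comp C \<phi> F u k l m n a = {0}" using n by (auto simp: rec_comp_def)
  moreover have "f a \<in> rec_comp C \<phi> F u k l m n a" using f unfolding rec_sp_def by blast
  ultimately show "f a = 0 a" by (simp add: zero_fun_apply)
qed

lemma rec_pair_superset:
  assumes "finite S" "{a. f a \<noteq> 0} \<subseteq> S"
  shows "rec_pair u f x = (\<Sum>a\<in>S. f a (x (u a)))"
  unfolding rec_pair_def using assms by (intro sum.mono_neutral_left) (auto simp: zero_fun_apply)

lemma rec_pair_lin: "linear_on (A k l m n) (\<lambda>f. rec_pair u f x)"
  unfolding linear_on_def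
proof (intro conjI ballI allI)
  fix f g assume f: "f \<in> A k l m n" and g: "g \<in> A k l m n"
  let ?S = "{a. f a \<noteq> 0} \<union> {a. g a \<noteq> 0}"
  have S: "finite ?S" using f g by (simp add: rec_sp_def)
  have "{a. (f + g) a \<noteq> 0} \<subseteq> ?S" by (auto simp: plus_fun_apply)
  then show "rec_pair u (f + g) x = rec_pair u f x + rec_pair u g x"
    using S rec_pair_superset[OF S, of f x] rec_pair_superset[OF S, of g x] rec_pair_superset[OF S, of "f + g" x]
    by (simp add: plus_fun_apply sum.distrib)
next
  fix c f assume f: "f \<in> A k l m n"
  let ?S = "{a. f a \<noteq> 0}"
  have S: "finite ?S" using f by (simp add: rec_sp_def)
  have "{a. (c *\<^sub>C f) a \<noteq> 0} \<subseteq> ?S" by (auto simp: scaleC_fun_def[of c f])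
  then show "rec_pair u (c *\<^sub>C f) x = c *\<^sub>C rec_pair u f x"
    using S rec_pair_superset[OF S, of f x] rec_pair_superset[OF S, of "c *\<^sub>C f" x]
    by (simp add: scaleC_fun_def scaleC_complex_def sum_distrib_left)
qed

lemma rec_pair_add: "f \<in> A k l m n \<Longrightarrow> g \<in> A k l m n \<Longrightarrow> rec_pair u (f + g) x = rec_pair u f x + rec_pair u g x"
  using linear_on_add[OF rec_pair_lin] .

lemma rec_pair_scale: "f \<in> A k l m n \<Longrightarrow> rec_pair u (c *\<^sub>C f) x = c * rec_pair u f x"
  using linear_on_scale[OF rec_pair_lin] by (simp add: scaleC_complex_def)

lemma rec_pair_sum: "(\<And>i. i \<in> S \<Longrightarrow> h i \<in> A k l m n) \<Longrightarrow> rec_pair u (\<Sum>i\<in>S. h i) x = (\<Sum>i\<in>S. rec_pair u (h i) x)"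
  by (rule linear_on_sum[OF rec_pair_lin A_subspace])

lemma rec_pair_zero: "rec_pair u 0 x = 0"
  by (simp add: rec_pair_def zero_fun_apply)

text \<open>
  Every operator at a single irreducible object is the value of a natural transformation that vanishes
  at the other ones, hence natural transformations separate the elements.
\<close>

lemma A_eq_zeroI:
  assumes f: "f \<in> A k l m n" and z: "\<And>x. x \<in> Nat m n k l \<Longrightarrow> rec_pair u f x = 0"
  shows "f = 0"
proof (rule ext)
  fix a
  have fa: "f a \<in> rec_comp C \<phi> F u k l m n a" using f by (simp add: rec_sp_def)
  show "f a = 0 a"
  proof (cases "\<phi> k = \<phi> m \<and> \<phi> m = lft C (u a) \<and> \<phi> l = \<phi> n \<and> \<phi> n = rgt C (u a)")
    case False
    then show ?thesis using fa by (auto simp: rec_comp_def zero_fun_apply split: if_splits)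
  next
    case True
    then have ua: "u a \<in> Ob k l" "u a \<in> Ob m n" by (auto simp: obj_def)
    have fd': "f a \<in> dual_space (hmap (Fob F m n (u a)) (Fob F k l (u a)))"
      using fa True by (simp add: rec_comp_def)
    have "f a T = 0" for T
    proof (cases "T \<in> hmap (Fob F m n (u a)) (Fob F k l (u a))")
      case False
      then show ?thesis using fd' by (simp add: dual_space_def)
    next
      case T: True
      let ?T = "\<lambda>b. if b = a then T else 0"
      have hz: "(0 :: 'v \<Rightarrow> 'v) \<in> hmap (Fob F m n (u b)) (Fob F k l (u b))" if "u b \<in> Ob k l" for b
        using cvs.subspace_0[OF hmap_subspace[OF fd[OF that]]] .
      have "\<exists>x\<in>Nat m n k l. \<forall>b. u b \<in> Ob k l \<longrightarrow> x (u b) = ?T b"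
      proof (rule nat_extend)
        show "\<phi> k = \<phi> m" "\<phi> l = \<phi> n" using True by auto
        show "?T b \<in> hmap (Fob F m n (u b)) (Fob F k l (u b))" if "u b \<in> Ob k l" for b
          using T hz[OF that] by simp
      qed
      then obtain x where x: "x \<in> Nat m n k l" "\<And>b. u b \<in> Ob k l \<Longrightarrow> x (u b) = ?T b" by blast
      have S: "finite {b. f b \<noteq> 0}" using f by (simp add: rec_sp_def)
      have "f b (x (u b)) = (if b = a then f a T else 0)" for b
      proof (cases "u b \<in> Ob k l")
        case True
        then show ?thesis
        proof (cases "b = a")
          case False
          have "linear_on (hmap (Fob F m n (u b)) (Fob F k l (u b))) (f b)" if "f b \<noteq> 0"
          proof -
            have "f b \<in> rec_comp C \<phi> F u k l m n b" using f by (simp add: rec_sp_def)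
            then show ?thesis using that unfolding rec_comp_def dual_space_def by (metis (lifting) mem_Collect_eq singletonD)
          qed
          then have "f b 0 = 0" using linear_on_zero[OF _ hz[OF True]] by (cases "f b = 0") (auto simp: zero_fun_apply)
          then show ?thesis using x(2)[OF True] False by simp
        qed (use x(2)[OF True] in simp)
      next
        case False
        then have "rec_comp C \<phi> F u k l m n b = {0}"
          unfolding rec_comp_def obj_def by (intro if_not_P) (metis (mono_tags, lifting) mem_Collect_eq)
        moreover have "f b \<in> rec_comp C \<phi> F u k l m n b" using f unfolding rec_sp_def by blast
        ultimately have "f b = 0" "b \<noteq> a" using False ua(1) by auto
        then show ?thesis by (simp add: zero_fun_apply)
      qed
      then have "rec_pair u f x = (\<Sum>b\<in>insert a {b. f b \<noteq> 0}. if b = a then f a T else 0)"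
        using S rec_pair_superset[of "insert a {b. f b \<noteq> 0}" f x] by auto
      then show ?thesis using z[OF x(1)] S by simp
    qed
    then show ?thesis by (simp add: fun_eq_iff zero_fun_apply)
  qed
qed

lemma A_eqI:
  assumes f: "f \<in> A k l m n" and g: "g \<in> A k l m n"
    and eq: "\<And>x. x \<in> Nat m n k l \<Longrightarrow> rec_pair u f x = rec_pair u g x"
  shows "f = g"
proof -
  have "f + (- 1) *\<^sub>C g \<in> A k l m n" using A_add[OF f A_scale[OF g]] .
  moreover have "rec_pair u (f + (- 1) *\<^sub>C g) x = 0" if "x \<in> Nat m n k l" for x
    unfolding rec_pair_add[OF f A_scale[OF g]] rec_pair_scale[OF g] using eq[OF that] by simp
  ultimately have "f + (- 1) *\<^sub>C g = 0" by (rule A_eq_zeroI)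
  then show ?thesis by simp
qed

text \<open>
  \<open>mc k l m n X v w\<close> is the matrix coefficient \<open>x \<mapsto> \<langle>v, x\<^sub>X w\<rangle>\<close>. All structure maps are simple on
  matrix coefficients, and these span.
\<close>

definition mc :: "'i \<Rightarrow> 'i \<Rightarrow> 'i \<Rightarrow> 'i \<Rightarrow> 'o \<Rightarrow> 'v \<Rightarrow> 'v \<Rightarrow> ('a, 'v) rec_elem" where
  "mc k l m n X v w = (THE f. f \<in> A k l m n \<and> (\<forall>x\<in>Nat m n k l. rec_pair u f x = pr k l X v (x X w)))"

lemma the_A:
  assumes "f \<in> A k l m n" "\<And>x. x \<in> Nat m n k l \<Longrightarrow> rec_pair u f x = \<theta> x"
  shows "(THE f. f \<in> A k l m n \<and> (\<forall>x\<in>Nat m n k l. rec_pair u f x = \<theta> x)) = f"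
proof (rule the_equality)
  show "f \<in> A k l m n \<and> (\<forall>x\<in>Nat m n k l. rec_pair u f x = \<theta> x)" using assms by blast
  fix g assume g: "g \<in> A k l m n \<and> (\<forall>x\<in>Nat m n k l. rec_pair u g x = \<theta> x)"
  show "g = f" by (rule A_eqI[of g k l m n f]) (use g assms in auto)
qed

context
  fixes k l m n assumes km: "\<phi> k = \<phi> m" and ln: "\<phi> l = \<phi> n"
begin

lemma Ob_mn: "X \<in> Ob k l \<Longrightarrow> X \<in> Ob m n" using km ln by simp

private definition gen :: "'a \<Rightarrow> 'v \<Rightarrow> 'v \<Rightarrow> ('a, 'v) rec_elem" where
  "gen a v w = (\<lambda>b T. if b = a \<and> T \<in> hmap (Fob F m n (u a)) (Fob F k l (u a)) then pr k l (u a) v (T w) else 0)"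

private lemma gen_in:
  assumes a: "u a \<in> Ob k l" and v: "v \<in> H k l (u a)" and w: "w \<in> H m n (u a)"
  shows "gen a v w \<in> A k l m n"
proof -
  note sub = hmap_subspace[OF fd[OF a], of "Fob F m n (u a)"]
  have "gen a v w b \<in> rec_comp C \<phi> F u k l m n b" for b
  proof (cases "b = a")
    case True
    have "linear_on (hmap (Fob F m n (u a)) (Fob F k l (u a))) (gen a v w a)"
      unfolding linear_on_def gen_def using cvs.subspace_add[OF sub] cvs.subspace_scale[OF sub] v w
      by (simp add: plus_fun_apply scaleC_fun_def ip_add_right[OF fd[OF a] v] ip_scale_right[OF fd[OF a] v]
          hmap_in scaleC_complex_def)
    then have "gen a v w a \<in> dual_space (hmap (Fob F m n (u a)) (Fob F k l (u a)))"
      by (simp add: dual_space_def) (simp add: gen_def)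
    then show ?thesis using True a km ln by (simp add: rec_comp_def obj_def)
  next
    case False
    then have "gen a v w b = 0" by (simp add: gen_def fun_eq_iff zero_fun_apply)
    then show ?thesis using cvs.subspace_0[OF rec_comp_subspace] by metis
  qed
  moreover have "finite {b. gen a v w b \<noteq> 0}"
    by (rule finite_subset[of _ "{a}"]) (auto simp: gen_def fun_eq_iff zero_fun_apply)
  ultimately show ?thesis by (simp add: rec_sp_def)
qed

private lemma gen_pair:
  assumes a: "u a \<in> Ob k l" and x: "x (u a) \<in> hmap (Fob F m n (u a)) (Fob F k l (u a))"
  shows "rec_pair u (gen a v w) x = pr k l (u a) v (x (u a) w)"
proof -
  have "{b. gen a v w b \<noteq> 0} \<subseteq> {a}" by (auto simp: gen_def fun_eq_iff zero_fun_apply)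
  from rec_pair_superset[OF _ this] show ?thesis using x by (simp add: gen_def)
qed

private lemma mc_gen:
  assumes X: "X \<in> Ob k l" and v: "v \<in> H k l X" and w: "w \<in> H m n X"
  shows "\<exists>f\<in>A k l m n. \<forall>x\<in>Nat m n k l. rec_pair u f x = pr k l X v (x X w)"
proof -
  obtain N a i p where d: "direct_sum C X N (\<lambda>j. u (a j)) i p" using decompose[OF X] by blast
  note D = direct_sumD[OF d X] and XX = Ob_mn[OF X]
  let ?f = "\<lambda>j. gen (a j) (Fmo F k l X (u (a j)) (dag C (i j)) v) (Fmo F m n X (u (a j)) (p j) w)"
  have v': "Fmo F k l X (u (a j)) (dag C (i j)) v \<in> H k l (u (a j))" if "j < N" for j
    using Fmo_in[OF X D(1) hom_dag[OF D(1) X D(2)] v] that by blast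
  have w': "Fmo F m n X (u (a j)) (p j) w \<in> H m n (u (a j))" if "j < N" for j
    using Fmo_in[OF XX Ob_mn[OF D(1)] D(3) w] that by blast
  have fA: "?f j \<in> A k l m n" if "j < N" for j using gen_in[OF D(1) v' w'] that by blast
  show ?thesis
  proof (intro bexI[of _ "\<Sum>j<N. ?f j"] ballI)
    show "(\<Sum>j<N. ?f j) \<in> A k l m n" using fA by (intro A_sum) auto
    fix x assume x: "x \<in> Nat m n k l"
    have "rec_pair u (\<Sum>j<N. ?f j) x = (\<Sum>j<N. rec_pair u (?f j) x)"
      using fA by (intro rec_pair_sum) auto
    also have "\<dots> = (\<Sum>j<N. pr k l X v (Fmo F k l (u (a j)) X (i j) (Fmo F k l X (u (a j)) (p j) (x X w))))"
    proof (intro sum.cong refl)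
      fix j assume "j \<in> {..<N}"
      then have j: "j < N" by simp
      have "rec_pair u (?f j) x = pr k l (u (a j)) (Fmo F k l X (u (a j)) (dag C (i j)) v)
        (x (u (a j)) (Fmo F m n X (u (a j)) (p j) w))"
        by (rule gen_pair[of "a j" x, OF D(1)[OF j] nat_in[OF x D(1)[OF j]]])
      also have "\<dots> = pr k l X v (Fmo F k l (u (a j)) X (i j) (x (u (a j)) (Fmo F m n X (u (a j)) (p j) w)))"
        by (rule Fmo_dag_ip[OF D(1)[OF j] X D(2)[OF j] nat_vec[OF x D(1)[OF j] w'[OF j]] v])
      finally show "rec_pair u (?f j) x = pr k l X v (Fmo F k l (u (a j)) X (i j) (Fmo F k l X (u (a j)) (p j) (x X w)))"
        unfolding nat_nat[OF x X D(1)[OF j] D(3)[OF j]] .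
    qed
    also have "\<dots> = pr k l X v (\<Sum>j<N. Fmo F k l (u (a j)) X (i j) (Fmo F k l X (u (a j)) (p j) (x X w)))"
      using D X nat_vec[OF x X w] by (intro ip_sum_right[OF fd[OF X] v, symmetric] Fmo_in) auto
    also have "\<dots> = pr k l X v (x X w)" using Fmo_resolution[OF d X nat_vec[OF x X w]] by simp
    finally show "rec_pair u (\<Sum>j<N. ?f j) x = pr k l X v (x X w)" .
  qed
qed

lemma mc:
  assumes X: "X \<in> Ob k l" and v: "v \<in> H k l X" and w: "w \<in> H m n X"
  shows mc_in: "mc k l m n X v w \<in> A k l m n"
    and mc_pair: "x \<in> Nat m n k l \<Longrightarrow> rec_pair u (mc k l m n X v w) x = pr k l X v (x X w)"
proof -
  obtain f where f: "f \<in> A k l m n" "\<And>x. x \<in> Nat m n k l \<Longrightarrow> rec_pair u f x = pr k l X v (x X w)"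
    using mc_gen[OF assms] by blast
  have "mc k l m n X v w = f" unfolding mc_def by (rule the_A[OF f])
  then show "mc k l m n X v w \<in> A k l m n"
    "x \<in> Nat m n k l \<Longrightarrow> rec_pair u (mc k l m n X v w) x = pr k l X v (x X w)" using f by auto
qed

private lemma mc_eq_gen:
  assumes a: "u a \<in> Ob k l" and v: "v \<in> H k l (u a)" and w: "w \<in> H m n (u a)"
  shows "mc k l m n (u a) v w = gen a v w"
  by (rule A_eqI[OF mc_in[OF assms] gen_in[OF assms]]) (simp add: mc_pair[OF assms] gen_pair[OF a nat_in[OF _ a]])

lemma mc_u:
  assumes a: "u a \<in> Ob k l" and v: "v \<in> H k l (u a)" and w: "w \<in> H m n (u a)"
  shows "b \<noteq> a \<Longrightarrow> mc k l m n (u a) v w b = 0"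
    and "T \<in> hmap (Fob F m n (u a)) (Fob F k l (u a)) \<Longrightarrow> mc k l m n (u a) v w a T = pr k l (u a) v (T w)"
  unfolding mc_eq_gen[OF assms] by (auto simp: gen_def fun_eq_iff zero_fun_apply)

lemma mc_eqI:
  assumes "X \<in> Ob k l" "v \<in> H k l X" "w \<in> H m n X" "f \<in> A k l m n"
    and "\<And>x. x \<in> Nat m n k l \<Longrightarrow> rec_pair u f x = pr k l X v (x X w)"
  shows "mc k l m n X v w = f"
  using A_eqI[OF mc_in[OF assms(1-3)] assms(4)] mc_pair[OF assms(1-3)] assms(5) by simp

text \<open>
  The equation \<open>\<langle>F(g)\<^sup>* v, x w\<rangle> = \<langle>v, x (F(g) w)\<rangle>\<close>. Every comparison of coefficients of different objects
  goes through this lemma.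
\<close>

lemma mc_natural:
  assumes X: "X \<in> Ob k l" and Y: "Y \<in> Ob k l" and g: "g \<in> hom C X Y" and v: "v \<in> H k l Y" and w: "w \<in> H m n X"
  shows "mc k l m n X (Fmo F k l Y X (dag C g) v) w = mc k l m n Y v (Fmo F m n X Y g w)"
proof (rule mc_eqI[OF X Fmo_in[OF Y X hom_dag[OF X Y g] v] w])
  note w' = Fmo_in[OF Ob_mn[OF X] Ob_mn[OF Y] g w]
  show "mc k l m n Y v (Fmo F m n X Y g w) \<in> A k l m n" using mc_in[OF Y v w'] .
  fix x assume x: "x \<in> Nat m n k l"
  show "rec_pair u (mc k l m n Y v (Fmo F m n X Y g w)) x = pr k l X (Fmo F k l Y X (dag C g) v) (x X w)"
    unfolding mc_pair[OF Y v w' x] nat_nat[OF x X Y g]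
    by (rule Fmo_dag_ip[OF X Y g nat_vec[OF x X w] v, symmetric])
qed

lemma mc_add_left:
  assumes X: "X \<in> Ob k l" and v: "v \<in> H k l X" and v': "v' \<in> H k l X" and w: "w \<in> H m n X"
  shows "mc k l m n X (v + v') w = mc k l m n X v w + mc k l m n X v' w"
  using X v v' w by (intro mc_eqI fdh_add A_add mc_in fd)
    (simp_all add: rec_pair_add[OF mc_in mc_in] mc_pair ip_add_left[OF fd] nat_vec)

lemma mc_add_right:
  assumes X: "X \<in> Ob k l" and v: "v \<in> H k l X" and w: "w \<in> H m n X" and w': "w' \<in> H m n X"
  shows "mc k l m n X v (w + w') = mc k l m n X v w + mc k l m n X v w'"
  using X v w w' Ob_mn[OF X] by (intro mc_eqI fdh_add A_add mc_in fd)
    (simp_all add: rec_pair_add[OF mc_in mc_in] mc_pair ip_add_right[OF fd] nat_vec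
      linear_on_add[OF hmap_linear[OF nat_in]])

lemma mc_scale_left:
  assumes X: "X \<in> Ob k l" and v: "v \<in> H k l X" and w: "w \<in> H m n X"
  shows "mc k l m n X (c *\<^sub>C v) w = cnj c *\<^sub>C mc k l m n X v w"
  using X v w by (intro mc_eqI fdh_scale A_scale mc_in fd)
    (simp_all add: rec_pair_scale[OF mc_in] mc_pair ip_scale_left[OF fd] nat_vec)

lemma mc_scale_right:
  assumes X: "X \<in> Ob k l" and v: "v \<in> H k l X" and w: "w \<in> H m n X"
  shows "mc k l m n X v (c *\<^sub>C w) = c *\<^sub>C mc k l m n X v w"
  using X v w Ob_mn[OF X] by (intro mc_eqI fdh_scale A_scale mc_in fd)
    (simp_all add: rec_pair_scale[OF mc_in] mc_pair ip_scale_right[OF fd] nat_vec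
      linear_on_scale[OF hmap_linear[OF nat_in]])

lemma mc_lin_right:
  "X \<in> Ob k l \<Longrightarrow> v \<in> H k l X \<Longrightarrow> linear_on (H m n X) (mc k l m n X v)"
  by (simp add: linear_on_def mc_add_right mc_scale_right)

lemma mc_sum_right:
  assumes X: "X \<in> Ob k l" and v: "v \<in> H k l X" and w: "\<And>i. i \<in> S \<Longrightarrow> w i \<in> H m n X"
  shows "mc k l m n X v (\<Sum>i\<in>S. w i) = (\<Sum>i\<in>S. mc k l m n X v (w i))"
  by (rule linear_on_sum[OF mc_lin_right[OF X v] fdh_subspace[OF fd[OF Ob_mn[OF X]]] w])

lemma mc_zero_right: "X \<in> Ob k l \<Longrightarrow> v \<in> H k l X \<Longrightarrow> mc k l m n X v 0 = 0"
  using linear_on_zero[OF mc_lin_right fdh_zero[OF fd[OF Ob_mn]]] .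

lemma mc_zero_left: "X \<in> Ob k l \<Longrightarrow> w \<in> H m n X \<Longrightarrow> mc k l m n X 0 w = 0"
  using mc_scale_left[of X 0 w 0] fdh_zero[OF fd[of X k l]] by simp

lemma mc_sum_left:
  assumes X: "X \<in> Ob k l" and w: "w \<in> H m n X" and v: "\<And>i. i \<in> S \<Longrightarrow> v i \<in> H k l X"
  shows "mc k l m n X (\<Sum>i\<in>S. v i) w = (\<Sum>i\<in>S. mc k l m n X (v i) w)"
  using v
proof (induction S rule: infinite_finite_induct)
  case (insert i S)
  then show ?case using mc_add_left[OF X _ _ w] fdh_sum[OF fd[OF X], of S v] by simp
qed (simp_all add: mc_zero_left[OF X w])

lemma mc_direct_sum:
  assumes X: "X \<in> Ob k l" and d: "direct_sum C X N Z i p" and v: "v \<in> H k l X" and w: "w \<in> H m n X"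
  shows "mc k l m n X v w
    = (\<Sum>j<N. mc k l m n (Z j) (Fmo F k l X (Z j) (dag C (i j)) v) (Fmo F m n X (Z j) (p j) w))"
proof -
  note D = direct_sumD[OF d X] and XX = Ob_mn[OF X]
  have "mc k l m n X v w = mc k l m n X v (\<Sum>j<N. Fmo F m n (Z j) X (i j) (Fmo F m n X (Z j) (p j) w))"
    by (simp add: Fmo_resolution[OF d XX w])
  also have "\<dots> = (\<Sum>j<N. mc k l m n X v (Fmo F m n (Z j) X (i j) (Fmo F m n X (Z j) (p j) w)))"
    using D Ob_mn w by (intro mc_sum_right[OF X v] Fmo_in[OF _ XX] Fmo_in[OF XX]) auto
  also have "\<dots> = (\<Sum>j<N. mc k l m n (Z j) (Fmo F k l X (Z j) (dag C (i j)) v) (Fmo F m n X (Z j) (p j) w))"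
    using D Ob_mn w by (intro sum.cong refl mc_natural[OF _ X _ v, symmetric] Fmo_in[OF XX]) auto
  finally show ?thesis .
qed

end

text \<open>Matrix coefficients of the irreducible objects span, by the same expansion in matrix units.\<close>

lemma A_induct [consumes 1, case_names zero add mc]:
  assumes f: "f \<in> A k l m n" and 0: "P 0"
    and add: "\<And>f g. f \<in> A k l m n \<Longrightarrow> g \<in> A k l m n \<Longrightarrow> P f \<Longrightarrow> P g \<Longrightarrow> P (f + g)"
    and mc: "\<And>a v w. \<phi> k = \<phi> m \<Longrightarrow> \<phi> l = \<phi> n \<Longrightarrow> u a \<in> Ob k l \<Longrightarrow> v \<in> H k l (u a) \<Longrightarrow> w \<in> H m n (u a)
      \<Longrightarrow> P (mc k l m n (u a) v w)"
  shows "P f"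
proof (cases "\<phi> k = \<phi> m \<and> \<phi> l = \<phi> n")
  case False
  then show ?thesis using A_trivial[OF False f] 0 by simp
next
  case True
  then have km: "\<phi> k = \<phi> m" and ln: "\<phi> l = \<phi> n" by auto
  let ?S = "{a. f a \<noteq> 0}"
  have S: "finite ?S" using f by (simp add: rec_sp_def)
  have ua: "u a \<in> Ob k l" "u a \<in> Ob m n" "f a \<in> dual_space (hmap (Fob F m n (u a)) (Fob F k l (u a)))" if "a \<in> ?S" for a
  proof -
    have "f a \<in> rec_comp C \<phi> F u k l m n a" using f by (simp add: rec_sp_def)
    then show "u a \<in> Ob k l" "u a \<in> Ob m n" "f a \<in> dual_space (hmap (Fob F m n (u a)) (Fob F k l (u a)))"
      using that by (auto simp: rec_comp_def obj_def split: if_splits)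
  qed
  define c where "c a e b = f a (\<lambda>x. if x \<in> H m n (u a) then pr m n (u a) b x *\<^sub>C e else 0)" for a e b
  let ?g = "\<lambda>a e b. mc k l m n (u a) (cnj (c a e b) *\<^sub>C e) b"
  have gg: "?g a e b \<in> A k l m n \<and> P (?g a e b)" if "a \<in> ?S" "e \<in> ONB k l (u a)" "b \<in> ONB m n (u a)" for a e b
    using that ua[OF that(1)] onb_in[OF fd[OF ua(1)[OF that(1)]]] onb_in[OF fd[OF ua(2)[OF that(1)]]]
    by (intro conjI mc_in[OF km ln] mc[OF km ln] fdh_scale[OF fd[OF ua(1)[OF that(1)]]]) auto
  have sum1: "(\<Sum>b\<in>ONB m n (u a). ?g a e b) \<in> A k l m n \<and> P (\<Sum>b\<in>ONB m n (u a). ?g a e b)"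
    if "a \<in> ?S" "e \<in> ONB k l (u a)" for a e
    by (rule additive_closed_sum[where P = P, OF A_subspace 0 add]) (use gg[OF that] in blast)+
  have sum2: "(\<Sum>e\<in>ONB k l (u a). \<Sum>b\<in>ONB m n (u a). ?g a e b) \<in> A k l m n \<and>
      P (\<Sum>e\<in>ONB k l (u a). \<Sum>b\<in>ONB m n (u a). ?g a e b)" if "a \<in> ?S" for a
    by (rule additive_closed_sum[where P = P, OF A_subspace 0 add]) (use sum1[OF that] in blast)+
  let ?h = "\<Sum>a\<in>?S. \<Sum>e\<in>ONB k l (u a). \<Sum>b\<in>ONB m n (u a). ?g a e b"
  have sum3: "?h \<in> A k l m n \<and> P ?h"
    by (rule additive_closed_sum[where P = P, OF A_subspace 0 add]) (use sum2 in blast)+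
  have "f = ?h"
  proof (rule A_eqI[OF f])
    show "?h \<in> A k l m n" using sum3 by blast
    fix x assume x: "x \<in> Nat m n k l"
    have "rec_pair u ?h x = (\<Sum>a\<in>?S. \<Sum>e\<in>ONB k l (u a). \<Sum>b\<in>ONB m n (u a). rec_pair u (?g a e b) x)"
    proof -
      note rs = rec_pair_sum[where k = k and l = l and m = m and n = n and x = x]
      have 1: "rec_pair u (\<Sum>b\<in>ONB m n (u a). ?g a e b) x = (\<Sum>b\<in>ONB m n (u a). rec_pair u (?g a e b) x)"
        if "a \<in> ?S" "e \<in> ONB k l (u a)" for a e
        by (rule rs) (use gg[OF that] in blast)
      have 2: "rec_pair u (\<Sum>e\<in>ONB k l (u a). \<Sum>b\<in>ONB m n (u a). ?g a e b) x
        = (\<Sum>e\<in>ONB k l (u a). rec_pair u (\<Sum>b\<in>ONB m n (u a). ?g a e b) x)" if "a \<in> ?S" for a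
        by (rule rs) (use sum1[OF that] in blast)
      have 3: "rec_pair u ?h x = (\<Sum>a\<in>?S. rec_pair u (\<Sum>e\<in>ONB k l (u a). \<Sum>b\<in>ONB m n (u a). ?g a e b) x)"
        by (rule rs) (use sum2 in blast)
      show ?thesis unfolding 3 by (intro sum.cong refl) (simp add: 1 2)
    qed
    also have "\<dots> = (\<Sum>a\<in>?S. \<Sum>e\<in>ONB k l (u a). \<Sum>b\<in>ONB m n (u a). c a e b * pr k l (u a) e (x (u a) b))"
    proof (intro sum.cong refl)
      fix a e b assume a: "a \<in> ?S" and e: "e \<in> ONB k l (u a)" and b: "b \<in> ONB m n (u a)"
      have e': "e \<in> H k l (u a)" "b \<in> H m n (u a)" using onb_in[OF fd[OF ua(1)[OF a]] e] onb_in[OF fd[OF ua(2)[OF a]] b] .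
      show "rec_pair u (?g a e b) x = c a e b * pr k l (u a) e (x (u a) b)"
        unfolding mc_pair[OF km ln ua(1)[OF a] fdh_scale[OF fd[OF ua(1)[OF a]] e'(1)] e'(2) x]
        using ip_scale_left[OF fd[OF ua(1)[OF a]] nat_vec[OF x ua(1)[OF a] e'(2)] e'(1)] by simp
    qed
    also have "\<dots> = (\<Sum>a\<in>?S. f a (x (u a)))"
      unfolding c_def
      by (intro sum.cong refl dual_hmap_expand[OF fd[OF ua(2)] fd[OF ua(1)] ua(3) nat_in[OF x ua(1)], symmetric])
    finally show "rec_pair u f x = rec_pair u ?h x" by (simp add: rec_pair_def)
  qed
  then show ?thesis using sum3 by simp
qed

end

lemma functional_tensor_scale:
  "functional_tensor H H' K K' (c *\<^sub>C f) g T = c * functional_tensor H H' K K' f g T"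
  "functional_tensor H H' K K' f (c *\<^sub>C g) T = c * functional_tensor H H' K K' f g T"
  unfolding functional_tensor_def case_prod_unfold
  by (simp_all add: scaleC_fun_def scaleC_complex_def sum_list_const_mult[symmetric] mult.assoc mult.left_commute)

context tannaka_data
begin

section \<open>Structure maps on matrix coefficients\<close>

subsection \<open>Comultiplication\<close>

lemma nat_comp_in: "x \<in> Nat r s k l \<Longrightarrow> y \<in> Nat m n r s \<Longrightarrow> nat_comp x y \<in> Nat m n k l"
proof (rule natI)
  assume x: "x \<in> Nat r s k l" and y: "y \<in> Nat m n r s"
  note px = nat_phi[OF x] and py = nat_phi[OF y]
  show "\<phi> k = \<phi> m" "\<phi> l = \<phi> n" using px py by auto
  have O: "X \<in> Ob r s" if "X \<in> Ob k l" for X using that px by simp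
  show "nat_comp x y X \<in> hmap (Fob F m n X) (Fob F k l X)" if X: "X \<in> Ob k l" for X
  proof (rule hmapI)
    note hx = nat_in[OF x X] and hy = nat_in[OF y O[OF X]]
    show "linear_on (H m n X) (nat_comp x y X)"
      using hmap_linear[OF hx] hmap_linear[OF hy] hmap_in[OF hy] by (simp add: linear_on_def nat_comp_def)
    show "nat_comp x y X v \<in> H k l X" if "v \<in> H m n X" for v
      using hmap_in[OF hx hmap_in[OF hy that]] by (simp add: nat_comp_def)
    show "nat_comp x y X v = 0" if "v \<notin> H m n X" for v
      using hmap_off[OF hy that] linear_on_zero[OF hmap_linear[OF hx] fdh_zero[OF fd[OF O[OF X]]]]
      by (simp add: nat_comp_def)
  qed
  show "nat_comp x y X = 0" if "X \<notin> Ob k l" for X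
    using that x by (simp add: nat_comp_def nat_trans_def fun_eq_iff zero_fun_apply)
  show "nat_comp x y Y (Fmo F m n X Y f v) = Fmo F k l X Y f (nat_comp x y X v)"
    if "X \<in> Ob k l" "Y \<in> Ob k l" "f \<in> hom C X Y" for X Y f v
    using nat_nat[OF y O[OF that(1)] O[OF that(2)] that(3)] nat_nat[OF x that] by (simp add: nat_comp_def)
qed

lemma rec_pair_bilinear: "bilinear_on (A k l m n) (A k' l' m' n') (\<lambda>g h. rec_pair u g x * rec_pair u h y)"
  by (rule bilinear_mult[OF rec_pair_lin rec_pair_lin])

lemmas pair2_balanced = bilinear_balanced[OF rec_pair_bilinear]

text \<open>Separation on both factors, by the criterion for tensors to vanish.\<close>

lemma A_tensor_eqI:
  assumes s: "s \<in> tensor_space (A k l r q) (A k' l' r' q')" and t: "t \<in> tensor_space (A k l r q) (A k' l' r' q')"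
    and eq: "\<And>x y. x \<in> Nat r q k l \<Longrightarrow> y \<in> Nat r' q' k' l' \<Longrightarrow>
      tlift (A k l r q) (A k' l' r' q') (\<lambda>g h. rec_pair u g x * rec_pair u h y) s =
      tlift (A k l r q) (A k' l' r' q') (\<lambda>g h. rec_pair u g x * rec_pair u h y) t"
  shows "s = t"
proof -
  let ?T = "tensor_space (A k l r q) (A k' l' r' q')"
  have m: "(- 1) *\<^sub>C t \<in> ?T" using cvs.subspace_scale[OF tensor_space_subspace t] .
  have "s + (- 1) *\<^sub>C t = 0"
  proof (rule tensor_eq_zeroI[OF A_subspace A_subspace, where P = "(\<lambda>x f. rec_pair u f x) ` Nat r q k l"
      and Q = "(\<lambda>x f. rec_pair u f x) ` Nat r' q' k' l'"])
    show "s + (- 1) *\<^sub>C t \<in> ?T" using cvs.subspace_add[OF tensor_space_subspace s m] .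
    show "linear_on (A k l r q) p" if "p \<in> (\<lambda>x f. rec_pair u f x) ` Nat r q k l" for p
      using that rec_pair_lin by auto
    show "linear_on (A k' l' r' q') p" if "p \<in> (\<lambda>x f. rec_pair u f x) ` Nat r' q' k' l'" for p
      using that rec_pair_lin by auto
    show "f = 0" if "f \<in> A k l r q" "\<And>p. p \<in> (\<lambda>x f. rec_pair u f x) ` Nat r q k l \<Longrightarrow> p f = 0" for f
      using A_eq_zeroI[OF that(1)] that(2) by blast
    show "f = 0" if "f \<in> A k' l' r' q'" "\<And>p. p \<in> (\<lambda>x f. rec_pair u f x) ` Nat r' q' k' l' \<Longrightarrow> p f = 0" for f
      using A_eq_zeroI[OF that(1)] that(2) by blast
    fix p q0 assume "p \<in> (\<lambda>x f. rec_pair u f x) ` Nat r q k l" "q0 \<in> (\<lambda>x f. rec_pair u f x) ` Nat r' q' k' l'"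
    then obtain x y where xy: "x \<in> Nat r q k l" "y \<in> Nat r' q' k' l'" "p = (\<lambda>f. rec_pair u f x)" "q0 = (\<lambda>f. rec_pair u f y)"
      by auto
    note L = tlift_linear[OF A_subspace A_subspace rec_pair_bilinear]
    show "tlift (A k l r q) (A k' l' r' q') (\<lambda>v w. p v * q0 w) (s + (- 1) *\<^sub>C t) = 0"
      unfolding xy(3,4) linear_on_add[OF L s m] linear_on_scale[OF L t] eq[OF xy(1,2)] by (simp add: scaleC_complex_def)
  qed
  then show ?thesis by simp
qed

abbreviation AA :: "'i \<Rightarrow> 'i \<Rightarrow> 'i \<Rightarrow> 'i \<Rightarrow> 'i \<Rightarrow> 'i \<Rightarrow> (('a, 'v) rec_elem, ('a, 'v) rec_elem) tensor set" where
  "AA k l r s m n \<equiv> tensor_space (A k l r s) (A r s m n)"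
abbreviation "pair2 k l r s m n x y \<equiv> tlift (A k l r s) (A r s m n) (\<lambda>g h. rec_pair u g x * rec_pair u h y)"
abbreviation "\<Delta> \<equiv> rec_comul C \<phi> F u"
abbreviation "\<epsilon> \<equiv> rec_counit C \<phi> F u"
abbreviation "oneA \<equiv> rec_one C \<phi> F u"
abbreviation "Shat \<equiv> rec_antipode C \<phi> F"

lemma comulI:
  assumes t: "t \<in> AA k l r s m n"
    and p: "\<And>x y. x \<in> Nat r s k l \<Longrightarrow> y \<in> Nat m n r s \<Longrightarrow> pair2 k l r s m n x y t = rec_pair u f (nat_comp x y)"
  shows "\<Delta> k l m n r s f = t"
  unfolding rec_comul_def
proof (rule the_equality)
  show "t \<in> AA k l r s m n \<and> (\<forall>x\<in>Nat r s k l. \<forall>y\<in>Nat m n r s. pair2 k l r s m n x y t = rec_pair u f (nat_comp x y))"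
    using assms by blast
  fix t' assume t': "t' \<in> AA k l r s m n \<and> (\<forall>x\<in>Nat r s k l. \<forall>y\<in>Nat m n r s. pair2 k l r s m n x y t' = rec_pair u f (nat_comp x y))"
  show "t' = t" by (rule A_tensor_eqI[of t' k l r s r s m n]) (use t' assms in auto)
qed

text \<open>
  Any pair of dual bases of \<open>F\<^sub>r\<^sub>s X\<close> may be used; the involution does not preserve orthonormality of
  a basis, but it turns an orthonormal basis into such a pair.
\<close>

lemma comul_mc_dual_bases:
  assumes km: "\<phi> k = \<phi> m" and ln: "\<phi> l = \<phi> n" and kr: "\<phi> k = \<phi> r" and ls: "\<phi> l = \<phi> s"
    and X: "X \<in> Ob k l" and v: "v \<in> H k l X" and w: "w \<in> H m n X"
    and e: "\<And>i. i \<in> S \<Longrightarrow> e i \<in> H r s X" and f: "\<And>i. i \<in> S \<Longrightarrow> f i \<in> H r s X"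
    and dual: "\<And>z. z \<in> H r s X \<Longrightarrow> (\<Sum>i\<in>S. pr r s X (f i) z *\<^sub>C e i) = z"
  shows "(\<Sum>i\<in>S. mc k l r s X v (e i) \<otimes> mc r s m n X (f i) w) \<in> AA k l r s m n"
    and "x \<in> Nat r s k l \<Longrightarrow> y \<in> Nat m n r s \<Longrightarrow>
      pair2 k l r s m n x y (\<Sum>i\<in>S. mc k l r s X v (e i) \<otimes> mc r s m n X (f i) w) =
      rec_pair u (mc k l m n X v w) (nat_comp x y)"
    and "\<Delta> k l m n r s (mc k l m n X v w) = (\<Sum>i\<in>S. mc k l r s X v (e i) \<otimes> mc r s m n X (f i) w)"
proof -
  have rm: "\<phi> r = \<phi> m" and sn: "\<phi> s = \<phi> n" using km ln kr ls by auto
  have Xr: "X \<in> Ob r s" using X kr ls by simp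
  note m1 = mc_in[OF kr ls X v e] and m2 = mc_in[OF rm sn Xr f w]
  show 1: "(\<Sum>i\<in>S. mc k l r s X v (e i) \<otimes> mc r s m n X (f i) w) \<in> AA k l r s m n"
    using m1 m2 by (intro cvs.subspace_sum[OF tensor_space_subspace] tens_in)
  show 2: "pair2 k l r s m n x y (\<Sum>i\<in>S. mc k l r s X v (e i) \<otimes> mc r s m n X (f i) w) =
      rec_pair u (mc k l m n X v w) (nat_comp x y)" if x: "x \<in> Nat r s k l" and y: "y \<in> Nat m n r s" for x y
  proof -
    have yw: "y X w \<in> H r s X" using nat_vec[OF y Xr w] .
    note xl = hmap_linear[OF nat_in[OF x X]]
    have "pair2 k l r s m n x y (\<Sum>i\<in>S. mc k l r s X v (e i) \<otimes> mc r s m n X (f i) w)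
      = (\<Sum>i\<in>S. pr k l X v (x X (e i)) * pr r s X (f i) (y X w))"
      by (subst tlift_sum_tens[OF A_subspace A_subspace pair2_balanced m1 m2])
        (auto simp: mc_pair[OF kr ls X v e x] mc_pair[OF rm sn Xr f w y])
    also have "\<dots> = (\<Sum>i\<in>S. pr k l X v (x X (pr r s X (f i) (y X w) *\<^sub>C e i)))"
      using e nat_vec[OF x X] by (intro sum.cong refl)
        (simp add: linear_on_scale[OF xl] ip_scale_right[OF fd[OF X] v] mult.commute)
    also have "\<dots> = pr k l X v (\<Sum>i\<in>S. x X (pr r s X (f i) (y X w) *\<^sub>C e i))"
      using e nat_vec[OF x X] fdh_scale[OF fd[OF Xr]] by (intro ip_sum_right[OF fd[OF X] v, symmetric]) auto
    also have "(\<Sum>i\<in>S. x X (pr r s X (f i) (y X w) *\<^sub>C e i)) = x X (\<Sum>i\<in>S. pr r s X (f i) (y X w) *\<^sub>C e i)"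
      using e fdh_scale[OF fd[OF Xr]] by (intro linear_on_sum[OF xl fdh_subspace[OF fd[OF Xr]], symmetric]) auto
    finally show ?thesis unfolding dual[OF yw] mc_pair[OF km ln X v w nat_comp_in[OF x y]]
      by (simp add: nat_comp_def)
  qed
  show "\<Delta> k l m n r s (mc k l m n X v w) = (\<Sum>i\<in>S. mc k l r s X v (e i) \<otimes> mc r s m n X (f i) w)"
    by (rule comulI[OF 1 2])
qed

lemma comul_mc:
  assumes km: "\<phi> k = \<phi> m" and ln: "\<phi> l = \<phi> n" and kr: "\<phi> k = \<phi> r" and ls: "\<phi> l = \<phi> s"
    and X: "X \<in> Ob k l" and v: "v \<in> H k l X" and w: "w \<in> H m n X"
  shows "\<Delta> k l m n r s (mc k l m n X v w) = (\<Sum>e\<in>ONB r s X. mc k l r s X v e \<otimes> mc r s m n X e w)"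
proof -
  have Xr: "X \<in> Ob r s" using X kr ls by simp
  show ?thesis by (rule comul_mc_dual_bases(3)[OF assms]) (auto simp: onb_in[OF fd[OF Xr]] onb_expand[OF fd[OF Xr]])
qed

lemma comul_off:
  assumes "f \<in> A k l m n" "\<not> (\<phi> k = \<phi> r \<and> \<phi> l = \<phi> s)"
  shows "\<Delta> k l m n r s f = 0"
proof (rule comulI)
  show "0 \<in> AA k l r s m n" using cvs.subspace_0[OF tensor_space_subspace] .
  show "pair2 k l r s m n x y 0 = rec_pair u f (nat_comp x y)" if "x \<in> Nat r s k l" for x y
    using nat_phi[OF that] assms(2) by simp
qed

lemma comul_spec_ex:
  assumes "f \<in> A k l m n"
  shows "\<exists>t\<in>AA k l r s m n. \<forall>x\<in>Nat r s k l. \<forall>y\<in>Nat m n r s. pair2 k l r s m n x y t = rec_pair u f (nat_comp x y)"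
proof (cases "\<phi> k = \<phi> r \<and> \<phi> l = \<phi> s")
  case False
  then have "Nat r s k l = {}" using nat_phi by blast
  then show ?thesis using cvs.subspace_0[OF tensor_space_subspace] by blast
next
  case True
  note L = tlift_linear[OF A_subspace A_subspace rec_pair_bilinear]
  show ?thesis using assms
  proof (induction f rule: A_induct)
    case zero
    show ?case by (rule bexI[of _ 0])
      (auto simp: rec_pair_zero tlift_zero[OF A_subspace A_subspace pair2_balanced] cvs.subspace_0[OF tensor_space_subspace])
  next
    case (add f g)
    then obtain s' t where st: "s' \<in> AA k l r s m n" "t \<in> AA k l r s m n"
      "\<And>x y. x \<in> Nat r s k l \<Longrightarrow> y \<in> Nat m n r s \<Longrightarrow> pair2 k l r s m n x y s' = rec_pair u f (nat_comp x y)"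
      "\<And>x y. x \<in> Nat r s k l \<Longrightarrow> y \<in> Nat m n r s \<Longrightarrow> pair2 k l r s m n x y t = rec_pair u g (nat_comp x y)"
      by blast
    show ?case
    proof (intro bexI[of _ "s' + t"] ballI)
      show "s' + t \<in> AA k l r s m n" using st cvs.subspace_add[OF tensor_space_subspace] by blast
    qed (simp add: linear_on_add[OF L st(1,2)] st(3,4) rec_pair_add[OF add(1,2)])
  next
    case (mc a v w)
    from True have Xr: "u a \<in> Ob r s" using mc(3) by simp
    show ?case
      using comul_mc_dual_bases(1,2)[of k m l n r s "u a" v w "ONB r s (u a)" "\<lambda>e. e" "\<lambda>e. e"] True mc
        onb_in[OF fd[OF Xr]] onb_expand[OF fd[OF Xr]] by (intro bexI ballI) auto
  qed
qed

lemma comul_in: "f \<in> A k l m n \<Longrightarrow> \<Delta> k l m n r s f \<in> AA k l r s m n"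
  and comul_pair: "f \<in> A k l m n \<Longrightarrow> x \<in> Nat r s k l \<Longrightarrow> y \<in> Nat m n r s \<Longrightarrow>
    pair2 k l r s m n x y (\<Delta> k l m n r s f) = rec_pair u f (nat_comp x y)"
proof -
  assume f: "f \<in> A k l m n"
  obtain t where t: "t \<in> AA k l r s m n" "\<And>x y. x \<in> Nat r s k l \<Longrightarrow> y \<in> Nat m n r s \<Longrightarrow>
      pair2 k l r s m n x y t = rec_pair u f (nat_comp x y)" using comul_spec_ex[OF f] by blast
  have "\<Delta> k l m n r s f = t" by (rule comulI[OF t])
  then show "\<Delta> k l m n r s f \<in> AA k l r s m n" "x \<in> Nat r s k l \<Longrightarrow> y \<in> Nat m n r s \<Longrightarrow>
    pair2 k l r s m n x y (\<Delta> k l m n r s f) = rec_pair u f (nat_comp x y)" using t by auto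
qed

lemma comul_lin: "linear_on (A k l m n) (\<Delta> k l m n r s)"
  unfolding linear_on_def
proof (intro conjI ballI allI)
  note L = tlift_linear[OF A_subspace A_subspace rec_pair_bilinear]
  fix f assume f: "f \<in> A k l m n"
  { fix g assume g: "g \<in> A k l m n"
    show "\<Delta> k l m n r s (f + g) = \<Delta> k l m n r s f + \<Delta> k l m n r s g"
      by (rule comulI) (simp_all add: cvs.subspace_add[OF tensor_space_subspace] comul_in f g
          linear_on_add[OF L comul_in[OF f] comul_in[OF g]] comul_pair rec_pair_add[OF f g]) }
  show "\<Delta> k l m n r s (c *\<^sub>C f) = c *\<^sub>C \<Delta> k l m n r s f" for c
    by (rule comulI) (simp_all add: cvs.subspace_scale[OF tensor_space_subspace] comul_in f
        linear_on_scale[OF L comul_in[OF f]] comul_pair rec_pair_scale[OF f] scaleC_complex_def)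
qed

lemma comul_zero: "\<Delta> k l m n r s 0 = 0"
  using linear_on_zero[OF comul_lin A_zero] .

subsection \<open>Multiplication\<close>

lemma dag_idm: "dag C (idm C X) = idm C X"
proof -
  have pX: "par C X X" by (simp add: par_def)
  note d = dag_hom[OF pX idm_hom]
  have "dag C (idm C X) = dag C (idm C X) \<cdot> dag C (dag C (idm C X))"
    using dag_dag[OF pX idm_hom] cmp_idm[OF pX d] by simp
  also have "\<dots> = dag C (dag C (idm C X) \<cdot> idm C X)" by (rule dag_cmp[OF pX pX idm_hom d, symmetric])
  also have "\<dots> = idm C X" using cmp_idm[OF pX d] dag_dag[OF pX idm_hom] by simp
  finally show ?thesis .
qed

lemma dag_tensor:
  "\<lbrakk>X \<in> obj C \<alpha> \<beta>; X' \<in> obj C \<alpha> \<beta>; Y \<in> obj C \<beta> \<gamma>; Y' \<in> obj C \<beta> \<gamma>; f \<in> hom C X X'; g \<in> hom C Y Y'\<rbrakk>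
    \<Longrightarrow> dag C (f \<odot> g) = dag C f \<odot> dag C g"
  using dag_tmo[of X X' Y Y'] obj_par obj_lr by metis

lemma tmo_lin:
  assumes "X \<in> obj C \<alpha> \<beta>" "X' \<in> obj C \<alpha> \<beta>" "Y \<in> obj C \<beta> \<gamma>" "Y' \<in> obj C \<beta> \<gamma>"
  shows "f \<in> hom C X X' \<Longrightarrow> linear_on (hom C Y Y') (\<lambda>g. f \<odot> g)"
    and "g \<in> hom C Y Y' \<Longrightarrow> linear_on (hom C X X') (\<lambda>f. f \<odot> g)"
  using tmo_bilinear[OF obj_par[OF assms(1,2)] obj_par[OF assms(3,4)]] assms obj_lr
  by (auto simp: bilinear_on_def)

lemma direct_sum_tensor_left:
  assumes X: "X \<in> obj C \<alpha> \<beta>" and Y: "Y \<in> obj C \<beta> \<gamma>" and d: "direct_sum C X n Z i p"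
  shows "direct_sum C (X \<boxtimes> Y) n (\<lambda>j. Z j \<boxtimes> Y) (\<lambda>j. i j \<odot> idm C Y) (\<lambda>j. p j \<odot> idm C Y)"
  unfolding direct_sum_def
proof (intro conjI allI impI)
  note D = direct_sumD[OF d X]
  have c: "(f' \<odot> idm C Y) \<cdot> (f \<odot> idm C Y) = (f' \<cdot> f) \<odot> idm C Y"
    if "U \<in> obj C \<alpha> \<beta>" "U' \<in> obj C \<alpha> \<beta>" "U'' \<in> obj C \<alpha> \<beta>" "f \<in> hom C U U'" "f' \<in> hom C U' U''" for U U' U'' f f'
    using tmo_cmp[OF obj_par[OF that(1,2)] obj_par[OF that(2,3)] obj_par[OF Y Y] obj_par[OF Y Y] _ that(4,5) idm_hom idm_hom]
      cmp_idm[OF obj_par[OF Y Y] idm_hom] that(1) Y obj_lr by metis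
  show "(\<Sum>j<n. (i j \<odot> idm C Y) \<cdot> (p j \<odot> idm C Y)) = idm C (X \<boxtimes> Y)"
  proof -
    have "(\<Sum>j<n. (i j \<odot> idm C Y) \<cdot> (p j \<odot> idm C Y)) = (\<Sum>j<n. (i j \<cdot> p j) \<odot> idm C Y)"
      by (intro sum.cong refl c[OF X D(1) X D(3) D(2)]) auto
    also have "\<dots> = (\<Sum>j<n. i j \<cdot> p j) \<odot> idm C Y"
      by (intro linear_on_sum[OF tmo_lin(2)[OF X X Y Y idm_hom] hom_sub[OF X X], symmetric])
        (simp add: hom_comp[OF X D(1) X D(3) D(2)])
    also have "\<dots> = idm C (X \<boxtimes> Y)" using D(4) tmo_idm[of X Y] X Y obj_lr by metis
    finally show ?thesis .
  qed
  fix j assume j: "j < n"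
  show "par C (Z j \<boxtimes> Y) (X \<boxtimes> Y)" using obj_par[OF tob_obj[OF D(1)[OF j] Y] tob_obj[OF X Y]] .
  show "i j \<odot> idm C Y \<in> hom C (Z j \<boxtimes> Y) (X \<boxtimes> Y)" using hom_tensor[OF D(1)[OF j] X Y Y D(2)[OF j] idm_hom] .
  show "p j \<odot> idm C Y \<in> hom C (X \<boxtimes> Y) (Z j \<boxtimes> Y)" using hom_tensor[OF X D(1)[OF j] Y Y D(3)[OF j] idm_hom] .
  fix r assume r: "r < n"
  have "(p j \<odot> idm C Y) \<cdot> (i r \<odot> idm C Y) = (p j \<cdot> i r) \<odot> idm C Y"
    by (rule c[OF D(1)[OF r] X D(1)[OF j] D(2)[OF r] D(3)[OF j]])
  also have "p j \<cdot> i r = (if j = r then idm C (Z j) else 0)" using d j r by (auto simp: direct_sum_def)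
  also have "(if j = r then idm C (Z j) else 0) \<odot> idm C Y = (if j = r then idm C (Z j \<boxtimes> Y) else 0)"
    using linear_on_zero[OF tmo_lin(2)[OF D(1)[OF r] D(1)[OF j] Y Y idm_hom] cvs.subspace_0[OF hom_sub[OF D(1)[OF r] D(1)[OF j]]]]
      tmo_idm[of "Z j" Y] D(1)[OF j] Y obj_lr by (metis (full_types))
  finally show "(p j \<odot> idm C Y) \<cdot> (i r \<odot> idm C Y) = (if j = r then idm C (Z j \<boxtimes> Y) else 0)" .
qed

lemma direct_sum_tensor_right:
  assumes X: "X \<in> obj C \<alpha> \<beta>" and Y: "Y \<in> obj C \<beta> \<gamma>" and d: "direct_sum C Y n Z i p"
  shows "direct_sum C (X \<boxtimes> Y) n (\<lambda>j. X \<boxtimes> Z j) (\<lambda>j. idm C X \<odot> i j) (\<lambda>j. idm C X \<odot> p j)"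
  unfolding direct_sum_def
proof (intro conjI allI impI)
  note D = direct_sumD[OF d Y]
  have c: "(idm C X \<odot> f') \<cdot> (idm C X \<odot> f) = idm C X \<odot> (f' \<cdot> f)"
    if "U \<in> obj C \<beta> \<gamma>" "U' \<in> obj C \<beta> \<gamma>" "U'' \<in> obj C \<beta> \<gamma>" "f \<in> hom C U U'" "f' \<in> hom C U' U''" for U U' U'' f f'
    using tmo_cmp[OF obj_par[OF X X] obj_par[OF X X] obj_par[OF that(1,2)] obj_par[OF that(2,3)] _ idm_hom idm_hom that(4,5)]
      cmp_idm[OF obj_par[OF X X] idm_hom] that(1) X obj_lr by metis
  show "(\<Sum>j<n. (idm C X \<odot> i j) \<cdot> (idm C X \<odot> p j)) = idm C (X \<boxtimes> Y)"
  proof -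
    have "(\<Sum>j<n. (idm C X \<odot> i j) \<cdot> (idm C X \<odot> p j)) = (\<Sum>j<n. idm C X \<odot> (i j \<cdot> p j))"
      by (intro sum.cong refl c[OF Y D(1) Y D(3) D(2)]) auto
    also have "\<dots> = idm C X \<odot> (\<Sum>j<n. i j \<cdot> p j)"
      by (intro linear_on_sum[OF tmo_lin(1)[OF X X Y Y idm_hom] hom_sub[OF Y Y], symmetric])
        (simp add: hom_comp[OF Y D(1) Y D(3) D(2)])
    also have "\<dots> = idm C (X \<boxtimes> Y)" using D(4) tmo_idm[of X Y] X Y obj_lr by metis
    finally show ?thesis .
  qed
  fix j assume j: "j < n"
  show "par C (X \<boxtimes> Z j) (X \<boxtimes> Y)" using obj_par[OF tob_obj[OF X D(1)[OF j]] tob_obj[OF X Y]] .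
  show "idm C X \<odot> i j \<in> hom C (X \<boxtimes> Z j) (X \<boxtimes> Y)" using hom_tensor[OF X X D(1)[OF j] Y idm_hom D(2)[OF j]] .
  show "idm C X \<odot> p j \<in> hom C (X \<boxtimes> Y) (X \<boxtimes> Z j)" using hom_tensor[OF X X Y D(1)[OF j] idm_hom D(3)[OF j]] .
  fix r assume r: "r < n"
  have "(idm C X \<odot> p j) \<cdot> (idm C X \<odot> i r) = idm C X \<odot> (p j \<cdot> i r)"
    by (rule c[OF D(1)[OF r] Y D(1)[OF j] D(2)[OF r] D(3)[OF j]])
  also have "p j \<cdot> i r = (if j = r then idm C (Z j) else 0)" using d j r by (auto simp: direct_sum_def)
  also have "idm C X \<odot> (if j = r then idm C (Z j) else 0) = (if j = r then idm C (X \<boxtimes> Z j) else 0)"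
    using linear_on_zero[OF tmo_lin(1)[OF X X D(1)[OF r] D(1)[OF j] idm_hom] cvs.subspace_0[OF hom_sub[OF D(1)[OF r] D(1)[OF j]]]]
      tmo_idm[of X "Z j"] D(1)[OF j] X obj_lr by (metis (full_types))
  finally show "(idm C X \<odot> p j) \<cdot> (idm C X \<odot> i r) = (if j = r then idm C (X \<boxtimes> Z j) else 0)" .
qed

abbreviation M where "M \<equiv> rec_mul C \<phi> F u"

definition mul_functional :: "'i \<Rightarrow> 'i \<Rightarrow> 'i \<Rightarrow> 'i \<Rightarrow> 'i \<Rightarrow> 'i \<Rightarrow> ('a, 'v) rec_elem \<Rightarrow> ('a, 'v) rec_elem \<Rightarrow> ('o \<Rightarrow> 'v \<Rightarrow> 'v) \<Rightarrow> complex" where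
  "mul_functional k l m r s t f g x = (\<Sum>a | f a \<noteq> 0. \<Sum>b | g b \<noteq> 0.
      functional_tensor (Fob F r s (u a)) (Fob F k l (u a)) (Fob F s t (u b)) (Fob F l m (u b))
        (f a) (g b) (rec_hat C F k l m r s t x (u a) (u b)))"

lemma mul_functional_superset:
  assumes "finite S" "finite T" "{a. f a \<noteq> 0} \<subseteq> S" "{b. g b \<noteq> 0} \<subseteq> T"
  shows "mul_functional k l m r s t f g x = (\<Sum>a\<in>S. \<Sum>b\<in>T.
      functional_tensor (Fob F r s (u a)) (Fob F k l (u a)) (Fob F s t (u b)) (Fob F l m (u b))
        (f a) (g b) (rec_hat C F k l m r s t x (u a) (u b)))" (is "_ = (\<Sum>a\<in>S. \<Sum>b\<in>T. ?h a b)")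
proof -
  have "(\<Sum>a\<in>S. \<Sum>b\<in>T. ?h a b) = (\<Sum>a | f a \<noteq> 0. \<Sum>b\<in>T. ?h a b)"
    using assms by (intro sum.mono_neutral_right) (auto simp: functional_tensor_zero)
  also have "\<dots> = (\<Sum>a | f a \<noteq> 0. \<Sum>b | g b \<noteq> 0. ?h a b)"
    using assms by (intro sum.cong refl sum.mono_neutral_right) (auto simp: functional_tensor_zero)
  finally show ?thesis by (simp add: mul_functional_def)
qed

lemma A_finite: "f \<in> A k l m n \<Longrightarrow> finite {a. f a \<noteq> 0}"
  by (simp add: rec_sp_def)

lemma mul_functional_add_left:
  assumes f: "f \<in> A k l r s" and f': "f' \<in> A k l r s" and g: "g \<in> A l m s t"
  shows "mul_functional k l m r s t (f + f') g x = mul_functional k l m r s t f g x + mul_functional k l m r s t f' g x"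
proof -
  let ?S = "{a. f a \<noteq> 0} \<union> {a. f' a \<noteq> 0}"
  have S: "finite ?S" using f f' A_finite by blast
  note ms = mul_functional_superset[OF S A_finite[OF g], of _ g]
  have "{a. (f + f') a \<noteq> 0} \<subseteq> ?S" by (auto simp: plus_fun_apply)
  then show ?thesis by (subst (1 2 3) ms) (auto simp: plus_fun_apply[of f f'] functional_tensor_add sum.distrib)
qed

lemma mul_functional_add_right:
  assumes f: "f \<in> A k l r s" and g: "g \<in> A l m s t" and g': "g' \<in> A l m s t"
  shows "mul_functional k l m r s t f (g + g') x = mul_functional k l m r s t f g x + mul_functional k l m r s t f g' x"
proof -
  let ?S = "{a. g a \<noteq> 0} \<union> {a. g' a \<noteq> 0}"
  have S: "finite ?S" using g g' A_finite by blast
  note ms = mul_functional_superset[OF A_finite[OF f] S, of f]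
  have "{a. (g + g') a \<noteq> 0} \<subseteq> ?S" by (auto simp: plus_fun_apply)
  then show ?thesis by (subst (1 2 3) ms) (auto simp: plus_fun_apply[of g g'] functional_tensor_add sum.distrib)
qed

lemma mul_functional_scale:
  assumes f: "f \<in> A k l r s" and g: "g \<in> A l m s t"
  shows "mul_functional k l m r s t (c *\<^sub>C f) g x = c * mul_functional k l m r s t f g x"
    and "mul_functional k l m r s t f (c *\<^sub>C g) x = c * mul_functional k l m r s t f g x"
proof -
  note ms = mul_functional_superset[OF A_finite[OF f] A_finite[OF g]]
  have "{a. (c *\<^sub>C f) a \<noteq> 0} \<subseteq> {a. f a \<noteq> 0}" "{a. (c *\<^sub>C g) a \<noteq> 0} \<subseteq> {a. g a \<noteq> 0}"
    by (auto simp: scaleC_fun_def[of c f] scaleC_fun_def[of c g])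
  then show "mul_functional k l m r s t (c *\<^sub>C f) g x = c * mul_functional k l m r s t f g x"
    "mul_functional k l m r s t f (c *\<^sub>C g) x = c * mul_functional k l m r s t f g x"
    by (subst (1 2) ms; auto simp: scaleC_fun_def[of c f] scaleC_fun_def[of c g] functional_tensor_scale sum_distrib_left)+
qed

lemma mul_functional_zero: "mul_functional k l m r s t 0 g x = 0" "mul_functional k l m r s t f 0 x = 0"
  by (simp_all add: mul_functional_def zero_fun_apply)

lemma Fpi_hmap:
  assumes X: "X \<in> Ob k l" and Y: "Y \<in> Ob l m"
  shows "Fpi C F k l m X Y \<in> hmap (Fob F k m (X \<boxtimes> Y)) (htensor (Fob F k l X) (Fob F l m Y))"
  unfolding Fpi_def by (rule hadj_hmap[OF fdh_htensor[OF fd[OF X] fd[OF Y]] fd[OF tob_Ob[OF X Y]] io_hmap[OF X Y]])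

lemma Fpi_ip:
  assumes X: "X \<in> Ob k l" and Y: "Y \<in> Ob l m" and v: "v \<in> H k l X" and v': "v' \<in> H l m Y" and xi: "\<xi> \<in> H k m (X \<boxtimes> Y)"
  shows "ip (htensor (Fob F k l X) (Fob F l m Y)) (v \<otimes> v') (Fpi C F k l m X Y \<xi>) = pr k m (X \<boxtimes> Y) (io k l m X Y v v') \<xi>"
proof -
  note T = fdh_htensor[OF fd[OF X] fd[OF Y]] and tv = htensor_in[OF fd[OF X] fd[OF Y] v v']
  have "ip (htensor (Fob F k l X) (Fob F l m Y)) (v \<otimes> v') (Fpi C F k l m X Y \<xi>)
    = cnj (ip (htensor (Fob F k l X) (Fob F l m Y)) (Fpi C F k l m X Y \<xi>) (v \<otimes> v'))"
    using ip_cnj[OF T hmap_in[OF Fpi_hmap[OF X Y] xi] tv] by simp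
  also have "\<dots> = cnj (pr k m (X \<boxtimes> Y) \<xi> (io k l m X Y v v'))"
    unfolding Fpi_def using hadj_ip[OF T fd[OF tob_Ob[OF X Y]] io_hmap[OF X Y] tv xi] by simp
  finally show ?thesis using ip_cnj[OF fd[OF tob_Ob[OF X Y]] xi io_in[OF X Y v v']] by simp
qed

text \<open>
  As \<open>\<pi>\<close> is the adjoint of \<open>\<iota>\<close>, a coefficient of \<open>\<pi> x \<iota>\<close> between elementary tensors is the
  coefficient of \<open>x\<close> between their images under \<open>\<iota>\<close>.
\<close>

lemma mul_functional_mc:
  assumes kr: "\<phi> k = \<phi> r" and ls: "\<phi> l = \<phi> s" and mt: "\<phi> m = \<phi> t"
    and a: "u a \<in> Ob k l" and b: "u b \<in> Ob l m" and v: "v \<in> H k l (u a)" and w: "w \<in> H r s (u a)"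
    and v': "v' \<in> H l m (u b)" and w': "w' \<in> H s t (u b)" and x: "x \<in> Nat r t k m"
  shows "mul_functional k l m r s t (mc k l r s (u a) v w) (mc l m s t (u b) v' w') x
    = pr k m (u a \<boxtimes> u b) (io k l m (u a) (u b) v v') (x (u a \<boxtimes> u b) (io r s t (u a) (u b) w w'))"
proof -
  have a': "u a \<in> Ob r s" and b': "u b \<in> Ob s t" using a b kr ls mt by auto
  let ?T = "rec_hat C F k l m r s t x (u a) (u b)"
  note f1 = mc_u[OF kr ls a v w] and f2 = mc_u[OF ls mt b v' w']
  have xh: "x (u a \<boxtimes> u b) \<in> hmap (Fob F r t (u a \<boxtimes> u b)) (Fob F k m (u a \<boxtimes> u b))" by (rule nat_in[OF x tob_Ob[OF a b]])
  note i = io_hmap[OF a' b'] and p = Fpi_hmap[OF a b]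
  have T: "?T \<in> hmap (htensor (Fob F r s (u a)) (Fob F s t (u b))) (htensor (Fob F k l (u a)) (Fob F l m (u b)))"
  proof (rule hmapI)
    show "linear_on (hsp (htensor (Fob F r s (u a)) (Fob F s t (u b)))) ?T"
      using hmap_linear[OF i] hmap_linear[OF xh] hmap_linear[OF p] hmap_in[OF i] hmap_in[OF xh]
      by (simp add: linear_on_def rec_hat_def)
    show "?T z \<in> hsp (htensor (Fob F k l (u a)) (Fob F l m (u b)))" if "z \<in> hsp (htensor (Fob F r s (u a)) (Fob F s t (u b)))" for z
      using hmap_in[OF p hmap_in[OF xh hmap_in[OF i that]]] by (simp add: rec_hat_def)
    show "?T z = 0" if "z \<notin> hsp (htensor (Fob F r s (u a)) (Fob F s t (u b)))" for z
      using hmap_off[OF i that] linear_on_zero[OF hmap_linear[OF xh] fdh_zero[OF fd[OF tob_Ob[OF a' b']]]]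
        linear_on_zero[OF hmap_linear[OF p] fdh_zero[OF fd[OF tob_Ob[OF a b]]]] by (simp add: rec_hat_def)
  qed
  have "mul_functional k l m r s t (mc k l r s (u a) v w) (mc l m s t (u b) v' w') x =
    functional_tensor (Fob F r s (u a)) (Fob F k l (u a)) (Fob F s t (u b)) (Fob F l m (u b))
      (mc k l r s (u a) v w a) (mc l m s t (u b) v' w' b) ?T"
    using f1(1) f2(1) by (subst mul_functional_superset[of "{a}" "{b}"]) (simp_all, (blast+)?)
  also have "\<dots> = ip (htensor (Fob F k l (u a)) (Fob F l m (u b))) (v \<otimes> v') (?T (w \<otimes> w'))"
    by (rule functional_tensor_rank_one[OF fd[OF a'] fd[OF b'] fd[OF a] fd[OF b] T v w v' w']) (use f1(2) f2(2) in auto)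
  also have "\<dots> = pr k m (u a \<boxtimes> u b) (io k l m (u a) (u b) v v') (x (u a \<boxtimes> u b) (io r s t (u a) (u b) w w'))"
    using Fpi_ip[OF a b v v' hmap_in[OF xh io_in[OF a' b' w w']]] by (simp add: rec_hat_def)
  finally show ?thesis .
qed

lemma rec_mul_alt: "M k l m r s t f g = (THE h. h \<in> A k m r t \<and> (\<forall>x\<in>Nat r t k m. rec_pair u h x = mul_functional k l m r s t f g x))"
  by (simp add: rec_mul_def mul_functional_def)

lemma mul_functional_ex:
  assumes f: "f \<in> A k l r s" and g: "g \<in> A l m s t"
  shows "\<exists>h\<in>A k m r t. \<forall>x\<in>Nat r t k m. rec_pair u h x = mul_functional k l m r s t f g x"
  using f
proof (induction f rule: A_induct)
  case zero
  show ?case by (rule bexI[OF _ A_zero]) (simp add: mul_functional_zero rec_pair_zero)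
next
  case (add f f')
  then obtain h h' where "h \<in> A k m r t" "\<forall>x\<in>Nat r t k m. rec_pair u h x = mul_functional k l m r s t f g x"
    "h' \<in> A k m r t" "\<forall>x\<in>Nat r t k m. rec_pair u h' x = mul_functional k l m r s t f' g x" by blast
  then show ?case using add(1,2) g
    by (intro bexI[of _ "h + h'"]) (auto simp: rec_pair_add mul_functional_add_left A_add)
next
  case (mc a v w)
  note m1 = mc and f = mc_in[OF mc]
  show ?case using g
  proof (induction g rule: A_induct)
    case zero
    show ?case by (rule bexI[OF _ A_zero]) (simp add: mul_functional_zero rec_pair_zero)
  next
    case (add g g')
    then obtain h h' where "h \<in> A k m r t" "\<forall>x\<in>Nat r t k m. rec_pair u h x = mul_functional k l m r s t (mc k l r s (u a) v w) g x"
      "h' \<in> A k m r t" "\<forall>x\<in>Nat r t k m. rec_pair u h' x = mul_functional k l m r s t (mc k l r s (u a) v w) g' x" by blast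
    then show ?case using add(1,2) f
      by (intro bexI[of _ "h + h'"]) (auto simp: rec_pair_add mul_functional_add_right A_add)
  next
    case (mc b v' w')
    have a': "u a \<in> Ob r s" and b': "u b \<in> Ob s t" using m1 mc by auto
    note o = io_in[OF m1(3) mc(3) m1(4) mc(4)] io_in[OF a' b' m1(5) mc(5)]
    note X = tob_Ob[OF m1(3) mc(3)]
    show ?case
      by (intro bexI[OF _ mc_in[OF m1(1) mc(2) X o]] ballI)
        (simp add: mc_pair[OF m1(1) mc(2) X o] mul_functional_mc[OF m1(1,2) mc(2) m1(3) mc(3) m1(4,5) mc(4,5)])
  qed
qed

lemma mul:
  assumes f: "f \<in> A k l r s" and g: "g \<in> A l m s t"
  shows mul_in: "M k l m r s t f g \<in> A k m r t"
    and mul_pair: "x \<in> Nat r t k m \<Longrightarrow> rec_pair u (M k l m r s t f g) x = mul_functional k l m r s t f g x"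
proof -
  obtain h where h: "h \<in> A k m r t" "\<And>x. x \<in> Nat r t k m \<Longrightarrow> rec_pair u h x = mul_functional k l m r s t f g x"
    using mul_functional_ex[OF assms] by blast
  have "M k l m r s t f g = h" unfolding rec_mul_alt by (rule the_A[OF h])
  then show "M k l m r s t f g \<in> A k m r t"
    "x \<in> Nat r t k m \<Longrightarrow> rec_pair u (M k l m r s t f g) x = mul_functional k l m r s t f g x" using h by auto
qed

lemma mul_bilinear: "bilinear_on (A k l r s) (A l m s t) (M k l m r s t)"
  unfolding bilinear_on_def linear_on_def
proof (intro conjI ballI allI)
  fix f g assume f: "f \<in> A k l r s" and g: "g \<in> A l m s t"
  { fix g' assume g': "g' \<in> A l m s t"
    show "M k l m r s t f (g + g') = M k l m r s t f g + M k l m r s t f g'"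
      by (rule A_eqI[of _ k m r t])
        (simp_all add: mul_in f g g' A_add mul_pair rec_pair_add[OF mul_in[OF f g] mul_in[OF f g']] mul_functional_add_right[OF f g g']) }
  { fix f' assume f': "f' \<in> A k l r s"
    show "M k l m r s t (f + f') g = M k l m r s t f g + M k l m r s t f' g"
      by (rule A_eqI[of _ k m r t])
        (simp_all add: mul_in f g f' A_add mul_pair rec_pair_add[OF mul_in[OF f g] mul_in[OF f' g]] mul_functional_add_left[OF f f' g]) }
  fix c
  show "M k l m r s t f (c *\<^sub>C g) = c *\<^sub>C M k l m r s t f g" "M k l m r s t (c *\<^sub>C f) g = c *\<^sub>C M k l m r s t f g"
    by (rule A_eqI[of _ k m r t];
        simp add: mul_in f g A_scale mul_pair rec_pair_scale[OF mul_in[OF f g]] mul_functional_scale[OF f g])+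
qed

lemma mul_lin:
  "f \<in> A k l r s \<Longrightarrow> linear_on (A l m s t) (M k l m r s t f)"
  "g \<in> A l m s t \<Longrightarrow> linear_on (A k l r s) (\<lambda>f. M k l m r s t f g)"
  using mul_bilinear by (auto simp: bilinear_on_def)

lemma mul_zero: "f \<in> A k l r s \<Longrightarrow> M k l m r s t f 0 = 0" "g \<in> A l m s t \<Longrightarrow> M k l m r s t 0 g = 0"
  using linear_on_zero[OF mul_lin(1) A_zero] linear_on_zero[OF mul_lin(2) A_zero] by auto

lemma mul_mc_u:
  assumes kr: "\<phi> k = \<phi> r" and ls: "\<phi> l = \<phi> s" and mt: "\<phi> m = \<phi> t"
    and a: "u a \<in> Ob k l" and b: "u b \<in> Ob l m" and v: "v \<in> H k l (u a)" and w: "w \<in> H r s (u a)"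
    and v': "v' \<in> H l m (u b)" and w': "w' \<in> H s t (u b)"
  shows "M k l m r s t (mc k l r s (u a) v w) (mc l m s t (u b) v' w')
    = mc k m r t (u a \<boxtimes> u b) (io k l m (u a) (u b) v v') (io r s t (u a) (u b) w w')"
proof -
  have a': "u a \<in> Ob r s" and b': "u b \<in> Ob s t" using a b kr ls mt by auto
  note f = mc_in[OF kr ls a v w] and g = mc_in[OF ls mt b v' w']
  show ?thesis
    by (rule mc_eqI[OF kr mt tob_Ob[OF a b] io_in[OF a b v v'] io_in[OF a' b' w w'] mul_in[OF f g], symmetric])
      (simp add: mul_pair[OF f g] mul_functional_mc[OF assms])
qed

text \<open>
  Matrix coefficients multiply by tensoring; the case of general objects follows by decomposing
  one factor at a time.
\<close>

lemma mul_mc: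
  assumes kr: "\<phi> k = \<phi> r" and ls: "\<phi> l = \<phi> s" and mt: "\<phi> m = \<phi> t"
    and X: "X \<in> Ob k l" and Y: "Y \<in> Ob l m" and v: "v \<in> H k l X" and w: "w \<in> H r s X"
    and v': "v' \<in> H l m Y" and w': "w' \<in> H s t Y"
  shows "M k l m r s t (mc k l r s X v w) (mc l m s t Y v' w')
    = mc k m r t (X \<boxtimes> Y) (io k l m X Y v v') (io r s t X Y w w')"
proof -
  have half: "M k l m r s t (mc k l r s X v w) (mc l m s t (u b) v' w')
    = mc k m r t (X \<boxtimes> u b) (io k l m X (u b) v v') (io r s t X (u b) w w')"
    if b: "u b \<in> Ob l m" and v': "v' \<in> H l m (u b)" and w': "w' \<in> H s t (u b)" for b v' w'
  proof -
    obtain n a i p where d: "direct_sum C X n (\<lambda>j. u (a j)) i p" using decompose[OF X] by blast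
    note D = direct_sumD[OF d X]
    have X': "X \<in> Ob r s" and b': "u b \<in> Ob s t" using X b kr ls mt by auto
    have D': "u (a j) \<in> Ob r s" if "j < n" for j using D(1)[OF that] kr ls by simp
    have v1: "Fmo F k l X (u (a j)) (dag C (i j)) v \<in> H k l (u (a j))" if "j < n" for j
      using Fmo_in[OF X D(1) hom_dag[OF D(1) X D(2)] v] that by blast
    have w1: "Fmo F r s X (u (a j)) (p j) w \<in> H r s (u (a j))" if "j < n" for j
      using Fmo_in[OF X' D' D(3) w] that by blast
    have "M k l m r s t (mc k l r s X v w) (mc l m s t (u b) v' w') = (\<Sum>j<n.
      M k l m r s t (mc k l r s (u (a j)) (Fmo F k l X (u (a j)) (dag C (i j)) v) (Fmo F r s X (u (a j)) (p j) w))
        (mc l m s t (u b) v' w'))"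
      unfolding mc_direct_sum[OF kr ls X d v w]
      using mc_in[OF kr ls D(1) v1 w1]
      by (intro linear_on_sum[OF mul_lin(2)[OF mc_in[OF ls mt b v' w']] A_subspace]) auto
    also have "\<dots> = (\<Sum>j<n. mc k m r t (u (a j) \<boxtimes> u b)
       (Fmo F k m (X \<boxtimes> u b) (u (a j) \<boxtimes> u b) (dag C (i j \<odot> idm C (u b))) (io k l m X (u b) v v'))
       (Fmo F r t (X \<boxtimes> u b) (u (a j) \<boxtimes> u b) (p j \<odot> idm C (u b)) (io r s t X (u b) w w')))"
    proof (intro sum.cong refl)
      fix j assume "j \<in> {..<n}"
      then have j: "j < n" by simp
      show "M k l m r s t (mc k l r s (u (a j)) (Fmo F k l X (u (a j)) (dag C (i j)) v) (Fmo F r s X (u (a j)) (p j) w))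
        (mc l m s t (u b) v' w') = mc k m r t (u (a j) \<boxtimes> u b)
       (Fmo F k m (X \<boxtimes> u b) (u (a j) \<boxtimes> u b) (dag C (i j \<odot> idm C (u b))) (io k l m X (u b) v v'))
       (Fmo F r t (X \<boxtimes> u b) (u (a j) \<boxtimes> u b) (p j \<odot> idm C (u b)) (io r s t X (u b) w w'))"
        unfolding dag_tensor[OF D(1)[OF j] X b b D(2)[OF j] idm_hom] dag_idm
          io_nat[OF X b D(1)[OF j] b hom_dag[OF D(1)[OF j] X D(2)[OF j]] idm_hom v v']
          io_nat[OF X' b' D'[OF j] b' D(3)[OF j] idm_hom w w'] Fmo_id[OF b v'] Fmo_id[OF b' w']
        by (rule mul_mc_u[OF kr ls mt D(1)[OF j] b v1[OF j] w1[OF j] v' w'])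
    qed
    also have "\<dots> = mc k m r t (X \<boxtimes> u b) (io k l m X (u b) v v') (io r s t X (u b) w w')"
      by (rule mc_direct_sum[OF kr mt tob_Ob[OF X b] direct_sum_tensor_left[OF X b d] io_in[OF X b v v'] io_in[OF X' b' w w'], symmetric])
    finally show ?thesis .
  qed
  obtain n a i p where d: "direct_sum C Y n (\<lambda>j. u (a j)) i p" using decompose[OF Y] by blast
  note D = direct_sumD[OF d Y]
  have X': "X \<in> Ob r s" and Y': "Y \<in> Ob s t" using X Y kr ls mt by auto
  have D': "u (a j) \<in> Ob s t" if "j < n" for j using D(1)[OF that] ls mt by simp
  have v1: "Fmo F l m Y (u (a j)) (dag C (i j)) v' \<in> H l m (u (a j))" if "j < n" for j
    using Fmo_in[OF Y D(1) hom_dag[OF D(1) Y D(2)] v'] that by blast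
  have w1: "Fmo F s t Y (u (a j)) (p j) w' \<in> H s t (u (a j))" if "j < n" for j
    using Fmo_in[OF Y' D' D(3) w'] that by blast
  have "M k l m r s t (mc k l r s X v w) (mc l m s t Y v' w') = (\<Sum>j<n. M k l m r s t (mc k l r s X v w)
      (mc l m s t (u (a j)) (Fmo F l m Y (u (a j)) (dag C (i j)) v') (Fmo F s t Y (u (a j)) (p j) w')))"
    unfolding mc_direct_sum[OF ls mt Y d v' w']
    using mc_in[OF ls mt D(1) v1 w1]
    by (intro linear_on_sum[OF mul_lin(1)[OF mc_in[OF kr ls X v w]] A_subspace]) auto
  also have "\<dots> = (\<Sum>j<n. mc k m r t (X \<boxtimes> u (a j))
     (Fmo F k m (X \<boxtimes> Y) (X \<boxtimes> u (a j)) (dag C (idm C X \<odot> i j)) (io k l m X Y v v'))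
     (Fmo F r t (X \<boxtimes> Y) (X \<boxtimes> u (a j)) (idm C X \<odot> p j) (io r s t X Y w w')))"
  proof (intro sum.cong refl)
    fix j assume "j \<in> {..<n}"
    then have j: "j < n" by simp
    show "M k l m r s t (mc k l r s X v w)
        (mc l m s t (u (a j)) (Fmo F l m Y (u (a j)) (dag C (i j)) v') (Fmo F s t Y (u (a j)) (p j) w')) =
      mc k m r t (X \<boxtimes> u (a j))
       (Fmo F k m (X \<boxtimes> Y) (X \<boxtimes> u (a j)) (dag C (idm C X \<odot> i j)) (io k l m X Y v v'))
       (Fmo F r t (X \<boxtimes> Y) (X \<boxtimes> u (a j)) (idm C X \<odot> p j) (io r s t X Y w w'))"
      unfolding dag_tensor[OF X X D(1)[OF j] Y idm_hom D(2)[OF j]] dag_idm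
        io_nat[OF X Y X D(1)[OF j] idm_hom hom_dag[OF D(1)[OF j] Y D(2)[OF j]] v v']
        io_nat[OF X' Y' X' D'[OF j] idm_hom D(3)[OF j] w w'] Fmo_id[OF X v] Fmo_id[OF X' w]
      by (rule half[OF D(1)[OF j] v1[OF j] w1[OF j]])
  qed
  also have "\<dots> = mc k m r t (X \<boxtimes> Y) (io k l m X Y v v') (io r s t X Y w w')"
    by (rule mc_direct_sum[OF kr mt tob_Ob[OF X Y] direct_sum_tensor_right[OF X Y d] io_in[OF X Y v v'] io_in[OF X' Y' w w'], symmetric])
  finally show ?thesis .
qed

subsection \<open>Unit and counit\<close>

lemma u_unique: "u a = u b \<Longrightarrow> a = b"
proof (rule u_inj)
  assume "u a = u b"
  moreover have "inverse_arrows C (u a) (u a) (idm C (u a)) (idm C (u a))"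
    using idm_hom cmp_idm[of "u a" "u a" "idm C (u a)"] by (simp add: inverse_arrows_def par_def)
  ultimately show "isomorphic C (u a) (u b)" by (auto simp: isomorphic_def iso_arrow_def par_def)
qed

lemma unit_index: "\<exists>a. u a = unit C \<alpha>"
  using family by (simp add: maximal_irreducible_family_def)

lemma rec_one_mc:
  assumes kl: "\<phi> k = \<phi> l"
  shows "oneA k l = mc k k l l (un k) (mu k) (mu l)"
proof -
  obtain a where a: "u a = un k" using unit_index by blast
  have ul: "un k = un l" using kl by simp
  have o: "u a \<in> Ob k k" "u a \<in> Ob l l" using un_Ob[of k] un_Ob[of l] ul a by auto
  have v: "mu k \<in> H k k (u a)" "mu l \<in> H l l (u a)" using mu_in[of k] mu_in[of l] ul a by auto
  note m = mc_u[OF kl kl o(1) v] and mi = mc_in[OF kl kl o(1) v]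
  show ?thesis
  proof (intro ext)
    fix b T
    show "oneA k l b T = mc k k l l (un k) (mu k) (mu l) b T"
    proof (cases "b = a")
      case False
      then have "u b \<noteq> un k" using u_unique a by metis
      then show ?thesis using m(1)[OF False] a by (simp add: rec_one_def Let_def zero_fun_apply)
    next
      case True
      show ?thesis
      proof (cases "T \<in> hmap (Fob F l l (u a)) (Fob F k k (u a))")
        case T: True
        have "T (mu l) \<in> H k k (un k)" using hmap_in[OF T v(2)] a by simp
        from Fmu_adj[OF this] show ?thesis using True T a kl m(2)[OF T] by (simp add: rec_one_def Let_def)
      next
        case T: False
        have "mc k k l l (u a) (mu k) (mu l) a \<in> rec_comp C \<phi> F u k k l l a" using mi by (simp add: rec_sp_def)
        moreover have "f T = 0" if "f \<in> rec_comp C \<phi> F u k k l l a" for f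
          using that T unfolding rec_comp_def dual_space_def
          by (simp add: zero_fun_apply split: if_split_asm)
        ultimately have "mc k k l l (u a) (mu k) (mu l) a T = 0" by blast
        then show ?thesis using True T a by (simp add: rec_one_def Let_def)
      qed
    qed
  qed
qed

lemma rec_one_off: "\<phi> k \<noteq> \<phi> l \<Longrightarrow> oneA k l = 0"
  by (auto simp: rec_one_def fun_eq_iff zero_fun_apply)

lemma mu_in': "\<phi> k = \<phi> l \<Longrightarrow> mu l \<in> H l l (un k)"
  using mu_in[of l] by simp

lemma un_Ob2: "\<phi> k = \<phi> l \<Longrightarrow> un k \<in> Ob l l"
  using un_Ob[of l] by simp

lemma one_in: "oneA k l \<in> A k k l l"
proof (cases "\<phi> k = \<phi> l")
  case True
  then show ?thesis unfolding rec_one_mc[OF True] by (intro mc_in un_Ob mu_in mu_in')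
qed (simp add: rec_one_off A_zero)

lemma nat_id_in: "nat_id C \<phi> F k l \<in> Nat k l k l"
  by (rule natI) (auto simp: nat_id_def hid_def Fmo_in linear_on_def fdh_add[OF fd] fdh_scale[OF fd] intro!: hmapI)

lemma counit_lin: "linear_on (A k l k l) (\<epsilon> k l)"
  unfolding rec_counit_def by (rule rec_pair_lin)

lemma counit_mc:
  assumes X: "X \<in> Ob k l" and v: "v \<in> H k l X" and w: "w \<in> H k l X"
  shows "\<epsilon> k l (mc k l k l X v w) = pr k l X v w"
  unfolding rec_counit_def mc_pair[OF refl refl X v w nat_id_in] using X w by (simp add: nat_id_def hid_def)

section \<open>The involution\<close>

lemma Fev_eq:
  assumes X: "X \<in> Ob k l" and z: "z \<in> H l k (ldual C X)" and v: "v \<in> H k l X"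
  shows "Fev C \<phi> F k l X (z \<otimes> v) = ev_form X k l z v"
proof -
  note X' = ldual_obj[OF X]
  show ?thesis unfolding Fev_def bform_def
    by (rule Fmu_adj[OF Fmo_in[OF tob_Ob[OF X' X] un_Ob ev_hom[OF X] io_in[OF X' X z v]]])
qed

lemma Fcoev_eq:
  assumes X: "X \<in> Ob k l"
  shows "Fcoev C \<phi> F k l X = (\<Sum>e\<in>ONB k l X. e \<otimes> J k l X e)"
proof -
  note X' = ldual_obj[OF X] and FX = fd[OF X] and FX' = fd[OF ldual_obj[OF X]]
  have "Fcoev C \<phi> F k l X = Fpi C F k l k X (ldual C X) (coev_vec k X)" by (simp add: Fcoev_def coev_vec_def)
  also have "\<dots> = (\<Sum>e\<in>ONB k l X. \<Sum>f\<in>ONB l k (ldual C X).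
      ip (htensor (Fob F k l X) (Fob F l k (ldual C X))) (e \<otimes> f) (Fpi C F k l k X (ldual C X) (coev_vec k X)) *\<^sub>C (e \<otimes> f))"
    by (rule htensor_expand[OF FX FX' hmap_in[OF Fpi_hmap[OF X X'] coev_vec_in[OF X]], symmetric])
  also have "\<dots> = (\<Sum>e\<in>ONB k l X. e \<otimes> J k l X e)"
  proof (intro sum.cong refl)
    fix e assume e: "e \<in> ONB k l X"
    show "(\<Sum>f\<in>ONB l k (ldual C X). ip (htensor (Fob F k l X) (Fob F l k (ldual C X))) (e \<otimes> f)
        (Fpi C F k l k X (ldual C X) (coev_vec k X)) *\<^sub>C (e \<otimes> f)) = e \<otimes> J k l X e"
      unfolding J_def tens_sum_right tens_simps
      by (intro sum.cong refl arg_cong[of _ _ "\<lambda>c. c *\<^sub>C _"] Fpi_ip[OF X X' onb_in[OF FX e] onb_in[OF FX'] coev_vec_in[OF X]])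
  qed
  finally show ?thesis .
qed

context
  fixes k l m n x assumes x: "x \<in> Nat m n k l"
begin

private lemma ph: "\<phi> k = \<phi> m" "\<phi> l = \<phi> n" using nat_phi[OF x] by auto

lemma antipode_vec:
  assumes X: "X \<in> Ob l k" and v: "v \<in> H l k X"
  shows "Shat k l m n x X v = (\<Sum>e\<in>ONB n m X. ev_form X l k (x (ldual C X) (J n m X e)) v *\<^sub>C e)"
proof -
  have Xn: "X \<in> Ob n m" using X ph by simp
  note X' = ldual_obj[OF X] and Xn' = ldual_obj[OF Xn] note xh = nat_in[OF x X']
  let ?b = "\<lambda>w z. Fev C \<phi> F l k X (x (ldual C X) z \<otimes> v) *\<^sub>C w"
  have F: "Fev C \<phi> F l k X (x (ldual C X) z \<otimes> v) = ev_form X l k (x (ldual C X) z) v" if "z \<in> H m n (ldual C X)" for z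
    by (rule Fev_eq[OF X hmap_in[OF xh that] v])
  note L = bform_lin(2)[OF X X' ev_hom[OF X] v] and xl = hmap_linear[OF xh]
  have b: "balanced_on (H n m X) (H m n (ldual C X)) ?b"
    unfolding balanced_on_def
    using hmap_in[OF xh] fdh_add[OF fd[OF Xn']] fdh_scale[OF fd[OF Xn']] fdh_add[OF fd[OF X']] fdh_scale[OF fd[OF X']]
    by (simp add: Fev_eq[OF X _ v] linear_on_add[OF xl] linear_on_scale[OF xl] linear_on_add[OF L] linear_on_scale[OF L]
        scaleC_add_left scaleC_add_right scaleC_scaleC scaleC_complex_def mult.commute)
  have "Shat k l m n x X v = tlift (H n m X) (H m n (ldual C X)) ?b (\<Sum>e\<in>ONB n m X. e \<otimes> J n m X e)"
    using X v by (simp add: rec_antipode_def Fcoev_eq[OF Xn])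
  also have "\<dots> = (\<Sum>e\<in>ONB n m X. ?b e (J n m X e))"
    using onb_in[OF fd[OF Xn]] J_in[OF Xn]
    by (intro tlift_sum_tens[OF fdh_subspace[OF fd[OF Xn]] fdh_subspace[OF fd[OF Xn']] b]) auto
  also have "\<dots> = (\<Sum>e\<in>ONB n m X. ev_form X l k (x (ldual C X) (J n m X e)) v *\<^sub>C e)"
    using onb_in[OF fd[OF Xn]] J_in[OF Xn] by (intro sum.cong refl) (simp add: F)
  finally show ?thesis .
qed

lemma antipode_vec_in:
  assumes X: "X \<in> Ob l k" and v: "v \<in> H l k X"
  shows "Shat k l m n x X v \<in> H n m X"
proof -
  have Xn: "X \<in> Ob n m" using X ph by simp
  show ?thesis unfolding antipode_vec[OF assms]
    using onb_in[OF fd[OF Xn]] by (intro fdh_sum fdh_scale fd Xn)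
qed

text \<open>
  In terms of matrix entries, the composite \<open>(id \<otimes> ev)(id \<otimes> x \<otimes> id)(coev \<otimes> id)\<close> is the transpose of \<open>x\<close> with
  respect to the evaluation pairing.
\<close>

lemma antipode_ip:
  assumes X: "X \<in> Ob l k" and v: "v \<in> H l k X" and w: "w \<in> H n m X"
  shows "pr n m X w (Shat k l m n x X v) = ev_form X l k (x (ldual C X) (J n m X w)) v"
proof -
  have Xn: "X \<in> Ob n m" using X ph by simp
  note X' = ldual_obj[OF X] and Xn' = ldual_obj[OF Xn] note xh = nat_in[OF x X'] and FX = fd[OF Xn]
  note L = bform_lin(2)[OF X X' ev_hom[OF X] v] and xl = hmap_linear[OF xh] and oi = onb_in[OF FX]
  have j: "pr n m X w e *\<^sub>C J n m X e \<in> H m n (ldual C X)" if "e \<in> ONB n m X" for e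
    using fdh_scale[OF fd[OF Xn'] J_in[OF Xn oi[OF that]]] .
  have "pr n m X w (Shat k l m n x X v)
    = (\<Sum>e\<in>ONB n m X. ev_form X l k (x (ldual C X) (J n m X e)) v * pr n m X w e)"
    unfolding antipode_vec[OF X v] using oi
    by (simp add: ip_sum_right[OF FX w] fdh_scale[OF FX] ip_scale_right[OF FX w])
  also have "\<dots> = (\<Sum>e\<in>ONB n m X. ev_form X l k (x (ldual C X) (pr n m X w e *\<^sub>C J n m X e)) v)"
    using oi J_in[OF Xn] hmap_in[OF xh] by (intro sum.cong refl)
      (simp add: linear_on_scale[OF xl] linear_on_scale[OF L] scaleC_complex_def mult.commute)
  also have "\<dots> = ev_form X l k (\<Sum>e\<in>ONB n m X. x (ldual C X) (pr n m X w e *\<^sub>C J n m X e)) v"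
    using j hmap_in[OF xh] by (intro linear_on_sum[OF L fdh_subspace[OF fd[OF X']], symmetric]) blast
  also have "(\<Sum>e\<in>ONB n m X. x (ldual C X) (pr n m X w e *\<^sub>C J n m X e))
    = x (ldual C X) (\<Sum>e\<in>ONB n m X. pr n m X w e *\<^sub>C J n m X e)"
    using j by (intro linear_on_sum[OF xl fdh_subspace[OF fd[OF Xn']], symmetric]) blast
  finally show ?thesis by (simp add: J_sum[OF Xn w])
qed

text \<open>
  Naturality: a morphism \<open>g : X \<rightarrow> Y\<close> has a transpose \<open>ldual Y \<rightarrow> ldual X\<close>, through which \<open>J\<close> and the
  evaluations intertwine.
\<close>

lemma antipode_nat: "Shat k l m n x \<in> Nat l k n m"
proof (rule natI)
  show "\<phi> n = \<phi> l" "\<phi> m = \<phi> k" using ph by auto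
  have O: "X \<in> Ob l k" if "X \<in> Ob n m" for X using that ph by simp
  let ?S = "Shat k l m n x"
  show "?S X \<in> hmap (Fob F l k X) (Fob F n m X)" if Xn: "X \<in> Ob n m" for X
  proof (rule hmapI)
    note X = O[OF Xn] note X' = ldual_obj[OF X] note xh = nat_in[OF x X']
    have lin: "linear_on (H l k X) (ev_form X l k (x (ldual C X) (J n m X e)))" if "e \<in> ONB n m X" for e
      using bform_lin(1)[OF X X' ev_hom[OF X] hmap_in[OF xh J_in[OF Xn onb_in[OF fd[OF Xn] that]]]] .
    show "linear_on (H l k X) (?S X)"
      unfolding linear_on_def
    proof (intro conjI ballI allI)
      fix v assume v: "v \<in> H l k X"
      { fix w assume w: "w \<in> H l k X"
        show "?S X (v + w) = ?S X v + ?S X w"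
          unfolding antipode_vec[OF X v] antipode_vec[OF X w] antipode_vec[OF X fdh_add[OF fd[OF X] v w]]
            sum.distrib[symmetric] scaleC_add_left[symmetric]
          by (intro sum.cong refl arg_cong[of _ _ "\<lambda>c. c *\<^sub>C _"] linear_on_add[OF lin v w]) }
      show "?S X (c *\<^sub>C v) = c *\<^sub>C ?S X v" for c
        unfolding antipode_vec[OF X v] antipode_vec[OF X fdh_scale[OF fd[OF X] v]] cvs.scale_sum_right
        by (intro sum.cong refl) (simp add: linear_on_scale[OF lin v] scaleC_scaleC scaleC_complex_def)
    qed
    show "?S X v \<in> H n m X" if "v \<in> H l k X" for v using antipode_vec_in[OF X that] .
    show "?S X v = 0" if "v \<notin> H l k X" for v using that by (simp add: rec_antipode_def)
  qed
  show "?S X = 0" if "X \<notin> Ob n m" for X using that ph by (simp add: rec_antipode_def fun_eq_iff zero_fun_apply)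
  show "?S Y (Fmo F l k X Y g v) = Fmo F n m X Y g (?S X v)"
    if Xn: "X \<in> Ob n m" and Yn: "Y \<in> Ob n m" and g: "g \<in> hom C X Y" and v: "v \<in> H l k X" for X Y g v
  proof (rule ip_eqI[OF fd[OF Yn]])
    note X = O[OF Xn] and Y = O[OF Yn]
    note X' = ldual_obj[OF X] and Y' = ldual_obj[OF Y] note Xn' = ldual_obj[OF Xn] and Yn' = ldual_obj[OF Yn]
    note gv = Fmo_in[OF X Y g v]
    show "?S Y (Fmo F l k X Y g v) \<in> H n m Y" using antipode_vec_in[OF Y gv] .
    show r: "Fmo F n m X Y g (?S X v) \<in> H n m Y" by (rule Fmo_in[OF Xn Yn g antipode_vec_in[OF X v]])
    fix w assume w: "w \<in> H n m Y"
    let ?e = "ev C Y \<cdot> (idm C (ldual C Y) \<odot> g)"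
    have e: "?e \<in> hom C (ldual C Y \<boxtimes> X) (un k)"
      by (rule hom_comp[OF tob_obj[OF Y' X] tob_obj[OF Y' Y] unit_obj hom_tensor[OF Y' Y' X Y idm_hom g] ev_hom[OF Y]])
    then have em: "?e \<in> hom C (ldual C Y \<boxtimes> X) (un m)" using ph by simp
    let ?t = "ltrans ?e (ldual C Y) X"
    note t = ltrans_hom(1)[OF X Y' e] and Jw = J_in[OF Yn w]
    have 1: "Fmo F m n (ldual C Y) (ldual C X) ?t (J n m Y w) = J n m X (Fmo F n m Y X (dag C g) w)"
    proof -
      have "Fmo F m n (ldual C Y) (ldual C X) ?t (J n m Y w)
        = (\<Sum>y\<in>ONB n m X. pr n m X (Fmo F n m Y X (dag C g) w) y *\<^sub>C J n m X y)"
        unfolding ltrans_vec[OF Xn Yn' em Jw]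
      proof (intro sum.cong refl arg_cong[of _ _ "\<lambda>c. c *\<^sub>C _"])
        fix y assume "y \<in> ONB n m X"
        then have y: "y \<in> H n m X" by (rule onb_in[OF fd[OF Xn]])
        show "bform ?e (ldual C Y) X n m (J n m Y w) y = pr n m X (Fmo F n m Y X (dag C g) w) y"
          unfolding bform_nat_right[OF Yn Xn Yn' ev_hom[OF Yn] g Jw y] ev_J[OF Yn w Fmo_in[OF Xn Yn g y]]
          by (rule Fmo_dag_ip[OF Xn Yn g y w, symmetric])
      qed
      also have "\<dots> = J n m X (Fmo F n m Y X (dag C g) w)"
        by (rule J_sum[OF Xn Fmo_in[OF Yn Xn hom_dag[OF Xn Yn g] w]])
      finally show ?thesis .
    qed
    note xJ = hmap_in[OF nat_in[OF x Y'] Jw]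
    have "pr n m Y w (?S Y (Fmo F l k X Y g v)) = ev_form Y l k (x (ldual C Y) (J n m Y w)) (Fmo F l k X Y g v)"
      by (rule antipode_ip[OF Y gv w])
    also have "\<dots> = ev_form X l k (Fmo F k l (ldual C Y) (ldual C X) ?t (x (ldual C Y) (J n m Y w))) v"
      unfolding bform_ltrans[OF X Y' e xJ v] by (rule bform_nat_right[OF Y X Y' ev_hom[OF Y] g xJ v, symmetric])
    also have "\<dots> = ev_form X l k (x (ldual C X) (J n m X (Fmo F n m Y X (dag C g) w))) v"
      unfolding nat_nat[OF x Y' X' t, symmetric] 1 ..
    also have "\<dots> = pr n m X (Fmo F n m Y X (dag C g) w) (?S X v)"
      by (rule antipode_ip[OF X v Fmo_in[OF Yn Xn hom_dag[OF Xn Yn g] w], symmetric])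
    also have "\<dots> = pr n m Y w (Fmo F n m X Y g (?S X v))"
      by (rule Fmo_dag_ip[OF Xn Yn g antipode_vec_in[OF X v] w])
    finally show "pr n m Y w (?S Y (Fmo F l k X Y g v)) = pr n m Y w (Fmo F n m X Y g (?S X v))" .
  qed
qed

end

lemma nat_adj_ip:
  assumes y: "y \<in> Nat k l m n" and X: "X \<in> Ob k l" and v: "v \<in> H k l X" and w: "w \<in> H m n X"
  shows "nat_adj C \<phi> F k l m n y X w \<in> H k l X"
    and "pr k l X v (nat_adj C \<phi> F k l m n y X w) = pr m n X (y X v) w"
proof -
  have Xm: "X \<in> Ob m n" using X nat_phi[OF y] by simp
  note yh = nat_in[OF y Xm]
  note h = hadj_hmap[OF fd[OF X] fd[OF Xm] yh]
  have e: "nat_adj C \<phi> F k l m n y X = hadj (Fob F k l X) (Fob F m n X) (y X)" using Xm by (simp add: nat_adj_def)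
  show 1: "nat_adj C \<phi> F k l m n y X w \<in> H k l X" unfolding e using hmap_in[OF h w] .
  have "cnj (pr k l X (nat_adj C \<phi> F k l m n y X w) v) = cnj (pr m n X w (y X v))"
    unfolding e using hadj_ip[OF fd[OF X] fd[OF Xm] yh v w] by simp
  then show "pr k l X v (nat_adj C \<phi> F k l m n y X w) = pr m n X (y X v) w"
    using ip_cnj[OF fd[OF X] 1 v] ip_cnj[OF fd[OF Xm] w hmap_in[OF yh v]] by simp
qed

lemma nat_adj_in:
  assumes y: "y \<in> Nat k l m n"
  shows "nat_adj C \<phi> F k l m n y \<in> Nat m n k l"
proof (rule natI)
  show "\<phi> k = \<phi> m" "\<phi> l = \<phi> n" using nat_phi[OF y] by auto
  have O: "X \<in> Ob m n" if "X \<in> Ob k l" for X using that nat_phi[OF y] by simp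
  show "nat_adj C \<phi> F k l m n y X \<in> hmap (Fob F m n X) (Fob F k l X)" if X: "X \<in> Ob k l" for X
    using hadj_hmap[OF fd[OF X] fd[OF O[OF X]] nat_in[OF y O[OF X]]] O[OF X] by (simp add: nat_adj_def)
  show "nat_adj C \<phi> F k l m n y X = 0" if "X \<notin> Ob k l" for X
    using that nat_phi[OF y] by (simp add: nat_adj_def)
  fix X Y f w assume X: "X \<in> Ob k l" and Y: "Y \<in> Ob k l" and f: "f \<in> hom C X Y" and w: "w \<in> H m n X"
  let ?y = "nat_adj C \<phi> F k l m n y"
  have fw: "Fmo F m n X Y f w \<in> H m n Y" by (rule Fmo_in[OF O[OF X] O[OF Y] f w])
  have a: "?y X w \<in> H k l X" using nat_adj_ip(1)[OF y X fdh_zero[OF fd[OF X]] w] .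
  have b: "?y Y (Fmo F m n X Y f w) \<in> H k l Y" using nat_adj_ip(1)[OF y Y fdh_zero[OF fd[OF Y]] fw] .
  show "?y Y (Fmo F m n X Y f w) = Fmo F k l X Y f (?y X w)"
  proof (rule ip_eqI[OF fd[OF Y] b Fmo_in[OF X Y f a]])
    fix v assume v: "v \<in> H k l Y"
    note d = hom_dag[OF X Y f] note dv = Fmo_in[OF Y X d v] note yv = nat_vec[OF y O[OF Y] v]
    have "pr k l Y v (?y Y (Fmo F m n X Y f w)) = pr m n Y (y Y v) (Fmo F m n X Y f w)"
      by (rule nat_adj_ip(2)[OF y Y v fw])
    also have "\<dots> = pr m n X (Fmo F m n Y X (dag C f) (y Y v)) w"
      by (rule Fmo_dag_ip[OF O[OF X] O[OF Y] f w yv, symmetric])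
    also have "\<dots> = pr m n X (y X (Fmo F k l Y X (dag C f) v)) w"
      using nat_nat[OF y O[OF Y] O[OF X] d, of v] by simp
    also have "\<dots> = pr k l X (Fmo F k l Y X (dag C f) v) (?y X w)"
      by (rule nat_adj_ip(2)[OF y X dv w, symmetric])
    also have "\<dots> = pr k l Y v (Fmo F k l X Y f (?y X w))"
      by (rule Fmo_dag_ip[OF X Y f a v])
    finally show "pr k l Y v (?y Y (Fmo F m n X Y f w)) = pr k l Y v (Fmo F k l X Y f (?y X w))" .
  qed
qed

abbreviation inv where "inv \<equiv> rec_invol C \<phi> F u"
abbreviation star_functional :: "'i \<Rightarrow> 'i \<Rightarrow> 'i \<Rightarrow> 'i \<Rightarrow> ('a, 'v) rec_elem \<Rightarrow> ('o \<Rightarrow> 'v \<Rightarrow> 'v) \<Rightarrow> complex" where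
  "star_functional k l m n f x \<equiv> cnj (rec_pair u f (nat_adj C \<phi> F k l m n (Shat l k n m x)))"

text \<open>
  The adjoint of a matrix coefficient of \<open>X\<close> may be computed with any object \<open>X'\<close> that pairs with \<open>X\<close>,
  provided that the pairing \<open>e\<close> converts \<open>v\<close>, \<open>w\<close> into \<open>v'\<close>, \<open>w'\<close>: the morphism \<open>X' \<rightarrow> ldual X\<close>
  through which \<open>e\<close> factors carries one expression to the other.
\<close>

context
  fixes k l m n X v w X' e v' w'
  assumes km: "\<phi> k = \<phi> m" and ln: "\<phi> l = \<phi> n"
    and X: "X \<in> Ob k l" and v: "v \<in> H k l X" and w: "w \<in> H m n X"
    and X': "X' \<in> Ob l k" and e: "e \<in> hom C (X' \<boxtimes> X) (un l)" and v': "v' \<in> H l k X'" and w': "w' \<in> H n m X'"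
    and 1: "\<And>z. z \<in> H l k X' \<Longrightarrow> pr l k X' v' z = bform e X' X k l z v"
    and 2: "\<And>y. y \<in> H m n X \<Longrightarrow> bform e X' X m n w' y = pr m n X w y"
begin

lemma star_functional_mc:
  assumes x: "x \<in> Nat n m l k"
  shows "rec_pair u (mc l k n m X' v' w') x = star_functional k l m n (mc k l m n X v w) x"
proof -
  have Xm: "X \<in> Ob m n" and Xm': "X' \<in> Ob n m" and em: "e \<in> hom C (X' \<boxtimes> X) (un n)"
    using X X' e km ln by auto
  note Xd = ldual_obj[OF X] and Xmd = ldual_obj[OF Xm]
  let ?S = "Shat l k n m x"
  note S = antipode_nat[OF x] and t = ltrans_hom(1)[OF X X' e]
  note Sv = antipode_vec_in[OF x X v] and xw = nat_vec[OF x X' w']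
  have "star_functional k l m n (mc k l m n X v w) x = cnj (pr m n X (?S X v) w)"
    unfolding mc_pair[OF km ln X v w nat_adj_in[OF S]] nat_adj_ip(2)[OF S X v w] ..
  also have "\<dots> = pr m n X w (?S X v)" by (rule ip_cnj[OF fd[OF Xm] Sv w])
  also have "\<dots> = ev_form X k l (x (ldual C X) (J m n X w)) v" by (rule antipode_ip[OF x X v w])
  also have "J m n X w = Fmo F n m X' (ldual C X) (ltrans e X' X) w'"
    unfolding ltrans_vec[OF Xm Xm' em w'] J_sum[OF Xm w, symmetric]
    using 2 onb_in[OF fd[OF Xm]] by (intro sum.cong refl) simp
  also have "ev_form X k l (x (ldual C X) (Fmo F n m X' (ldual C X) (ltrans e X' X) w')) v = bform e X' X k l (x X' w') v"
    unfolding nat_nat[OF x X' Xd t] by (rule bform_ltrans[OF X X' e xw v])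
  also have "\<dots> = pr l k X' v' (x X' w')" by (rule 1[OF xw, symmetric])
  also have "\<dots> = rec_pair u (mc l k n m X' v' w') x" using mc_pair[OF ln km X' v' w' x] by simp
  finally show ?thesis by simp
qed

lemma inv_mc_general: "inv k l m n (mc k l m n X v w) = mc l k n m X' v' w'"
  unfolding rec_invol_def by (rule the_A[OF mc_in[OF ln km X' v' w'] star_functional_mc])

end

lemma dual_conditions:
  assumes km: "\<phi> k = \<phi> m" and ln: "\<phi> l = \<phi> n" and X: "X \<in> Ob k l" and v: "v \<in> H k l X" and w: "w \<in> H m n X"
  shows "Jd k l X v \<in> H l k (ldual C X)" "J m n X w \<in> H n m (ldual C X)"
    "\<And>z. z \<in> H l k (ldual C X) \<Longrightarrow> pr l k (ldual C X) (Jd k l X v) z = ev_form X k l z v"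
    "\<And>y. y \<in> H m n X \<Longrightarrow> ev_form X m n (J m n X w) y = pr m n X w y"
proof -
  have Xm: "X \<in> Ob m n" using X km ln by simp
  show "Jd k l X v \<in> H l k (ldual C X)" "J m n X w \<in> H n m (ldual C X)"
    "\<And>z. z \<in> H l k (ldual C X) \<Longrightarrow> pr l k (ldual C X) (Jd k l X v) z = ev_form X k l z v"
    "\<And>y. y \<in> H m n X \<Longrightarrow> ev_form X m n (J m n X w) y = pr m n X w y"
    using Jd_in[OF X v] J_in[OF Xm w] Jd_ip[OF X v] ev_J[OF Xm w] by auto
qed

lemma inv_mc:
  assumes km: "\<phi> k = \<phi> m" and ln: "\<phi> l = \<phi> n" and X: "X \<in> Ob k l" and v: "v \<in> H k l X" and w: "w \<in> H m n X"
  shows "inv k l m n (mc k l m n X v w) = mc l k n m (ldual C X) (Jd k l X v) (J m n X w)"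
  using inv_mc_general[OF assms ldual_obj[OF X] ev_hom[OF X] dual_conditions[OF assms]] by simp

lemma inv_ex:
  assumes f: "f \<in> A k l m n"
  shows "\<exists>h\<in>A l k n m. \<forall>x\<in>Nat n m l k. rec_pair u h x = star_functional k l m n f x"
  using f
proof (induction f rule: A_induct)
  case zero
  show ?case by (rule bexI[OF _ A_zero]) (simp add: rec_pair_zero)
next
  case (add f g)
  then obtain h h' where "h \<in> A l k n m" "\<forall>x\<in>Nat n m l k. rec_pair u h x = star_functional k l m n f x"
    "h' \<in> A l k n m" "\<forall>x\<in>Nat n m l k. rec_pair u h' x = star_functional k l m n g x" by blast
  then show ?case using add(1,2)
    by (intro bexI[of _ "h + h'"] ballI) (simp_all add: rec_pair_add A_add)
next
  case (mc a v w)
  note X' = ldual_obj[OF mc(3)] and d = dual_conditions[OF mc]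
  show ?case
  proof (rule bexI[OF _ mc_in[OF mc(2,1) X' d(1,2)]], rule ballI)
    fix x assume x: "x \<in> Nat n m l k"
    show "rec_pair u (local.mc l k n m (ldual C (u a)) (Jd k l (u a) v) (J m n (u a) w)) x
      = star_functional k l m n (local.mc k l m n (u a) v w) x"
      by (rule star_functional_mc[OF mc X' ev_hom[OF mc(3)] d x])
  qed
qed

lemma inv_in: "f \<in> A k l m n \<Longrightarrow> inv k l m n f \<in> A l k n m"
  and inv_pair: "f \<in> A k l m n \<Longrightarrow> x \<in> Nat n m l k \<Longrightarrow> rec_pair u (inv k l m n f) x = star_functional k l m n f x"
proof -
  assume "f \<in> A k l m n"
  then obtain h where h: "h \<in> A l k n m" "\<And>x. x \<in> Nat n m l k \<Longrightarrow> rec_pair u h x = star_functional k l m n f x"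
    using inv_ex by blast
  have "inv k l m n f = h" unfolding rec_invol_def by (rule the_A[OF h])
  then show "inv k l m n f \<in> A l k n m" "x \<in> Nat n m l k \<Longrightarrow> rec_pair u (inv k l m n f) x = star_functional k l m n f x"
    using h by auto
qed

lemma inv_antilinear: "antilinear_on (A k l m n) (inv k l m n)"
  unfolding antilinear_on_def
proof (intro conjI ballI allI)
  fix f assume f: "f \<in> A k l m n"
  { fix g assume g: "g \<in> A k l m n"
    show "inv k l m n (f + g) = inv k l m n f + inv k l m n g"
      by (rule A_eqI[of _ l k n m]) (simp_all add: inv_in f g A_add inv_pair
          rec_pair_add[OF inv_in[OF f] inv_in[OF g]] rec_pair_add[OF f g]) }
  show "inv k l m n (c *\<^sub>C f) = cnj c *\<^sub>C inv k l m n f" for c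
    by (rule A_eqI[of _ l k n m]) (simp_all add: inv_in f A_scale inv_pair
        rec_pair_scale[OF inv_in[OF f]] rec_pair_scale[OF f])
qed

lemma inv_add: "f \<in> A k l m n \<Longrightarrow> g \<in> A k l m n \<Longrightarrow> inv k l m n (f + g) = inv k l m n f + inv k l m n g"
  and inv_scale: "f \<in> A k l m n \<Longrightarrow> inv k l m n (c *\<^sub>C f) = cnj c *\<^sub>C inv k l m n f"
  using inv_antilinear by (auto simp: antilinear_on_def)

lemma inv_zero: "inv k l m n 0 = 0"
  using inv_scale[OF A_zero, of k l m n 0] by simp

text \<open>\<open>X\<close> pairs with its dual through the adjoint of the coevaluation, which makes the involution involutive.\<close>

lemma bform_dag_coev:
  assumes X: "X \<in> Ob k l" and w: "w \<in> H k l X" and y: "y \<in> H l k (ldual C X)"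
  shows "bform (dag C (coev C X)) X (ldual C X) l k w y = pr l k (ldual C X) (J k l X w) y"
proof -
  note X' = ldual_obj[OF X]
  note o = tob_Ob[OF X X'] note i = io_in[OF X X' w y]
  note d = hom_dag[OF un_Ob o coev_hom[OF X]]
  note c = Fmo_in[OF o un_Ob d i]
  have "bform (dag C (coev C X)) X (ldual C X) l k w y
    = cnj (pr k k (un k) (Fmo F k k (X \<boxtimes> ldual C X) (un k) (dag C (coev C X)) (io k l k X (ldual C X) w y)) (mu k))"
    unfolding bform_def by (rule ip_cnj[OF fd[OF un_Ob] c mu_in, symmetric])
  also have "\<dots> = cnj (pr k k (X \<boxtimes> ldual C X) (io k l k X (ldual C X) w y) (coev_vec k X))"
    unfolding coev_vec_def Fmo_dag_ip[OF un_Ob o coev_hom[OF X] mu_in i] ..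
  also have "\<dots> = cnj (pr l k (ldual C X) y (J k l X w))" by (simp add: J_ip[OF X w y])
  also have "\<dots> = pr l k (ldual C X) (J k l X w) y" by (rule ip_cnj[OF fd[OF X'] y J_in[OF X w]])
  finally show ?thesis .
qed

lemma inv_inv:
  assumes f: "f \<in> A k l m n"
  shows "inv l k n m (inv k l m n f) = f"
  using f
proof (induction f rule: A_induct)
  case (add f g)
  then show ?case by (simp add: inv_add inv_in)
next
  case (mc a v w)
  let ?X = "u a"
  have Xm: "?X \<in> Ob m n" using mc by simp
  note X = mc(3) note X' = ldual_obj[OF X] and Xm' = ldual_obj[OF Xm]
  note d = dual_conditions[OF mc]
  have "inv l k n m (local.mc l k n m (ldual C ?X) (Jd k l ?X v) (J m n ?X w)) = local.mc k l m n ?X v w"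
  proof (rule inv_mc_general[OF mc(2,1) X' d(1,2) X _ mc(4,5)])
    show "dag C (coev C ?X) \<in> hom C (?X \<boxtimes> ldual C ?X) (un k)"
      by (rule hom_dag[OF un_Ob tob_Ob[OF X X'] coev_hom[OF X]])
    show "pr k l ?X v z = bform (dag C (coev C ?X)) ?X (ldual C ?X) l k z (Jd k l ?X v)" if z: "z \<in> H k l ?X" for z
    proof -
      have "bform (dag C (coev C ?X)) ?X (ldual C ?X) l k z (Jd k l ?X v) = pr l k (ldual C ?X) (J k l ?X z) (Jd k l ?X v)"
        by (rule bform_dag_coev[OF X z d(1)])
      also have "\<dots> = cnj (pr l k (ldual C ?X) (Jd k l ?X v) (J k l ?X z))"
        by (rule ip_cnj[OF fd[OF X'] d(1) J_in[OF X z], symmetric])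
      also have "\<dots> = cnj (pr k l ?X z v)" by (simp add: d(3)[OF J_in[OF X z]] ev_J[OF X z mc(4)])
      also have "\<dots> = pr k l ?X v z" by (rule ip_cnj[OF fd[OF X] z mc(4)])
      finally show ?thesis by simp
    qed
    show "bform (dag C (coev C ?X)) ?X (ldual C ?X) n m w y = pr n m (ldual C ?X) (J m n ?X w) y"
      if "y \<in> H n m (ldual C ?X)" for y
      by (rule bform_dag_coev[OF Xm mc(5) that])
  qed
  then show ?case unfolding inv_mc[OF mc] .
qed (simp add: inv_zero)

text \<open>\<open>ldual Y \<otimes> ldual X\<close> pairs with \<open>X \<otimes> Y\<close> by evaluating the inner pair first.\<close>

definition evprod :: "'o \<Rightarrow> 'o \<Rightarrow> 'm" where
  "evprod X Y = ev C Y \<cdot> ((idm C (ldual C Y) \<odot> lcontr (ev C X) (ldual C X) X Y)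
    \<cdot> assoc C (ldual C Y) (ldual C X) (X \<boxtimes> Y))"

lemma evprod_hom:
  assumes X: "X \<in> obj C \<alpha> \<beta>" and Y: "Y \<in> obj C \<beta> \<gamma>"
  shows "evprod X Y \<in> hom C ((ldual C Y \<boxtimes> ldual C X) \<boxtimes> (X \<boxtimes> Y)) (unit C \<gamma>)"
    "(idm C (ldual C Y) \<odot> lcontr (ev C X) (ldual C X) X Y) \<cdot> assoc C (ldual C Y) (ldual C X) (X \<boxtimes> Y)
      \<in> hom C ((ldual C Y \<boxtimes> ldual C X) \<boxtimes> (X \<boxtimes> Y)) (ldual C Y \<boxtimes> Y)"
    "idm C (ldual C Y) \<odot> lcontr (ev C X) (ldual C X) X Y
      \<in> hom C (ldual C Y \<boxtimes> (ldual C X \<boxtimes> (X \<boxtimes> Y))) (ldual C Y \<boxtimes> Y)"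
proof -
  note X' = ldual_obj[OF X] and Y' = ldual_obj[OF Y] note XY = tob_obj[OF X Y]
  note o = tob_obj[OF tob_obj[OF Y' X'] XY] tob_obj[OF Y' tob_obj[OF X' XY]] tob_obj[OF Y' Y]
  show 3: "idm C (ldual C Y) \<odot> lcontr (ev C X) (ldual C X) X Y
      \<in> hom C (ldual C Y \<boxtimes> (ldual C X \<boxtimes> (X \<boxtimes> Y))) (ldual C Y \<boxtimes> Y)"
    by (rule hom_tensor[OF Y' Y' tob_obj[OF X' XY] Y idm_hom lcontr_hom(1)[OF X X' Y ev_hom[OF X]]])
  show 2: "(idm C (ldual C Y) \<odot> lcontr (ev C X) (ldual C X) X Y) \<cdot> assoc C (ldual C Y) (ldual C X) (X \<boxtimes> Y)
      \<in> hom C ((ldual C Y \<boxtimes> ldual C X) \<boxtimes> (X \<boxtimes> Y)) (ldual C Y \<boxtimes> Y)"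
    by (rule hom_comp[OF o assoc_hom(1)[OF Y' X' XY] 3])
  show "evprod X Y \<in> hom C ((ldual C Y \<boxtimes> ldual C X) \<boxtimes> (X \<boxtimes> Y)) (unit C \<gamma>)"
    unfolding evprod_def by (rule hom_comp[OF o(1,3) unit_obj 2 ev_hom[OF Y]])
qed

lemma bform_evprod:
  assumes X: "X \<in> Ob k l" and Y: "Y \<in> Ob l p" and l': "\<phi> l' = \<phi> l"
    and y: "y \<in> H p l' (ldual C Y)" and x: "x \<in> H l' k (ldual C X)" and x': "x' \<in> H k l X" and y': "y' \<in> H l p Y"
  shows "bform (evprod X Y) (ldual C Y \<boxtimes> ldual C X) (X \<boxtimes> Y) k p
      (io p l' k (ldual C Y) (ldual C X) y x) (io k l p X Y x' y')
    = (if l' = l then ev_form X k l x x' * ev_form Y l p y y' else 0)"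
proof -
  have X2: "X \<in> Ob k l'" and Y2: "Y \<in> Ob l' p" and e: "ev C X \<in> hom C (ldual C X \<boxtimes> X) (un l')"
    using X Y l' ev_hom[OF X] by auto
  note X' = ldual_obj[OF X2] and Y' = ldual_obj[OF Y2]
  note XY = tob_Ob[OF X Y]
  note h = evprod_hom[OF X Y]
  note o = tob_Ob[OF tob_Ob[OF Y' X'] XY] tob_Ob[OF Y' tob_Ob[OF X' XY]] tob_Ob[OF Y' Y2]
  note i = io_in[OF X Y x' y']
  let ?L = "Fmo F l' p (ldual C X \<boxtimes> (X \<boxtimes> Y)) Y (lcontr (ev C X) (ldual C X) X Y)
      (io l' k p (ldual C X) (X \<boxtimes> Y) x (io k l p X Y x' y'))"
  have L: "?L = (if l' = l then ev_form X k l' x x' *\<^sub>C y' else 0)"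
    by (rule lcontr_vec[OF X X' Y l' e x x' y'])
  have "Fmo F p p ((ldual C Y \<boxtimes> ldual C X) \<boxtimes> (X \<boxtimes> Y)) (un p) (evprod X Y)
      (io p k p (ldual C Y \<boxtimes> ldual C X) (X \<boxtimes> Y) (io p l' k (ldual C Y) (ldual C X) y x) (io k l p X Y x' y'))
    = Fmo F p p (ldual C Y \<boxtimes> Y) (un p) (ev C Y) (io p l' p (ldual C Y) Y y ?L)"
    unfolding evprod_def Fmo_comp[OF o(1,3) un_Ob h(2) ev_hom[OF Y]]
      Fmo_comp[OF o assoc_hom(1)[OF Y' X' XY] h(3)] Fio_assoc[OF Y' X' XY y x i]
      io_nat[OF Y' tob_Ob[OF X' XY] Y' Y2 idm_hom lcontr_hom(1)[OF X2 X' Y2 e] y io_in[OF X' XY x i]]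
      Fmo_id[OF Y' y] ..
  then have b: "bform (evprod X Y) (ldual C Y \<boxtimes> ldual C X) (X \<boxtimes> Y) k p
      (io p l' k (ldual C Y) (ldual C X) y x) (io k l p X Y x' y') = ev_form Y l' p y ?L"
    by (simp add: bform_def)
  note lin = bform_lin(1)[OF Y2 Y' ev_hom[OF Y2] y]
  show ?thesis unfolding b L
    using linear_on_scale[OF lin, of y'] y' linear_on_zero[OF lin fdh_zero[OF fd[OF Y2]]]
    by (auto simp: scaleC_complex_def)
qed

text \<open>
  Both conditions on the pairing \<open>evprod\<close> are checked on vectors \<open>\<iota>(x \<otimes> y)\<close>; for intermediate indices
  other than the given ones both sides vanish.
\<close>

lemma inv_mul_mc:
  assumes km: "\<phi> k = \<phi> m" and ln: "\<phi> l = \<phi> n" and pq: "\<phi> p = \<phi> q"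
    and X: "X \<in> Ob k l" and v: "v \<in> H k l X" and w: "w \<in> H m n X"
    and Y: "Y \<in> Ob l p" and v': "v' \<in> H l p Y" and w': "w' \<in> H n q Y"
  shows "inv k p m q (mc k p m q (X \<boxtimes> Y) (io k l p X Y v v') (io m n q X Y w w'))
    = mc p k q m (ldual C Y \<boxtimes> ldual C X) (io p l k (ldual C Y) (ldual C X) (Jd l p Y v') (Jd k l X v))
        (io q n m (ldual C Y) (ldual C X) (J n q Y w') (J m n X w))"
proof -
  have Xm: "X \<in> Ob m n" and Ym: "Y \<in> Ob n q" using X Y km ln pq by auto
  note X' = ldual_obj[OF X] and Y' = ldual_obj[OF Y] and Xm' = ldual_obj[OF Xm] and Ym' = ldual_obj[OF Ym]
  note d1 = dual_conditions[OF km ln X v w] and d2 = dual_conditions[OF ln pq Y v' w']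
  note XY = tob_Ob[OF X Y] and YX' = tob_Ob[OF Y' X'] and XYm = tob_Ob[OF Xm Ym] and YXm' = tob_Ob[OF Ym' Xm']
  note E = evprod_hom(1)[OF X Y] and Em = evprod_hom(1)[OF Xm Ym]
  note iV = io_in[OF X Y v v'] and iW = io_in[OF Xm Ym w w']
  note jV = io_in[OF Y' X' d2(1) d1(1)] and jW = io_in[OF Ym' Xm' d2(2) d1(2)]
  note FYX = fd[OF YX'] and FXY = fd[OF XYm]
  show ?thesis
  proof (rule inv_mc_general[OF km pq XY iV iW YX' E jV jW])
    fix z assume "z \<in> H p k (ldual C Y \<boxtimes> ldual C X)"
    then show "pr p k (ldual C Y \<boxtimes> ldual C X) (io p l k (ldual C Y) (ldual C X) (Jd l p Y v') (Jd k l X v)) z =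
      bform (evprod X Y) (ldual C Y \<boxtimes> ldual C X) (X \<boxtimes> Y) k p z (io k l p X Y v v')"
    proof (induction rule: io_induct[OF Y' X', consumes 1, case_names zero add io])
      note L = bform_lin(2)[OF XY YX' E iV]
      case zero
      show ?case using ip_zero_right[OF FYX jV] linear_on_zero[OF L fdh_zero[OF FYX]] by simp
    next
      note L = bform_lin(2)[OF XY YX' E iV]
      case (add a b)
      then show ?case using ip_add_right[OF FYX jV] linear_on_add[OF L] by simp
    next
      case (io l' y x)
      have Xl: "ldual C X \<in> Ob l' k" "ldual C Y \<in> Ob p l'" using X' Y' io(1) by auto
      show ?case
      proof (cases "l' = l")
        case True
        then show ?thesis using io bform_evprod[OF X Y io(1,2,3) v v'] io_ip[OF Y' X' d2(1) d1(1)] d1(3) d2(3)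
          by simp
      next
        case False
        then show ?thesis using bform_evprod[OF X Y io(1,2,3) v v']
            io_orth[OF Y' X' refl io(1) _ d2(1) d1(1) io(2,3)] by simp
      qed
    qed
  next
    fix y assume "y \<in> H m q (X \<boxtimes> Y)"
    then show "bform (evprod X Y) (ldual C Y \<boxtimes> ldual C X) (X \<boxtimes> Y) m q
        (io q n m (ldual C Y) (ldual C X) (J n q Y w') (J m n X w)) y = pr m q (X \<boxtimes> Y) (io m n q X Y w w') y"
    proof (induction rule: io_induct[OF Xm Ym, consumes 1, case_names zero add io])
      note L = bform_lin(1)[OF XYm YXm' Em jW]
      case zero
      show ?case using ip_zero_right[OF FXY iW] linear_on_zero[OF L fdh_zero[OF FXY]] by simp
    next
      note L = bform_lin(1)[OF XYm YXm' Em jW]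
      case (add a b)
      then show ?case using ip_add_right[OF FXY iW] linear_on_add[OF L] by simp
    next
      case (io n' x y)
      have Xn: "X \<in> Ob m n'" "Y \<in> Ob n' q" using Xm Ym io(1) by auto
      show ?case
      proof (cases "n' = n")
        case True
        then show ?thesis using io bform_evprod[OF Xn io(1)[symmetric] d2(2) d1(2) io(2,3)] io_ip[OF Xm Ym w w'] d1(4) d2(4)
          by simp
      next
        case False
        then show ?thesis using bform_evprod[OF Xn io(1)[symmetric] d2(2) d1(2) io(2,3)]
            io_orth[OF Xm Ym refl io(1) _ w w' io(2,3)] by simp
      qed
    qed
  qed
qed

lemma inv_mul:
  assumes f: "f \<in> A k l m n" and g: "g \<in> A l p n q"
  shows "inv k p m q (M k l p m n q f g) = M p l k q n m (inv l p n q g) (inv k l m n f)"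
  using f
proof (induction f rule: A_induct)
  case zero
  show ?case by (simp add: mul_zero(2)[OF g] inv_zero mul_zero(1)[OF inv_in[OF g]])
next
  case (add f f')
  then show ?case using linear_on_add[OF mul_lin(2)[OF g] add(1,2)]
      linear_on_add[OF mul_lin(1)[OF inv_in[OF g]] inv_in[OF add(1)] inv_in[OF add(2)]]
    by (simp add: inv_add mul_in g)
next
  case (mc a v w)
  note m1 = mc and f = mc_in[OF mc]
  show ?case using g
  proof (induction g rule: A_induct)
    case zero
    show ?case by (simp add: mul_zero(1)[OF f] inv_zero mul_zero(2)[OF inv_in[OF f]])
  next
    case (add g g')
    then show ?case using linear_on_add[OF mul_lin(1)[OF f] add(1,2)]
        linear_on_add[OF mul_lin(2)[OF inv_in[OF f]] inv_in[OF add(1)] inv_in[OF add(2)]]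
      by (simp add: inv_add mul_in f)
  next
    case (mc b v' w')
    note d1 = dual_conditions[OF m1] and d2 = dual_conditions[OF mc]
    show ?case
      unfolding mul_mc[OF m1(1,2) mc(2) m1(3) mc(3) m1(4,5) mc(4,5)] inv_mc[OF m1] inv_mc[OF mc]
        mul_mc[OF mc(2) m1(2,1) ldual_obj[OF mc(3)] ldual_obj[OF m1(3)] d2(1,2) d1(1,2)]
      by (rule inv_mul_mc[OF m1(1,2) mc(2) m1(3,4,5) mc(3,4,5)])
  qed
qed

text \<open>
  The unit object pairs with itself by the unit constraint, and this pairing is \<open>1\<close> on unit vectors.
\<close>

lemma inv_one: "inv k k m m (oneA k m) = oneA k m"
proof (cases "\<phi> k = \<phi> m")
  case km: True
  note o = un_Ob[of k] and om = un_Ob2[OF km] and mm = mu_in'[OF km]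
  note L = lun_hom(1)[OF o]
  have um: "un k = un m" using km by simp
  have e: "lun C (un k) \<in> hom C (un k \<boxtimes> un k) (un k)" using lun_hom(1)[OF o] .
  have b: "bform (lun C (un k)) (un k) (un k) j j (mu j) y = pr j j (un k) (mu j) y"
    if "\<phi> k = \<phi> j" "y \<in> H j j (un k)" for j y
    unfolding bform_def using io_lun[of "un k" j j y] un_Ob2[OF that(1)] that by simp
  have mu_sym: "pr k k (un k) (mu k) z = bform (lun C (un k)) (un k) (un k) k k z (mu k)" if z: "z \<in> H k k (un k)" for z
  proof -
    define c where "c = pr k k (un k) (mu k) z"
    have zc: "z = c *\<^sub>C mu k" unfolding c_def by (rule mu_expand[OF z])
    have "bform (lun C (un k)) (un k) (un k) k k z (mu k) = c *\<^sub>C bform (lun C (un k)) (un k) (un k) k k (mu k) (mu k)"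
      unfolding zc by (rule bilinear_scale(1)[OF bform_bilinear[OF o o e] mu_in mu_in])
    then show ?thesis using b[OF refl mu_in] mu_ip by (simp add: c_def scaleC_complex_def)
  qed
  show ?thesis unfolding rec_one_mc[OF km]
    by (rule inv_mc_general[OF km km o mu_in mm o e mu_in mm mu_sym]) (simp_all add: b[OF km])
next
  case False
  then show ?thesis by (simp add: rec_one_off inv_zero)
qed

lemma inv_tens_balanced: "balanced_on (A k l r s) (A r s m n) (\<lambda>f g. inv k l r s f \<otimes> inv r s m n g)"
  by (auto simp: balanced_on_def inv_add inv_scale tens_simps)

text \<open>
  The involution maps \<open>\<Sum> c(v, e) \<otimes> c(e, w)\<close> to the expression for the dual bases \<open>J e\<close> and \<open>Jd e\<close>.
\<close>

lemma comul_inv: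
  assumes f: "f \<in> A k l m n"
  shows "tmap (A k l r s) (A r s m n) (inv k l r s) (inv r s m n) (\<Delta> k l m n r s f) = \<Delta> l k n m s r (inv k l m n f)"
  unfolding tmap_def
proof (cases "\<phi> k = \<phi> r \<and> \<phi> l = \<phi> s")
  case False
  then have "\<not> (\<phi> l = \<phi> s \<and> \<phi> k = \<phi> r)" by blast
  then show "tlift (A k l r s) (A r s m n) (\<lambda>v w. inv k l r s v \<otimes> inv r s m n w) (\<Delta> k l m n r s f) = \<Delta> l k n m s r (inv k l m n f)"
    using comul_off[OF f False] comul_off[OF inv_in[OF f]] tlift_zero[OF A_subspace A_subspace inv_tens_balanced] by simp
next
  case True
  then have kr: "\<phi> k = \<phi> r" and ls: "\<phi> l = \<phi> s" by auto
  note tb = inv_tens_balanced[of k l r s m n]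
  show "tlift (A k l r s) (A r s m n) (\<lambda>v w. inv k l r s v \<otimes> inv r s m n w) (\<Delta> k l m n r s f) = \<Delta> l k n m s r (inv k l m n f)"
    using f
  proof (induction f rule: A_induct)
    case zero
    show ?case by (simp add: comul_zero inv_zero tlift_zero[OF A_subspace A_subspace tb])
  next
    case (add f g)
    then show ?case by (simp add: inv_add inv_in linear_on_add[OF comul_lin] comul_in tlift_add[OF A_subspace A_subspace tb])
  next
    case (mc a v w)
    have rm: "\<phi> r = \<phi> m" and sn: "\<phi> s = \<phi> n" using mc kr ls by auto
    have Xr: "u a \<in> Ob r s" using mc kr ls by simp
    note X = mc(3) note X' = ldual_obj[OF X] and Xr' = ldual_obj[OF Xr] note oi = onb_in[OF fd[OF Xr]]
    note d = dual_conditions[OF mc]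
    have "tlift (A k l r s) (A r s m n) (\<lambda>v w. inv k l r s v \<otimes> inv r s m n w) (\<Delta> k l m n r s (local.mc k l m n (u a) v w))
      = (\<Sum>e\<in>ONB r s (u a). local.mc l k s r (ldual C (u a)) (Jd k l (u a) v) (J r s (u a) e) \<otimes>
          local.mc s r n m (ldual C (u a)) (Jd r s (u a) e) (J m n (u a) w))"
      unfolding comul_mc[OF mc(1,2) kr ls X mc(4,5)]
      using oi by (subst tlift_sum_tens[OF A_subspace A_subspace tb])
        (auto simp: inv_mc[OF kr ls X mc(4)] inv_mc[OF rm sn Xr _ mc(5)] mc_in[OF kr ls X mc(4)] mc_in[OF rm sn Xr _ mc(5)])
    also have "\<dots> = \<Delta> l k n m s r (local.mc l k n m (ldual C (u a)) (Jd k l (u a) v) (J m n (u a) w))"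
    proof (rule comul_mc_dual_bases(3)[OF mc(2,1) ls kr X' d(1,2), symmetric])
      show "J r s (u a) e \<in> H s r (ldual C (u a))" "Jd r s (u a) e \<in> H s r (ldual C (u a))" if "e \<in> ONB r s (u a)" for e
        using J_in[OF Xr oi[OF that]] Jd_in[OF Xr oi[OF that]] .
      show "(\<Sum>e\<in>ONB r s (u a). pr s r (ldual C (u a)) (Jd r s (u a) e) z *\<^sub>C J r s (u a) e) = z"
        if z: "z \<in> H s r (ldual C (u a))" for z
      proof -
        have "(\<Sum>e\<in>ONB r s (u a). pr s r (ldual C (u a)) (Jd r s (u a) e) z *\<^sub>C J r s (u a) e)
          = (\<Sum>e\<in>ONB r s (u a). ev_form (u a) r s z e *\<^sub>C J r s (u a) e)"
          using oi by (intro sum.cong refl) (simp add: Jd_ip[OF Xr _ z])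
        then show ?thesis by (simp add: snake_left[OF Xr z])
      qed
    qed
    finally show ?case unfolding inv_mc[OF mc] .
  qed
qed

end

lemma tlift_fun_scale: "tlift V W (\<lambda>v w. c *\<^sub>C b v w) t = c *\<^sub>C tlift V W b t"
  by (simp add: tlift_def case_prod_unfold scaleC_sum_list)

lemma tlift_fun_zero: "tlift V W (\<lambda>v w. 0) t = 0"
  by (simp add: tlift_def case_prod_unfold)

lemma tlift_eq_0:
  assumes "cvs.subspace V" "t \<in> tensor_space V W" "\<And>v w. v \<in> V \<Longrightarrow> w \<in> W \<Longrightarrow> b v w = 0"
  shows "tlift V W b t = 0"
  using tlift_cong[OF assms(1,2), of b "\<lambda>v w. 0"] assms(3) by (simp add: tlift_fun_zero)

lemma tens_linear_balanced:
  assumes "linear_on V f" "linear_on W g"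
  shows "balanced_on V W (\<lambda>v w. f v \<otimes> g w)"
  using assms by (auto simp: balanced_on_def linear_on_def tens_simps)

lemma tassoc_inner_bilinear: "bilinear_on U V (\<lambda>u v. u \<otimes> (v \<otimes> w))"
  by (auto simp: bilinear_on_def linear_on_def tens_simps)

lemma tassoc_balanced:
  assumes U: "cvs.subspace U" and V: "cvs.subspace V"
  shows "balanced_on (tensor_space U V) W (\<lambda>s w. tlift U V (\<lambda>u v. u \<otimes> (v \<otimes> w)) s)"
  unfolding balanced_on_def
proof (intro conjI ballI allI)
  note L = tlift_linear[OF U V tassoc_inner_bilinear]
  fix s w assume s: "s \<in> tensor_space U V"
  { fix s' assume s': "s' \<in> tensor_space U V"
    show "tlift U V (\<lambda>u v. u \<otimes> v \<otimes> w) (s + s') = tlift U V (\<lambda>u v. u \<otimes> v \<otimes> w) s + tlift U V (\<lambda>u v. u \<otimes> v \<otimes> w) s'"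
      by (rule linear_on_add[OF L s s']) }
  show "tlift U V (\<lambda>u v. u \<otimes> v \<otimes> (w + w')) s = tlift U V (\<lambda>u v. u \<otimes> v \<otimes> w) s + tlift U V (\<lambda>u v. u \<otimes> v \<otimes> w') s" for w'
    by (simp add: tens_simps tlift_fun_add)
  show "tlift U V (\<lambda>u v. u \<otimes> v \<otimes> w) (c *\<^sub>C s) = tlift U V (\<lambda>u v. u \<otimes> v \<otimes> (c *\<^sub>C w)) s" for c
    by (simp add: linear_on_scale[OF L s] tens_simps tlift_fun_scale)
qed

context tannaka_data
begin

section \<open>The bialgebra axioms\<close>

text \<open>
  The two triple products are coefficients of \<open>(X \<otimes> Y) \<otimes> Z\<close> and \<open>X \<otimes> (Y \<otimes> Z)\<close>, which agree by naturality with
  respect to the associator.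
\<close>

lemma mul_assoc_A:
  assumes f: "f \<in> A k l m n" and g: "g \<in> A l p n q" and h: "h \<in> A p r q s"
  shows "M k p r m q s (M k l p m n q f g) h = M k l r m n s f (M l p r n q s g h)"
  using f
proof (induction f rule: A_induct)
  case zero
  show ?case by (simp add: mul_zero(2)[OF g] mul_zero(2)[OF h] mul_zero(2)[OF mul_in[OF g h]])
next
  case (add f f')
  then show ?case by (simp add: linear_on_add[OF mul_lin(2)[OF g]] linear_on_add[OF mul_lin(2)[OF h]]
        linear_on_add[OF mul_lin(2)[OF mul_in[OF g h]]] mul_in[OF _ g])
next
  case (mc a v w)
  note m1 = mc and f = mc_in[OF mc]
  show ?case using g
  proof (induction g rule: A_induct)
    case zero
    show ?case by (simp add: mul_zero(1)[OF f] mul_zero(2)[OF h])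
  next
    case (add g g')
    then show ?case by (simp add: linear_on_add[OF mul_lin(1)[OF f]] linear_on_add[OF mul_lin(2)[OF h]]
        mul_in[OF f] mul_in[OF _ h])
  next
    case (mc b v' w')
    note m2 = mc and g = mc_in[OF mc]
    show ?case using h
    proof (induction h rule: A_induct)
      case zero
      show ?case by (simp add: mul_zero(1)[OF f] mul_zero(1)[OF g] mul_zero(1)[OF mul_in[OF f g]])
    next
      case (add h h')
      then show ?case by (simp add: linear_on_add[OF mul_lin(1)[OF f]] linear_on_add[OF mul_lin(1)[OF g]]
          linear_on_add[OF mul_lin(1)[OF mul_in[OF f g]]] mul_in[OF g])
    next
      case (mc c v'' w'')
      let ?X = "u a" and ?Y = "u b" and ?Z = "u c"
      note km = m1(1) and ln = m1(2) and pq = m2(2) and rs = mc(2)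
      note X = m1(3) and Y = m2(3) and Z = mc(3)
      have Xm: "?X \<in> Ob m n" and Ym: "?Y \<in> Ob n q" and Zm: "?Z \<in> Ob q s" using X Y Z km ln pq rs by auto
      note v = m1(4) m2(4) mc(4) and w = m1(5) m2(5) mc(5)
      note XY = tob_Ob[OF X Y] and YZ = tob_Ob[OF Y Z] and XYm = tob_Ob[OF Xm Ym] and YZm = tob_Ob[OF Ym Zm]
      note i1 = io_in[OF X Y v(1,2)] and i2 = io_in[OF Xm Ym w(1,2)]
      note j1 = io_in[OF Y Z v(2,3)] and j2 = io_in[OF Ym Zm w(2,3)]
      let ?a = "assoc C ?X ?Y ?Z"
      let ?V = "io k p r (?X \<boxtimes> ?Y) ?Z (io k l p ?X ?Y v v') v''" and ?W = "io m q s (?X \<boxtimes> ?Y) ?Z (io m n q ?X ?Y w w') w''"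
      let ?V' = "io k l r ?X (?Y \<boxtimes> ?Z) v (io l p r ?Y ?Z v' v'')" and ?W' = "io m n s ?X (?Y \<boxtimes> ?Z) w (io n q s ?Y ?Z w' w'')"
      note O = tob_Ob[OF XY Z] and O' = tob_Ob[OF X YZ] note ah = assoc_hom(1)[OF X Y Z]
      have "M k p r m q s (M k l p m n q (local.mc k l m n ?X v w) (local.mc l p n q ?Y v' w')) (local.mc p r q s ?Z v'' w'')
        = local.mc k r m s ((?X \<boxtimes> ?Y) \<boxtimes> ?Z) ?V ?W"
        unfolding mul_mc[OF km ln pq X Y v(1) w(1) v(2) w(2)] by (rule mul_mc[OF km pq rs XY Z i1 i2 v(3) w(3)])
      also have "?V = Fmo F k r (?X \<boxtimes> (?Y \<boxtimes> ?Z)) ((?X \<boxtimes> ?Y) \<boxtimes> ?Z) (dag C ?a) ?V'"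
        by (rule dag_assoc[OF X Y Z v, symmetric])
      also have "local.mc k r m s ((?X \<boxtimes> ?Y) \<boxtimes> ?Z) \<dots> ?W =
        local.mc k r m s (?X \<boxtimes> (?Y \<boxtimes> ?Z)) ?V' (Fmo F m s ((?X \<boxtimes> ?Y) \<boxtimes> ?Z) (?X \<boxtimes> (?Y \<boxtimes> ?Z)) ?a ?W)"
        by (rule mc_natural[OF km rs O O' ah io_in[OF X YZ v(1) j1] io_in[OF XYm Zm i2 w(3)]])
      also have "\<dots> = local.mc k r m s (?X \<boxtimes> (?Y \<boxtimes> ?Z)) ?V' ?W'" by (simp only: Fio_assoc[OF Xm Ym Zm w])
      also have "\<dots> = M k l r m n s (local.mc k l m n ?X v w) (M l p r n q s (local.mc l p n q ?Y v' w') (local.mc p r q s ?Z v'' w''))"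
        unfolding mul_mc[OF ln pq rs Y Z v(2) w(2) v(3) w(3)] by (rule mul_mc[OF km ln rs X YZ v(1) w(1) j1 j2, symmetric])
      finally show ?case .
    qed
  qed
qed

text \<open>Naturality with respect to the unit constraint \<open>1 \<otimes> X \<rightarrow> X\<close>.\<close>

lemma one_mul_A:
  assumes f: "f \<in> A k l m n" shows "M k k l m m n (oneA k m) f = f"
  using f
proof (induction f rule: A_induct)
  case zero
  show ?case by (rule mul_zero(1)[OF one_in])
next
  case (add f g)
  then show ?case by (simp add: linear_on_add[OF mul_lin(1)[OF one_in]])
next
  case (mc a v w)
  note km = mc(1) and X = mc(3) note Xm = Ob_mn[OF mc(1,2) X]
  note oi = io_in[OF un_Ob X mu_in mc(4)] and om = io_in[OF un_Ob2[OF km] Xm mu_in'[OF km] mc(5)]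
  note O = tob_Ob[OF un_Ob X] note L = lun_hom(1)[OF X]
  have W: "Fmo F m n (un k \<boxtimes> u a) (u a) (lun C (u a)) (io m m n (un k) (u a) (mu m) w) = w"
    using io_lun[OF Xm mc(5)] km by simp
  show ?case
    unfolding rec_one_mc[OF km] mul_mc[OF km km mc(2) un_Ob X mu_in mu_in'[OF km] mc(4,5)] dag_lun[OF X mc(4), symmetric]
      mc_natural[OF mc(1,2) O X L mc(4) om] W ..
qed

lemma mul_one_A:
  assumes f: "f \<in> A k l m n" shows "M k l l m n n f (oneA l n) = f"
  using f
proof (induction f rule: A_induct)
  case zero
  show ?case by (rule mul_zero(2)[OF one_in])
next
  case (add f g)
  then show ?case by (simp add: linear_on_add[OF mul_lin(2)[OF one_in]])
next
  case (mc a v w)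
  note ln = mc(2) and X = mc(3) note Xm = Ob_mn[OF mc(1,2) X]
  note oi = io_in[OF X un_Ob mc(4) mu_in] and om = io_in[OF Xm un_Ob2[OF ln] mc(5) mu_in'[OF ln]]
  note O = tob_Ob[OF X un_Ob] note L = run_hom(1)[OF X]
  have W: "Fmo F m n (u a \<boxtimes> un l) (u a) (run C (u a)) (io m n n (u a) (un l) w (mu n)) = w"
    using io_run[OF Xm mc(5)] ln by simp
  show ?case
    unfolding rec_one_mc[OF ln] mul_mc[OF mc(1) ln ln X un_Ob mc(4,5) mu_in mu_in'[OF ln]] dag_run[OF X mc(4), symmetric]
      mc_natural[OF mc(1,2) O X L mc(4) om] W ..
qed

text \<open>
  Both sides equal \<open>\<Sum> c(v, g) \<otimes> (c(g, e) \<otimes> c(e, w))\<close>, over two orthonormal bases.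
\<close>

lemma coassoc_A:
  assumes f: "f \<in> A k l m n"
  shows "tassoc (A k l p q) (A p q r s) (A r s m n) (tmap (A k l r s) (A r s m n) (\<Delta> k l r s p q) id (\<Delta> k l m n r s f))
    = tmap (A k l p q) (A p q m n) id (\<Delta> p q m n r s) (\<Delta> k l m n p q f)"
proof -
  note AS = A_subspace A_subspace
  have b1: "balanced_on (A k l r s) (A r s m n) (\<lambda>v w. \<Delta> k l r s p q v \<otimes> id w)"
    by (rule tens_linear_balanced[OF comul_lin]) (simp add: linear_on_def)
  have b2: "balanced_on (A k l p q) (A p q m n) (\<lambda>v w. id v \<otimes> \<Delta> p q m n r s w)"
    by (rule tens_linear_balanced[OF _ comul_lin]) (simp add: linear_on_def)
  note b3 = tassoc_balanced[OF AS, of k l p q p q r s "A r s m n"]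
  note b4 = bilinear_balanced[OF tassoc_inner_bilinear]
  have t1: "tmap (A k l r s) (A r s m n) (\<Delta> k l r s p q) id t \<in> tensor_space (AA k l p q r s) (A r s m n)"
    if "t \<in> AA k l r s m n" for t
    unfolding tmap_def by (rule tlift_in[OF A_subspace that tensor_space_subspace]) (auto intro: tens_in comul_in)
  show ?thesis
  proof (cases "\<phi> k = \<phi> r \<and> \<phi> l = \<phi> s \<and> \<phi> k = \<phi> p \<and> \<phi> l = \<phi> q")
    case False
    have "tmap (A k l r s) (A r s m n) (\<Delta> k l r s p q) id (\<Delta> k l m n r s f) = 0"
    proof (cases "\<phi> k = \<phi> r \<and> \<phi> l = \<phi> s")
      case True
      with False have "\<not> (\<phi> k = \<phi> p \<and> \<phi> l = \<phi> q)" by blast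
      then show ?thesis unfolding tmap_def
        by (intro tlift_eq_0[OF A_subspace comul_in[OF f]]) (simp add: comul_off tens_simps)
    next
      case False
      show ?thesis unfolding tmap_def comul_off[OF f False] by (rule tlift_zero[OF AS b1])
    qed
    moreover have "tmap (A k l p q) (A p q m n) id (\<Delta> p q m n r s) (\<Delta> k l m n p q f) = 0"
    proof (cases "\<phi> k = \<phi> p \<and> \<phi> l = \<phi> q")
      case True
      with False have "\<not> (\<phi> p = \<phi> r \<and> \<phi> q = \<phi> s)" by metis
      then show ?thesis unfolding tmap_def
        by (intro tlift_eq_0[OF A_subspace comul_in[OF f]]) (simp add: comul_off tens_simps)
    next
      case False
      show ?thesis unfolding tmap_def comul_off[OF f False] by (rule tlift_zero[OF AS b2])
    qed
    ultimately show ?thesis by (simp add: tassoc_def tlift_zero[OF tensor_space_subspace A_subspace b3])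
  next
    case True
    then have kr: "\<phi> k = \<phi> r" and ls: "\<phi> l = \<phi> s" and kp: "\<phi> k = \<phi> p" and lq: "\<phi> l = \<phi> q"
      and rp: "\<phi> r = \<phi> p" and sq: "\<phi> s = \<phi> q" and pr': "\<phi> p = \<phi> r" and qs': "\<phi> q = \<phi> s" by auto
    show ?thesis using f
    proof (induction f rule: A_induct)
      case zero
      show ?case unfolding comul_zero tmap_def tassoc_def tlift_zero[OF AS b1] tlift_zero[OF AS b2]
          tlift_zero[OF tensor_space_subspace A_subspace b3] ..
    next
      case (add f g)
      have "tassoc (A k l p q) (A p q r s) (A r s m n) (tmap (A k l r s) (A r s m n) (\<Delta> k l r s p q) id (\<Delta> k l m n r s (f + g)))
        = tassoc (A k l p q) (A p q r s) (A r s m n) (tmap (A k l r s) (A r s m n) (\<Delta> k l r s p q) id (\<Delta> k l m n r s f)) +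
          tassoc (A k l p q) (A p q r s) (A r s m n) (tmap (A k l r s) (A r s m n) (\<Delta> k l r s p q) id (\<Delta> k l m n r s g))"
        unfolding linear_on_add[OF comul_lin add(1,2)] tmap_def
          tlift_add[OF AS b1 comul_in[OF add(1)] comul_in[OF add(2)]] tassoc_def
        by (rule tlift_add[OF tensor_space_subspace A_subspace b3
            t1[OF comul_in[OF add(1)], unfolded tmap_def] t1[OF comul_in[OF add(2)], unfolded tmap_def]])
      moreover have "tmap (A k l p q) (A p q m n) id (\<Delta> p q m n r s) (\<Delta> k l m n p q (f + g))
        = tmap (A k l p q) (A p q m n) id (\<Delta> p q m n r s) (\<Delta> k l m n p q f) +
          tmap (A k l p q) (A p q m n) id (\<Delta> p q m n r s) (\<Delta> k l m n p q g)"
        unfolding linear_on_add[OF comul_lin add(1,2)] tmap_def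
        by (rule tlift_add[OF AS b2 comul_in[OF add(1)] comul_in[OF add(2)]])
      ultimately show ?case using add(3,4) by (simp only:)
    next
      case (mc a v w)
      let ?X = "u a"
      have rm: "\<phi> r = \<phi> m" and sn: "\<phi> s = \<phi> n" and pm: "\<phi> p = \<phi> m" and qn: "\<phi> q = \<phi> n" using True mc by auto
      note X = mc(3) note Xr = Ob_mn[OF kr ls X] and Xp = Ob_mn[OF kp lq X]
      note oi = onb_in[OF fd[OF Xr]] and op = onb_in[OF fd[OF Xp]]
      have m1: "local.mc k l r s ?X v e \<in> A k l r s" "local.mc r s m n ?X e w \<in> A r s m n" if "e \<in> ONB r s ?X" for e
        using mc_in[OF kr ls X mc(4) oi[OF that]] mc_in[OF rm sn Xr oi[OF that] mc(5)] by auto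
      have m2: "local.mc k l p q ?X v g \<in> A k l p q" "local.mc p q m n ?X g w \<in> A p q m n" if "g \<in> ONB p q ?X" for g
        using mc_in[OF kp lq X mc(4) op[OF that]] mc_in[OF pm qn Xp op[OF that] mc(5)] by auto
      have m3: "local.mc p q r s ?X g e \<in> A p q r s" if "g \<in> ONB p q ?X" "e \<in> ONB r s ?X" for g e
        using mc_in[OF pr' qs' Xp op[OF that(1)] oi[OF that(2)]] .
      have "tmap (A k l r s) (A r s m n) (\<Delta> k l r s p q) id (\<Delta> k l m n r s (local.mc k l m n ?X v w))
        = (\<Sum>e\<in>ONB r s ?X. \<Delta> k l r s p q (local.mc k l r s ?X v e) \<otimes> local.mc r s m n ?X e w)"
        unfolding comul_mc[OF mc(1,2) kr ls X mc(4,5)] tmap_def using m1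
        by (subst tlift_sum_tens[OF AS b1]) auto
      then have "tassoc (A k l p q) (A p q r s) (A r s m n)
          (tmap (A k l r s) (A r s m n) (\<Delta> k l r s p q) id (\<Delta> k l m n r s (local.mc k l m n ?X v w)))
        = (\<Sum>e\<in>ONB r s ?X. tlift (A k l p q) (A p q r s) (\<lambda>x y. x \<otimes> (y \<otimes> local.mc r s m n ?X e w)) (\<Delta> k l r s p q (local.mc k l r s ?X v e)))"
        unfolding tassoc_def using m1 by (subst tlift_sum_tens[OF tensor_space_subspace A_subspace b3, symmetric]) (auto intro: comul_in)
      also have "\<dots> = (\<Sum>e\<in>ONB r s ?X. \<Sum>g\<in>ONB p q ?X. local.mc k l p q ?X v g \<otimes> (local.mc p q r s ?X g e \<otimes> local.mc r s m n ?X e w))"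
      proof (intro sum.cong refl)
        fix e assume e: "e \<in> ONB r s ?X"
        show "tlift (A k l p q) (A p q r s) (\<lambda>x y. x \<otimes> (y \<otimes> local.mc r s m n ?X e w)) (\<Delta> k l r s p q (local.mc k l r s ?X v e))
          = (\<Sum>g\<in>ONB p q ?X. local.mc k l p q ?X v g \<otimes> (local.mc p q r s ?X g e \<otimes> local.mc r s m n ?X e w))"
          unfolding comul_mc[OF kr ls kp lq X mc(4) oi[OF e]] using m2 m3[OF _ e]
          by (subst tlift_sum_tens[OF AS b4]) auto
      qed
      also have "\<dots> = (\<Sum>g\<in>ONB p q ?X. local.mc k l p q ?X v g \<otimes> \<Delta> p q m n r s (local.mc p q m n ?X g w))"
        by (subst sum.swap) (intro sum.cong refl, simp add: tens_sum_right comul_mc[OF pm qn pr' qs' Xp op mc(5)])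
      also have "\<dots> = tmap (A k l p q) (A p q m n) id (\<Delta> p q m n r s) (\<Delta> k l m n p q (local.mc k l m n ?X v w))"
        unfolding comul_mc[OF mc(1,2) kp lq X mc(4,5)] tmap_def using m2
        by (subst tlift_sum_tens[OF AS b2]) auto
      finally show ?case .
    qed
  qed
qed

lemma counit_left_A:
  assumes f: "f \<in> A k l m n"
  shows "tlift (A k l k l) (A k l m n) (\<lambda>b c. \<epsilon> k l b *\<^sub>C c) (\<Delta> k l m n k l f) = f"
proof -
  note AS = A_subspace A_subspace
  have b: "balanced_on (A k l k l) (A k l m n) (\<lambda>b c. \<epsilon> k l b *\<^sub>C c)"
    using linear_onD[OF counit_lin[of k l]]
    by (auto simp: balanced_on_def scaleC_add_left scaleC_add_right scaleC_scaleC scaleC_complex_def mult.commute)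
  show ?thesis using f
  proof (induction f rule: A_induct)
    case zero
    show ?case by (simp add: comul_zero tlift_zero[OF AS b])
  next
    case (add f g)
    then show ?case by (simp add: linear_on_add[OF comul_lin] comul_in tlift_add[OF AS b])
  next
    case (mc a v w)
    let ?X = "u a"
    note X = mc(3) note oi = onb_in[OF fd[OF X]]
    have "tlift (A k l k l) (A k l m n) (\<lambda>b c. \<epsilon> k l b *\<^sub>C c) (\<Delta> k l m n k l (local.mc k l m n ?X v w))
      = (\<Sum>e\<in>ONB k l ?X. pr k l ?X v e *\<^sub>C local.mc k l m n ?X e w)"
      unfolding comul_mc[OF mc(1,2) refl refl X mc(4,5)]
      using oi by (subst tlift_sum_tens[OF AS b]) (auto simp: counit_mc[OF X mc(4)] mc_in[OF refl refl X mc(4)] mc_in[OF mc(1,2) X _ mc(5)])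
    also have "\<dots> = (\<Sum>e\<in>ONB k l ?X. local.mc k l m n ?X (pr k l ?X e v *\<^sub>C e) w)"
      using oi by (intro sum.cong refl) (simp add: mc_scale_left[OF mc(1,2) X _ mc(5)] ip_cnj[OF fd[OF X] _ mc(4)])
    also have "\<dots> = local.mc k l m n ?X (\<Sum>e\<in>ONB k l ?X. pr k l ?X e v *\<^sub>C e) w"
      using oi by (intro mc_sum_left[OF mc(1,2) X mc(5), symmetric] fdh_scale[OF fd[OF X]])
    finally show ?case by (simp add: onb_expand[OF fd[OF X] mc(4)])
  qed
qed

lemma counit_right_A:
  assumes f: "f \<in> A k l m n"
  shows "tlift (A k l m n) (A m n m n) (\<lambda>b c. \<epsilon> m n c *\<^sub>C b) (\<Delta> k l m n m n f) = f"
proof -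
  note AS = A_subspace A_subspace
  have b: "balanced_on (A k l m n) (A m n m n) (\<lambda>b c. \<epsilon> m n c *\<^sub>C b)"
    using linear_onD[OF counit_lin[of m n]]
    by (auto simp: balanced_on_def scaleC_add_left scaleC_add_right scaleC_scaleC scaleC_complex_def mult.commute)
  show ?thesis using f
  proof (induction f rule: A_induct)
    case zero
    show ?case by (simp add: comul_zero tlift_zero[OF AS b])
  next
    case (add f g)
    then show ?case by (simp add: linear_on_add[OF comul_lin] comul_in tlift_add[OF AS b])
  next
    case (mc a v w)
    let ?X = "u a"
    note X = mc(3) note Xm = Ob_mn[OF mc(1,2) X] note oi = onb_in[OF fd[OF Xm]]
    have "tlift (A k l m n) (A m n m n) (\<lambda>b c. \<epsilon> m n c *\<^sub>C b) (\<Delta> k l m n m n (local.mc k l m n ?X v w))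
      = (\<Sum>e\<in>ONB m n ?X. pr m n ?X e w *\<^sub>C local.mc k l m n ?X v e)"
      unfolding comul_mc[OF mc(1,2,1,2) X mc(4,5)]
      using oi by (subst tlift_sum_tens[OF AS b]) (auto simp: counit_mc[OF Xm _ mc(5)] mc_in[OF refl refl Xm _ mc(5)] mc_in[OF mc(1,2) X mc(4)])
    also have "\<dots> = local.mc k l m n ?X v (\<Sum>e\<in>ONB m n ?X. pr m n ?X e w *\<^sub>C e)"
      using oi fdh_scale[OF fd[OF Xm] oi] by (subst mc_sum_right[OF mc(1,2) X mc(4)]) (simp_all add: mc_scale_right[OF mc(1,2) X mc(4)])
    finally show ?case by (simp add: onb_expand[OF fd[OF Xm] mc(5)])
  qed
qed

text \<open>
  The space \<open>F\<^sub>l\<^sub>l(1)\<close> has the orthonormal basis \<open>\<mu>\<^sub>l\<close>, while the off-diagonal fibres of the unit are zero.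
\<close>

lemma comul_one_A:
  "\<Delta> k k m m l l' (oneA k m) = (if l = l' then oneA k l \<otimes> oneA l m else 0)"
proof (cases "\<phi> k = \<phi> m")
  case False
  then have "\<phi> k \<noteq> \<phi> l \<or> \<phi> l \<noteq> \<phi> m" by auto
  then have "oneA k l \<otimes> oneA l m = 0" using rec_one_off[of k l] rec_one_off[of l m]
    by (auto simp: tens_simps)
  then show ?thesis using rec_one_off[OF False] by (cases "l = l'") (simp_all add: comul_zero)
next
  case km: True
  show ?thesis
  proof (cases "\<phi> k = \<phi> l \<and> \<phi> k = \<phi> l'")
    case False
    then have "\<Delta> k k m m l l' (oneA k m) = 0" by (rule comul_off[OF one_in])
    moreover have "oneA k l = 0" if "l = l'" using False that rec_one_off[of k l] by auto
    ultimately show ?thesis by (auto simp: tens_simps)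
  next
    case True
    then have kl: "\<phi> k = \<phi> l" and kl': "\<phi> k = \<phi> l'" and lm: "\<phi> l = \<phi> m" using km by auto
    note o = un_Ob[of k] and w = mu_in'[OF km]
    have ul: "un k = un l" using kl by simp
    have L: "un k \<in> Ob l l'" using Ob_mn[OF kl kl' o] .
    show ?thesis
    proof (cases "l = l'")
      case False
      have "H l l' (un k) = {0}" using Fob_unit_zero[of l l'] False kl kl' by simp
      then have "ONB l l' (un k) = {}" by (rule onb_trivial[OF fd[OF L]])
      then show ?thesis using False unfolding rec_one_mc[OF km] comul_mc[OF km km kl kl' o mu_in w] by simp
    next
      case True
      have "\<Delta> k k m m l l (mc k k m m (un k) (mu k) (mu m)) = (\<Sum>i\<in>{()}. mc k k l l (un k) (mu k) (mu l) \<otimes> mc l l m m (un k) (mu l) (mu m))"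
        by (rule comul_mc_dual_bases(3)[OF km km kl kl o mu_in w])
          (use mu_in[of l] ul mu_expand[of _ l] in auto)
      then show ?thesis
        unfolding True[symmetric] rec_one_mc[OF km] rec_one_mc[OF kl] rec_one_mc[OF lm] ul[symmetric] by simp
    qed
  qed
qed

text \<open>
  Both sides are \<open>\<langle>\<iota>(v \<otimes> v'), \<iota>(w \<otimes> w')\<rangle>\<close>, computed from isometry of \<open>\<iota>\<close> for equal intermediate indices and from
  orthogonality of ranges otherwise.
\<close>

lemma counit_mul_A:
  assumes f: "f \<in> A k l m n" and g: "g \<in> A l p n q"
  shows "(if (k, p) = (m, q) then \<epsilon> k p (M k l p m n q f g) else 0)
    = (if (k, l) = (m, n) then \<epsilon> k l f else 0) * (if (l, p) = (n, q) then \<epsilon> l p g else 0)"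
proof (cases "k = m \<and> p = q")
  case True
  then have [simp]: "m = k" "q = p" by auto
  note L = linear_onD[OF counit_lin]
  have f': "f \<in> A k l k n" and g': "g \<in> A l p n p" using f g by auto
  have z: "\<epsilon> k l 0 = 0" for k l using linear_on_zero[OF counit_lin A_zero] .
  have "\<epsilon> k p (M k l p k n p f g)
    = (if l = n then \<epsilon> k l f * \<epsilon> l p g else 0)"
    using f'
  proof (induction f rule: A_induct)
    case zero
    show ?case by (simp add: mul_zero(2)[OF g'] z)
  next
    case (add f f')
    then show ?case
      using L(1)[OF mul_in[OF add(1) g'] mul_in[OF add(2) g']] L(1)[of f k l f']
      by (auto simp: linear_on_add[OF mul_lin(2)[OF g']] algebra_simps)
  next
    case (mc a v w)
    note m1 = mc and f = mc_in[OF mc]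
    show ?case using g'
    proof (induction g rule: A_induct)
      case zero
      show ?case by (simp add: mul_zero(1)[OF f] z)
    next
      case (add g g')
      then show ?case
        using L(1)[OF mul_in[OF f add(1)] mul_in[OF f add(2)]] L(1)[of g l p g']
        by (auto simp: linear_on_add[OF mul_lin(1)[OF f]] algebra_simps)
    next
      case (mc b v' w')
      note X = m1(3) and Y = mc(3) note Xn = Ob_mn[OF m1(1,2) X] and Yn = Ob_mn[OF mc(1,2) Y]
      note i = io_in[OF X Y m1(4) mc(4)] and j = io_in[OF Xn Yn m1(5) mc(5)]
      have e: "\<epsilon> k p (M k l p k n p (local.mc k l k n (u a) v w) (local.mc l p n p (u b) v' w'))
        = pr k p (u a \<boxtimes> u b) (io k l p (u a) (u b) v v') (io k n p (u a) (u b) w w')"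
        unfolding mul_mc[OF m1(1,2) mc(2) X Y m1(4,5) mc(4,5)] by (rule counit_mc[OF tob_Ob[OF X Y] i j])
      show ?case
      proof (cases "l = n")
        case True
        then show ?thesis unfolding e
          using io_ip[OF X Y m1(4) mc(4)] counit_mc[OF X m1(4)] counit_mc[OF Y mc(4)] m1(5) mc(5) by simp
      next
        case False
        then show ?thesis unfolding e using io_orth[OF X Y refl m1(2)[symmetric] False m1(4) mc(4) m1(5) mc(5)] by simp
      qed
    qed
  qed
  then show ?thesis by simp
next
  case False
  then show ?thesis by auto
qed

lemma counit_one_A: "\<epsilon> k k (oneA k k) = 1"
  unfolding rec_one_mc[OF refl] counit_mc[OF un_Ob mu_in mu_in] by (rule mu_ip)

text \<open>
  For a coefficient of \<open>X\<close>, the sum over a basis of \<open>F\<^sub>r\<^sub>s X\<close> is empty unless \<open>F\<^sub>r\<^sub>s X \<noteq> 0\<close>.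
\<close>

lemma comul_rcf_A:
  assumes f: "f \<in> A k l m n"
  shows "rcf_on UNIV UNIV (\<lambda>r s. \<Delta> k l m n r s f \<noteq> 0)"
  using f
proof (induction f rule: A_induct)
  case zero
  show ?case by (simp add: rcf_on_def comul_zero)
next
  case (add f g)
  have "{s \<in> UNIV. \<Delta> k l m n r s (f + g) \<noteq> 0} \<subseteq> {s \<in> UNIV. \<Delta> k l m n r s f \<noteq> 0} \<union> {s \<in> UNIV. \<Delta> k l m n r s g \<noteq> 0}"
    "{r \<in> UNIV. \<Delta> k l m n r s (f + g) \<noteq> 0} \<subseteq> {r \<in> UNIV. \<Delta> k l m n r s f \<noteq> 0} \<union> {r \<in> UNIV. \<Delta> k l m n r s g \<noteq> 0}" for r s
    using linear_on_add[OF comul_lin add(1,2)] by auto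
  then show ?case using add(3,4) unfolding rcf_on_def by (meson finite_UnI finite_subset)
next
  case (mc a v w)
  let ?f = "local.mc k l m n (u a) v w"
  have *: "r \<in> \<phi> -` {\<phi> k} \<and> s \<in> \<phi> -` {\<phi> l} \<and> H r s (u a) \<noteq> {0}" if ne: "\<Delta> k l m n r s ?f \<noteq> 0" for r s
  proof -
    have kr: "\<phi> k = \<phi> r" and ls: "\<phi> l = \<phi> s" using ne comul_off[OF mc_in[OF mc]] by auto
    have "ONB r s (u a) \<noteq> {}" using ne unfolding comul_mc[OF mc(1,2) kr ls mc(3,4,5)] by auto
    then show ?thesis using onb_trivial[OF fd[OF Ob_mn[OF kr ls mc(3)]]] kr ls by auto
  qed
  note R = Fob_rcf[OF mc(3), unfolded rcf_on_def]
  show ?case unfolding rcf_on_def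
  proof (intro conjI ballI)
    fix r
    show "finite {s \<in> UNIV. \<Delta> k l m n r s ?f \<noteq> 0}"
    proof (cases "r \<in> \<phi> -` {\<phi> k}")
      case True
      then have "finite {s \<in> \<phi> -` {\<phi> l}. H r s (u a) \<noteq> {0}}" using R by blast
      then show ?thesis by (rule rev_finite_subset) (use * in blast)
    next
      case False
      then have "{s \<in> UNIV. \<Delta> k l m n r s ?f \<noteq> 0} = {}" using * by blast
      then show ?thesis by simp
    qed
  next
    fix s
    show "finite {r \<in> UNIV. \<Delta> k l m n r s ?f \<noteq> 0}"
    proof (cases "s \<in> \<phi> -` {\<phi> l}")
      case True
      then have "finite {r \<in> \<phi> -` {\<phi> k}. H r s (u a) \<noteq> {0}}" using R by blast
      then show ?thesis by (rule rev_finite_subset) (use * in blast)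
    next
      case False
      then have "{r \<in> UNIV. \<Delta> k l m n r s ?f \<noteq> 0} = {}" using * by blast
      then show ?thesis by simp
    qed
  qed
qed

subsection \<open>Multiplicativity of the comultiplication\<close>

text \<open>
  For \<open>x \<in> AA k l r t m n\<close> and \<open>y \<in> AA l p t s n q\<close>, \<open>tmul\<close> is the product in the tensor square, with
  \<open>(a \<otimes> a') (b \<otimes> b') = ab \<otimes> a'b'\<close>.
\<close>

abbreviation tmul_inner where
  "tmul_inner k l p m n q r t s a a' \<equiv> \<lambda>y. tlift (A l p t s) (A t s n q) (\<lambda>b b'. M k l p r t s a b \<otimes> M r t s m n q a' b') y"
abbreviation tmul where
  "tmul k l p m n q r t s x y \<equiv> tlift (A k l r t) (A r t m n) (\<lambda>a a'. tmul_inner k l p m n q r t s a a' y) x"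

lemma tmul_inner_balanced:
  "a \<in> A k l r t \<Longrightarrow> a' \<in> A r t m n \<Longrightarrow>
    balanced_on (A l p t s) (A t s n q) (\<lambda>b b'. M k l p r t s a b \<otimes> M r t s m n q a' b')"
  by (rule tens_linear_balanced[OF mul_lin(1) mul_lin(1)])

lemma outer_tmul_balanced:
  assumes y: "y \<in> AA l p t s n q"
  shows "balanced_on (A k l r t) (A r t m n) (\<lambda>a a'. tmul_inner k l p m n q r t s a a' y)"
  unfolding balanced_on_def
proof (intro conjI ballI allI)
  note cong = tlift_cong[OF A_subspace y]
  fix a a' assume a: "a \<in> A k l r t" and a': "a' \<in> A r t m n"
  { fix b assume b: "b \<in> A k l r t"
    show "tmul_inner k l p m n q r t s (a + b) a' y = tmul_inner k l p m n q r t s a a' y + tmul_inner k l p m n q r t s b a' y"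
      unfolding tlift_fun_add[symmetric]
      by (rule cong) (simp add: linear_on_add[OF mul_lin(2) a b] tens_simps) }
  { fix b assume b: "b \<in> A r t m n"
    show "tmul_inner k l p m n q r t s a (a' + b) y = tmul_inner k l p m n q r t s a a' y + tmul_inner k l p m n q r t s a b y"
      unfolding tlift_fun_add[symmetric]
      by (rule cong) (simp add: linear_on_add[OF mul_lin(2) a' b] tens_simps) }
  show "tmul_inner k l p m n q r t s (c *\<^sub>C a) a' y = tmul_inner k l p m n q r t s a (c *\<^sub>C a') y" for c
    by (rule cong) (simp add: linear_on_scale[OF mul_lin(2) a] linear_on_scale[OF mul_lin(2) a'] tens_simps)
qed

lemma tmul_add_left:
  assumes "x \<in> AA k l r t m n" "x' \<in> AA k l r t m n" "y \<in> AA l p t s n q"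
  shows "tmul k l p m n q r t s (x + x') y = tmul k l p m n q r t s x y + tmul k l p m n q r t s x' y"
  by (rule tlift_add[OF A_subspace A_subspace outer_tmul_balanced[OF assms(3)] assms(1,2)])

lemma tmul_add_right:
  assumes x: "x \<in> AA k l r t m n" and y: "y \<in> AA l p t s n q" "y' \<in> AA l p t s n q"
  shows "tmul k l p m n q r t s x (y + y') = tmul k l p m n q r t s x y + tmul k l p m n q r t s x y'"
  unfolding tlift_fun_add[symmetric]
  by (rule tlift_cong[OF A_subspace x]) (simp add: tlift_add[OF A_subspace A_subspace tmul_inner_balanced y])

lemma tmul_zero:
  "y \<in> AA l p t s n q \<Longrightarrow> tmul k l p m n q r t s 0 y = 0"
  "x \<in> AA k l r t m n \<Longrightarrow> tmul k l p m n q r t s x 0 = 0"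
  by (rule tlift_zero[OF A_subspace A_subspace outer_tmul_balanced], assumption)
    (rule tlift_eq_0[OF A_subspace], assumption, rule tlift_zero[OF A_subspace A_subspace tmul_inner_balanced])

text \<open>
  On matrix coefficients the formula expresses that the vectors \<open>\<iota>(e \<otimes> f)\<close>, over all intermediate
  indices, form an orthonormal basis. The finite set of relevant indices depends on the
  coefficients, so for the passage to sums the formula is stated for all sufficiently large finite
  index sets.
\<close>

lemma comul_mul_mc:
  assumes km: "\<phi> k = \<phi> m" and ln: "\<phi> l = \<phi> n" and pq: "\<phi> p = \<phi> q"
    and X: "X \<in> Ob k l" and v: "v \<in> H k l X" and w: "w \<in> H m n X"
    and Y: "Y \<in> Ob l p" and v': "v' \<in> H l p Y" and w': "w' \<in> H n q Y"
  shows "\<exists>T0. finite T0 \<and> (\<forall>T. finite T \<longrightarrow> T0 \<subseteq> T \<longrightarrow>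
    \<Delta> k p m q r s (mc k p m q (X \<boxtimes> Y) (io k l p X Y v v') (io m n q X Y w w')) =
    (\<Sum>t\<in>T. tmul k l p m n q r t s (\<Delta> k l m n r t (mc k l m n X v w)) (\<Delta> l p n q t s (mc l p n q Y v' w'))))"
proof (cases "\<phi> k = \<phi> r \<and> \<phi> p = \<phi> s")
  case False
  note f = mc_in[OF km ln X v w] and g = mc_in[OF ln pq Y v' w']
  have "tmul k l p m n q r t s (\<Delta> k l m n r t (mc k l m n X v w)) (\<Delta> l p n q t s (mc l p n q Y v' w')) = 0" for t
  proof (cases "\<phi> k = \<phi> r")
    case True
    then have "\<Delta> l p n q t s (mc l p n q Y v' w') = 0" using False by (intro comul_off[OF g]) auto
    then show ?thesis using tmul_zero(2)[OF comul_in[OF f]] by simp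
  next
    case False
    then have "\<Delta> k l m n r t (mc k l m n X v w) = 0" by (intro comul_off[OF f]) auto
    then show ?thesis using tmul_zero(1)[OF comul_in[OF g]] by simp
  qed
  moreover have "\<Delta> k p m q r s (mc k p m q (X \<boxtimes> Y) (io k l p X Y v v') (io m n q X Y w w')) = 0"
    using False mc_in[OF km pq tob_Ob[OF X Y] io_in[OF X Y v v'] io_in[OF Ob_mn[OF km ln X] Ob_mn[OF ln pq Y] w w']]
    by (intro comul_off)
  ultimately show ?thesis by auto
next
  case True
  then have kr: "\<phi> k = \<phi> r" and ps: "\<phi> p = \<phi> s" and rm: "\<phi> r = \<phi> m" and sq: "\<phi> s = \<phi> q" using km pq by auto
  note f = mc_in[OF km ln X v w] and g = mc_in[OF ln pq Y v' w']
  note Xm = Ob_mn[OF km ln X] and Ym = Ob_mn[OF ln pq Y]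
  have Xr: "X \<in> obj C (\<phi> r) (\<phi> l)" and Yr: "Y \<in> obj C (\<phi> l) (\<phi> s)" using X Y kr ps by auto
  note XY = tob_Ob[OF X Y] and i = io_in[OF X Y v v'] and j = io_in[OF Xm Ym w w']
  let ?V = "io k l p X Y v v'" and ?W = "io m n q X Y w w'"
  let ?M = "fibre_indices r X (\<phi> l)"
  let ?tmul = "\<lambda>t. tmul k l p m n q r t s (\<Delta> k l m n r t (mc k l m n X v w)) (\<Delta> l p n q t s (mc l p n q Y v' w'))"
  let ?S = "SIGMA t:?M. ONB r t X \<times> ONB t s Y"
  let ?e = "\<lambda>(t, e, f). io r t s X Y e f"
  have fin: "finite ?S"
    using fibre_indices_finite[OF Xr Yr] fibre_indices_phi[OF Xr Yr] X Y kr ps by (intro finite_SigmaI finite_cartesian_product finite_onb fd) auto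
  have XO: "X \<in> Ob r t" "Y \<in> Ob t s" if "\<phi> t = \<phi> l" for t using Xr Yr that by auto
  have S1: "(\<Sum>i\<in>?S. h i) = (\<Sum>t\<in>?M. \<Sum>e\<in>ONB r t X. \<Sum>f\<in>ONB t s Y. h (t, e, f))"
    for h :: "_ \<Rightarrow> 'z::comm_monoid_add"
  proof -
    have "(\<Sum>i\<in>?S. h i) = (\<Sum>t\<in>?M. \<Sum>ef\<in>ONB r t X \<times> ONB t s Y. h (t, ef))"
      using fibre_indices_finite[OF Xr Yr] finite_onb[OF fd[OF XO(1)[OF fibre_indices_phi[OF Xr Yr]]]] finite_onb[OF fd[OF XO(2)[OF fibre_indices_phi[OF Xr Yr]]]]
      by (subst sum.Sigma) auto
    then show ?thesis by (simp add: sum.cartesian_product case_prod_unfold)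
  qed
  have ein: "?e i \<in> H r s (X \<boxtimes> Y)" if i: "i \<in> ?S" for i
  proof -
    obtain t e f where i': "i = (t, e, f)" "t \<in> ?M" "e \<in> ONB r t X" "f \<in> ONB t s Y" using i by auto
    note o = XO[OF fibre_indices_phi[OF Xr Yr i'(2)]]
    show ?thesis using io_in[OF o onb_in[OF fd[OF o(1)] i'(3)] onb_in[OF fd[OF o(2)] i'(4)]] i'(1) by simp
  qed
  have D: "\<Delta> k p m q r s (mc k p m q (X \<boxtimes> Y) ?V ?W)
    = (\<Sum>i\<in>?S. mc k p r s (X \<boxtimes> Y) ?V (?e i) \<otimes> mc r s m q (X \<boxtimes> Y) (?e i) ?W)"
  proof (rule comul_mc_dual_bases(3)[OF km pq kr ps XY i j ein ein])
    show "(\<Sum>i\<in>?S. pr r s (X \<boxtimes> Y) (?e i) z *\<^sub>C ?e i) = z" if "z \<in> H r s (X \<boxtimes> Y)" for z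
      unfolding S1 using io_expand[OF Xr Yr that] by simp
  qed
  have T1: "?tmul t = (\<Sum>e\<in>ONB r t X. \<Sum>f\<in>ONB t s Y. mc k p r s (X \<boxtimes> Y) ?V (io r t s X Y e f) \<otimes> mc r s m q (X \<boxtimes> Y) (io r t s X Y e f) ?W)"
    if t: "\<phi> t = \<phi> l" for t
  proof -
    have lt: "\<phi> l = \<phi> t" and tn: "\<phi> t = \<phi> n" using t ln by auto
    note o = XO[OF t] note oX = onb_in[OF fd[OF o(1)]] and oY = onb_in[OF fd[OF o(2)]]
    have mX: "mc k l r t X v e \<in> A k l r t" "mc r t m n X e w \<in> A r t m n" if "e \<in> ONB r t X" for e
      using mc_in[OF kr lt X v oX[OF that]] mc_in[OF rm tn o(1) oX[OF that] w] by auto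
    have mY: "mc l p t s Y v' e \<in> A l p t s" "mc t s n q Y e w' \<in> A t s n q" if "e \<in> ONB t s Y" for e
      using mc_in[OF lt ps Y v' oY[OF that]] mc_in[OF tn sq o(2) oY[OF that] w'] by auto
    have "?tmul t = (\<Sum>e\<in>ONB r t X. tmul_inner k l p m n q r t s (mc k l r t X v e) (mc r t m n X e w) (\<Delta> l p n q t s (mc l p n q Y v' w')))"
      unfolding comul_mc[OF km ln kr lt X v w] using mX
      by (intro tlift_sum_tens[OF A_subspace A_subspace outer_tmul_balanced[OF comul_in[OF g]]]) auto
    also have "\<dots> = (\<Sum>e\<in>ONB r t X. \<Sum>f\<in>ONB t s Y. M k l p r t s (mc k l r t X v e) (mc l p t s Y v' f) \<otimes> M r t s m n q (mc r t m n X e w) (mc t s n q Y f w'))"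
      unfolding comul_mc[OF ln pq lt ps Y v' w'] using mX mY
      by (intro sum.cong refl tlift_sum_tens[OF A_subspace A_subspace tmul_inner_balanced]) auto
    also have "\<dots> = (\<Sum>e\<in>ONB r t X. \<Sum>f\<in>ONB t s Y. mc k p r s (X \<boxtimes> Y) ?V (io r t s X Y e f) \<otimes> mc r s m q (X \<boxtimes> Y) (io r t s X Y e f) ?W)"
      using oX oY by (intro sum.cong refl) (simp add: mul_mc[OF kr lt ps X Y v _ v'] mul_mc[OF rm tn sq o _ w _ w'])
    finally show ?thesis .
  qed
  have T2: "?tmul t = 0" if "t \<notin> ?M" for t
  proof (cases "\<phi> t = \<phi> l")
    case True
    then show ?thesis using T1[OF True] fibre_indices_off[OF Xr Yr that True] by simp
  next
    case False
    then have "\<Delta> k l m n r t (mc k l m n X v w) = 0" by (intro comul_off[OF f]) auto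
    then show ?thesis using tmul_zero(1)[OF comul_in[OF g]] by simp
  qed
  show ?thesis
  proof (intro exI[of _ ?M] conjI allI impI)
    show "finite ?M" by (rule fibre_indices_finite[OF Xr Yr])
    fix T assume T: "finite T" "?M \<subseteq> T"
    have "\<Delta> k p m q r s (mc k p m q (X \<boxtimes> Y) ?V ?W) = (\<Sum>t\<in>?M. ?tmul t)"
      unfolding D S1 using fibre_indices_phi[OF Xr Yr] by (intro sum.cong refl) (simp add: T1)
    also have "\<dots> = (\<Sum>t\<in>T. ?tmul t)" using T T2 by (intro sum.mono_neutral_left) auto
    finally show "\<Delta> k p m q r s (mc k p m q (X \<boxtimes> Y) ?V ?W) = (\<Sum>t\<in>T. ?tmul t)" .
  qed
qed

lemma comul_mul_large:
  assumes f: "f \<in> A k l m n" and g: "g \<in> A l p n q"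
  shows "\<exists>T0. finite T0 \<and> (\<forall>T. finite T \<longrightarrow> T0 \<subseteq> T \<longrightarrow>
    \<Delta> k p m q r s (M k l p m n q f g) = (\<Sum>t\<in>T. tmul k l p m n q r t s (\<Delta> k l m n r t f) (\<Delta> l p n q t s g)))"
  using f
proof (induction f rule: A_induct)
  case zero
  show ?case by (simp add: mul_zero(2)[OF g] comul_zero tmul_zero(1)[OF comul_in[OF g]] exI[of _ "{}"])
next
  case (add f f')
  then obtain T0 T1 where T: "finite T0" "finite T1"
    "\<And>T. finite T \<Longrightarrow> T0 \<subseteq> T \<Longrightarrow> \<Delta> k p m q r s (M k l p m n q f g) = (\<Sum>t\<in>T. tmul k l p m n q r t s (\<Delta> k l m n r t f) (\<Delta> l p n q t s g))"
    "\<And>T. finite T \<Longrightarrow> T1 \<subseteq> T \<Longrightarrow> \<Delta> k p m q r s (M k l p m n q f' g) = (\<Sum>t\<in>T. tmul k l p m n q r t s (\<Delta> k l m n r t f') (\<Delta> l p n q t s g))"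
    by blast
  show ?case
  proof (intro exI[of _ "T0 \<union> T1"] conjI allI impI)
    fix T assume "finite T" "T0 \<union> T1 \<subseteq> T"
    then show "\<Delta> k p m q r s (M k l p m n q (f + f') g) = (\<Sum>t\<in>T. tmul k l p m n q r t s (\<Delta> k l m n r t (f + f')) (\<Delta> l p n q t s g))"
      using T(3)[of T] T(4)[of T] by (simp add: linear_on_add[OF mul_lin(2)[OF g] add(1,2)]
          linear_on_add[OF comul_lin mul_in[OF add(1) g] mul_in[OF add(2) g]] linear_on_add[OF comul_lin add(1,2)]
          tmul_add_left[OF comul_in[OF add(1)] comul_in[OF add(2)] comul_in[OF g]] sum.distrib)
  qed (use T in simp)
next
  case (mc a v w)
  note m1 = mc and f = mc_in[OF mc]
  show ?case using g
  proof (induction g rule: A_induct)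
    case zero
    show ?case by (simp add: mul_zero(1)[OF f] comul_zero tmul_zero(2)[OF comul_in[OF f]] exI[of _ "{}"])
  next
    case (add g g')
    let ?f = "local.mc k l m n (u a) v w"
    obtain T0 T1 where T: "finite T0" "finite T1"
      "\<And>T. finite T \<Longrightarrow> T0 \<subseteq> T \<Longrightarrow> \<Delta> k p m q r s (M k l p m n q ?f g) = (\<Sum>t\<in>T. tmul k l p m n q r t s (\<Delta> k l m n r t ?f) (\<Delta> l p n q t s g))"
      "\<And>T. finite T \<Longrightarrow> T1 \<subseteq> T \<Longrightarrow> \<Delta> k p m q r s (M k l p m n q ?f g') = (\<Sum>t\<in>T. tmul k l p m n q r t s (\<Delta> k l m n r t ?f) (\<Delta> l p n q t s g'))"
      using add(3,4) by blast
    show ?case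
    proof (intro exI[of _ "T0 \<union> T1"] conjI allI impI)
      fix T assume "finite T" "T0 \<union> T1 \<subseteq> T"
      then show "\<Delta> k p m q r s (M k l p m n q ?f (g + g')) = (\<Sum>t\<in>T. tmul k l p m n q r t s (\<Delta> k l m n r t ?f) (\<Delta> l p n q t s (g + g')))"
        using T(3)[of T] T(4)[of T] by (simp add: linear_on_add[OF mul_lin(1)[OF f] add(1,2)]
            linear_on_add[OF comul_lin mul_in[OF f add(1)] mul_in[OF f add(2)]] linear_on_add[OF comul_lin add(1,2)]
            tmul_add_right[OF comul_in[OF f] comul_in[OF add(1)] comul_in[OF add(2)]] sum.distrib)
    qed (use T in simp)
  next
    case (mc b v' w')
    show ?case unfolding mul_mc[OF m1(1,2) mc(2) m1(3) mc(3) m1(4,5) mc(4,5)]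
      by (rule comul_mul_mc[OF m1(1,2) mc(2) m1(3,4,5) mc(3,4,5)])
  qed
qed

lemma comul_mul_A:
  assumes f: "f \<in> A k l m n" and g: "g \<in> A l p n q"
  shows "\<Delta> k p m q r s (M k l p m n q f g) =
    (\<Sum>t | \<Delta> k l m n r t f \<noteq> 0 \<and> \<Delta> l p n q t s g \<noteq> 0. tmul k l p m n q r t s (\<Delta> k l m n r t f) (\<Delta> l p n q t s g))"
proof -
  from comul_mul_large[OF f g] obtain T0 where T0': "finite T0 \<and> (\<forall>T. finite T \<longrightarrow> T0 \<subseteq> T \<longrightarrow>
    \<Delta> k p m q r s (M k l p m n q f g) = (\<Sum>t\<in>T. tmul k l p m n q r t s (\<Delta> k l m n r t f) (\<Delta> l p n q t s g)))"
    by (rule exE)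
  note T0 = conjunct1[OF T0'] conjunct2[OF T0', rule_format]
  let ?S = "{t. \<Delta> k l m n r t f \<noteq> 0 \<and> \<Delta> l p n q t s g \<noteq> 0}"
  have "finite {t \<in> UNIV. \<Delta> k l m n r t f \<noteq> 0}" using comul_rcf_A[OF f] by (auto simp: rcf_on_def)
  then have S: "finite ?S" by (rule rev_finite_subset) auto
  have "\<Delta> k p m q r s (M k l p m n q f g) = (\<Sum>t\<in>T0 \<union> ?S. tmul k l p m n q r t s (\<Delta> k l m n r t f) (\<Delta> l p n q t s g))"
    using T0(1) S by (intro T0(2)) auto
  also have "\<dots> = (\<Sum>t\<in>?S. tmul k l p m n q r t s (\<Delta> k l m n r t f) (\<Delta> l p n q t s g))"
    using T0(1) S tmul_zero(1)[OF comul_in[OF g]] tmul_zero(2)[OF comul_in[OF f]]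
    by (intro sum.mono_neutral_right) auto
  finally show ?thesis .
qed

abbreviation R where "R \<equiv> reconstruction C \<phi> F u"

lemma R_simps:
  "sp R = A" "mul R = M" "one R = oneA" "comul R = \<Delta>" "counit R = \<epsilon>"
  "invol R = inv"
  by (simp_all add: reconstruction_def)

lemma counit0_mul:
  "f \<in> A k l m n \<Longrightarrow> g \<in> A l p n q \<Longrightarrow>
    counit0 R k p m q (M k l p m n q f g) = counit0 R k l m n f * counit0 R l p n q g"
  unfolding counit0_def R_simps by (rule counit_mul_A)

lemma reconstruction_bialgebra: "partial_bialgebra R"
  by unfold_locales
    (simp_all add: R_simps A_subspace mul_in mul_bilinear mul_assoc_A one_in one_mul_A mul_one_A
      comul_in comul_lin coassoc_A counit_lin counit_left_A counit_right_A comul_one_A counit_one_A comul_rcf_A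
      comul_mul_A tensor_mul_def counit0_mul)

section \<open>The antipode\<close>

definition S :: "'i \<Rightarrow> 'i \<Rightarrow> 'i \<Rightarrow> 'i \<Rightarrow> ('a, 'v) rec_elem \<Rightarrow> ('a, 'v) rec_elem" where
  "S k l m n f = (THE h. h \<in> A n m l k \<and>
     (\<forall>x\<in>Nat l k n m. rec_pair u h x = rec_pair u f (Shat n m l k x)))"

lemma S_mc_pair:
  assumes km: "\<phi> k = \<phi> m" and ln: "\<phi> l = \<phi> n" and X: "X \<in> Ob k l" and v: "v \<in> H k l X" and w: "w \<in> H m n X"
  shows "mc n m l k (ldual C X) (Jd m n X w) (J k l X v) \<in> A n m l k"
    and "x \<in> Nat l k n m \<Longrightarrow> rec_pair u (mc n m l k (ldual C X) (Jd m n X w) (J k l X v)) x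
      = rec_pair u (mc k l m n X v w) (Shat n m l k x)"
proof -
  note Xm = Ob_mn[OF km ln X] note X' = ldual_obj[OF X] and Xm' = ldual_obj[OF Xm]
  note d = Jd_in[OF Xm w] and j = J_in[OF X v]
  show "mc n m l k (ldual C X) (Jd m n X w) (J k l X v) \<in> A n m l k"
    by (rule mc_in[OF ln[symmetric] km[symmetric] Xm' d j])
  show "rec_pair u (mc n m l k (ldual C X) (Jd m n X w) (J k l X v)) x
      = rec_pair u (mc k l m n X v w) (Shat n m l k x)" if x: "x \<in> Nat l k n m" for x
    unfolding mc_pair[OF ln[symmetric] km[symmetric] Xm' d j x] mc_pair[OF km ln X v w antipode_nat[OF x]]
      antipode_ip[OF x Xm w v] by (rule Jd_ip[OF Xm w nat_vec[OF x Xm' j]])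
qed

lemma S_ex:
  assumes f: "f \<in> A k l m n"
  shows "\<exists>h\<in>A n m l k. \<forall>x\<in>Nat l k n m. rec_pair u h x = rec_pair u f (Shat n m l k x)"
  using f
proof (induction f rule: A_induct)
  case zero
  show ?case by (rule bexI[OF _ A_zero]) (simp add: rec_pair_zero)
next
  case (add f g)
  then obtain h h' where "h \<in> A n m l k" "\<forall>x\<in>Nat l k n m. rec_pair u h x = rec_pair u f (Shat n m l k x)"
    "h' \<in> A n m l k" "\<forall>x\<in>Nat l k n m. rec_pair u h' x = rec_pair u g (Shat n m l k x)" by blast
  then show ?case using add(1,2)
    by (intro bexI[of _ "h + h'"] ballI) (simp_all add: rec_pair_add A_add)
next
  case (mc a v w)
  show ?case using S_mc_pair[OF mc] by blast
qed

lemma S_in: "f \<in> A k l m n \<Longrightarrow> S k l m n f \<in> A n m l k"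
  and S_pair: "f \<in> A k l m n \<Longrightarrow> x \<in> Nat l k n m \<Longrightarrow>
    rec_pair u (S k l m n f) x = rec_pair u f (Shat n m l k x)"
proof -
  assume "f \<in> A k l m n"
  then obtain h where h: "h \<in> A n m l k"
    "\<And>x. x \<in> Nat l k n m \<Longrightarrow> rec_pair u h x = rec_pair u f (Shat n m l k x)"
    using S_ex by blast
  have "S k l m n f = h" unfolding S_def by (rule the_A[OF h])
  then show "S k l m n f \<in> A n m l k" "x \<in> Nat l k n m \<Longrightarrow>
    rec_pair u (S k l m n f) x = rec_pair u f (Shat n m l k x)" using h by auto
qed

lemma S_mc:
  assumes "\<phi> k = \<phi> m" "\<phi> l = \<phi> n" "X \<in> Ob k l" "v \<in> H k l X" "w \<in> H m n X"
  shows "S k l m n (mc k l m n X v w) = mc n m l k (ldual C X) (Jd m n X w) (J k l X v)"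
  unfolding S_def by (rule the_A[OF S_mc_pair[OF assms]])

lemma S_lin: "linear_on (A k l m n) (S k l m n)"
  unfolding linear_on_def
proof (intro conjI ballI allI)
  fix f assume f: "f \<in> A k l m n"
  { fix g assume g: "g \<in> A k l m n"
    show "S k l m n (f + g) = S k l m n f + S k l m n g"
      by (rule A_eqI[of _ n m l k]) (simp_all add: S_in f g A_add S_pair
          rec_pair_add[OF S_in[OF f] S_in[OF g]] rec_pair_add[OF f g]) }
  show "S k l m n (c *\<^sub>C f) = c *\<^sub>C S k l m n f" for c
    by (rule A_eqI[of _ n m l k]) (simp_all add: S_in f A_scale S_pair
        rec_pair_scale[OF S_in[OF f]] rec_pair_scale[OF f])
qed

text \<open>
  The convolution products \<open>id * S\<close> and \<open>S * id\<close>, one summand at a time.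
\<close>

abbreviation conv_id_S where
  "conv_id_S k l m r s f \<equiv> tlift (A k l r s) (A r s m l) (\<lambda>b c. M k l m r s r b (S r s m l c)) (\<Delta> k l m l r s f)"
abbreviation conv_S_id where
  "conv_S_id k l n r s f \<equiv> tlift (A k l r s) (A r s k n) (\<lambda>b c. M s r s l k n (S k l r s b) c) (\<Delta> k l k n r s f)"

lemma conv_id_S_balanced: "balanced_on (A k l r s) (A r s m l) (\<lambda>b c. M k l m r s r b (S r s m l c))"
  unfolding balanced_on_def
  by (simp add: linear_on_add[OF mul_lin(2)] linear_on_scale[OF mul_lin(2)] linear_on_add[OF mul_lin(1)]
      linear_on_scale[OF mul_lin(1)] linear_on_add[OF S_lin] linear_on_scale[OF S_lin] S_in)

lemma conv_S_id_balanced: "balanced_on (A k l r s) (A r s k n) (\<lambda>b c. M s r s l k n (S k l r s b) c)"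
  unfolding balanced_on_def
  by (simp add: linear_on_add[OF mul_lin(2)] linear_on_scale[OF mul_lin(2)] linear_on_add[OF mul_lin(1)]
      linear_on_scale[OF mul_lin(1)] linear_on_add[OF S_lin] linear_on_scale[OF S_lin] S_in)

text \<open>
  Both antipode identities contract a coefficient against the dual object. The first one produces
  the coevaluation vector as a sum over all intermediate indices, which then moves to the unit
  object by naturality; the second one does the same with the adjoint of the evaluation.
\<close>

lemma conv_id_S_mc:
  assumes km: "\<phi> k = \<phi> m" and X: "X \<in> Ob k l" and v: "v \<in> H k l X" and w: "w \<in> H m l X"
  shows "\<exists>T0. finite T0 \<and> (\<forall>T. finite T \<longrightarrow> T0 \<subseteq> T \<longrightarrow>
    (\<Sum>s\<in>T. conv_id_S k l m r s (mc k l m l X v w)) = (if k = m then \<epsilon> k l (mc k l m l X v w) *\<^sub>C oneA k r else 0))"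
proof (cases "\<phi> k = \<phi> r")
  case False
  then have "\<Delta> k l m l r s (mc k l m l X v w) = 0" for s by (intro comul_off[OF mc_in[OF km refl X v w]]) auto
  then have "conv_id_S k l m r s (mc k l m l X v w) = 0" for s using tlift_zero[OF A_subspace A_subspace conv_id_S_balanced] by simp
  then show ?thesis using rec_one_off[OF False] by (intro exI[of _ "{}"]) auto
next
  case kr: True
  then have rm: "\<phi> r = \<phi> m" and mr: "\<phi> m = \<phi> r" using km by auto
  note Xm = Ob_mn[OF km refl X] note X' = ldual_obj[OF X] and Xm' = ldual_obj[OF Xm]
  have Xr: "X \<in> obj C (\<phi> r) (\<phi> l)" using X kr by simp
  note Xr' = ldual_obj[OF Xr]
  note d = Jd_in[OF Xm w] note V = io_in[OF X Xm' v d]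
  note XX = tob_Ob[OF X Xm'] and XXr = tob_obj[OF Xr Xr']
  let ?V = "io k l m X (ldual C X) v (Jd m l X w)" and ?M = "fibre_indices r X (\<phi> l)"
  let ?mc = "mc k m r r (X \<boxtimes> ldual C X) ?V"
  have D0: "\<Delta> k l m l r s (mc k l m l X v w) = 0" if "\<phi> s \<noteq> \<phi> l" for s
    using that by (intro comul_off[OF mc_in[OF km refl X v w]]) auto
  have i: "io r s r X (ldual C X) e (J r s X e) \<in> H r r (X \<boxtimes> ldual C X)" if s: "\<phi> s = \<phi> l" and e: "e \<in> ONB r s X" for s e
  proof -
    have o: "X \<in> Ob r s" "ldual C X \<in> Ob s r" using Xr Xr' s by auto
    note e' = onb_in[OF fd[OF o(1)] e]
    show ?thesis by (rule io_in[OF o e' J_in[OF o(1) e']])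
  qed
  have T1: "conv_id_S k l m r s (mc k l m l X v w) = (\<Sum>e\<in>ONB r s X. ?mc (io r s r X (ldual C X) e (J r s X e)))"
    if s: "\<phi> s = \<phi> l" for s
  proof -
    have ls: "\<phi> l = \<phi> s" and o: "X \<in> Ob r s" "ldual C X \<in> Ob s r" using Xr Xr' s by auto
    note oi = onb_in[OF fd[OF o(1)]]
    show ?thesis unfolding comul_mc[OF km refl kr ls X v w]
      using oi mc_in[OF kr ls X v] mc_in[OF rm s o(1) _ w] J_in[OF o(1)]
      by (subst tlift_sum_tens[OF A_subspace A_subspace conv_id_S_balanced])
        (auto simp: S_mc[OF rm s o(1) _ w] mul_mc[OF kr ls mr X Xm' v _ d] intro!: sum.cong)
  qed
  have T2: "conv_id_S k l m r s (mc k l m l X v w) = 0" if "s \<notin> ?M" for s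
  proof (cases "\<phi> s = \<phi> l")
    case True
    then show ?thesis using T1[OF True] fibre_indices_off[OF Xr Xr' that True] by simp
  qed (simp add: D0 tlift_zero[OF A_subspace A_subspace conv_id_S_balanced])
  \<comment> \<open>Summed over \<open>s\<close>, the second vectors are the components of the coevaluation vector.\<close>
  have "(\<Sum>s\<in>?M. conv_id_S k l m r s (mc k l m l X v w)) = ?mc (coev_vec r X)"
  proof -
    have "(\<Sum>s\<in>?M. conv_id_S k l m r s (mc k l m l X v w))
      = (\<Sum>s\<in>?M. ?mc (\<Sum>e\<in>ONB r s X. io r s r X (ldual C X) e (J r s X e)))"
      using i fibre_indices_phi[OF Xr Xr'] by (intro sum.cong refl) (simp add: T1 mc_sum_right[OF kr mr XX V])
    also have "\<dots> = ?mc (\<Sum>s\<in>?M. \<Sum>e\<in>ONB r s X. io r s r X (ldual C X) e (J r s X e))"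
      using i fibre_indices_phi[OF Xr Xr'] by (intro mc_sum_right[OF kr mr XX V, symmetric] fdh_sum[OF fd[OF XXr]]) auto
    finally show ?thesis by (simp add: coev_vec_expand[OF Xr])
  qed
  also have "\<dots> = (if k = m then \<epsilon> k l (mc k l m l X v w) *\<^sub>C oneA k r else 0)"
  proof -
    have ur: "un r = un k" "un k = un m" using kr km by auto
    note o = un_Ob'[OF km]
    have c: "coev C X \<in> hom C (un k) (X \<boxtimes> ldual C X)" using coev_hom[OF X] .
    note dc = hom_dag[OF o XX c]
    let ?z = "Fmo F k m (X \<boxtimes> ldual C X) (un k) (dag C (coev C X)) ?V"
    have z: "?z \<in> H k m (un k)" by (rule Fmo_in[OF XX o dc V])
    have mr': "mu r \<in> H r r (un k)" using mu_in[of r] ur by simp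
    have e: "?mc (coev_vec r X) = mc k m r r (un k) ?z (mu r)"
      unfolding coev_vec_def ur(1) by (rule mc_natural[OF kr mr o XX c V mr', symmetric])
    show ?thesis
    proof (cases "k = m")
      case False
      then have "?z = 0" using un_off(1)[OF False km z] by simp
      then show ?thesis using e False mc_zero_left[OF kr mr o mr'] by simp
    next
      case True
      note w' = w[folded True] note d' = Jd_in[OF X w'] and j = J_in[OF X v]
      have b: "bform (dag C (coev C X)) X (ldual C X) l k v (Jd k l X w) = cnj (pr k l X v w)"
        unfolding bform_dag_coev[OF X v d'] ip_cnj[OF fd[OF X'] d' j, symmetric] Jd_ip[OF X w' j] ev_J[OF X v w'] ..
      have zz: "?z = cnj (pr k l X v w) *\<^sub>C mu k"
        using bform_vec[OF X' X hom_dag[OF un_Ob tob_Ob[OF X X'] c] v d'] b True by simp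
      have mk: "mu k \<in> H k m (un k)" using mu_in[of k] True by simp
      have "?mc (coev_vec r X) = pr k l X v w *\<^sub>C mc k m r r (un k) (mu k) (mu r)"
        unfolding e zz mc_scale_left[OF kr mr o mk mr'] by simp
      moreover have "mc k m r r (un k) (mu k) (mu r) = oneA k r"
        using rec_one_mc[OF kr] True by simp
      ultimately show ?thesis using True counit_mc[OF X v w'] by simp
    qed
  qed
  finally have fin: "(\<Sum>s\<in>?M. conv_id_S k l m r s (mc k l m l X v w)) = \<dots>" .
  show ?thesis
  proof (intro exI[of _ ?M] conjI allI impI)
    show "finite ?M" by (rule fibre_indices_finite[OF Xr Xr'])
    fix T assume T: "finite T" "?M \<subseteq> T"
    have "(\<Sum>s\<in>T. conv_id_S k l m r s (mc k l m l X v w)) = (\<Sum>s\<in>?M. conv_id_S k l m r s (mc k l m l X v w))"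
      using T T2 by (intro sum.mono_neutral_right) auto
    then show "(\<Sum>s\<in>T. conv_id_S k l m r s (mc k l m l X v w)) = (if k = m then \<epsilon> k l (mc k l m l X v w) *\<^sub>C oneA k r else 0)"
      using fin by simp
  qed
qed

lemma conv_S_id_mc:
  assumes ln: "\<phi> l = \<phi> n" and X: "X \<in> Ob k l" and v: "v \<in> H k l X" and w: "w \<in> H k n X"
  shows "\<exists>T0. finite T0 \<and> (\<forall>T. finite T \<longrightarrow> T0 \<subseteq> T \<longrightarrow>
    (\<Sum>r\<in>T. conv_S_id k l n r s (mc k l k n X v w)) = (if l = n then \<epsilon> k l (mc k l k n X v w) *\<^sub>C oneA s n else 0))"
proof (cases "\<phi> l = \<phi> s")
  case False
  then have "\<Delta> k l k n r s (mc k l k n X v w) = 0" for r by (intro comul_off[OF mc_in[OF refl ln X v w]]) auto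
  then have "conv_S_id k l n r s (mc k l k n X v w) = 0" for r using tlift_zero[OF A_subspace A_subspace conv_S_id_balanced] by simp
  moreover have "\<phi> s \<noteq> \<phi> n" using False ln by simp
  ultimately show ?thesis by (intro exI[of _ "{}"]) (simp add: rec_one_off)
next
  case ls: True
  then have sl: "\<phi> s = \<phi> l" and sn: "\<phi> s = \<phi> n" using ln by auto
  note Xn = Ob_mn[OF refl ln X] note X' = ldual_obj[OF X]
  have Xs: "X \<in> obj C (\<phi> k) (\<phi> s)" using X ls by simp
  note Xs' = ldual_obj[OF Xs]
  note j = J_in[OF X v] note W = io_in[OF X' Xn j w]
  note XXs = tob_obj[OF Xs' Xs]
  let ?W = "io l k n (ldual C X) X (J k l X v) w" and ?M = "{r \<in> \<phi> -` {\<phi> k}. H r s X \<noteq> {0}}"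
  let ?mc = "\<lambda>z. mc s s l n (ldual C X \<boxtimes> X) z ?W"
  have finM: "finite ?M" using Fob_rcf[OF Xs] unfolding rcf_on_def by blast
  have D0: "\<Delta> k l k n r s (mc k l k n X v w) = 0" if "\<phi> r \<noteq> \<phi> k" for r
    using that by (intro comul_off[OF mc_in[OF refl ln X v w]]) auto
  have o: "X \<in> Ob r s" "ldual C X \<in> Ob s r" if "\<phi> r = \<phi> k" for r using Xs Xs' that by auto
  have dd: "Jd r s X e \<in> H s r (ldual C X)" "e \<in> H r s X"
    "io s r s (ldual C X) X (Jd r s X e) e \<in> H s s (ldual C X \<boxtimes> X)" if r: "\<phi> r = \<phi> k" and e: "e \<in> ONB r s X" for r e
  proof -
    note e' = onb_in[OF fd[OF o(1)[OF r]] e]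
    note d = Jd_in[OF o(1)[OF r] e']
    show "Jd r s X e \<in> H s r (ldual C X)" "e \<in> H r s X"
      "io s r s (ldual C X) X (Jd r s X e) e \<in> H s s (ldual C X \<boxtimes> X)"
      using d e' io_in[OF o(2,1)[OF r] d e'] .
  qed
  have T1: "conv_S_id k l n r s (mc k l k n X v w) = (\<Sum>e\<in>ONB r s X. ?mc (io s r s (ldual C X) X (Jd r s X e) e))"
    if r: "\<phi> r = \<phi> k" for r
  proof -
    note oo = o[OF r]
    note oi = onb_in[OF fd[OF oo(1)]]
    show ?thesis unfolding comul_mc[OF refl ln r[symmetric] ls X v w]
      using oi mc_in[OF r[symmetric] ls X v] mc_in[OF r sn oo(1) _ w] Jd_in[OF oo(1)]
      by (subst tlift_sum_tens[OF A_subspace A_subspace conv_S_id_balanced])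
        (auto simp: S_mc[OF r[symmetric] ls X v] mul_mc[OF sl r sn oo(2,1) _ j _ w] intro!: sum.cong)
  qed
  have T2: "conv_S_id k l n r s (mc k l k n X v w) = 0" if "r \<notin> ?M" for r
  proof (cases "\<phi> r = \<phi> k")
    case True
    then have "ONB r s X = {}" using that by (intro onb_trivial[OF fd[OF o(1)[OF True]]]) auto
    then show ?thesis using T1[OF True] by simp
  qed (simp add: D0 tlift_zero[OF A_subspace A_subspace conv_S_id_balanced])
  let ?D = "\<Sum>r\<in>?M. \<Sum>e\<in>ONB r s X. io s r s (ldual C X) X (Jd r s X e) e"
  note FXX = fd[OF XXs]
  note evs = ev_hom[OF Xs] note devs = hom_dag[OF XXs un_Ob evs]
  note mue = Fmo_in[OF un_Ob XXs devs mu_in]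
  have Din: "(\<Sum>e\<in>ONB r s X. io s r s (ldual C X) X (Jd r s X e) e) \<in> H s s (ldual C X \<boxtimes> X)" if "r \<in> ?M" for r
    using dd that by (intro fdh_sum[OF FXX]) auto
  \<comment> \<open>The first vectors add up to the adjoint of the evaluation, applied to the unit vector.\<close>
  have D: "?D = Fmo F s s (un s) (ldual C X \<boxtimes> X) (dag C (ev C X)) (mu s)"
  proof (rule ip_eqI[OF FXX _ mue])
    show D': "?D \<in> H s s (ldual C X \<boxtimes> X)" by (rule fdh_sum[OF FXX Din])
    fix \<xi> assume xi: "\<xi> \<in> H s s (ldual C X \<boxtimes> X)"
    from xi have "pr s s (ldual C X \<boxtimes> X) ?D \<xi> = pr s s (ldual C X \<boxtimes> X) (Fmo F s s (un s) (ldual C X \<boxtimes> X) (dag C (ev C X)) (mu s)) \<xi>"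
    proof (induction rule: io_induct[OF Xs' Xs, consumes 1, case_names zero add io])
      case zero
      show ?case unfolding ip_zero_right[OF FXX D'] ip_zero_right[OF FXX mue] ..
    next
      case (add a b)
      then show ?case
        unfolding ip_add_right[OF FXX D' add(1,2)] ip_add_right[OF FXX mue add(1,2)] by (simp only:)
    next
      case (io r' z y)
      note r' = io(1) note oo = o[OF r'] note i = io_in[OF oo(2,1) io(2,3)]
      have "pr s s (ldual C X \<boxtimes> X) ?D (io s r' s (ldual C X) X z y)
        = (\<Sum>r\<in>?M. \<Sum>e\<in>ONB r s X. pr s s (ldual C X \<boxtimes> X) (io s r s (ldual C X) X (Jd r s X e) e) (io s r' s (ldual C X) X z y))"
      proof -
        have "pr s s (ldual C X \<boxtimes> X) ?D (io s r' s (ldual C X) X z y)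
          = (\<Sum>r\<in>?M. pr s s (ldual C X \<boxtimes> X) (\<Sum>e\<in>ONB r s X. io s r s (ldual C X) X (Jd r s X e) e) (io s r' s (ldual C X) X z y))"
          by (rule ip_sum_left[OF FXX i]) (rule Din)
        also have "\<dots> = (\<Sum>r\<in>?M. \<Sum>e\<in>ONB r s X. pr s s (ldual C X \<boxtimes> X) (io s r s (ldual C X) X (Jd r s X e) e) (io s r' s (ldual C X) X z y))"
          using dd by (intro sum.cong refl ip_sum_left[OF FXX i]) auto
        finally show ?thesis .
      qed
      also have "\<dots> = (\<Sum>r\<in>?M. if r = r' then \<Sum>e\<in>ONB r s X. ev_form X r s z e * pr r s X e y else 0)"
      proof (intro sum.cong refl)
        fix r assume "r \<in> ?M"
        then have r: "\<phi> r = \<phi> k" by simp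
        show "(\<Sum>e\<in>ONB r s X. pr s s (ldual C X \<boxtimes> X) (io s r s (ldual C X) X (Jd r s X e) e) (io s r' s (ldual C X) X z y))
          = (if r = r' then \<Sum>e\<in>ONB r s X. ev_form X r s z e * pr r s X e y else 0)"
        proof (cases "r = r'")
          case True
          then show ?thesis using io dd(1,2)[OF r] io_ip[OF o(2,1)[OF r]] Jd_ip[OF o(1)[OF r]] by simp
        next
          case False
          then show ?thesis using io_orth[OF Xs' Xs r r' False dd(1,2)[OF r] io(2,3)] by simp
        qed
      qed
      also have "\<dots> = (\<Sum>e\<in>ONB r' s X. ev_form X r' s z e * pr r' s X e y)"
        using finM r' onb_trivial[OF fd[OF oo(1)]] by simp
      also have "\<dots> = (\<Sum>e\<in>ONB r' s X. ev_form X r' s z (pr r' s X e y *\<^sub>C e))"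
        using onb_in[OF fd[OF oo(1)]] linear_on_scale[OF bform_lin(1)[OF oo evs io(2)]]
        by (intro sum.cong refl) (simp add: scaleC_complex_def mult.commute)
      also have "\<dots> = ev_form X r' s z (\<Sum>e\<in>ONB r' s X. pr r' s X e y *\<^sub>C e)"
        using onb_in[OF fd[OF oo(1)]] fdh_scale[OF fd[OF oo(1)]]
        by (intro linear_on_sum[OF bform_lin(1)[OF oo evs io(2)] fdh_subspace[OF fd[OF oo(1)]], symmetric]) auto
      also have "\<dots> = ev_form X r' s z y" by (simp add: onb_expand[OF fd[OF oo(1)] io(3)])
      also have "\<dots> = pr s s (ldual C X \<boxtimes> X) (Fmo F s s (un s) (ldual C X \<boxtimes> X) (dag C (ev C X)) (mu s)) (io s r' s (ldual C X) X z y)"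
        unfolding bform_def by (rule Fmo_dag_ip[OF XXs un_Ob evs i mu_in, symmetric])
      finally show ?case .
    qed
    then show "pr s s (ldual C X \<boxtimes> X) \<xi> ?D = pr s s (ldual C X \<boxtimes> X) \<xi> (Fmo F s s (un s) (ldual C X \<boxtimes> X) (dag C (ev C X)) (mu s))"
      using ip_cnj[OF FXX D' xi] ip_cnj[OF FXX mue xi] by simp
  qed
  have "(\<Sum>r\<in>?M. conv_S_id k l n r s (mc k l k n X v w)) = ?mc ?D"
  proof -
    have "(\<Sum>r\<in>?M. conv_S_id k l n r s (mc k l k n X v w))
      = (\<Sum>r\<in>?M. ?mc (\<Sum>e\<in>ONB r s X. io s r s (ldual C X) X (Jd r s X e) e))"
      using dd by (intro sum.cong refl) (simp add: T1 mc_sum_left[OF sl sn XXs W])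
    also have "\<dots> = ?mc ?D" by (rule mc_sum_left[OF sl sn XXs W Din, symmetric])
    finally show ?thesis .
  qed
  also have "\<dots> = (if l = n then \<epsilon> k l (mc k l k n X v w) *\<^sub>C oneA s n else 0)"
  proof -
    note o1 = tob_Ob[OF X' Xn]
    have un': "un s = un n" "un s = un l" using sl sn by auto
    have os: "un s \<in> Ob s s" by (rule un_Ob)
    let ?z = "Fmo F l n (ldual C X \<boxtimes> X) (un s) (ev C X) ?W"
    have e: "?mc ?D = mc s s l n (un s) (mu s) ?z"
      unfolding D by (rule mc_natural[OF sl sn XXs os evs mu_in W])
    show ?thesis
    proof (cases "l = n")
      case False
      have "ev C X \<in> hom C (ldual C X \<boxtimes> X) (un n)" using evs un' by simp
      from bform_off[OF Xn X' this ln[symmetric] _ j w] False have "?z = 0" by (simp add: un')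
      then show ?thesis using e False mc_zero_right[OF sl sn os mu_in] by simp
    next
      case True
      note w' = w[folded True]
      have zz: "?z = pr k l X v w *\<^sub>C mu l"
        using bform_vec[OF X X' ev_hom[OF X] j w'] ev_J[OF X v w'] True un' by simp
      have ml: "mu l \<in> H l n (un s)" using mu_in'[OF sl] True by simp
      have "?mc ?D = pr k l X v w *\<^sub>C mc s s l n (un s) (mu s) (mu l)"
        unfolding e zz by (rule mc_scale_right[OF sl sn os mu_in ml])
      moreover have "mc s s l n (un s) (mu s) (mu l) = oneA s n"
        using rec_one_mc[OF sn] True by simp
      ultimately show ?thesis using True counit_mc[OF X v w'] by (simp only: if_True simp_thms)
    qed
  qed
  finally have fin: "(\<Sum>r\<in>?M. conv_S_id k l n r s (mc k l k n X v w)) = \<dots>" .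
  show ?thesis
  proof (intro exI[of _ ?M] conjI allI impI)
    show "finite ?M" by (rule finM)
    fix T assume T: "finite T" "?M \<subseteq> T"
    have "(\<Sum>r\<in>T. conv_S_id k l n r s (mc k l k n X v w)) = (\<Sum>r\<in>?M. conv_S_id k l n r s (mc k l k n X v w))"
      using T T2 by (intro sum.mono_neutral_right) auto
    then show "(\<Sum>r\<in>T. conv_S_id k l n r s (mc k l k n X v w)) = (if l = n then \<epsilon> k l (mc k l k n X v w) *\<^sub>C oneA s n else 0)"
      using fin by simp
  qed
qed

text \<open>Passage from matrix coefficients to sums, for a family of additive maps that vanish with the comultiplication.\<close>

lemma large_sum_induct:
  assumes f: "f \<in> A k l m n"
    and G: "\<And>t f g. f \<in> A k l m n \<Longrightarrow> g \<in> A k l m n \<Longrightarrow> G t (f + g) = G t f + G t g" "\<And>t. G t 0 = 0"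
    and R: "\<And>f g. f \<in> A k l m n \<Longrightarrow> g \<in> A k l m n \<Longrightarrow> rhs (f + g) = rhs f + rhs g" "rhs 0 = 0"
    and mc: "\<And>a v w. \<phi> k = \<phi> m \<Longrightarrow> \<phi> l = \<phi> n \<Longrightarrow> u a \<in> Ob k l \<Longrightarrow> v \<in> H k l (u a) \<Longrightarrow> w \<in> H m n (u a) \<Longrightarrow>
      \<exists>T0. finite T0 \<and> (\<forall>T. finite T \<longrightarrow> T0 \<subseteq> T \<longrightarrow> (\<Sum>t\<in>T. G t (mc k l m n (u a) v w)) = rhs (mc k l m n (u a) v w))"
    and S: "finite S0" "\<And>t. t \<notin> S0 \<Longrightarrow> G t f = (0 :: 'z::comm_monoid_add)"
  shows "(\<Sum>t\<in>S0. G t f) = rhs f"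
proof -
  have "\<exists>T0. finite T0 \<and> (\<forall>T. finite T \<longrightarrow> T0 \<subseteq> T \<longrightarrow> (\<Sum>t\<in>T. G t f) = rhs f)"
    using f
  proof (induction f rule: A_induct)
    case zero
    show ?case by (intro exI[of _ "{}"]) (simp add: G(2) R(2))
  next
    case (add f g)
    from add(3,4) obtain T0 T1 where T: "finite T0 \<and> (\<forall>T. finite T \<longrightarrow> T0 \<subseteq> T \<longrightarrow> (\<Sum>t\<in>T. G t f) = rhs f)"
      "finite T1 \<and> (\<forall>T. finite T \<longrightarrow> T1 \<subseteq> T \<longrightarrow> (\<Sum>t\<in>T. G t g) = rhs g)" by (elim exE)
    show ?case
    proof (intro exI[of _ "T0 \<union> T1"] conjI allI impI)
      fix T assume "finite T" "T0 \<union> T1 \<subseteq> T"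
      then show "(\<Sum>t\<in>T. G t (f + g)) = rhs (f + g)"
        using T by (simp add: G(1)[OF add(1,2)] R(1)[OF add(1,2)] sum.distrib)
    qed (use T in simp)
  next
    case (mc a v w)
    then show ?case by (rule assms(6))
  qed
  then obtain T0 where T0: "finite T0 \<and> (\<forall>T. finite T \<longrightarrow> T0 \<subseteq> T \<longrightarrow> (\<Sum>t\<in>T. G t f) = rhs f)" by (rule exE)
  have "(\<Sum>t\<in>S0. G t f) = (\<Sum>t\<in>T0 \<union> S0. G t f)"
    using S T0 by (intro sum.mono_neutral_left) auto
  also have "\<dots> = rhs f" using T0 S(1) by simp
  finally show ?thesis .
qed

lemma antipode1_A:
  assumes f: "f \<in> A k l m l"
  shows "(\<Sum>s | \<Delta> k l m l r s f \<noteq> 0. conv_id_S k l m r s f) = (if k = m then \<epsilon> k l f *\<^sub>C oneA k r else 0)"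
proof (rule large_sum_induct[OF f, where G = "conv_id_S k l m r" and rhs = "\<lambda>f. if k = m then \<epsilon> k l f *\<^sub>C oneA k r else 0"])
  note z = tlift_zero[OF A_subspace A_subspace conv_id_S_balanced]
  show "conv_id_S k l m r t (f + g) = conv_id_S k l m r t f + conv_id_S k l m r t g" if "f \<in> A k l m l" "g \<in> A k l m l" for t f g
    unfolding linear_on_add[OF comul_lin that]
    by (rule tlift_add[OF A_subspace A_subspace conv_id_S_balanced comul_in[OF that(1)] comul_in[OF that(2)]])
  show "conv_id_S k l m r t 0 = 0" for t using z by (simp add: comul_zero)
  show "conv_id_S k l m r t f = 0" if "t \<notin> {s. \<Delta> k l m l r s f \<noteq> 0}" for t using that z by simp
  show "finite {s. \<Delta> k l m l r s f \<noteq> 0}" using comul_rcf_A[OF f] by (auto simp: rcf_on_def)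
  show "(if k = m then \<epsilon> k l (f + g) *\<^sub>C oneA k r else 0) =
    (if k = m then \<epsilon> k l f *\<^sub>C oneA k r else 0) +
    (if k = m then \<epsilon> k l g *\<^sub>C oneA k r else 0)" if "f \<in> A k l m l" "g \<in> A k l m l" for f g
    using linear_on_add[OF counit_lin, of f k l g] that by (auto simp: scaleC_add_left split: if_split)
  show "(if k = m then \<epsilon> k l 0 *\<^sub>C oneA k r else 0) = 0"
    using linear_on_zero[OF counit_lin A_zero] by simp
qed (rule conv_id_S_mc)

lemma antipode2_A:
  assumes f: "f \<in> A k l k n"
  shows "(\<Sum>r | \<Delta> k l k n r s f \<noteq> 0. conv_S_id k l n r s f) = (if l = n then \<epsilon> k l f *\<^sub>C oneA s n else 0)"
proof (rule large_sum_induct[OF f, where G = "\<lambda>r. conv_S_id k l n r s" and rhs = "\<lambda>f. if l = n then \<epsilon> k l f *\<^sub>C oneA s n else 0"])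
  note z = tlift_zero[OF A_subspace A_subspace conv_S_id_balanced]
  show "conv_S_id k l n t s (f + g) = conv_S_id k l n t s f + conv_S_id k l n t s g" if "f \<in> A k l k n" "g \<in> A k l k n" for t f g
    unfolding linear_on_add[OF comul_lin that]
    by (rule tlift_add[OF A_subspace A_subspace conv_S_id_balanced comul_in[OF that(1)] comul_in[OF that(2)]])
  show "conv_S_id k l n t s 0 = 0" for t using z by (simp add: comul_zero)
  show "conv_S_id k l n t s f = 0" if "t \<notin> {r. \<Delta> k l k n r s f \<noteq> 0}" for t using that z by simp
  show "finite {r. \<Delta> k l k n r s f \<noteq> 0}" using comul_rcf_A[OF f] by (auto simp: rcf_on_def)
  show "(if l = n then \<epsilon> k l (f + g) *\<^sub>C oneA s n else 0) =
    (if l = n then \<epsilon> k l f *\<^sub>C oneA s n else 0) +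
    (if l = n then \<epsilon> k l g *\<^sub>C oneA s n else 0)" if "f \<in> A k l k n" "g \<in> A k l k n" for f g
    using linear_on_add[OF counit_lin, of f k l g] that by (auto simp: scaleC_add_left split: if_split)
  show "(if l = n then \<epsilon> k l 0 *\<^sub>C oneA s n else 0) = 0"
    using linear_on_zero[OF counit_lin A_zero] by simp
qed (rule conv_S_id_mc)

lemma reconstruction_hopf_star: "partial_hopf_star_algebra R"
proof -
  interpret partial_bialgebra R by (rule reconstruction_bialgebra)
  have "is_antipode R S"
    unfolding is_antipode_def R_simps using S_lin S_in antipode1_A antipode2_A by auto
  then show ?thesis
    by unfold_locales (auto simp: R_simps inv_in inv_antilinear inv_inv inv_mul inv_one comul_inv)
qed

section \<open>The invariant integral\<close>

text \<open>
  The natural transformation from \<open>F\<^sub>m\<^sub>m\<close> to \<open>F\<^sub>k\<^sub>k\<close> that is \<open>\<xi> \<mapsto> \<langle>\<mu>\<^sub>m, \<xi>\<rangle> \<mu>\<^sub>k\<close> on the unit object and zero on the other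
  irreducible objects.
\<close>

definition unit_proj :: "'i \<Rightarrow> 'i \<Rightarrow> 'o \<Rightarrow> 'v \<Rightarrow> 'v" where
  "unit_proj k m = (SOME x. x \<in> Nat m m k k \<and> (\<forall>a. u a \<in> Ob k k \<longrightarrow> x (u a) =
     (if u a = un k then (\<lambda>\<xi>. if \<xi> \<in> H m m (un k) then pr m m (un k) (mu m) \<xi> *\<^sub>C mu k else 0) else 0)))"

context
  fixes k m assumes km: "\<phi> k = \<phi> m"
begin

lemma unit_proj_spec: "unit_proj k m \<in> Nat m m k k \<and> (\<forall>a. u a \<in> Ob k k \<longrightarrow> unit_proj k m (u a) =
     (if u a = un k then (\<lambda>\<xi>. if \<xi> \<in> H m m (un k) then pr m m (un k) (mu m) \<xi> *\<^sub>C mu k else 0) else 0))"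
proof -
  let ?T = "\<lambda>a. if u a = un k then (\<lambda>\<xi>. if \<xi> \<in> H m m (un k) then pr m m (un k) (mu m) \<xi> *\<^sub>C mu k else 0) else 0"
  have T: "?T a \<in> hmap (Fob F m m (u a)) (Fob F k k (u a))" if a: "u a \<in> Ob k k" for a
  proof (cases "u a = un k")
    case True
    then show ?thesis
      using rank_one_hmap[OF fd[OF un_Ob2[OF km]] fd[OF un_Ob] mu_in'[OF km] mu_in] by simp
  next
    case False
    then show ?thesis using cvs.subspace_0[OF hmap_subspace[OF fd[OF a]]] by simp
  qed
  have ex: "\<exists>x. x \<in> Nat m m k k \<and> (\<forall>a. u a \<in> Ob k k \<longrightarrow> x (u a) = ?T a)"
    using nat_extend[OF km km, of ?T, OF T] by blast
  from someI_ex[OF ex] show ?thesis unfolding unit_proj_def .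
qed

lemma unit_proj_in: "unit_proj k m \<in> Nat m m k k" using unit_proj_spec by blast

lemma unit_proj_unit:
  assumes "u a = un k" "\<xi> \<in> H m m (un k)"
  shows "unit_proj k m (u a) \<xi> = pr m m (un k) (mu m) \<xi> *\<^sub>C mu k"
proof -
  have a: "u a \<in> Ob k k" using assms(1) un_Ob by simp
  show ?thesis unfolding unit_proj_spec[THEN conjunct2, rule_format, OF a] if_P[OF assms(1)] if_P[OF assms(2)] ..
qed

lemma unit_proj_other: "u a \<in> Ob k k \<Longrightarrow> u a \<noteq> un k \<Longrightarrow> unit_proj k m (u a) \<xi> = 0"
  by (subst unit_proj_spec[THEN conjunct2, rule_format]) (simp_all add: zero_fun_apply)

end

text \<open>
  Since \<open>unit_proj\<close> lives on the unit object, composing with it leaves only the value of a natural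
  transformation between unit vectors.
\<close>

lemma pair_comp_unit_proj_right:
  assumes lm: "\<phi> l = \<phi> m" and f: "f \<in> A k p m m" and x: "x \<in> Nat l l k p"
  shows "rec_pair u f (nat_comp x (unit_proj l m)) =
    (if k = p then rec_pair u (oneA k l) x * rec_pair u f (unit_proj k m) else 0)"
  using f
proof (induction f rule: A_induct)
  case zero
  show ?case by (simp add: rec_pair_zero)
next
  case (add f g)
  then show ?case by (auto simp: rec_pair_add algebra_simps)
next
  case (mc a v w)
  note km = mc(1) and pm = mc(2) and X = mc(3)
  have kl: "\<phi> k = \<phi> l" and pl: "\<phi> p = \<phi> l" and kp: "\<phi> k = \<phi> p" using km pm lm by auto
  have Xl: "u a \<in> Ob l l" and Xk: "u a \<in> Ob k k" using X kl pl kp by auto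
  have uu: "un l = un k" "un m = un k" using kl km by auto
  note e = mc_pair[OF mc nat_comp_in[OF x unit_proj_in[OF lm]]]
  show ?case
  proof (cases "u a = un k")
    case False
    have "unit_proj l m (u a) w = 0" using unit_proj_other[OF lm Xl] False uu by simp
    moreover have "x (u a) 0 = 0" using linear_on_zero[OF hmap_linear[OF nat_in[OF x X]] fdh_zero[OF fd[OF Xl]]] .
    ultimately have 0: "rec_pair u (local.mc k p m m (u a) v w) (nat_comp x (unit_proj l m)) = 0"
      unfolding e by (simp add: nat_comp_def ip_zero_right[OF fd[OF X] mc(4)])
    have "rec_pair u (local.mc k p m m (u a) v w) (unit_proj k m) = 0" if "k = p"
    proof -
      note mc' = mc[folded that]
      show ?thesis unfolding that[symmetric] mc_pair[OF mc' unit_proj_in[OF km]] unit_proj_other[OF km Xk False]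
        by (rule ip_zero_right[OF fd[OF Xk] mc'(4)])
    qed
    with 0 show ?thesis by simp
  next
    case True
    define c where "c = pr m m (un k) (mu m) w"
    have w: "w \<in> H m m (un k)" using mc(5) True by simp
    have h: "unit_proj l m (u a) w = c *\<^sub>C mu l" using unit_proj_unit[OF lm, of a w] True w uu by (simp add: c_def)
    have ml: "mu l \<in> H l l (u a)" using mu_in[of l] uu True by simp
    have xh: "x (u a) (c *\<^sub>C mu l) = c *\<^sub>C x (u a) (mu l)"
      by (rule linear_on_scale[OF hmap_linear[OF nat_in[OF x X]] ml])
    have xm: "x (u a) (mu l) \<in> H k p (un k)" using nat_vec[OF x X ml] True by simp
    have v: "v \<in> H k p (un k)" using mc(4) True by simp
    have lhs: "rec_pair u (local.mc k p m m (u a) v w) (nat_comp x (unit_proj l m)) = c * pr k p (un k) v (x (u a) (mu l))"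
      unfolding e unfolding nat_comp_def o_def h xh using ip_scale_right[OF fd[OF X] mc(4) nat_vec[OF x X ml]] True by simp
    show ?thesis
    proof (cases "k = p")
      case False
      have "v = 0" using un_off(1)[OF False kp v] .
      then show ?thesis using lhs False ip_zero_left[OF fd[OF X]] nat_vec[OF x X ml] True by simp
    next
      case kp: True
      have xk: "x (u a) (mu l) = pr k k (un k) (mu k) (x (u a) (mu l)) *\<^sub>C mu k"
        by (rule mu_expand) (use xm kp in simp)
      have one: "rec_pair u (oneA k l) x = pr k k (un k) (mu k) (x (u a) (mu l))"
        unfolding rec_one_mc[OF kl] using mc_pair[OF kl kl un_Ob mu_in mu_in'[OF kl], of x] x kp True by simp
      have v': "v \<in> H k k (un k)" using v kp by simp
      have vx: "pr k p (un k) v (x (u a) (mu l)) = pr k k (un k) (mu k) (x (u a) (mu l)) * pr k k (un k) v (mu k)"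
        unfolding kp[symmetric] by (subst xk) (rule ip_scale_right[OF fd[OF un_Ob] v' mu_in])
      have rhs: "rec_pair u (local.mc k p m m (u a) v w) (unit_proj k m) = c * pr k k (un k) v (mu k)"
      proof -
        have "rec_pair u (local.mc k p m m (u a) v w) (unit_proj k m) = pr k k (u a) v (unit_proj k m (u a) w)"
          using mc_pair[OF km km Xk _ mc(5) unit_proj_in[OF km], of v] mc(4) kp by simp
        also have "unit_proj k m (u a) w = c *\<^sub>C mu k" unfolding c_def by (rule unit_proj_unit[OF km True w])
        finally show ?thesis using ip_scale_right[OF fd[OF un_Ob] v' mu_in] True by simp
      qed
      show ?thesis unfolding lhs vx one rhs using kp by simp
    qed
  qed
qed

lemma pair_comp_unit_proj_left:
  assumes kl: "\<phi> k = \<phi> l" and f: "f \<in> A k k m p" and y: "y \<in> Nat m p l l"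
  shows "rec_pair u f (nat_comp (unit_proj k l) y) =
    (if m = p then rec_pair u (oneA l m) y * rec_pair u f (unit_proj k m) else 0)"
  using f
proof (induction f rule: A_induct)
  case zero
  show ?case by (simp add: rec_pair_zero)
next
  case (add f g)
  then show ?case by (auto simp: rec_pair_add algebra_simps)
next
  case (mc a v w)
  note km = mc(1) and kp = mc(2) and X = mc(3)
  have lm: "\<phi> l = \<phi> m" and mp: "\<phi> m = \<phi> p" using kl km kp by auto
  note Xl = Ob_mn[OF kl kl X] and Xm = Ob_mn[OF km kp X]
  have uu: "un l = un k" "un m = un k" using kl km by auto
  note yw = nat_vec[OF y Xl mc(5)]
  note e = mc_pair[OF mc nat_comp_in[OF unit_proj_in[OF kl] y]]
  show ?case
  proof (cases "u a = un k")
    case False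
    have "rec_pair u (local.mc k k m p (u a) v w) (nat_comp (unit_proj k l) y) = 0"
      unfolding e unfolding nat_comp_def o_def unit_proj_other[OF kl X False] by (rule ip_zero_right[OF fd[OF X] mc(4)])
    moreover have "rec_pair u (local.mc k k m p (u a) v w) (unit_proj k m) = 0" if "m = p"
    proof -
      note mc' = mc[folded that]
      show ?thesis unfolding that[symmetric] mc_pair[OF mc' unit_proj_in[OF km]] unit_proj_other[OF km X False]
        by (rule ip_zero_right[OF fd[OF X] mc'(4)])
    qed
    ultimately show ?thesis by simp
  next
    case True
    have v: "v \<in> H k k (un k)" and w: "w \<in> H m p (un k)" and yw': "y (u a) w \<in> H l l (un k)"
      using mc(4,5) yw True by auto
    have lhs: "rec_pair u (local.mc k k m p (u a) v w) (nat_comp (unit_proj k l) y) = pr l l (un k) (mu l) (y (u a) w) * pr k k (un k) v (mu k)"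
      unfolding e unfolding nat_comp_def o_def unit_proj_unit[OF kl True yw'] using ip_scale_right[OF fd[OF un_Ob] v mu_in] True by simp
    show ?thesis
    proof (cases "m = p")
      case False
      have "w = 0" using un_off(1)[OF False mp] w uu by simp
      then have "y (u a) w = 0"
        using linear_on_zero[OF hmap_linear[OF nat_in[OF y Xl]] fdh_zero[OF fd[OF Xm]]] by simp
      then show ?thesis using lhs False ip_zero_right[OF fd[OF Xl]] mu_in'[OF kl] True by simp
    next
      case mp: True
      define c where "c = pr m m (un k) (mu m) w"
      have w': "w \<in> H m m (un k)" using w mp by simp
      have wc: "w = c *\<^sub>C mu m" unfolding c_def using mu_expand[of w m] w' uu by simp
      have ml: "mu m \<in> H m p (u a)" using mu_in[of m] uu True mp by simp
      have yc: "y (u a) w = c *\<^sub>C y (u a) (mu m)"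
        unfolding wc by (rule linear_on_scale[OF hmap_linear[OF nat_in[OF y Xl]] ml])
      have one: "rec_pair u (oneA l m) y = pr l l (un k) (mu l) (y (u a) (mu m))"
        unfolding rec_one_mc[OF lm] using mc_pair[OF lm lm un_Ob mu_in mu_in'[OF lm], of y] y mp True uu by simp
      have yc': "pr l l (un k) (mu l) (y (u a) w) = c * pr l l (un k) (mu l) (y (u a) (mu m))"
        unfolding yc using ip_scale_right[OF fd[OF Xl], of "mu l" "y (u a) (mu m)" c] nat_vec[OF y Xl ml] mu_in'[OF kl] True
        by simp
      have rhs: "rec_pair u (local.mc k k m p (u a) v w) (unit_proj k m) = c * pr k k (un k) v (mu k)"
      proof -
        have "rec_pair u (local.mc k k m p (u a) v w) (unit_proj k m) = pr k k (u a) v (unit_proj k m (u a) w)"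
          using mc_pair[OF km km X mc(4) _ unit_proj_in[OF km], of w] mc(5) mp by simp
        also have "unit_proj k m (u a) w = c *\<^sub>C mu k" unfolding c_def by (rule unit_proj_unit[OF km True w'])
        finally show ?thesis using ip_scale_right[OF fd[OF un_Ob] v mu_in] True by simp
      qed
      show ?thesis unfolding lhs yc' one rhs using mp by simp
    qed
  qed
qed

definition haar :: "'i \<Rightarrow> 'i \<Rightarrow> ('a, 'v) rec_elem \<Rightarrow> complex" where
  "haar k m f = rec_pair u f (unit_proj k m)"

lemma haar_lin: "linear_on (A k l k' l') (haar m n)"
  unfolding haar_def by (rule rec_pair_lin)

lemma haar_zero: "haar m n 0 = 0"
  by (simp add: haar_def rec_pair_zero)

lemma haar_right:
  assumes f: "f \<in> A k p m m"
  shows "tlift (A k p l l) (A l l m m) (\<lambda>b c. haar l m c *\<^sub>C b) (\<Delta> k p m m l l f) =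
    (if k = p then haar k m f *\<^sub>C oneA k l else 0)"
proof -
  let ?b = "\<lambda>b c. haar l m c *\<^sub>C b"
  have b: "balanced_on (A k p l l) (A l l m m) ?b"
    using linear_onD[OF haar_lin] by (auto simp: balanced_on_def scaleC_add_left scaleC_add_right scaleC_scaleC scaleC_complex_def mult.commute)
  show ?thesis
  proof (cases "\<phi> l = \<phi> m")
    case False
    have "\<Delta> k p m m l l f = 0"
    proof (cases "\<phi> k = \<phi> m \<and> \<phi> p = \<phi> m")
      case True
      then show ?thesis using False by (intro comul_off[OF f]) auto
    qed (use A_trivial[OF _ f] comul_zero in auto)
    moreover have "haar k m f *\<^sub>C oneA k l = 0" if "k = p"
    proof (cases "\<phi> k = \<phi> l")
      case True
      then have "f = 0" using A_trivial[OF _ f] False by auto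
      then show ?thesis by (simp add: haar_zero)
    qed (simp add: rec_one_off)
    ultimately show ?thesis using tlift_zero[OF A_subspace A_subspace b] by simp
  next
    case lm: True
    have D: "\<Delta> k p m m l l f \<in> AA k p l l m m" by (rule comul_in[OF f])
    have inn: "tlift (A k p l l) (A l l m m) ?b (\<Delta> k p m m l l f) \<in> A k p l l"
      by (rule tlift_in[OF A_subspace D A_subspace]) (rule A_scale)
    have r: "(if k = p then haar k m f *\<^sub>C oneA k l else 0) \<in> A k p l l"
      using one_in[of k l] by (auto intro: A_scale A_zero)
    show ?thesis
    proof (rule A_eqI[OF inn r])
      fix x assume x: "x \<in> Nat l l k p"
      have "rec_pair u (tlift (A k p l l) (A l l m m) ?b (\<Delta> k p m m l l f)) x
        = tlift (A k p l l) (A l l m m) (\<lambda>b c. rec_pair u (?b b c) x) (\<Delta> k p m m l l f)"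
        by (rule tlift_additive_comp[OF A_subspace D A_subspace[of k p l l]]) (simp_all add: A_scale rec_pair_add rec_pair_zero)
      also have "\<dots> = pair2 k p l l m m x (unit_proj l m) (\<Delta> k p m m l l f)"
        by (rule tlift_cong[OF A_subspace D]) (simp add: rec_pair_scale haar_def)
      also have "\<dots> = rec_pair u f (nat_comp x (unit_proj l m))" by (rule comul_pair[OF f x unit_proj_in[OF lm]])
      finally show "rec_pair u (tlift (A k p l l) (A l l m m) ?b (\<Delta> k p m m l l f)) x
        = rec_pair u (if k = p then haar k m f *\<^sub>C oneA k l else 0) x"
        using pair_comp_unit_proj_right[OF lm f x]
        by (cases "k = p") (simp_all add: rec_pair_zero rec_pair_scale[OF one_in] haar_def mult.commute)
    qed
  qed
qed

lemma haar_left: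
  assumes f: "f \<in> A k k m p"
  shows "tlift (A k k l l) (A l l m p) (\<lambda>b c. haar k l b *\<^sub>C c) (\<Delta> k k m p l l f) =
    (if m = p then haar k m f *\<^sub>C oneA l m else 0)"
proof -
  let ?b = "\<lambda>b c. haar k l b *\<^sub>C c"
  have b: "balanced_on (A k k l l) (A l l m p) ?b"
    using linear_onD[OF haar_lin] by (auto simp: balanced_on_def scaleC_add_left scaleC_add_right scaleC_scaleC scaleC_complex_def mult.commute)
  show ?thesis
  proof (cases "\<phi> k = \<phi> l")
    case False
    then have "\<Delta> k k m p l l f = 0" by (intro comul_off[OF f]) auto
    moreover have "haar k m f *\<^sub>C oneA l m = 0"
    proof (cases "\<phi> l = \<phi> m")
      case True
      then have "f = 0" using A_trivial[OF _ f] False by auto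
      then show ?thesis by (simp add: haar_zero)
    qed (simp add: rec_one_off)
    ultimately show ?thesis by (simp only: tlift_zero[OF A_subspace A_subspace b] if_cancel)
  next
    case kl: True
    have D: "\<Delta> k k m p l l f \<in> AA k k l l m p" by (rule comul_in[OF f])
    have inn: "tlift (A k k l l) (A l l m p) ?b (\<Delta> k k m p l l f) \<in> A l l m p"
      by (rule tlift_in[OF A_subspace D A_subspace]) (rule A_scale)
    have r: "(if m = p then haar k m f *\<^sub>C oneA l m else 0) \<in> A l l m p"
      using one_in[of l m] by (auto intro: A_scale A_zero)
    show ?thesis
    proof (rule A_eqI[OF inn r])
      fix y assume y: "y \<in> Nat m p l l"
      have "rec_pair u (tlift (A k k l l) (A l l m p) ?b (\<Delta> k k m p l l f)) y
        = tlift (A k k l l) (A l l m p) (\<lambda>b c. rec_pair u (?b b c) y) (\<Delta> k k m p l l f)"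
        by (rule tlift_additive_comp[OF A_subspace D A_subspace[of l l m p]]) (simp_all add: A_scale rec_pair_add rec_pair_zero)
      also have "\<dots> = pair2 k k l l m p (unit_proj k l) y (\<Delta> k k m p l l f)"
        by (rule tlift_cong[OF A_subspace D]) (simp add: rec_pair_scale haar_def)
      also have "\<dots> = rec_pair u f (nat_comp (unit_proj k l) y)" by (rule comul_pair[OF f unit_proj_in[OF kl] y])
      finally show "rec_pair u (tlift (A k k l l) (A l l m p) ?b (\<Delta> k k m p l l f)) y
        = rec_pair u (if m = p then haar k m f *\<^sub>C oneA l m else 0) y"
        using pair_comp_unit_proj_left[OF kl f y]
        by (cases "m = p") (simp_all add: rec_pair_zero rec_pair_scale[OF one_in] haar_def mult.commute)
    qed
  qed
qed

lemma haar_one: "haar k k (oneA k k) = 1"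
proof -
  obtain a where a: "u a = un k" using unit_index by blast
  have "unit_proj k k (un k) (mu k) = mu k" using unit_proj_unit[OF refl a mu_in] a mu_ip by simp
  then show ?thesis unfolding haar_def rec_one_mc[OF refl] mc_pair[OF refl refl un_Ob mu_in mu_in unit_proj_in[OF refl]]
    by (simp add: mu_ip)
qed

lemma haar_invariant: "invariant_integral R haar"
  unfolding invariant_integral_def R_simps
  by (intro conjI allI ballI haar_lin haar_one haar_right haar_left)

subsection \<open>Positivity\<close>

lemma nat_eqI:
  assumes x: "x \<in> Nat m n k l" and y: "y \<in> Nat m n k l"
    and eq: "\<And>a v. u a \<in> Ob k l \<Longrightarrow> v \<in> H m n (u a) \<Longrightarrow> x (u a) v = y (u a) v"
    and X: "X \<in> Ob k l" and v: "v \<in> H m n X"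
  shows "x X v = y X v"
proof -
  have Xm: "X \<in> Ob m n" using X nat_phi[OF x] by simp
  obtain N a i p where d: "direct_sum C X N (\<lambda>j. u (a j)) i p" using decompose[OF X] by blast
  note D = direct_sumD[OF d X]
  have Dm: "u (a j) \<in> Ob m n" if "j < N" for j using D(1)[OF that] nat_phi[OF x] by simp
  have pv: "Fmo F m n X (u (a j)) (p j) v \<in> H m n (u (a j))" if "j < N" for j
    by (rule Fmo_in[OF Xm Dm[OF that] D(3)[OF that] v])
  have e: "Fmo F k l X (u (a j)) (p j) (x X v) = Fmo F k l X (u (a j)) (p j) (y X v)" if j: "j < N" for j
    unfolding nat_nat[OF x X D(1)[OF j] D(3)[OF j], symmetric] nat_nat[OF y X D(1)[OF j] D(3)[OF j], symmetric]
    by (rule eq[OF D(1)[OF j] pv[OF j]])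
  have "x X v = (\<Sum>j<N. Fmo F k l (u (a j)) X (i j) (Fmo F k l X (u (a j)) (p j) (x X v)))"
    by (rule Fmo_resolution[OF d X nat_vec[OF x X v], symmetric])
  also have "\<dots> = (\<Sum>j<N. Fmo F k l (u (a j)) X (i j) (Fmo F k l X (u (a j)) (p j) (y X v)))"
    by (intro sum.cong refl arg_cong[of _ _ "Fmo F k l _ X _"] e) simp
  also have "\<dots> = y X v" by (rule Fmo_resolution[OF d X nat_vec[OF y X v]])
  finally show ?thesis .
qed

text \<open>
  For equal indices \<open>unit_proj\<close> is selfadjoint and idempotent, as can be checked on irreducible objects;
  so it consists of orthogonal projections.
\<close>

lemma unit_proj_nonneg:
  assumes X: "X \<in> Ob l l" and xi: "\<xi> \<in> H l l X"
  shows "pr l l X \<xi> (unit_proj l l X \<xi>) \<in> \<real>\<^sub>\<ge>\<^sub>0"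
proof -
  let ?p = "unit_proj l l"
  note p = unit_proj_in[OF refl, of l] note pa = nat_adj_in[OF p]
  have adj: "nat_adj C \<phi> F l l l l ?p X \<zeta> = ?p X \<zeta>" if zeta: "\<zeta> \<in> H l l X" for \<zeta>
  proof (rule nat_eqI[OF pa p _ X zeta])
    fix a v assume ua: "u a \<in> Ob l l" and v: "v \<in> H l l (u a)"
    show "nat_adj C \<phi> F l l l l ?p (u a) v = ?p (u a) v"
    proof (rule ip_eqI[OF fd[OF ua] nat_vec[OF pa ua v] nat_vec[OF p ua v]])
      fix z assume z: "z \<in> H l l (u a)"
      have "pr l l (u a) (?p (u a) z) v = pr l l (u a) z (?p (u a) v)"
      proof (cases "u a = un l")
        case True
        have z': "z \<in> H l l (un l)" and v': "v \<in> H l l (un l)" using z v True by auto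
        show ?thesis unfolding unit_proj_unit[OF refl True z'] unit_proj_unit[OF refl True v'] unfolding True
          using ip_scale_left[OF fd[OF un_Ob] v' mu_in] ip_scale_right[OF fd[OF un_Ob] z' mu_in]
            ip_cnj[OF fd[OF un_Ob] mu_in z'] by simp
      next
        case False
        show ?thesis unfolding unit_proj_other[OF refl ua False] ip_zero_left[OF fd[OF ua] v] ip_zero_right[OF fd[OF ua] z] ..
      qed
      then show "pr l l (u a) z (nat_adj C \<phi> F l l l l ?p (u a) v) = pr l l (u a) z (?p (u a) v)"
        unfolding nat_adj_ip(2)[OF p ua z v] .
    qed
  qed
  have i: "nat_comp ?p ?p X \<xi> = ?p X \<xi>"
  proof (rule nat_eqI[OF nat_comp_in[OF p p] p _ X xi])
    fix a v assume ua: "u a \<in> Ob l l" and v: "v \<in> H l l (u a)"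
    show "nat_comp ?p ?p (u a) v = ?p (u a) v"
    proof (cases "u a = un l")
      case True
      have v': "v \<in> H l l (un l)" using v True by simp
      have "?p (u a) (c *\<^sub>C mu l) = c *\<^sub>C mu l" for c
        using unit_proj_unit[OF refl True fdh_scale[OF fd[OF un_Ob] mu_in]] ip_scale_right[OF fd[OF un_Ob] mu_in mu_in] mu_ip by simp
      then show ?thesis using unit_proj_unit[OF refl True v'] by (simp add: nat_comp_def)
    next
      case False
      show ?thesis unfolding nat_comp_def o_def unit_proj_other[OF refl ua False] ..
    qed
  qed
  note px = nat_vec[OF p X xi]
  have "pr l l X \<xi> (?p X \<xi>) = pr l l X \<xi> (nat_adj C \<phi> F l l l l ?p X (?p X \<xi>))"
    unfolding adj[OF px] using i by (simp add: nat_comp_def)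
  also have "\<dots> = pr l l X (?p X \<xi>) (?p X \<xi>)" by (rule nat_adj_ip(2)[OF p X xi px])
  finally show ?thesis using ip_self_nonneg[OF fd[OF X] px] by simp
qed

text \<open>
  A morphism \<open>ldual (u a) \<otimes> u b \<rightarrow> 1\<close> factors through a morphism \<open>u b \<rightarrow> u a\<close>, hence is a multiple of
  the evaluation, by a scalar that does not depend on the fibre.
\<close>

lemma form_scalar:
  assumes a: "u a \<in> obj C \<alpha> \<beta>" and b: "u b \<in> obj C \<alpha> \<beta>" and e: "e \<in> hom C (ldual C (u a) \<boxtimes> u b) (unit C \<beta>)"
  shows "\<exists>d. \<forall>k l z y. \<phi> k = \<alpha> \<longrightarrow> \<phi> l = \<beta> \<longrightarrow> z \<in> H l k (ldual C (u a)) \<longrightarrow> y \<in> H k l (u b) \<longrightarrow>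
    bform e (ldual C (u a)) (u b) k l z y = (if a = b then d * ev_form (u a) k l z y else 0)"
proof -
  let ?t = "rtrans e (u a) (u b)"
  note t = rtrans_hom(1)[OF a b e]
  have eq: "bform e (ldual C (u a)) (u b) k l z y = ev_form (u a) k l z (Fmo F k l (u b) (u a) ?t y)"
    if "\<phi> k = \<alpha>" "\<phi> l = \<beta>" "z \<in> H l k (ldual C (u a))" "y \<in> H k l (u b)" for k l z y
    using bform_rtrans[of "u a" k l "u b" e z y] a b e that by simp
  have z0: "ev_form (u a) k l z 0 = 0" if "\<phi> k = \<alpha>" "\<phi> l = \<beta>" "z \<in> H l k (ldual C (u a))" for k l z
  proof -
    have X: "u a \<in> Ob k l" using a that by simp
    show ?thesis by (rule linear_on_zero[OF bform_lin(1)[OF X ldual_obj[OF X] ev_hom[OF X] that(3)] fdh_zero[OF fd[OF X]]])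
  qed
  from u_hom[OF b a t] show ?thesis
  proof (elim disjE conjE exE)
    fix c assume ba: "b = a" and c: "?t = c *\<^sub>C idm C (u b)"
    show ?thesis
    proof (intro exI[of _ c] allI impI)
      fix k l z y assume p: "\<phi> k = \<alpha>" "\<phi> l = \<beta>" "z \<in> H l k (ldual C (u a))" "y \<in> H k l (u b)"
      have X: "u a \<in> Ob k l" using a p by simp
      have y: "y \<in> H k l (u a)" using p(4) ba by simp
      have "Fmo F k l (u b) (u a) ?t y = c *\<^sub>C y"
        using linear_on_scale[OF Fmo_linear[OF X X] idm_hom] Fmo_id[OF X y] ba unfolding c by (simp add: scaleC_fun_def)
      then show "bform e (ldual C (u a)) (u b) k l z y = (if a = b then c * ev_form (u a) k l z y else 0)"
        unfolding eq[OF p]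
        using linear_on_scale[OF bform_lin(1)[OF X ldual_obj[OF X] ev_hom[OF X] p(3)] y] ba by (simp add: scaleC_complex_def)
    qed
  next
    assume 0: "?t = 0"
    show ?thesis
    proof (intro exI[of _ 0] allI impI)
      fix k l z y assume p: "\<phi> k = \<alpha>" "\<phi> l = \<beta>" "z \<in> H l k (ldual C (u a))" "y \<in> H k l (u b)"
      have X: "u a \<in> Ob k l" "u b \<in> Ob k l" using a b p by auto
      have "Fmo F k l (u b) (u a) ?t y = 0"
        using linear_on_zero[OF Fmo_linear[OF X(2,1)] cvs.subspace_0[OF hom_sub[OF X(2,1)]]] unfolding 0 by (simp add: zero_fun_apply)
      then show "bform e (ldual C (u a)) (u b) k l z y = (if a = b then 0 * ev_form (u a) k l z y else 0)"
        unfolding eq[OF p] using z0[OF p(1-3)] by simp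
    qed
  qed
qed

text \<open>
  The orthogonality relations, with a constant that does not depend on the fibres. In a decomposition
  of the tensor product into irreducible objects, \<open>unit_proj\<close> only sees the summands equal to the unit,
  whose adjoint inclusions and projections are multiples of the evaluation.
\<close>

lemma haar_orthogonality:
  assumes a: "u a \<in> obj C \<alpha> \<beta>" and b: "u b \<in> obj C \<alpha> \<beta>"
  shows "\<exists>K. \<forall>k l m n z y z' y'. \<phi> k = \<alpha> \<longrightarrow> \<phi> l = \<beta> \<longrightarrow> \<phi> m = \<alpha> \<longrightarrow> \<phi> n = \<beta> \<longrightarrow>
    z \<in> H l k (ldual C (u a)) \<longrightarrow> y \<in> H k l (u b) \<longrightarrow> z' \<in> H n m (ldual C (u a)) \<longrightarrow> y' \<in> H m n (u b) \<longrightarrow>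
    pr l l (ldual C (u a) \<boxtimes> u b) (io l k l (ldual C (u a)) (u b) z y)
      (unit_proj l n (ldual C (u a) \<boxtimes> u b) (io n m n (ldual C (u a)) (u b) z' y'))
    = (if a = b then K * cnj (ev_form (u a) k l z y) * ev_form (u a) m n z' y' else 0)"
proof -
  let ?A = "ldual C (u a)" let ?W = "?A \<boxtimes> u b"
  note A' = ldual_obj[OF a] note W = tob_obj[OF A' b]
  obtain N c i p where d: "direct_sum C ?W N (\<lambda>j. u (c j)) i p" using decompose[OF W] by blast
  note D = direct_sumD[OF d W]
  let ?I = "{j. j < N \<and> u (c j) = unit C \<beta>}"
  have iI: "dag C (i j) \<in> hom C ?W (unit C \<beta>)" "p j \<in> hom C ?W (unit C \<beta>)" "i j \<in> hom C (unit C \<beta>) ?W" if "j \<in> ?I" for j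
    using that D(2,3)[of j] hom_dag[OF D(1) W D(2), of j] by auto
  define P where "P e d \<longleftrightarrow> (\<forall>k l z y. \<phi> k = \<alpha> \<longrightarrow> \<phi> l = \<beta> \<longrightarrow> z \<in> H l k ?A \<longrightarrow> y \<in> H k l (u b) \<longrightarrow>
    bform e ?A (u b) k l z y = (if a = b then d * ev_form (u a) k l z y else 0))" for e d
  have P: "P e (SOME d. P e d)" if "e \<in> hom C ?W (unit C \<beta>)" for e
    using form_scalar[OF a b that] unfolding P_def[symmetric] by (rule someI_ex)
  \<comment> \<open>The scalars by which the adjoint inclusion and the projection of a unit summand differ from the evaluation.\<close>
  define q where "q j = (SOME d. P (dag C (i j)) d)" for j
  define r where "r j = (SOME d. P (p j) d)" for j
  have q: "bform (dag C (i j)) ?A (u b) k l z y = (if a = b then q j * ev_form (u a) k l z y else 0)"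
    if "j \<in> ?I" "\<phi> k = \<alpha>" "\<phi> l = \<beta>" "z \<in> H l k ?A" "y \<in> H k l (u b)" for j k l z y
    by (rule P[OF iI(1)[OF that(1)], unfolded P_def, folded P_def, folded q_def, unfolded P_def, rule_format, OF that(2-)])
  have r: "bform (p j) ?A (u b) k l z y = (if a = b then r j * ev_form (u a) k l z y else 0)"
    if "j \<in> ?I" "\<phi> k = \<alpha>" "\<phi> l = \<beta>" "z \<in> H l k ?A" "y \<in> H k l (u b)" for j k l z y
    by (rule P[OF iI(2)[OF that(1)], unfolded P_def, folded P_def, folded r_def, unfolded P_def, rule_format, OF that(2-)])
  show ?thesis
  proof (intro exI[of _ "\<Sum>j\<in>?I. cnj (q j) * r j"] allI impI)
    fix k l m n z y z' y'
    assume k: "\<phi> k = \<alpha>" and l: "\<phi> l = \<beta>" and m: "\<phi> m = \<alpha>" and n: "\<phi> n = \<beta>"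
      and z: "z \<in> H l k ?A" and y: "y \<in> H k l (u b)" and z': "z' \<in> H n m ?A" and y': "y' \<in> H m n (u b)"
    have ln: "\<phi> l = \<phi> n" using l n by simp
    have Al: "?A \<in> Ob l k" "u b \<in> Ob k l" "?A \<in> Ob n m" "u b \<in> Ob m n" using A' b k l m n by auto
    note Wl = tob_Ob[OF Al(1,2)] and Wn = tob_Ob[OF Al(3,4)]
    note \<xi> = io_in[OF Al(1,2) z y] and \<eta> = io_in[OF Al(3,4) z' y']
    let ?\<xi> = "io l k l ?A (u b) z y" and ?\<eta> = "io n m n ?A (u b) z' y'"
    note h = unit_proj_in[OF ln]
    have Dl: "u (c j) \<in> Ob l l" "u (c j) \<in> Ob n n" if "j < N" for j using D(1)[OF that] l n by auto
    note hW = nat_vec[OF h Wl \<eta>]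
    have "pr l l ?W ?\<xi> (unit_proj l n ?W ?\<eta>)
      = pr l l ?W ?\<xi> (\<Sum>j<N. Fmo F l l (u (c j)) ?W (i j) (Fmo F l l ?W (u (c j)) (p j) (unit_proj l n ?W ?\<eta>)))"
      by (simp add: Fmo_resolution[OF d Wl hW])
    also have "\<dots> = (\<Sum>j<N. pr l l ?W ?\<xi> (Fmo F l l (u (c j)) ?W (i j) (Fmo F l l ?W (u (c j)) (p j) (unit_proj l n ?W ?\<eta>))))"
      using D Dl Wl hW by (intro ip_sum_right[OF fd[OF Wl] \<xi>] Fmo_in) auto
    also have "\<dots> = (\<Sum>j<N. if j \<in> ?I then cnj (bform (dag C (i j)) ?A (u b) k l z y) * bform (p j) ?A (u b) m n z' y' else 0)"
    proof (intro sum.cong refl)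
      fix j assume "j \<in> {..<N}"
      then have j: "j < N" by simp
      note o = Dl(1)[OF j] Dl(2)[OF j]
      let ?w = "Fmo F n n ?W (u (c j)) (p j) ?\<eta>"
      note w = Fmo_in[OF Wn o(2) D(3)[OF j] \<eta>]
      have ph: "Fmo F l l ?W (u (c j)) (p j) (unit_proj l n ?W ?\<eta>) = unit_proj l n (u (c j)) ?w"
        by (rule nat_nat[OF h Wl o(1) D(3)[OF j], symmetric])
      show "pr l l ?W ?\<xi> (Fmo F l l (u (c j)) ?W (i j) (Fmo F l l ?W (u (c j)) (p j) (unit_proj l n ?W ?\<eta>))) =
        (if j \<in> ?I then cnj (bform (dag C (i j)) ?A (u b) k l z y) * bform (p j) ?A (u b) m n z' y' else 0)"
      proof (cases "u (c j) = unit C \<beta>")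
        case False
        then have "unit_proj l n (u (c j)) ?w = 0" using unit_proj_other[OF ln o(1)] l by simp
        then show ?thesis unfolding ph using False linear_on_zero[OF Fmo_lin[OF o(1) Wl D(2)[OF j]] fdh_zero[OF fd[OF o(1)]]]
          by (simp add: ip_zero_right[OF fd[OF Wl] \<xi>])
      next
        case True
        have ul: "u (c j) = un l" "u (c j) = un n" "un l = un n" using True l n by auto
        have jI: "j \<in> ?I" using j True by simp
        have i1: "i j \<in> hom C (un l) ?W" and i2: "dag C (i j) \<in> hom C ?W (un l)" using iI[OF jI] l by auto
        have w': "?w \<in> H n n (un l)" using w ul by simp
        have "unit_proj l n (u (c j)) ?w = pr n n (un l) (mu n) ?w *\<^sub>C mu l" by (rule unit_proj_unit[OF ln ul(1) w'])
        also have "pr n n (un l) (mu n) ?w = bform (p j) ?A (u b) m n z' y'" unfolding bform_def using ul by simp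
        finally have hw: "unit_proj l n (u (c j)) ?w = bform (p j) ?A (u b) m n z' y' *\<^sub>C mu l" .
        note iu = Fmo_in[OF un_Ob Wl i1 mu_in]
        have "pr l l ?W ?\<xi> (Fmo F l l (u (c j)) ?W (i j) (unit_proj l n (u (c j)) ?w))
          = bform (p j) ?A (u b) m n z' y' * pr l l ?W ?\<xi> (Fmo F l l (un l) ?W (i j) (mu l))"
          unfolding hw unfolding ul(1) linear_on_scale[OF Fmo_lin[OF un_Ob Wl i1] mu_in] by (rule ip_scale_right[OF fd[OF Wl] \<xi> iu])
        also have "pr l l ?W ?\<xi> (Fmo F l l (un l) ?W (i j) (mu l)) = pr l l (un l) (Fmo F l l ?W (un l) (dag C (i j)) ?\<xi>) (mu l)"
          by (rule Fmo_dag_ip[OF un_Ob Wl i1 mu_in \<xi>, symmetric])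
        also have "\<dots> = cnj (bform (dag C (i j)) ?A (u b) k l z y)"
          unfolding bform_def by (rule ip_cnj[OF fd[OF un_Ob] mu_in Fmo_in[OF Wl un_Ob i2 \<xi>], symmetric])
        finally show ?thesis unfolding ph using jI by (simp add: mult.commute)
      qed
    qed
    also have "\<dots> = (\<Sum>j\<in>?I. cnj (bform (dag C (i j)) ?A (u b) k l z y) * bform (p j) ?A (u b) m n z' y')"
      by (rule sum.mono_neutral_cong_right) auto
    also have "\<dots> = (\<Sum>j\<in>?I. if a = b then (cnj (q j) * r j) * (cnj (ev_form (u a) k l z y) * ev_form (u a) m n z' y') else 0)"
      using q[OF _ k l z y] r[OF _ m n z' y'] by (intro sum.cong refl) auto
    also have "\<dots> = (if a = b then (\<Sum>j\<in>?I. cnj (q j) * r j) * cnj (ev_form (u a) k l z y) * ev_form (u a) m n z' y' else 0)"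
      by (simp add: sum_distrib_right mult.assoc)
    finally show "pr l l ?W ?\<xi> (unit_proj l n ?W ?\<eta>) = \<dots>" .
  qed
qed

text \<open>
  The vector \<open>e\<close> enters through \<open>ev(J e, e') = \<langle>e, e'\<rangle>\<close>. Nonnegativity is read off from the case of
  equal indices, where \<open>unit_proj\<close> is a projection.
\<close>

lemma haar_mc:
  assumes km: "\<phi> k = \<phi> m" and ln: "\<phi> l = \<phi> n" and a: "u a \<in> Ob k l" and b: "u b \<in> Ob k l"
    and v: "v \<in> H k l (u a)" and v': "v' \<in> H k l (u b)" and e: "e \<in> ONB m n (u a)" and e': "e' \<in> ONB m n (u b)"
  shows "a \<noteq> b \<or> e \<noteq> e' \<Longrightarrow> haar l n (M l k l n m n (inv k l m n (mc k l m n (u a) v e)) (mc k l m n (u b) v' e')) = 0"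
    and "haar l n (M l k l n m n (inv k l m n (mc k l m n (u a) v e)) (mc k l m n (u a) v e)) \<in> \<real>\<^sub>\<ge>\<^sub>0"
proof -
  note am = Ob_mn[OF km ln a] and bm = Ob_mn[OF km ln b]
  note en = onb_in[OF fd[OF am] e] and en' = onb_in[OF fd[OF bm] e']
  note a' = ldual_obj[OF a] and am' = ldual_obj[OF am]
  note d = Jd_in[OF a v]
  have val: "haar l n (M l k l n m n (inv k l m n (mc k l m n (u a) v f)) (mc k l m n (u c) w f'))
    = pr l l (ldual C (u a) \<boxtimes> u c) (io l k l (ldual C (u a)) (u c) (Jd k l (u a) v) w)
      (unit_proj l n (ldual C (u a) \<boxtimes> u c) (io n m n (ldual C (u a)) (u c) (J m n (u a) f) f'))"
    if c: "u c \<in> Ob k l" and f: "f \<in> H m n (u a)" and w: "w \<in> H k l (u c)" and f': "f' \<in> H m n (u c)" for f c w f'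
  proof -
    note cm = Ob_mn[OF km ln c]
    note j = J_in[OF am f]
    show ?thesis
      unfolding inv_mc[OF km ln a v f] mul_mc[OF ln km ln a' c d j w f'] haar_def
      by (rule mc_pair[OF ln ln tob_Ob[OF a' c] io_in[OF a' c d w] io_in[OF am' cm j f'] unit_proj_in[OF ln]])
  qed
  note je = J_in[OF am en]
  show "haar l n (M l k l n m n (inv k l m n (mc k l m n (u a) v e)) (mc k l m n (u b) v' e')) = 0" if ne: "a \<noteq> b \<or> e \<noteq> e'"
  proof -
    obtain K where K: "\<forall>ka la ma na z y z' y'. \<phi> ka = \<phi> k \<longrightarrow> \<phi> la = \<phi> l \<longrightarrow> \<phi> ma = \<phi> k \<longrightarrow> \<phi> na = \<phi> l \<longrightarrow>
      z \<in> H la ka (ldual C (u a)) \<longrightarrow> y \<in> H ka la (u b) \<longrightarrow> z' \<in> H na ma (ldual C (u a)) \<longrightarrow> y' \<in> H ma na (u b) \<longrightarrow>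
      pr la la (ldual C (u a) \<boxtimes> u b) (io la ka la (ldual C (u a)) (u b) z y)
        (unit_proj la na (ldual C (u a) \<boxtimes> u b) (io na ma na (ldual C (u a)) (u b) z' y'))
      = (if a = b then K * cnj (ev_form (u a) ka la z y) * ev_form (u a) ma na z' y' else 0)"
      using haar_orthogonality[OF a b] by (rule exE)
    note K' = K[rule_format, OF refl refl km[symmetric] ln[symmetric] d v' je en']
    show ?thesis unfolding val[OF b en v' en'] K'
      using ne ev_J[OF am en, of e'] en' onb_ip[OF fd[OF am] e, of e'] e' by auto
  qed
  obtain K where K: "\<forall>ka la ma na z y z' y'. \<phi> ka = \<phi> k \<longrightarrow> \<phi> la = \<phi> l \<longrightarrow> \<phi> ma = \<phi> k \<longrightarrow> \<phi> na = \<phi> l \<longrightarrow>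
    z \<in> H la ka (ldual C (u a)) \<longrightarrow> y \<in> H ka la (u a) \<longrightarrow> z' \<in> H na ma (ldual C (u a)) \<longrightarrow> y' \<in> H ma na (u a) \<longrightarrow>
    pr la la (ldual C (u a) \<boxtimes> u a) (io la ka la (ldual C (u a)) (u a) z y)
      (unit_proj la na (ldual C (u a) \<boxtimes> u a) (io na ma na (ldual C (u a)) (u a) z' y'))
    = (if a = a then K * cnj (ev_form (u a) ka la z y) * ev_form (u a) ma na z' y' else 0)"
    using haar_orthogonality[OF a a] by (rule exE)
  let ?e = "ev_form (u a) k l (Jd k l (u a) v) v"
  have ee: "?e \<in> \<real>\<^sub>\<ge>\<^sub>0" unfolding Jd_ip[OF a v d, symmetric] by (rule ip_self_nonneg[OF fd[OF a'] d])
  have ce: "cnj ?e = ?e" using ee by (auto simp: nonneg_Reals_def complex_nonneg_Reals_iff complex_eq_iff)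
  have "K * ?e * ?e \<in> \<real>\<^sub>\<ge>\<^sub>0"
    using K[rule_format, OF refl refl refl refl d v d v] unit_proj_nonneg[OF tob_Ob[OF a' a] io_in[OF a' a d v]] ce by simp
  then have "K * ?e \<in> \<real>\<^sub>\<ge>\<^sub>0"
  proof (cases "?e = 0")
    case False
    assume "K * ?e * ?e \<in> \<real>\<^sub>\<ge>\<^sub>0"
    then have "K * ?e * ?e / ?e \<in> \<real>\<^sub>\<ge>\<^sub>0" using ee by (rule nonneg_Reals_divide_I)
    then show ?thesis using False by simp
  qed simp
  moreover have "ev_form (u a) m n (J m n (u a) e) e = 1"
    using ev_J[OF am en en] onb_ip[OF fd[OF am] e e] by simp
  ultimately show "haar l n (M l k l n m n (inv k l m n (mc k l m n (u a) v e)) (mc k l m n (u a) v e)) \<in> \<real>\<^sub>\<ge>\<^sub>0"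
    unfolding val[OF a en v en] K[rule_format, OF refl refl km[symmetric] ln[symmetric] d v je en] using ce by simp
qed

text \<open>Expanding the second vectors in orthonormal bases makes the orthogonality relations diagonal.\<close>

lemma A_normal_form:
  assumes f: "f \<in> A k l m n" and km: "\<phi> k = \<phi> m" and ln: "\<phi> l = \<phi> n"
  shows "\<exists>S V. finite S \<and> (\<forall>a\<in>S. u a \<in> Ob k l) \<and> (\<forall>a b. u a \<in> Ob k l \<longrightarrow> V a b \<in> H k l (u a)) \<and>
    (\<forall>a b. a \<notin> S \<longrightarrow> V a b = 0) \<and> f = (\<Sum>a\<in>S. \<Sum>b\<in>ONB m n (u a). mc k l m n (u a) (V a b) b)"
  using f
proof (induction f rule: A_induct)
  case zero
  show ?case by (intro exI[of _ "{}"] exI[of _ "\<lambda>_ _. 0"]) (auto intro: fdh_zero fd)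
next
  case (add f g)
  from add(3,4) obtain S V S' V' where SV: "finite S \<and> (\<forall>a\<in>S. u a \<in> Ob k l) \<and>
      (\<forall>a b. u a \<in> Ob k l \<longrightarrow> V a b \<in> H k l (u a)) \<and> (\<forall>a b. a \<notin> S \<longrightarrow> V a b = 0) \<and>
      f = (\<Sum>a\<in>S. \<Sum>b\<in>ONB m n (u a). mc k l m n (u a) (V a b) b)"
    and SV': "finite S' \<and> (\<forall>a\<in>S'. u a \<in> Ob k l) \<and>
      (\<forall>a b. u a \<in> Ob k l \<longrightarrow> V' a b \<in> H k l (u a)) \<and> (\<forall>a b. a \<notin> S' \<longrightarrow> V' a b = 0) \<and>
      g = (\<Sum>a\<in>S'. \<Sum>b\<in>ONB m n (u a). mc k l m n (u a) (V' a b) b)"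
    by (elim exE)
  note S = conjunct1[OF SV] conjunct1[OF conjunct2[OF SV]] conjunct1[OF conjunct2[OF conjunct2[OF SV]]]
    conjunct1[OF conjunct2[OF conjunct2[OF conjunct2[OF SV]]]] conjunct2[OF conjunct2[OF conjunct2[OF conjunct2[OF SV]]]]
  note S' = conjunct1[OF SV'] conjunct1[OF conjunct2[OF SV']] conjunct1[OF conjunct2[OF conjunct2[OF SV']]]
    conjunct1[OF conjunct2[OF conjunct2[OF conjunct2[OF SV']]]] conjunct2[OF conjunct2[OF conjunct2[OF conjunct2[OF SV']]]]
  have U: "u a \<in> Ob k l" if "a \<in> S \<union> S'" for a using S(2) S'(2) that by auto
  have bin: "b \<in> H m n (u a)" if "a \<in> S \<union> S'" "b \<in> ONB m n (u a)" for a b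
    using onb_in[OF fd[OF Ob_mn[OF km ln U[OF that(1)]]] that(2)] .
  have f: "f = (\<Sum>a\<in>S \<union> S'. \<Sum>b\<in>ONB m n (u a). mc k l m n (u a) (V a b) b)" unfolding S(5)
    using S S'(1) U bin by (intro sum.mono_neutral_left) (auto simp: mc_zero_left[OF km ln])
  have g: "g = (\<Sum>a\<in>S \<union> S'. \<Sum>b\<in>ONB m n (u a). mc k l m n (u a) (V' a b) b)" unfolding S'(5)
    using S' S(1) U bin by (intro sum.mono_neutral_left) (auto simp: mc_zero_left[OF km ln])
  have "f + g = (\<Sum>a\<in>S \<union> S'. \<Sum>b\<in>ONB m n (u a). mc k l m n (u a) (V a b + V' a b) b)"
    unfolding f g sum.distrib[symmetric] using S(3) S'(3) U bin
    by (intro sum.cong refl) (auto intro!: mc_add_left[OF km ln, symmetric])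
  then show ?case using S S' U fdh_add[OF fd]
    by (intro exI[of _ "S \<union> S'"] exI[of _ "\<lambda>a b. V a b + V' a b"]) auto
next
  case (mc a v w)
  note X = mc(3) note Xm = Ob_mn[OF km ln X]
  let ?V = "\<lambda>c b. if c = a then cnj (pr m n (u a) b w) *\<^sub>C v else 0"
  have "local.mc k l m n (u a) v w = local.mc k l m n (u a) v (\<Sum>b\<in>ONB m n (u a). pr m n (u a) b w *\<^sub>C b)"
    by (simp add: onb_expand[OF fd[OF Xm] mc(5)])
  also have "\<dots> = (\<Sum>b\<in>ONB m n (u a). local.mc k l m n (u a) v (pr m n (u a) b w *\<^sub>C b))"
    using onb_in[OF fd[OF Xm]] by (intro mc_sum_right[OF km ln X mc(4)] fdh_scale[OF fd[OF Xm]])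
  also have "\<dots> = (\<Sum>b\<in>ONB m n (u a). local.mc k l m n (u a) (?V a b) b)"
    using onb_in[OF fd[OF Xm]] by (intro sum.cong refl) (simp add: mc_scale_right[OF km ln X mc(4)] mc_scale_left[OF km ln X mc(4)])
  finally have "local.mc k l m n (u a) v w = (\<Sum>c\<in>{a}. \<Sum>b\<in>ONB m n (u c). local.mc k l m n (u c) (?V c b) b)" by simp
  then show ?case using X fdh_scale[OF fd[OF X] mc(4)] fdh_zero[OF fd]
    by (intro exI[of _ "{a}"] exI[of _ ?V]) auto
qed

text \<open>
  In normal form the off-diagonal terms of \<open>f\<^sup>* f\<close> integrate to zero and the diagonal terms are nonnegative.
\<close>

lemma haar_positive:
  assumes f: "f \<in> A k l m n"
  shows "haar l n (M l k l n m n (inv k l m n f) f) \<in> \<real>\<^sub>\<ge>\<^sub>0"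
proof (cases "\<phi> k = \<phi> m \<and> \<phi> l = \<phi> n")
  case False
  then have "f = 0" using A_trivial[OF _ f] by blast
  then show ?thesis by (simp add: mul_zero(1)[OF inv_in[OF A_zero]] haar_zero)
next
  case True
  then have km: "\<phi> k = \<phi> m" and ln: "\<phi> l = \<phi> n" by auto
  from A_normal_form[OF f km ln] obtain S V where SV: "finite S \<and> (\<forall>a\<in>S. u a \<in> Ob k l) \<and>
      (\<forall>a b. u a \<in> Ob k l \<longrightarrow> V a b \<in> H k l (u a)) \<and> (\<forall>a b. a \<notin> S \<longrightarrow> V a b = 0) \<and>
      f = (\<Sum>a\<in>S. \<Sum>b\<in>ONB m n (u a). mc k l m n (u a) (V a b) b)"
    by (elim exE)
  note S = conjunct1[OF SV] conjunct1[OF conjunct2[OF SV], rule_format]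
    conjunct1[OF conjunct2[OF conjunct2[OF SV]], rule_format] conjunct2[OF conjunct2[OF conjunct2[OF conjunct2[OF SV]]]]
  let ?I = "SIGMA a:S. ONB m n (u a)"
  let ?g = "\<lambda>(a, b). mc k l m n (u a) (V a b) b"
  have finI: "finite ?I" using S(1) finite_onb[OF fd[OF Ob_mn[OF km ln S(2)]]] by auto
  have fI: "f = (\<Sum>i\<in>?I. ?g i)"
    unfolding S(4) using S(1) finite_onb[OF fd[OF Ob_mn[OF km ln S(2)]]] by (subst sum.Sigma) auto
  have gA: "?g i \<in> A k l m n" if i: "i \<in> ?I" for i
  proof -
    obtain a b where ab: "i = (a, b)" "a \<in> S" "b \<in> ONB m n (u a)" using i by auto
    show ?thesis using mc_in[OF km ln S(2)[OF ab(2)] S(3)[OF S(2)[OF ab(2)]] onb_in[OF fd[OF Ob_mn[OF km ln S(2)[OF ab(2)]]] ab(3)]] ab(1)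
      by simp
  qed
  let ?B = "\<lambda>f g. haar l n (M l k l n m n (inv k l m n f) g)"
  have invs: "inv k l m n (\<Sum>i\<in>T. ?g i) = (\<Sum>i\<in>T. inv k l m n (?g i))" if "T \<subseteq> ?I" for T
    using finite_subset[OF that finI] that
  proof (induction T rule: finite_induct)
    case (insert i T)
    then have "?g i \<in> A k l m n" "(\<Sum>i\<in>T. ?g i) \<in> A k l m n" using gA by (blast, intro A_sum gA) blast
    with insert show ?case by (simp add: inv_add)
  qed (simp add: inv_zero)
  have "?B f f = (\<Sum>i\<in>?I. \<Sum>j\<in>?I. ?B (?g i) (?g j))"
  proof -
    have "M l k l n m n (inv k l m n f) f = (\<Sum>i\<in>?I. M l k l n m n (inv k l m n (?g i)) f)"
      unfolding arg_cong[OF fI, of "inv k l m n"] invs[OF subset_refl]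
      by (rule linear_on_sum[OF mul_lin(2)[OF f] A_subspace inv_in[OF gA]])
    also have "\<dots> = (\<Sum>i\<in>?I. \<Sum>j\<in>?I. M l k l n m n (inv k l m n (?g i)) (?g j))"
    proof (rule sum.cong[OF refl])
      fix i assume i: "i \<in> ?I"
      show "M l k l n m n (inv k l m n (?g i)) f = (\<Sum>j\<in>?I. M l k l n m n (inv k l m n (?g i)) (?g j))"
        unfolding arg_cong[OF fI, of "M l k l n m n (inv k l m n (?g i))"]
        by (rule linear_on_sum[OF mul_lin(1)[OF inv_in[OF gA[OF i]]] A_subspace gA])
    qed
    finally have "?B f f = haar l n (\<Sum>i\<in>?I. \<Sum>j\<in>?I. M l k l n m n (inv k l m n (?g i)) (?g j))" by (rule arg_cong)
    also have "\<dots> = (\<Sum>i\<in>?I. haar l n (\<Sum>j\<in>?I. M l k l n m n (inv k l m n (?g i)) (?g j)))"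
      using gA by (intro linear_on_sum[OF haar_lin A_subspace[of l l n n]] A_sum mul_in inv_in)
    also have "\<dots> = (\<Sum>i\<in>?I. \<Sum>j\<in>?I. ?B (?g i) (?g j))"
      using gA by (intro sum.cong refl linear_on_sum[OF haar_lin A_subspace[of l l n n]] mul_in inv_in)
    finally show ?thesis .
  qed
  also have "\<dots> = (\<Sum>i\<in>?I. ?B (?g i) (?g i))"
  proof (intro sum.cong refl)
    fix i assume i: "i \<in> ?I"
    have "?B (?g i) (?g j) = (if j = i then ?B (?g i) (?g i) else 0)" if j: "j \<in> ?I" for j
    proof (cases "j = i")
      case False
      obtain a b c d where ab: "i = (a, b)" "a \<in> S" "b \<in> ONB m n (u a)" "j = (c, d)" "c \<in> S" "d \<in> ONB m n (u c)"
        using i j by auto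
      have "a \<noteq> c \<or> b \<noteq> d" using False ab by auto
      from haar_mc(1)[OF km ln S(2)[OF ab(2)] S(2)[OF ab(5)] S(3)[OF S(2)[OF ab(2)], of b] S(3)[OF S(2)[OF ab(5)], of d] ab(3,6) this]
      show ?thesis using False ab(1,4) by auto
    qed simp
    then have "(\<Sum>j\<in>?I. ?B (?g i) (?g j)) = (\<Sum>j\<in>?I. if j = i then ?B (?g i) (?g i) else 0)" by (intro sum.cong refl)
    then show "(\<Sum>j\<in>?I. ?B (?g i) (?g j)) = ?B (?g i) (?g i)" using finI i by simp
  qed
  also have "\<dots> \<in> \<real>\<^sub>\<ge>\<^sub>0"
  proof (rule nonneg_Reals_sum)
    fix i assume i: "i \<in> ?I"
    obtain a b where ab: "i = (a, b)" "a \<in> S" "b \<in> ONB m n (u a)" using i by auto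
    note U = S(2)[OF ab(2)]
    show "?B (?g i) (?g i) \<in> \<real>\<^sub>\<ge>\<^sub>0" using haar_mc(2)[OF km ln U U S(3)[OF U] S(3)[OF U] ab(3,3)] ab(1) by simp
  qed
  finally show ?thesis .
qed

text \<open>
  In the total algebra the diagonal components of \<open>a\<^sup>* a\<close> are sums of products of one component with
  its own adjoint.
\<close>

lemma haar_total_positive:
  assumes a: "a \<in> total_space R"
  shows "total_functional haar (total_mul R (total_invol R a) a) \<in> \<real>\<^sub>\<ge>\<^sub>0"
  unfolding total_functional_def
proof (rule nonneg_Reals_sum)
  have aA: "a k l m n \<in> A k l m n" for k l m n using a by (simp add: total_space_def R_simps)
  fix km :: "'i \<times> 'i"
  obtain k m where km: "km = (k, m)" by force
  have "haar k m (total_mul R (total_invol R a) a k k m m) \<in> \<real>\<^sub>\<ge>\<^sub>0"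
  proof -
    let ?I = "{(l, n). total_invol R a k l m n \<noteq> 0 \<and> a l k n m \<noteq> 0}"
    let ?t = "\<lambda>(l, n). M k l k m n m (inv l k n m (a l k n m)) (a l k n m)"
    have t: "?t i \<in> A k k m m" for i using aA by (auto intro!: mul_in inv_in split: prod.split)
    have "total_mul R (total_invol R a) a k k m m = (\<Sum>i\<in>?I. ?t i)"
      unfolding total_mul_def total_invol_def R_simps by (simp add: case_prod_unfold)
    then have "haar k m (total_mul R (total_invol R a) a k k m m) = (\<Sum>i\<in>?I. haar k m (?t i))"
      using linear_on_sum[OF haar_lin A_subspace t] by simp
    also have "\<dots> \<in> \<real>\<^sub>\<ge>\<^sub>0" using haar_positive[OF aA] by (intro nonneg_Reals_sum) auto
    finally show ?thesis .
  qed
  then show "(case km of (k, m) \<Rightarrow> haar k m (total_mul R (total_invol R a) a k k m m)) \<in> \<real>\<^sub>\<ge>\<^sub>0" by (simp add: km)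
qed

lemma reconstruction_compact: "partial_compact_quantum_group R"
proof -
  interpret partial_hopf_star_algebra R by (rule reconstruction_hopf_star)
  show ?thesis by unfold_locales (use haar_invariant haar_total_positive in blast)
qed

end

theorem proposition4p14:
  fixes C :: "('j, 'o, 'm::complex_vs) pcat"
    and \<phi> :: "'i \<Rightarrow> 'j"
    and F :: "('i, 'o, 'm, 'v::complex_vs) umorph"
    and u :: "'a \<Rightarrow> 'o"
  assumes "partial_fusion_cstar_category C"
    and "indecomposable_units C"
    and "surj \<phi>"
    and "unital_morphism C \<phi> F"
    and "maximal_irreducible_family C u"
  shows "partial_compact_quantum_group (reconstruction C \<phi> F u)"
proof -
  interpret tannaka_data C \<phi> F u
    by (intro tannaka_data.intro fibre_functor.intro tannaka_data_axioms.intro assms)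
  show ?thesis by (rule reconstruction_compact)
qed

end
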